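(* Let $k$ be a perfect field and let $X\subset \mathbb{P}^{n+1}_k$ be an irreducible cubic hypersurface of dimension $n\geq 2$ over $k$ which is not a cone over an $(n-1)$-dimensional cubic. Then the following are equivalent: (1) $X$ is unirational over $k$. (2) $X$ has a $k$-point. (3) $X$ has a smooth $k$-point, i.e. there is a point $x\in X(k)$ at which $X$ is smooth.
   Context: A cubic hypersurface is the zero scheme of a nonzero cubic form; it is irreducible if this form is irreducible over $k$. $X$ is a cone over an $(n-1)$-dimensional cubic if, after a $k$-linear change of the homogeneous coordinates of $\mathbb{P}^{n+1}$, its cubic equation does not involve one of the variables. A $k$-variety $X$ is called unirational over $k$ if there is a dominant rational map $\mathbb{A}^m \dashrightarrow X$ defined over $k$ for some $m$ (no separability is required; the variant of the definition requiring $m=\dim X$ is equivalent). *)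

theory Defs
  imports
    "HOL-Library.Poly_Mapping"
    "HOL-Computational_Algebra.Computational_Algebra"
    "HOL-Algebra.Algebraic_Closure_Type"
    "Jordan_Normal_Form.Matrix"
begin

section \<open>Perfect fields\<close>

definition perfect_field :: "'a :: field itself \<Rightarrow> bool" where
  "perfect_field _ \<longleftrightarrow> CHAR('a) = 0 \<or> surj (\<lambda>x :: 'a. x ^ CHAR('a))"


section \<open>Multivariate polynomials\<close>

text \<open>
  Polynomials in the variables \<open>X\<^sub>0, X\<^sub>1, X\<^sub>2, \<dots>\<close>, as finitely supported maps from exponent
  vectors to coefficients; the ring structure is the one of \<^theory>\<open>HOL-Library.Poly_Mapping\<close>.
  The polynomial ring in \<open>N\<close> variables is the subring \<open>poly_ring N\<close>. Every divisor in the big ring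
  of a nonzero element of \<open>poly_ring N\<close> lies again in \<open>poly_ring N\<close>, so divisibility and
  irreducibility of elements of \<open>poly_ring N\<close> mean the same in both rings.
\<close>

type_synonym 'a mpoly = "(nat \<Rightarrow>\<^sub>0 nat) \<Rightarrow>\<^sub>0 'a"

definition mvars :: "'a :: zero mpoly \<Rightarrow> nat set" where
  "mvars p = (\<Union>m\<in>Poly_Mapping.keys p. Poly_Mapping.keys m)"

definition poly_ring :: "nat \<Rightarrow> 'a :: zero mpoly set" where
  "poly_ring N = {p. mvars p \<subseteq> {..<N}}"

definition mconst :: "'a :: zero \<Rightarrow> 'a mpoly" where
  "mconst c = Poly_Mapping.single 0 c"

definition mvar :: "nat \<Rightarrow> 'a :: zero_neq_one mpoly" where
  "mvar i = Poly_Mapping.single (Poly_Mapping.single i 1) 1"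

text \<open>
  Evaluation of \<open>p\<close> at \<open>x\<close> after applying \<open>h\<close> to the coefficients; \<open>h\<close> will be the identity,
  the embedding of the constants into a polynomial ring (which gives substitution of polynomials
  for the variables), or the embedding of \<open>k\<close> into its algebraic closure.
\<close>

definition meval ::
    "('a :: zero \<Rightarrow> 'b :: comm_semiring_1) \<Rightarrow> (nat \<Rightarrow> 'b) \<Rightarrow> 'a mpoly \<Rightarrow> 'b" where
  "meval h x p =
     (\<Sum>m\<in>Poly_Mapping.keys p. h (Poly_Mapping.lookup p m) *
        (\<Prod>i\<in>Poly_Mapping.keys m. x i ^ Poly_Mapping.lookup m i))"

text \<open>
  The formal partial derivative. The subtraction of exponent vectors truncates, but only where the
  factor \<open>of_nat\<close> vanishes.
\<close>

definition mpderiv :: "nat \<Rightarrow> 'a :: comm_semiring_1 mpoly \<Rightarrow> 'a mpoly" where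
  "mpderiv i p =
     (\<Sum>m\<in>Poly_Mapping.keys p.
        Poly_Mapping.single (m - Poly_Mapping.single i 1)
          (of_nat (Poly_Mapping.lookup m i) * Poly_Mapping.lookup p m))"

definition homogeneous :: "nat \<Rightarrow> 'a :: zero mpoly \<Rightarrow> bool" where
  "homogeneous d p \<longleftrightarrow>
     (\<forall>m\<in>Poly_Mapping.keys p. (\<Sum>i\<in>Poly_Mapping.keys m. Poly_Mapping.lookup m i) = d)"

definition cubic_form :: "nat \<Rightarrow> 'a :: zero mpoly \<Rightarrow> bool" where
  "cubic_form N F \<longleftrightarrow> F \<in> poly_ring N \<and> F \<noteq> 0 \<and> homogeneous 3 F"

definition lin_subst :: "nat \<Rightarrow> 'a :: comm_semiring_1 mat \<Rightarrow> 'a mpoly \<Rightarrow> 'a mpoly" where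
  "lin_subst N A F = meval mconst (\<lambda>i. \<Sum>j<N. mconst (A $$ (i, j)) * mvar j) F"


section \<open>Projective hypersurfaces\<close>

text \<open>
  In this section \<open>N\<close> is the number of homogeneous coordinates, so that the ambient projective
  space has dimension \<open>N - 1\<close> and the hypersurface \<open>X = {F = 0}\<close> has dimension \<open>N - 2\<close>.
  Points of projective space are given by vectors of homogeneous coordinates; all notions below are
  invariant under rescaling such a vector.
\<close>

definition proj_coords :: "nat \<Rightarrow> 'a :: zero vec set" where
  "proj_coords N = carrier_vec N - {0\<^sub>v N}"

definition is_cone :: "nat \<Rightarrow> 'a :: field mpoly \<Rightarrow> bool" where
  "is_cone N F \<longleftrightarrow>
     (\<exists>A \<in> carrier_mat N N. invertible_mat A \<and> (\<exists>i<N. i \<notin> mvars (lin_subst N A F)))"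

definition rational_points :: "nat \<Rightarrow> 'a :: field mpoly \<Rightarrow> 'a vec set" where
  "rational_points N F = {x \<in> proj_coords N. meval id (($) x) F = 0}"

definition geometric_points :: "nat \<Rightarrow> 'a :: field mpoly \<Rightarrow> 'a alg_closure vec set" where
  "geometric_points N F = {x \<in> proj_coords N. meval to_ac (($) x) F = 0}"

text \<open>
  The Jacobian criterion in homogeneous coordinates. By Euler's identity it agrees, at points of
  \<open>X\<close>, with the criterion in any standard affine chart around the point.
\<close>

definition smooth_at :: "nat \<Rightarrow> 'a :: field mpoly \<Rightarrow> 'a vec \<Rightarrow> bool" where
  "smooth_at N F x \<longleftrightarrow> (\<exists>i<N. meval id (($) x) (mpderiv i F) \<noteq> 0)"

text \<open>
  The Zariski topology of the \<open>k\<close>-scheme, whose closed subsets are cut out by forms over \<open>k\<close>.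
  Such a subset is determined by its points over the algebraic closure.
\<close>

definition zariski_closed :: "nat \<Rightarrow> 'a :: field alg_closure vec set \<Rightarrow> bool" where
  "zariski_closed N Z \<longleftrightarrow>
     (\<exists>S :: 'a mpoly set. (\<forall>G\<in>S. G \<in> poly_ring N \<and> (\<exists>d. homogeneous d G)) \<and>
        Z = {x \<in> proj_coords N. \<forall>G\<in>S. meval to_ac (($) x) G = 0})"

text \<open>
  A rational map from affine \<open>m\<close>-space to \<open>X\<close> over \<open>k\<close>, given by \<open>N\<close> polynomials in \<open>m\<close> variables
  that are not all zero: \<open>t \<mapsto> (g\<^sub>0(t) : \<dots> : g\<^sub>N\<^sub>-\<^sub>1(t))\<close>. Since denominators can be cleared, every
  rational map is of this form.
\<close>

definition rational_map ::
    "nat \<Rightarrow> nat \<Rightarrow> 'a :: field mpoly \<Rightarrow> (nat \<Rightarrow> 'a mpoly) \<Rightarrow> bool" where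
  "rational_map m N F g \<longleftrightarrow>
     (\<forall>i<N. g i \<in> poly_ring m) \<and> (\<exists>i<N. g i \<noteq> 0) \<and> meval mconst g F = 0"

definition map_image ::
    "nat \<Rightarrow> nat \<Rightarrow> (nat \<Rightarrow> 'a :: field mpoly) \<Rightarrow> 'a alg_closure vec set" where
  "map_image m N g =
     {y. y \<in> proj_coords N \<and> (\<exists>t \<in> carrier_vec m. y = vec N (\<lambda>i. meval to_ac (($) t) (g i)))}"

definition dominant ::
    "nat \<Rightarrow> nat \<Rightarrow> 'a :: field mpoly \<Rightarrow> (nat \<Rightarrow> 'a mpoly) \<Rightarrow> bool" where
  "dominant m N F g \<longleftrightarrow>
     (\<forall>Z. zariski_closed N Z \<and> map_image m N g \<subseteq> Z \<longrightarrow> geometric_points N F \<subseteq> Z)"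

definition unirational :: "nat \<Rightarrow> 'a :: field mpoly \<Rightarrow> bool" where
  "unirational N F \<longleftrightarrow> (\<exists>m g. rational_map m N F g \<and> dominant m N F g)"

end

theory Submission
  imports Defs "Jordan_Normal_Form.Determinant"
begin

text \<open>
  Write \<open>F\<close> for the cubic form, \<open>T(x, z)\<close> for the coefficient of \<open>t\<close> in \<open>F(x + t z)\<close>, and \<open>Q\<^sub>s = T(-, s)\<close>.
  A rational point is obtained from a parametrization by restricting it to a curve \<open>t \<mapsto> (t\<^sup>e\<^sup>1, t\<^sup>e\<^sup>2, \<dots>)\<close>,
  cancelling the power of \<open>t\<close> and setting \<open>t = 0\<close>. If \<open>s\<close> is a singular rational point, then \<open>Q\<^sub>s \<noteq> 0\<close>
  because the cubic is not a cone, and \<open>y \<mapsto> Q\<^sub>s(y) y - F(y) s\<close> yields smooth rational points and, once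
  one of them exists, unirationality.

  Let \<open>p\<close> be a smooth rational point. A general line through \<open>p\<close> meets the cubic again in a pair of
  conjugate points \<open>s, s'\<close>. The tangent section at \<open>s\<close> is singular at \<open>s\<close> and therefore rational, by
  projection from \<open>s\<close>, unless its equation is divisible by the quadric \<open>Q\<^sub>s\<close>. Joining conjugate points of the
  tangent sections at \<open>s\<close> and \<open>s'\<close> gives a rational third point on the cubic, and all these points form a
  dense set as soon as the two points are distinct and some geometric point \<open>s\<close> of the cubic is good, that is \<open>Q\<^sub>s\<close> does not divide the
  equation of the tangent section. The points \<open>s, s'\<close> always coincide only if \<open>Q\<^sub>p = 0\<close> in characteristic 2;
  then square roots of the coefficients give a parametrization directly. To produce a good point, one first tests \<open>p\<close> itself, and, if \<open>Q\<^sub>p\<close>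
  vanishes on the tangent hyperplane of \<open>p\<close>, points in the plane spanned by \<open>p\<close> and an auxiliary vector.
  If all of them fail, then the cubic contains a linear subspace of codimension 2 defined over the
  perfect field \<open>k\<close>. In that case either the hyperplanes tangent along a line of this subspace sweep out
  the pencil of hyperplanes through it, which gives a direct parametrization, or the equation is special enough to exhibit a good point.
\<close>

text \<open>Where a square or cube root in k is required, perfectness supplies it. A second
  obstacle: the cubic is irreducible only over k, while dominance concerns geometric points. Density
  is therefore not argued by dimension; instead a form G over k that vanishes on the image is shown
  to vanish on the whole cubic. Two devices serve this. A norm to k[y] along the lines through the
  smooth point turns vanishing on the cubic into divisibility by F, so that vanishing products have
  a vanishing factor and forms of degree at most 2 can be cancelled. And a point s' is reached as a
  limit of third intersection points: a curve of such points is divided by a power of t - a, where a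
  is a parameter at which F and the quadrics vanish to different orders. The certificate
  \<open>cert\<close> turns goodness into the nonvanishing of a polynomial, to which the same norm
  applies, now over the closure.\<close>

abbreviation lkp where "lkp \<equiv> Poly_Mapping.lookup"
abbreviation kys where "kys \<equiv> Poly_Mapping.keys"
abbreviation sgl where "sgl \<equiv> Poly_Mapping.single"

section \<open>Multivariate polynomials\<close>

definition monom_val :: "(nat \<Rightarrow> 'b :: comm_semiring_1) \<Rightarrow> (nat \<Rightarrow>\<^sub>0 nat) \<Rightarrow> 'b" where
  "monom_val x m = (\<Prod>i\<in>kys m. x i ^ lkp m i)"

lemma monom_val_superset:
  assumes "finite S" "kys m \<subseteq> S"
  shows "monom_val x m = (\<Prod>i\<in>S. x i ^ lkp m i)"
  unfolding monom_val_def
  by (rule prod.mono_neutral_left) (use assms in \<open>auto simp: in_keys_iff\<close>)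

lemma monom_val_0 [simp]: "monom_val x 0 = 1"
  by (simp add: monom_val_def)

lemma monom_val_single [simp]: "monom_val x (sgl i n) = x i ^ n"
  by (simp add: monom_val_def)

lemma monom_val_add: "monom_val x (m + n) = monom_val x m * monom_val x n"
proof -
  let ?S = "kys m \<union> kys n"
  have "monom_val x (m + n) = (\<Prod>i\<in>?S. x i ^ lkp (m + n) i)"
    by (rule monom_val_superset) (use keys_add[of m n] in auto)
  also have "\<dots> = (\<Prod>i\<in>?S. x i ^ lkp m i) * (\<Prod>i\<in>?S. x i ^ lkp n i)"
    by (simp add: lookup_add power_add prod.distrib)
  also have "\<dots> = monom_val x m * monom_val x n"
    by (simp add: monom_val_superset[of ?S m] monom_val_superset[of ?S n])
  finally show ?thesis .
qed

lemma meval_alt: "meval h x p = (\<Sum>m\<in>kys p. h (lkp p m) * monom_val x m)"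
  by (simp add: meval_def monom_val_def)

lemma mpoly_expand: "p = (\<Sum>m\<in>kys p. sgl m (lkp p m))"
proof (rule poly_mapping_eqI)
  fix k
  have "lkp (\<Sum>m\<in>kys p. sgl m (lkp p m)) k = (\<Sum>m\<in>kys p. if m = k then lkp p m else 0)"
    by (simp add: lookup_sum lookup_single when_def)
  also have "\<dots> = lkp p k"
    by (simp add: in_keys_iff)
  finally show "lkp p k = lkp (\<Sum>m\<in>kys p. sgl m (lkp p m)) k" by simp
qed

context comm_ring_hom
begin

lemma meval_superset:
  assumes "finite S" "kys p \<subseteq> S"
  shows "meval hom x p = (\<Sum>m\<in>S. hom (lkp p m) * monom_val x m)"
  unfolding meval_alt
  by (rule sum.mono_neutral_left) (use assms in \<open>auto simp: in_keys_iff\<close>)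

lemma meval_0 [simp]: "meval hom x 0 = 0"
  by (simp add: meval_alt)

lemma meval_single: "meval hom x (sgl m c) = hom c * monom_val x m"
  by (cases "c = 0") (simp_all add: meval_alt)

lemma meval_mconst [simp]: "meval hom x (mconst c) = hom c"
  by (simp add: mconst_def meval_single)

lemma meval_mvar [simp]: "meval hom x (mvar i) = x i"
  by (simp add: mvar_def meval_single hom_one)

lemma meval_1 [simp]: "meval hom x 1 = 1"
  using meval_mconst[of x 1] by (simp add: mconst_def)

lemma meval_add: "meval hom x (p + q) = meval hom x p + meval hom x q"
proof -
  let ?S = "kys p \<union> kys q"
  have "meval hom x (p + q) = (\<Sum>m\<in>?S. hom (lkp (p + q) m) * monom_val x m)"
    by (rule meval_superset) (use keys_add[of p q] in auto)
  also have "\<dots> = (\<Sum>m\<in>?S. hom (lkp p m) * monom_val x m) + (\<Sum>m\<in>?S. hom (lkp q m) * monom_val x m)"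
    by (simp add: lookup_add hom_add distrib_right sum.distrib)
  finally show ?thesis by (simp add: meval_superset[of ?S])
qed

lemma meval_sum: "meval hom x (sum f A) = (\<Sum>a\<in>A. meval hom x (f a))"
  by (induction A rule: infinite_finite_induct) (simp_all add: meval_add)

lemma meval_mult: "meval hom x (p * q) = meval hom x p * meval hom x q"
proof -
  have "p * q = (\<Sum>m\<in>kys p. sgl m (lkp p m)) * (\<Sum>n\<in>kys q. sgl n (lkp q n))"
    using mpoly_expand[of p] mpoly_expand[of q] by simp
  also have "\<dots> = (\<Sum>m\<in>kys p. \<Sum>n\<in>kys q. sgl (m + n) (lkp p m * lkp q n))"
    by (simp add: sum_product mult_single)
  finally have "meval hom x (p * q) =
     (\<Sum>m\<in>kys p. \<Sum>n\<in>kys q. meval hom x (sgl (m + n) (lkp p m * lkp q n)))"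
    by (simp add: meval_sum)
  also have "\<dots> = (\<Sum>m\<in>kys p. hom (lkp p m) * monom_val x m) * (\<Sum>n\<in>kys q. hom (lkp q n) * monom_val x n)"
    by (simp add: meval_single monom_val_add hom_mult sum_product ac_simps)
  finally show ?thesis by (simp add: meval_alt)
qed

lemma meval_hom: "comm_ring_hom (meval hom x)"
  by unfold_locales (simp_all add: meval_add meval_mult)

lemma meval_uminus: "meval hom x (- p) = - meval hom x p"
proof -
  interpret m: comm_ring_hom "meval hom x" by (rule meval_hom)
  show ?thesis by (rule m.hom_uminus)
qed

lemma meval_diff: "meval hom x (p - q) = meval hom x p - meval hom x q"
proof -
  interpret m: comm_ring_hom "meval hom x" by (rule meval_hom)
  show ?thesis by (rule m.hom_minus)
qed

lemma meval_power: "meval hom x (p ^ k) = meval hom x p ^ k"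
  by (induction k) (simp_all add: meval_mult)

lemmas meval_simps = meval_add meval_mult meval_uminus meval_diff meval_power meval_sum

end

lemma mconst_hom: "comm_ring_hom (mconst :: 'a :: comm_ring_1 \<Rightarrow> 'a mpoly)"
  by unfold_locales (simp_all add: mconst_def single_add mult_single)

lemma id_hom: "comm_ring_hom (id :: 'a :: comm_ring_1 \<Rightarrow> 'a)"
  by unfold_locales simp_all

lemma comp_hom:
  assumes "comm_ring_hom f" "comm_ring_hom g"
  shows "comm_ring_hom (f \<circ> g)"
proof -
  interpret f: comm_ring_hom f by fact
  interpret g: comm_ring_hom g by fact
  show ?thesis by unfold_locales (simp_all add: f.hom_add f.hom_mult f.hom_one g.hom_add g.hom_mult g.hom_one)
qed

lemma hom_monom_val:
  assumes "comm_ring_hom f"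
  shows "f (monom_val x m) = monom_val (\<lambda>i. f (x i)) m"
proof -
  interpret f: comm_ring_hom f by fact
  show ?thesis by (simp add: monom_val_def f.hom_prod f.hom_power)
qed

lemma hom_meval:
  assumes "comm_ring_hom f"
  shows "f (meval h x p) = meval (\<lambda>c. f (h c)) (\<lambda>i. f (x i)) p"
proof -
  interpret f: comm_ring_hom f by fact
  show ?thesis by (simp add: meval_alt f.hom_sum f.hom_mult hom_monom_val[OF assms])
qed

lemma monom_val_mvar: "monom_val mvar m = sgl m (1 :: 'a :: comm_ring_1)"
proof -
  have pw: "(mvar i :: 'a mpoly) ^ k = sgl (sgl i k) 1" for i k
  proof (induction k)
    case (Suc k)
    then show ?case by (simp add: mvar_def mult_single flip: single_add)
  qed simp
  have "finite S \<Longrightarrow> (\<Prod>i\<in>S. sgl (sgl i (lkp m i)) (1::'a)) = sgl (\<Sum>i\<in>S. sgl i (lkp m i)) 1" for S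
    by (induction S rule: finite_induct) (simp_all add: mult_single)
  then show ?thesis
    using mpoly_expand[of m] by (simp add: monom_val_def pw)
qed

lemma meval_mconst_mvar [simp]: "meval mconst mvar p = (p :: 'a :: comm_ring_1 mpoly)"
  using mpoly_expand[of p] by (simp add: meval_alt monom_val_mvar mconst_def mult_single)

lemma meval_compose:
  assumes "comm_ring_hom h"
  shows "meval h x (meval mconst g p) = meval h (\<lambda>i. meval h x (g i)) p"
proof -
  interpret comm_ring_hom h by fact
  show ?thesis by (simp add: hom_meval[OF meval_hom])
qed

lemma meval_cong:
  assumes "\<And>i. i \<in> mvars p \<Longrightarrow> x i = y i"
  shows "meval h x p = meval h y p"
proof -
  have "monom_val x m = monom_val y m" if "m \<in> kys p" for m
    unfolding monom_val_def using assms that by (intro prod.cong refl) (force simp: mvars_def)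
  then show ?thesis by (simp add: meval_alt)
qed

lemma finite_mvars [simp]: "finite (mvars p)"
  by (simp add: mvars_def)

lemma mpoly_induct [case_names const var add mult]:
  fixes p :: "'a :: comm_ring_1 mpoly"
  assumes "\<And>c. P (mconst c)" "\<And>i. P (mvar i)"
    and "\<And>p q. P p \<Longrightarrow> P q \<Longrightarrow> P (p + q)" "\<And>p q. P p \<Longrightarrow> P q \<Longrightarrow> P (p * q)"
  shows "P p"
proof -
  have 0: "P 0" using assms(1)[of 0] by (simp add: mconst_def)
  have 1: "P 1" using assms(1)[of 1] by (simp add: mconst_def)
  have S: "(\<And>a. a \<in> A \<Longrightarrow> P (f a)) \<Longrightarrow> P (sum f A)" for f :: "(nat \<Rightarrow>\<^sub>0 nat) \<Rightarrow> 'a mpoly" and A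
    by (induction A rule: infinite_finite_induct) (auto intro: assms 0)
  have PP: "(\<And>a. a \<in> A \<Longrightarrow> P (f a)) \<Longrightarrow> P (prod f A)" for f :: "nat \<Rightarrow> 'a mpoly" and A
    by (induction A rule: infinite_finite_induct) (auto intro: assms 1)
  have pw: "P (mvar i ^ k)" for i k
    by (induction k) (auto intro: assms 1)
  have "P (meval mconst mvar p)"
    unfolding meval_def by (intro S assms PP pw)
  then show ?thesis by simp
qed

lemma mvars_add: "mvars (p + q) \<subseteq> mvars p \<union> mvars q"
  using keys_add[of p q] unfolding mvars_def by blast

lemma mvars_mult: "mvars (p * q) \<subseteq> mvars p \<union> mvars q"
proof
  fix i assume "i \<in> mvars (p * q)"
  then obtain m where m: "m \<in> kys (p * q)" "i \<in> kys m" by (auto simp: mvars_def)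
  then obtain a b where "a \<in> kys p" "b \<in> kys q" "m = a + b"
    using keys_mult[of p q] by blast
  then show "i \<in> mvars p \<union> mvars q"
    using m(2) keys_add[of a b] unfolding mvars_def by blast
qed

lemma poly_ring_exists: "\<exists>M. \<forall>i<N. g i \<in> poly_ring M" for g :: "nat \<Rightarrow> 'a :: zero mpoly"
proof -
  have "finite (\<Union>i<N. mvars (g i))" by simp
  then obtain M where "\<forall>j\<in>(\<Union>i<N. mvars (g i)). j < M"
    using finite_nat_bounded by (metis lessThan_iff subset_iff)
  then show ?thesis by (intro exI[of _ M]) (auto simp: poly_ring_def)
qed

subsection \<open>Testing for zero by evaluation\<close>

lemma base_digits_inj:
  fixes a b :: "nat \<Rightarrow> nat"
  assumes "(\<Sum>i<N. a i * B ^ i) = (\<Sum>i<N. b i * B ^ i)" "\<And>i. i < N \<Longrightarrow> a i < B" "\<And>i. i < N \<Longrightarrow> b i < B"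
  shows "\<forall>i<N. a i = b i"
  using assms
proof (induction N arbitrary: a b)
  case (Suc N)
  have eq: "(\<Sum>i<Suc N. a i * B ^ i) = a 0 + B * (\<Sum>i<N. a (Suc i) * B ^ i)" for a :: "nat \<Rightarrow> nat"
    by (simp add: sum.lessThan_Suc_shift sum_distrib_left ac_simps del: sum.lessThan_Suc)
  have *: "a 0 + B * (\<Sum>i<N. a (Suc i) * B ^ i) = b 0 + B * (\<Sum>i<N. b (Suc i) * B ^ i)"
    using Suc.prems(1) by (simp only: eq)
  have lt: "a 0 < B" "b 0 < B" using Suc.prems by auto
  have 0: "a 0 = b 0"
    using arg_cong[OF *, of "\<lambda>x. x mod B"] lt by simp
  then have "(\<Sum>i<N. a (Suc i) * B ^ i) = (\<Sum>i<N. b (Suc i) * B ^ i)"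
    using * lt by auto
  then have "\<forall>i<N. a (Suc i) = b (Suc i)"
    by (rule Suc.IH) (use Suc.prems in auto)
  then show ?case using 0 by (auto simp: less_Suc_eq_0_disj)
qed simp

text \<open>Kronecker's substitution \<open>X\<^sub>i \<mapsto> t\<close> to the power \<open>B\<^sup>i\<close> is injective on finitely many monomials.\<close>

lemma kronecker_substitution:
  fixes p :: "'a :: idom mpoly"
  assumes "p \<noteq> 0"
  shows "\<exists>e :: nat \<Rightarrow> nat. meval (\<lambda>c. [:c:]) (\<lambda>i. Polynomial.monom 1 (e i)) p \<noteq> 0"
proof -
  obtain N where N: "mvars p \<subseteq> {..<N}"
    using finite_nat_bounded[of "mvars p"] by auto
  \<comment> \<open>\<open>B\<close> exceeds every exponent in \<open>p\<close>, so an exponent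
    vector can be recovered from the base \<open>B\<close> digits of
    \<open>\<kappa>\<close>.\<close>
  define B where "B = Suc (\<Sum>m\<in>kys p. \<Sum>i\<in>kys m. lkp m i)"
  define e where "e = (\<lambda>i. B ^ i)"
  define \<kappa> where "\<kappa> m = (\<Sum>i<N. lkp m i * e i)" for m
  have small: "lkp m i < B" if "m \<in> kys p" for m i
  proof (cases "i \<in> kys m")
    case True
    have "lkp m i \<le> (\<Sum>i\<in>kys m. lkp m i)"
      by (rule member_le_sum) (use True in auto)
    also have "\<dots> \<le> (\<Sum>m\<in>kys p. \<Sum>i\<in>kys m. lkp m i)"
      by (rule member_le_sum[of _ _ "\<lambda>m. \<Sum>i\<in>kys m. lkp m i"]) (use that in auto)
    finally show ?thesis by (simp add: B_def)
  qed (auto simp: in_keys_iff B_def)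
  have sub: "kys m \<subseteq> {..<N}" if "m \<in> kys p" for m
    using N that by (auto simp: mvars_def)
  have inj: "inj_on \<kappa> (kys p)"
  proof
    fix m m' assume m: "m \<in> kys p" "m' \<in> kys p" "\<kappa> m = \<kappa> m'"
    have "\<forall>i<N. lkp m i = lkp m' i"
      by (rule base_digits_inj[of "lkp m" B N "lkp m'"]) (use m small in \<open>auto simp: \<kappa>_def e_def\<close>)
    then show "m = m'"
      using sub[OF m(1)] sub[OF m(2)]
      by (intro poly_mapping_eqI) (metis in_keys_iff lessThan_iff subset_iff)
  qed
  have mv: "monom_val (\<lambda>i. Polynomial.monom (1::'a) (e i)) m = Polynomial.monom 1 (\<kappa> m)" if "m \<in> kys p" for m
  proof -
    have P: "finite S \<Longrightarrow> (\<Prod>i\<in>S. Polynomial.monom (1::'a) (e i) ^ lkp m i) = Polynomial.monom 1 (\<Sum>i\<in>S. lkp m i * e i)" for S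
      by (induction S rule: finite_induct) (simp_all add: mult_monom monom_power mult.commute)
    show ?thesis
      by (subst monom_val_superset[of "{..<N}"]) (use sub[OF that] P in \<open>auto simp: \<kappa>_def\<close>)
  qed
  obtain m0 where m0: "m0 \<in> kys p" using assms mpoly_expand[of p] by (metis sum.empty ex_in_conv)
  have "Polynomial.coeff (meval (\<lambda>c. [:c:]) (\<lambda>i. Polynomial.monom 1 (e i)) p) (\<kappa> m0)
      = (\<Sum>m\<in>kys p. if m = m0 then lkp p m else 0)"
    unfolding meval_alt coeff_sum using mv inj m0
    by (intro sum.cong refl) (auto simp: inj_on_eq_iff)
  also have "\<dots> = lkp p m0" using m0 by simp
  also have "\<dots> \<noteq> 0" using m0 by (simp add: in_keys_iff)
  finally show ?thesis by (intro exI[of _ e]) auto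
qed

lemma poly_hom: "comm_ring_hom (\<lambda>p. poly p (a :: 'a :: comm_ring_1))"
  by unfold_locales simp_all

lemma const_poly_hom: "comm_ring_hom (\<lambda>c :: 'a :: comm_ring_1. [:c:])"
  by unfold_locales (simp_all add: one_pCons)

text \<open>The ground field may be finite, so the coefficients are first moved along
  \<open>h\<close> into an infinite domain; Kronecker's substitution then yields a nonzero
  univariate polynomial with infinitely many roots.\<close>

lemma meval_eq_0_imp:
  fixes h :: "'a :: comm_ring_1 \<Rightarrow> 'e :: idom"
  assumes h: "comm_ring_hom h" and inj: "\<And>c. h c = 0 \<Longrightarrow> c = 0" and inf: "infinite (UNIV :: 'e set)"
    and 0: "\<And>x. meval h x p = 0"
  shows "p = 0"
proof (rule ccontr)
  assume "p \<noteq> 0"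
  define p' where "p' = meval (\<lambda>c. mconst (h c)) mvar p"
  interpret h: comm_ring_hom h by fact
  have "lkp p' m = h (lkp p m)" for m
    by (auto simp: p'_def meval_alt monom_val_mvar mconst_def mult_single lookup_sum lookup_single when_def in_keys_iff)
  then have "p' \<noteq> 0"
    using \<open>p \<noteq> 0\<close> inj by (metis lookup_zero poly_mapping_eqI)
  from kronecker_substitution[OF this] obtain e where
    e: "meval (\<lambda>c. [:c:]) (\<lambda>i. Polynomial.monom 1 (e i)) p' \<noteq> 0" (is "?q \<noteq> 0") by blast
  have "poly ?q a = 0" for a
  proof -
    have "poly ?q a = meval id (\<lambda>i. a ^ e i) p'"
      by (subst hom_meval[OF poly_hom]) (simp add: poly_monom id_def)
    also have "\<dots> = meval h (\<lambda>i. a ^ e i) p"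
      unfolding p'_def
      by (subst hom_meval[OF comm_ring_hom.meval_hom[OF id_hom]])
         (simp add: comm_ring_hom.meval_mconst[OF id_hom] comm_ring_hom.meval_mvar[OF id_hom])
    finally show ?thesis using 0 by simp
  qed
  then have "{a. poly ?q a = 0} = UNIV" by auto
  then show False using poly_roots_finite[OF e] inf by simp
qed

section \<open>Cubic forms and their polarizations\<close>

definition vadd :: "(nat \<Rightarrow> 'r :: comm_ring_1) \<Rightarrow> (nat \<Rightarrow> 'r) \<Rightarrow> nat \<Rightarrow> 'r" (infixl \<open>[+]\<close> 65)
  where "x [+] y = (\<lambda>i. x i + y i)"

definition vscale :: "'r :: comm_ring_1 \<Rightarrow> (nat \<Rightarrow> 'r) \<Rightarrow> nat \<Rightarrow> 'r" (infixr \<open>[*]\<close> 75)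
  where "a [*] x = (\<lambda>i. a * x i)"

definition unit :: "nat \<Rightarrow> nat \<Rightarrow> 'r :: comm_ring_1"
  where "unit i = (\<lambda>j. if j = i then 1 else 0)"

text \<open>The tensor \<open>c\<close> is not assumed symmetric, since symmetrizing would divide by
  2 and 3; \<open>cubT\<close> and \<open>cubD\<close> sum over the positions of the arguments
  instead.\<close>

definition trilin :: "nat \<Rightarrow> (nat \<Rightarrow> nat \<Rightarrow> nat \<Rightarrow> 'r :: comm_ring_1) \<Rightarrow> (nat \<Rightarrow> 'r) \<Rightarrow> (nat \<Rightarrow> 'r) \<Rightarrow> (nat \<Rightarrow> 'r) \<Rightarrow> 'r"
  where "trilin N c x y z = (\<Sum>i<N. \<Sum>j<N. \<Sum>k<N. c i j k * x i * y j * z k)"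

definition cub :: "nat \<Rightarrow> (nat \<Rightarrow> nat \<Rightarrow> nat \<Rightarrow> 'r :: comm_ring_1) \<Rightarrow> (nat \<Rightarrow> 'r) \<Rightarrow> 'r"
  where "cub N c x = trilin N c x x x"

text \<open>\<open>cubT x z\<close> is the coefficient of \<open>t\<close> in \<open>cub (x + t z)\<close>, and \<open>cubD\<close> is the full polarization.\<close>

definition cubT :: "nat \<Rightarrow> (nat \<Rightarrow> nat \<Rightarrow> nat \<Rightarrow> 'r :: comm_ring_1) \<Rightarrow> (nat \<Rightarrow> 'r) \<Rightarrow> (nat \<Rightarrow> 'r) \<Rightarrow> 'r"
  where "cubT N c x z = trilin N c x x z + trilin N c x z x + trilin N c z x x"

definition cubD :: "nat \<Rightarrow> (nat \<Rightarrow> nat \<Rightarrow> nat \<Rightarrow> 'r :: comm_ring_1) \<Rightarrow> (nat \<Rightarrow> 'r) \<Rightarrow> (nat \<Rightarrow> 'r) \<Rightarrow> (nat \<Rightarrow> 'r) \<Rightarrow> 'r"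
  where "cubD N c x y z = trilin N c x y z + trilin N c x z y + trilin N c y x z + trilin N c y z x
     + trilin N c z x y + trilin N c z y x"

lemma vadd_apply [simp]: "(x [+] y) i = x i + y i" by (simp add: vadd_def)
lemma vscale_apply [simp]: "(a [*] x) i = a * x i" by (simp add: vscale_def)
lemma vscale_1 [simp]: "1 [*] x = x" by (simp add: fun_eq_iff)

lemma trilin_add:
  "trilin N c (x [+] x') y z = trilin N c x y z + trilin N c x' y z"
  "trilin N c x (y [+] y') z = trilin N c x y z + trilin N c x y' z"
  "trilin N c x y (z [+] z') = trilin N c x y z + trilin N c x y z'"
  by (simp_all add: trilin_def algebra_simps sum.distrib)

lemma trilin_scale:
  "trilin N c (a [*] x) y z = a * trilin N c x y z"
  "trilin N c x (a [*] y) z = a * trilin N c x y z"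
  "trilin N c x y (a [*] z) = a * trilin N c x y z"
  by (simp_all add: trilin_def sum_distrib_left ac_simps)

lemma trilin_0 [simp]:
  "trilin N c (\<lambda>_. 0) y z = 0" "trilin N c x (\<lambda>_. 0) z = 0" "trilin N c x y (\<lambda>_. 0) = 0"
  by (simp_all add: trilin_def)

lemma cub_0 [simp]: "cub N c (\<lambda>_. 0) = 0" by (simp add: cub_def)
lemma cubT_0 [simp]: "cubT N c (\<lambda>_. 0) z = 0" "cubT N c x (\<lambda>_. 0) = 0" by (simp_all add: cubT_def)
lemma cubD_0 [simp]: "cubD N c (\<lambda>_. 0) y z = 0" "cubD N c x (\<lambda>_. 0) z = 0" "cubD N c x y (\<lambda>_. 0) = 0"
  by (simp_all add: cubD_def)

lemma cubD_commute: "cubD N c x y z = cubD N c y x z" "cubD N c x y z = cubD N c x z y"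
  by (simp_all add: cubD_def)


lemma cubD_same: "cubD N c x x z = 2 * cubT N c x z" "cubD N c x z x = 2 * cubT N c x z" "cubD N c z x x = 2 * cubT N c x z"
  by (simp_all add: cubD_def cubT_def)

lemma cubT_same: "cubT N c x x = 3 * cub N c x"
  by (simp add: cub_def cubT_def)

lemma cubD_add:
  "cubD N c (x [+] x') y z = cubD N c x y z + cubD N c x' y z"
  "cubD N c x (y [+] y') z = cubD N c x y z + cubD N c x y' z"
  "cubD N c x y (z [+] z') = cubD N c x y z + cubD N c x y z'"
  by (simp_all add: cubD_def trilin_add)

lemma cubD_scale:
  "cubD N c (a [*] x) y z = a * cubD N c x y z"
  "cubD N c x (a [*] y) z = a * cubD N c x y z"
  "cubD N c x y (a [*] z) = a * cubD N c x y z"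
  by (simp_all add: cubD_def trilin_scale algebra_simps)

lemma cubT_add:
  "cubT N c (x [+] y) z = cubT N c x z + cubD N c x y z + cubT N c y z"
  "cubT N c x (y [+] z) = cubT N c x y + cubT N c x z"
  by (simp_all add: cubT_def cubD_def trilin_add)

lemma cubT_scale:
  "cubT N c (a [*] x) z = a\<^sup>2 * cubT N c x z"
  "cubT N c x (a [*] z) = a * cubT N c x z"
  by (simp_all add: cubT_def trilin_scale algebra_simps power2_eq_square)

lemma cub_add: "cub N c (x [+] y) = cub N c x + cubT N c x y + cubT N c y x + cub N c y"
  by (simp add: cub_def cubT_def trilin_add)

lemma cub_scale: "cub N c (a [*] x) = a ^ 3 * cub N c x"
  by (simp add: cub_def trilin_scale algebra_simps power3_eq_cube)

lemmas cub_simps = cub_add cub_scale cubT_add cubT_scale cubD_add cubD_scale cubD_same cubT_same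

lemma cub_lin: "cub N c (a [*] x [+] b [*] y) =
    a ^ 3 * cub N c x + a\<^sup>2 * b * cubT N c x y + a * b\<^sup>2 * cubT N c y x + b ^ 3 * cub N c y"
  by (simp add: cub_simps algebra_simps)

lemma trilin_cong:
  assumes "\<And>i. i < N \<Longrightarrow> x i = x' i" "\<And>i. i < N \<Longrightarrow> y i = y' i" "\<And>i. i < N \<Longrightarrow> z i = z' i"
  shows "trilin N c x y z = trilin N c x' y' z'"
  using assms by (simp add: trilin_def)

lemma cub_cong: "(\<And>i. i < N \<Longrightarrow> x i = x' i) \<Longrightarrow> cub N c x = cub N c x'"
  unfolding cub_def by (rule trilin_cong)

lemma cubT_cong: "(\<And>i. i < N \<Longrightarrow> x i = x' i) \<Longrightarrow> (\<And>i. i < N \<Longrightarrow> y i = y' i) \<Longrightarrow> cubT N c x y = cubT N c x' y'"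
  unfolding cubT_def by (intro arg_cong2[of _ _ _ _ "(+)"] trilin_cong) auto

lemma cubT_unit_sum: "cubT N c x z = (\<Sum>i<N. z i * cubT N c x (unit i))"
proof -
  have *: "(\<Sum>i<N. z i * g (unit i)) = g z"
    if "\<And>a b. g (a [+] b) = g a + g b" "\<And>a b. g (a [*] b) = a * g b"
       "\<And>a b. (\<And>i. i < N \<Longrightarrow> a i = b i) \<Longrightarrow> g a = g b" for g :: "(nat \<Rightarrow> 'a) \<Rightarrow> 'a"
  proof -
    have g0: "g (\<lambda>_. 0) = 0"
    proof -
      have "g (\<lambda>_. 0) = g (0 [*] (\<lambda>_. 0))" by (rule that(3)) simp
      then show ?thesis using that(2)[of 0] by simp
    qed
    have "(\<Sum>i<M. z i * g (unit i)) = g (\<lambda>i. if i < M then z i else 0)" for M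
    proof (induction M)
      case (Suc M)
      have "(\<lambda>i. if i < Suc M then z i else 0) = (\<lambda>i. if i < M then z i else 0) [+] z M [*] unit M"
        by (auto simp: fun_eq_iff unit_def less_Suc_eq)
      then show ?case using Suc by (simp add: that(1,2))
    qed (simp add: g0)
    also have "g (\<lambda>i. if i < N then z i else 0) = g z" by (rule that(3)) auto
    finally show ?thesis .
  qed
  show ?thesis
    by (rule *[of "cubT N c x", symmetric]) (auto simp: cubT_add cubT_scale intro: cubT_cong)
qed

text \<open>Formulas for points are written once with polynomial entries; this rule and its
  analogues turn evaluation of those entries into the same formula at an actual point.\<close>

lemma hom_trilin:
  assumes "comm_ring_hom f"
  shows "f (trilin N c x y z) = trilin N (\<lambda>i j k. f (c i j k)) (\<lambda>i. f (x i)) (\<lambda>i. f (y i)) (\<lambda>i. f (z i))"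
proof -
  interpret f: comm_ring_hom f by fact
  show ?thesis by (simp add: trilin_def f.hom_sum f.hom_mult)
qed

lemma hom_cub: "comm_ring_hom f \<Longrightarrow> f (cub N c x) = cub N (\<lambda>i j k. f (c i j k)) (\<lambda>i. f (x i))"
  by (simp add: cub_def hom_trilin)

lemma hom_cubT:
  assumes "comm_ring_hom f"
  shows "f (cubT N c x z) = cubT N (\<lambda>i j k. f (c i j k)) (\<lambda>i. f (x i)) (\<lambda>i. f (z i))"
proof -
  interpret f: comm_ring_hom f by fact
  show ?thesis by (simp add: cubT_def hom_trilin[OF assms] f.hom_add)
qed

lemma hom_cubD:
  assumes "comm_ring_hom f"
  shows "f (cubD N c x y z) = cubD N (\<lambda>i j k. f (c i j k)) (\<lambda>i. f (x i)) (\<lambda>i. f (y i)) (\<lambda>i. f (z i))"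
proof -
  interpret f: comm_ring_hom f by fact
  show ?thesis by (simp add: cubD_def hom_trilin[OF assms] f.hom_add)
qed

subsection \<open>The coefficients of a cubic form\<close>

definition mdeg :: "(nat \<Rightarrow>\<^sub>0 nat) \<Rightarrow> nat" where "mdeg m = (\<Sum>i\<in>kys m. lkp m i)"

lemma mdeg_superset: "finite S \<Longrightarrow> kys m \<subseteq> S \<Longrightarrow> mdeg m = (\<Sum>i\<in>S. lkp m i)"
  unfolding mdeg_def by (rule sum.mono_neutral_left) (auto simp: in_keys_iff)

lemma mdeg_add: "mdeg (m + n) = mdeg m + mdeg n"
proof -
  let ?S = "kys m \<union> kys n"
  have "mdeg (m + n) = (\<Sum>i\<in>?S. lkp (m + n) i)"
    by (rule mdeg_superset) (use keys_add[of m n] in auto)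
  then show ?thesis by (simp add: mdeg_superset[of ?S] lookup_add sum.distrib)
qed

lemma mdeg_single [simp]: "mdeg (sgl i k) = k"
  by (simp add: mdeg_def)

lemma mdeg_SucE:
  assumes "mdeg m = Suc d"
  obtains i m' where "m = sgl i 1 + m'" "mdeg m' = d" "i \<in> kys m"
proof -
  obtain i where i: "i \<in> kys m"
    using assms unfolding mdeg_def by (metis equals0I nat.simps(3) sum.empty)
  have eq: "m = sgl i 1 + (m - sgl i 1)"
    using i by (intro poly_mapping_eqI) (auto simp: lookup_add lookup_minus lookup_single when_def in_keys_iff)
  have "mdeg m = 1 + mdeg (m - sgl i 1)"
    using arg_cong[OF eq, of mdeg] by (simp only: mdeg_add mdeg_single)
  with assms have "mdeg (m - sgl i 1) = d" by linarith
  then show ?thesis by (rule that[OF eq _ i])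
qed

definition mono3 :: "nat \<times> nat \<times> nat \<Rightarrow> nat \<Rightarrow>\<^sub>0 nat" where
  "mono3 t = sgl (fst t) 1 + (sgl (fst (snd t)) 1 + sgl (snd (snd t)) 1)"

definition idx3 :: "(nat \<Rightarrow>\<^sub>0 nat) \<Rightarrow> nat \<times> nat \<times> nat" where
  "idx3 m = (SOME t. mono3 t = m)"

text \<open>Each cubic monomial is assigned to one chosen ordered triple, so its whole coefficient
  sits in a single tensor entry and is not divided by the number of orderings.\<close>

definition cof3 :: "'a :: zero mpoly \<Rightarrow> nat \<Rightarrow> nat \<Rightarrow> nat \<Rightarrow> 'a" where
  "cof3 F i j k = (if idx3 (mono3 (i, j, k)) = (i, j, k) then lkp F (mono3 (i, j, k)) else 0)"

lemma mono3_idx3: "mdeg m = 3 \<Longrightarrow> mono3 (idx3 m) = m"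
proof -
  assume "mdeg m = 3"
  then have "mdeg m = Suc (Suc (Suc 0))" by simp
  then obtain i m1 where 1: "m = sgl i 1 + m1" "mdeg m1 = Suc (Suc 0)" by (rule mdeg_SucE)
  from 1(2) obtain j m2 where 2: "m1 = sgl j 1 + m2" "mdeg m2 = Suc 0" by (rule mdeg_SucE)
  from 2(2) obtain k m3 where 3: "m2 = sgl k 1 + m3" "mdeg m3 = 0" by (rule mdeg_SucE)
  have "m3 = 0"
    using 3(2) by (intro poly_mapping_eqI) (auto simp: mdeg_def in_keys_iff)
  then have "mono3 (i, j, k) = m" using 1 2 3 by (simp add: mono3_def)
  then show ?thesis unfolding idx3_def by (rule someI[where P = "\<lambda>t. mono3 t = m"])
qed

lemma meval_cubic:
  assumes F: "F \<in> poly_ring N" "homogeneous 3 F" and h: "comm_ring_hom h"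
  shows "meval h x F = cub N (\<lambda>i j k. h (cof3 F i j k)) x"
proof -
  interpret h: comm_ring_hom h by fact
  define g where "g t = h (cof3 F (fst t) (fst (snd t)) (snd (snd t))) * monom_val x (mono3 t)" for t
  have deg: "mdeg m = 3" if "m \<in> kys F" for m
    using F(2) that by (auto simp: homogeneous_def mdeg_def)
  have idx: "mono3 (idx3 m) = m" if "m \<in> kys F" for m
    using mono3_idx3 deg that by blast
  let ?T = "{..<N} \<times> {..<N} \<times> {..<N}"
  have "cub N (\<lambda>i j k. h (cof3 F i j k)) x = (\<Sum>t\<in>?T. g t)"
    by (simp add: cub_def trilin_def g_def sum.cartesian_product' mono3_def monom_val_add mult.assoc split_def)
  also have "\<dots> = (\<Sum>t\<in>idx3 ` kys F. g t)"
  proof (rule sum.mono_neutral_right)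
    show "idx3 ` kys F \<subseteq> ?T"
    proof
      fix t assume "t \<in> idx3 ` kys F"
      then obtain m where m: "m \<in> kys F" "t = idx3 m" by auto
      have "kys m \<subseteq> {..<N}" using F(1) m(1) by (auto simp: poly_ring_def mvars_def)
      moreover have "mono3 t = m" using idx m by simp
      then have "fst t \<in> kys m" "fst (snd t) \<in> kys m" "snd (snd t) \<in> kys m"
        by (auto simp: mono3_def in_keys_iff lookup_add)
      ultimately show "t \<in> ?T" by (cases t) auto
    qed
    show "\<forall>t\<in>?T - idx3 ` kys F. g t = 0"
    proof
      fix t assume t: "t \<in> ?T - idx3 ` kys F"
      have "cof3 F (fst t) (fst (snd t)) (snd (snd t)) = 0"
        using t by (cases t) (force simp: cof3_def image_iff in_keys_iff)
      then show "g t = 0" by (simp add: g_def)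
    qed
  qed simp
  also have "\<dots> = (\<Sum>m\<in>kys F. g (idx3 m))"
    by (rule sum.reindex_cong[of idx3]) (use idx in \<open>auto intro: inj_on_inverseI[of _ mono3]\<close>)
  also have "\<dots> = meval h x F"
    unfolding meval_alt
  proof (intro sum.cong refl)
    fix m assume m: "m \<in> kys F"
    have "cof3 F (fst (idx3 m)) (fst (snd (idx3 m))) (snd (snd (idx3 m))) = lkp F m"
      by (simp add: cof3_def idx[OF m])
    then show "g (idx3 m) = h (lkp F m) * monom_val x m" by (simp add: g_def idx[OF m])
  qed
  finally show ?thesis by simp
qed

lemma coeff_linear_power_1: "Polynomial.coeff ([:a, 1:] ^ n) (Suc 0) = of_nat n * a ^ (n - 1)" for a :: "'a :: comm_ring_1"
proof (induction n)
  case (Suc n)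
  have "Polynomial.coeff ([:a, 1:] ^ n) 0 = a ^ n" by (induction n) simp_all
  with Suc show ?case by (cases n) (simp_all add: algebra_simps)
qed simp

text \<open>Substituting \<open>x i + t\<close> for the variable \<open>i\<close> makes the
  derivative the coefficient of \<open>t\<close>, which for a cubic form is
  \<open>cubT\<close>.\<close>

lemma meval_mpderiv:
  fixes p :: "'a :: comm_ring_1 mpoly"
  shows "meval id x (mpderiv i p) =
    Polynomial.coeff (meval (\<lambda>c. [:c:]) (\<lambda>j. if j = i then [:x j, 1:] else [:x j:]) p) (Suc 0)"
proof -
  let ?y = "\<lambda>j. if j = i then [:x j, 1:] else [:x j:]"
  have *: "Polynomial.coeff (monom_val ?y m) (Suc 0) = of_nat (lkp m i) * monom_val x (m - sgl i 1)" for m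
  proof (cases "i \<in> kys m")
    case True
    have "kys (m - sgl i 1) \<subseteq> kys m"
      by (auto simp: in_keys_iff lookup_minus)
    then have 1: "monom_val x (m - sgl i 1) = (\<Prod>j\<in>kys m. x j ^ lkp (m - sgl i 1) j)"
      by (intro monom_val_superset) auto
    also have "\<dots> = x i ^ (lkp m i - 1) * (\<Prod>j\<in>kys m - {i}. x j ^ lkp m j)"
      using True by (subst prod.remove[of _ i]) (auto simp: lookup_minus lookup_single when_def intro!: prod.cong)
    finally have 2: "monom_val x (m - sgl i 1) = x i ^ (lkp m i - 1) * (\<Prod>j\<in>kys m - {i}. x j ^ lkp m j)" .
    have 3: "(\<Prod>j\<in>kys m - {i}. ?y j ^ lkp m j) = [:\<Prod>j\<in>kys m - {i}. x j ^ lkp m j:]"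
    proof -
      interpret c: comm_ring_hom "\<lambda>c :: 'a. [:c:]" by (rule const_poly_hom)
      show ?thesis by (simp add: c.hom_prod c.hom_power)
    qed
    have "monom_val ?y m = [:x i, 1:] ^ lkp m i * [:\<Prod>j\<in>kys m - {i}. x j ^ lkp m j:]"
      unfolding monom_val_def using True 3 by (subst prod.remove[of _ i]) auto
    then have "Polynomial.coeff (monom_val ?y m) (Suc 0)
       = (\<Prod>j\<in>kys m - {i}. x j ^ lkp m j) * Polynomial.coeff ([:x i, 1:] ^ lkp m i) (Suc 0)"
      by (simp add: mult.commute)
    then show ?thesis using 2 by (simp add: coeff_linear_power_1 algebra_simps)
  next
    case False
    interpret c: comm_ring_hom "\<lambda>c :: 'a. [:c:]" by (rule const_poly_hom)
    have "monom_val ?y m = [:monom_val x m:]"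
      unfolding monom_val_def using False by (simp add: c.hom_prod c.hom_power) (auto intro!: prod.cong)
    with False show ?thesis by (simp add: in_keys_iff)
  qed
  interpret i: comm_ring_hom "id :: 'a \<Rightarrow> 'a" by (rule id_hom)
  show ?thesis
    by (simp add: mpderiv_def i.meval_sum i.meval_single meval_alt[of "\<lambda>c. [:c:]"] coeff_sum * algebra_simps)
qed

lemma meval_mpderiv_cubic:
  fixes F :: "'a :: comm_ring_1 mpoly"
  assumes F: "F \<in> poly_ring N" "homogeneous 3 F"
  shows "meval id x (mpderiv i F) = cubT N (cof3 F) x (unit i)"
proof -
  let ?c = "\<lambda>i j k. [:cof3 F i j k:]" let ?x = "\<lambda>j. [:x j:]" let ?u = "\<lambda>j. [:unit i j:]"
  have "(\<lambda>j. if j = i then [:x j, 1:] else [:x j:]) = ?x [+] [:0, 1:] [*] ?u"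
    by (auto simp: fun_eq_iff unit_def)
  then have "meval id x (mpderiv i F) = Polynomial.coeff (cub N ?c (?x [+] [:0, 1:] [*] ?u)) (Suc 0)"
    by (simp add: meval_mpderiv meval_cubic[OF F const_poly_hom])
  also have "cub N ?c (?x [+] [:0, 1:] [*] ?u) = [:cub N (cof3 F) x:] + [:0, 1:] * [:cubT N (cof3 F) x (unit i):]
      + [:0, 1:]\<^sup>2 * [:cubT N (cof3 F) (unit i) x:] + [:0, 1:] ^ 3 * [:cub N (cof3 F) (unit i):]"
    by (simp add: cub_simps hom_cub[OF const_poly_hom] hom_cubT[OF const_poly_hom])
  also have "Polynomial.coeff \<dots> (Suc 0) = cubT N (cof3 F) x (unit i)"
    by (simp add: power2_eq_square power3_eq_cube)
  finally show ?thesis .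
qed

section \<open>Arithmetic of multivariate polynomials\<close>

subsection \<open>Leading monomials\<close>

text \<open>The order on exponent vectors is lexicographic, decided by the smallest index at which
  they differ; it is compatible with addition.\<close>

definition lmon :: "'a :: zero mpoly \<Rightarrow> (nat \<Rightarrow>\<^sub>0 nat)" where "lmon p = Max (kys p)"

lemma keys_empty_iff: "kys p = {} \<longleftrightarrow> p = 0" for p :: "'a :: comm_ring_1 mpoly"
  using mpoly_expand[of p] by (metis keys_zero sum.empty)

lemma lmon_in: "p \<noteq> 0 \<Longrightarrow> lmon p \<in> kys p" for p :: "'a :: comm_ring_1 mpoly"
  unfolding lmon_def by (rule Max_in) (simp_all add: keys_empty_iff)

lemma lmon_ge: "m \<in> kys p \<Longrightarrow> m \<le> lmon p"
  unfolding lmon_def by (rule Max_ge) simp_all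

lemma lookup_mult_sum: "lkp (p * q) k = (\<Sum>m\<in>kys p. \<Sum>n\<in>kys q. if m + n = k then lkp p m * lkp q n else 0)"
  for p q :: "'a :: comm_ring_1 mpoly"
proof -
  have "p * q = (\<Sum>m\<in>kys p. \<Sum>n\<in>kys q. sgl (m + n) (lkp p m * lkp q n))"
    by (subst (1) mpoly_expand[of p], subst (1) mpoly_expand[of q]) (simp add: sum_product mult_single)
  then show ?thesis by (simp add: lookup_sum lookup_single when_def)
qed

lemma lookup_mult_lmon:
  fixes p q :: "'a :: comm_ring_1 mpoly"
  assumes "p \<noteq> 0" "q \<noteq> 0"
  shows "lkp (p * q) (lmon p + lmon q) = lkp p (lmon p) * lkp q (lmon q)"
proof -
  have *: "m + n = lmon p + lmon q \<longleftrightarrow> m = lmon p \<and> n = lmon q" if "m \<in> kys p" "n \<in> kys q" for m n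
  proof
    assume eq: "m + n = lmon p + lmon q"
    have le: "m \<le> lmon p" "n \<le> lmon q" using that by (auto intro: lmon_ge)
    show "m = lmon p \<and> n = lmon q"
      using add_less_le_mono[of m "lmon p" n "lmon q"] add_le_less_mono[of m "lmon p" n "lmon q"] le eq
      by (metis order.not_eq_order_implies_strict less_irrefl)
  qed simp
  have "lkp (p * q) (lmon p + lmon q) =
    (\<Sum>m\<in>kys p. \<Sum>n\<in>kys q. if m = lmon p \<and> n = lmon q then lkp p m * lkp q n else 0)"
    unfolding lookup_mult_sum by (intro sum.cong refl) (simp add: *)
  also have "\<dots> = (\<Sum>m\<in>kys p. if m = lmon p then lkp p m * lkp q (lmon q) else 0)"
    using lmon_in[OF assms(2)] by (intro sum.cong refl) simp
  also have "\<dots> = lkp p (lmon p) * lkp q (lmon q)"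
    using lmon_in[OF assms(1)] by simp
  finally show ?thesis .
qed

lemma lmon_mult:
  fixes p q :: "'a :: idom mpoly"
  assumes "p \<noteq> 0" "q \<noteq> 0"
  shows "lmon (p * q) = lmon p + lmon q"
proof (rule antisym)
  have pq: "p * q \<noteq> 0" using assms by simp
  have "lmon (p * q) \<in> kys (p * q)" using lmon_in[OF pq] .
  then obtain m n where "m \<in> kys p" "n \<in> kys q" "lmon (p * q) = m + n"
    using keys_mult[of p q] by blast
  then show "lmon (p * q) \<le> lmon p + lmon q"
    using lmon_ge[of m p] lmon_ge[of n q] by (simp add: add_mono)
  have "lkp p (lmon p) * lkp q (lmon q) \<noteq> 0"
    using lmon_in[OF assms(1)] lmon_in[OF assms(2)] by (simp add: in_keys_iff)
  then show "lmon p + lmon q \<le> lmon (p * q)"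
    using lookup_mult_lmon[OF assms] by (intro lmon_ge) (simp add: in_keys_iff)
qed

lemma lookup_lmon_power: "p \<noteq> 0 \<Longrightarrow> lkp (lmon (p ^ i)) j = i * lkp (lmon p) j" for p :: "'a :: idom mpoly"
proof (induction i)
  case 0
  then show ?case by (simp add: lmon_def)
qed (simp add: lmon_mult lookup_add)

text \<open>The bound \<open>N\<close> matters: lexicographically
  \<open>X_0 > X_1 > X_2 > ...\<close> descends forever. With \<open>N\<close> fixed the exponent
  vectors become lists of one length.\<close>

lemma wf_monomials: "wf {(m, m' :: nat \<Rightarrow>\<^sub>0 nat). m < m' \<and> kys m \<subseteq> {..<N} \<and> kys m' \<subseteq> {..<N}}" (is "wf ?R")
proof -
  let ?l = "\<lambda>m. map (lkp m) [0..<N]"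
  have "?R \<subseteq> inv_image (lexn less_than N) ?l"
  proof clarify
    fix m m' :: "nat \<Rightarrow>\<^sub>0 nat" assume m: "m < m'" "kys m' \<subseteq> {..<N}"
    then obtain k where k: "lkp m k < lkp m' k" "\<And>k'. k' < k \<Longrightarrow> lkp m k' = lkp m' k'"
      by (auto simp: less_poly_mapping.rep_eq less_fun_def)
    have kN: "k < N" using k(1) m(2) by (metis in_keys_iff lessThan_iff not_less_zero subset_iff)
    have split: "?l n = map (lkp n) [0..<k] @ lkp n k # map (lkp n) [Suc k..<N]" for n :: "nat \<Rightarrow>\<^sub>0 nat"
      using kN by (metis list.simps(9) map_append upt_conv_Cons upt_add_eq_append le0 le_add_diff_inverse less_imp_le)
    have pre: "map (lkp m) [0..<k] = map (lkp m') [0..<k]" using k(2) by simp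
    have "(?l m, ?l m') \<in> lexn less_than N \<longleftrightarrow> (\<exists>xys x y xs' ys'. ?l m = xys @ x # xs' \<and> ?l m' = xys @ y # ys' \<and> x < y)"
      by (simp add: lexn_conv del: upt_Suc)
    moreover have "?l m = map (lkp m) [0..<k] @ lkp m k # map (lkp m) [Suc k..<N]" by (rule split)
    moreover have "?l m' = map (lkp m) [0..<k] @ lkp m' k # map (lkp m') [Suc k..<N]"
      unfolding pre by (rule split)
    ultimately have "(?l m, ?l m') \<in> lexn less_than N"
      using k(1) by blast
    then show "(m, m') \<in> inv_image (lexn less_than N) ?l" by simp
  qed
  moreover have "wf (inv_image (lexn less_than N) ?l)"
    by (intro wf_inv_image wf_lexn wf_less_than)
  ultimately show ?thesis by (rule wf_subset[rotated])
qed

lemma mvars_uminus [simp]: "mvars (- p) = mvars p" for p :: "'a :: comm_ring_1 mpoly"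
  by (simp add: mvars_def keys_def)

text \<open>
  If \<open>\<alpha> = A / B\<close> is integral then the denominators of its powers stay bounded, so the leading monomial of \<open>B\<close> divides that of \<open>A\<close>; now
  replace \<open>A\<close> by \<open>A - \<tau> B\<close> with a monomial \<open>\<tau>\<close> that cancels the leading term.
\<close>

lemma quadratic_integrally_closed:
  fixes A B q r :: "'a :: field mpoly"
  assumes "B \<noteq> 0" "A * A - q * A * B + r * B * B = 0"
  shows "B dvd A"
proof -
  obtain N where "mvars A \<union> mvars B \<subseteq> {..<N}"
    using finite_nat_bounded[of "mvars A \<union> mvars B"] by auto
  then have N: "mvars A \<subseteq> {..<N}" and NB: "mvars B \<subseteq> {..<N}" by auto
  have keysN: "kys m \<subseteq> {..<N}" if "mvars P \<subseteq> {..<N}" "m \<in> kys P" for P :: "'a mpoly" and m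
    using that by (auto simp: mvars_def)
  have main: "lmon A = m \<Longrightarrow> mvars A \<subseteq> {..<N} \<Longrightarrow> A * A - q * A * B + r * B * B = 0 \<Longrightarrow> B dvd A" for m A q r
  proof (induction m arbitrary: A q r rule: wf_induct_rule[OF wf_monomials[of N]])
    case (1 m)
    note eq = 1(4)
    show ?case
    proof (cases "A = 0")
      case False
      \<comment> \<open>With \<alpha> = A / B this says that every power of \<alpha> is a
        combination of 1 and \<alpha>, so that \<open>B\<close> is a common denominator.\<close>
      have pow: "\<exists>u v. A ^ Suc i = (u * B + v * A) * B ^ i" for i
      proof (induction i)
        case 0
        show ?case by (rule exI[of _ 0], rule exI[of _ 1]) simp
      next
        case (Suc i)
        then obtain u v where uv: "A ^ Suc i = (u * B + v * A) * B ^ i" by blast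
        have AA: "A * A = q * A * B - r * B * B" using eq by (simp add: algebra_simps)
        have "A ^ Suc (Suc i) = A * A ^ Suc i" by simp
        also have "\<dots> = (u * A * B + v * (A * A)) * B ^ i"
          unfolding uv by (simp add: algebra_simps)
        also have "\<dots> = (u * A * B + v * (q * A * B - r * B * B)) * B ^ i"
          unfolding AA ..
        also have "\<dots> = ((- v * r) * B + (u + v * q) * A) * B ^ Suc i"
          by (simp add: algebra_simps)
        finally show ?case by blast
      qed
      have le: "lkp (lmon B) j \<le> lkp (lmon A) j" for j
      proof (rule ccontr)
        assume "\<not> ?thesis"
        then have gt: "lkp (lmon B) j \<ge> Suc (lkp (lmon A) j)" by simp
        \<comment> \<open>If the exponent is \<open>a\<close> in \<open>A\<close> and at least
          \<open>a + 1\<close> in \<open>B\<close>, then \<open>pow\<close> gives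
          \<open>i * (a + 1) \<le> (i + 1) * a\<close>, that is \<open>i \<le> a\<close>; the choice
          \<open>i = a + 1\<close> contradicts this.\<close>
        define i where "i = Suc (lkp (lmon A) j)"
        obtain u v where uv: "A ^ Suc i = (u * B + v * A) * B ^ i" using pow by blast
        have "A ^ Suc i \<noteq> 0" using False by simp
        then have R: "u * B + v * A \<noteq> 0" using uv by auto
        have "lmon (A ^ Suc i) = lmon (u * B + v * A) + lmon (B ^ i)"
          unfolding uv by (rule lmon_mult[OF R]) (use assms(1) in simp)
        then have "Suc i * lkp (lmon A) j = lkp (lmon (u * B + v * A)) j + i * lkp (lmon B) j"
          using lookup_lmon_power[OF False, of "Suc i" j] lookup_lmon_power[OF assms(1), of i j]
          by (simp only: lookup_add)
        then have "i * lkp (lmon B) j \<le> Suc i * lkp (lmon A) j" by simp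
        moreover have "i * Suc (lkp (lmon A) j) \<le> i * lkp (lmon B) j" using gt by (rule mult_le_mono2)
        ultimately have "i * Suc (lkp (lmon A) j) \<le> Suc i * lkp (lmon A) j" by (rule order_trans[rotated])
        then show False by (simp add: i_def)
      qed
      define \<tau> where "\<tau> = sgl (lmon A - lmon B) (lkp A (lmon A) / lkp B (lmon B))"
      have lB: "lkp B (lmon B) \<noteq> 0" using lmon_in[OF assms(1)] by (simp add: in_keys_iff)
      have lA: "lkp A (lmon A) \<noteq> 0" using lmon_in[OF False] by (simp add: in_keys_iff)
      have \<tau>0: "\<tau> \<noteq> 0"
        using lA lB unfolding \<tau>_def by (metis divide_eq_0_iff lookup_single_eq lookup_zero)
      have l\<tau>: "lmon \<tau> = lmon A - lmon B" using lA lB by (simp add: \<tau>_def lmon_def)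
      have sum: "lmon A - lmon B + lmon B = lmon A"
        using le by (intro poly_mapping_eqI) (simp add: lookup_add lookup_minus)
      have lm\<tau>B: "lmon (\<tau> * B) = lmon A"
        using lmon_mult[OF \<tau>0 assms(1)] l\<tau> sum by simp
      have lc: "lkp (\<tau> * B) (lmon A) = lkp A (lmon A)"
        using lookup_mult_lmon[OF \<tau>0 assms(1)] lB unfolding l\<tau> sum by (simp add: \<tau>_def)
      define A' where "A' = A - \<tau> * B"
      have A: "A = A' + \<tau> * B" by (simp add: A'_def)
      have mv\<tau>: "mvars \<tau> \<subseteq> {..<N}"
      proof -
        have "mvars \<tau> \<subseteq> kys (lmon A - lmon B)" by (auto simp: mvars_def \<tau>_def split: if_splits)
        also have "\<dots> \<subseteq> kys (lmon A)" by (auto simp: in_keys_iff lookup_minus)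
        also have "\<dots> \<subseteq> {..<N}" using keysN[OF 1(3) lmon_in[OF False]] .
        finally show ?thesis .
      qed
      have mvA': "mvars A' \<subseteq> {..<N}"
      proof -
        have "mvars A' \<subseteq> mvars A \<union> mvars (\<tau> * B)"
          using mvars_add[of A "- (\<tau> * B)"] by (simp add: A'_def)
        with mvars_mult[of \<tau> B] 1(3) NB mv\<tau> show ?thesis by blast
      qed
      \<comment> \<open>The quotient A / B has been shifted by the polynomial \<tau>, so it stays a
        root of a monic quadratic polynomial.\<close>
      have eq': "A' * A' - (q - 2 * \<tau>) * A' * B + (\<tau> * \<tau> - q * \<tau> + r) * B * B = 0"
        using eq unfolding A by (simp add: algebra_simps)
      have "B dvd A'"
      proof (cases "A' = 0")
        case nz: False
        have sub: "kys A' \<subseteq> kys A \<union> kys (\<tau> * B)"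
          by (auto simp: A'_def in_keys_iff lookup_minus)
        have "lmon A' \<in> kys A'" using lmon_in[OF nz] .
        moreover from this have "lmon A' \<le> lmon A"
          using sub lmon_ge[of "lmon A'" A] lmon_ge[of "lmon A'" "\<tau> * B"] lm\<tau>B by auto
        moreover have "lmon A \<notin> kys A'" by (simp add: in_keys_iff A'_def lookup_minus lc)
        ultimately have "lmon A' < lmon A" by (metis order.not_eq_order_implies_strict)
        then have "(lmon A', m) \<in> {(m, m'). m < m' \<and> kys m \<subseteq> {..<N} \<and> kys m' \<subseteq> {..<N}}"
          using keysN[OF mvA' lmon_in[OF nz]] keysN[OF 1(3) lmon_in[OF False]] unfolding 1(2) by blast
        from 1(1)[OF this refl mvA' eq'] show ?thesis .
      qed simp
      then show ?thesis unfolding A by simp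
    qed simp
  qed
  show ?thesis by (rule main[OF refl N assms(2)])
qed

subsection \<open>Linear forms are prime\<close>

locale linear_form =
  fixes N :: nat and a :: "nat \<Rightarrow> 'a :: field" and i0 :: nat
  assumes i0: "i0 < N" "a i0 \<noteq> 0"
begin

definition lf :: "'a mpoly" where "lf = (\<Sum>i<N. mvar i * mconst (a i))"

text \<open>This substitution solves \<open>lf = 0\<close> for the variable \<open>i0\<close>. It is
  a ring homomorphism into a domain whose kernel is the ideal of \<open>lf\<close>, hence
  \<open>lf\<close> is prime.\<close>

definition elim :: "'a mpoly \<Rightarrow> 'a mpoly" where
  "elim = meval mconst (\<lambda>i. if i = i0 then mvar i0 - mconst (inverse (a i0)) * lf else mvar i)"

sublocale elim: comm_ring_hom elim
  unfolding elim_def by (rule comm_ring_hom.meval_hom[OF mconst_hom])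

lemma elim_mvar: "elim (mvar i) = (if i = i0 then mvar i0 - mconst (inverse (a i0)) * lf else mvar i)"
  by (simp add: elim_def comm_ring_hom.meval_mvar[OF mconst_hom])

lemma elim_mconst: "elim (mconst c) = mconst c"
  by (simp add: elim_def comm_ring_hom.meval_mconst[OF mconst_hom])

lemma mconst_inverse: "c \<noteq> 0 \<Longrightarrow> mconst c * mconst (inverse c) = (1 :: 'a mpoly)"
  by (simp add: mconst_def mult_single)

lemma elim_lf: "elim lf = 0"
proof -
  have "elim lf = (\<Sum>i<N. elim (mvar i) * mconst (a i))"
    by (simp add: lf_def elim.hom_sum elim.hom_mult elim_mconst)
  also have "\<dots> = (\<Sum>i<N. mvar i * mconst (a i) - (if i = i0 then mconst (a i0) * mconst (inverse (a i0)) * lf else 0))"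
    by (intro sum.cong refl) (simp add: elim_mvar algebra_simps)
  also have "\<dots> = lf - mconst (a i0) * mconst (inverse (a i0)) * lf"
    using i0 by (simp add: sum_subtractf lf_def)
  finally show ?thesis using mconst_inverse[OF i0(2)] by simp
qed

lemma lf_dvd_diff: "lf dvd P - elim P"
proof (induction P rule: mpoly_induct)
  case (const c)
  then show ?case by (simp add: elim_mconst)
next
  case (var i)
  then show ?case by (simp add: elim_mvar)
next
  case (add p q)
  have "p + q - elim (p + q) = (p - elim p) + (q - elim q)" by (simp add: elim.hom_add)
  with add show ?case by (metis dvd_add)
next
  case (mult p q)
  have "p * q - elim (p * q) = (p - elim p) * q + elim p * (q - elim q)"
    by (simp add: elim.hom_mult algebra_simps)
  with mult show ?case by (metis dvd_add dvd_mult dvd_mult2)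
qed

lemma lf_dvd_iff: "lf dvd P \<longleftrightarrow> elim P = 0"
proof
  assume "lf dvd P"
  then show "elim P = 0" by (auto simp: elim.hom_mult elim_lf elim!: dvdE)
next
  assume "elim P = 0"
  then show "lf dvd P" using lf_dvd_diff[of P] by simp
qed

lemma lf_prime: "lf dvd P * Q \<Longrightarrow> lf dvd P \<or> lf dvd Q"
  by (simp add: lf_dvd_iff elim.hom_mult)

lemma lf_nonzero: "lf \<noteq> 0"
proof
  assume "lf = 0"
  interpret i: comm_ring_hom "id :: 'a \<Rightarrow> 'a" by (rule id_hom)
  have "0 = meval id (unit i0) lf" using \<open>lf = 0\<close> by simp
  also have "\<dots> = a i0"
    using i0(1) by (simp add: lf_def i.meval_sum i.meval_mult unit_def if_distrib[of "\<lambda>x. x * _"] cong: if_cong)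
  finally show False using i0 by simp
qed

lemma lf_power_cancel:
  assumes "\<not> lf dvd F" "F * W = lf ^ d * P"
  shows "F dvd P"
  using assms(2)
proof (induction d arbitrary: W)
  case 0
  then show ?case by (metis dvd_triv_left mult.left_neutral power_0)
next
  case (Suc d)
  then have "lf dvd F * W" by (metis dvd_mult2 dvd_triv_left power_Suc mult.assoc)
  with assms(1) have "lf dvd W" using lf_prime by blast
  then obtain W' where "W = lf * W'" by (elim dvdE)
  with Suc.prems have "lf * (F * W') = lf * (lf ^ d * P)" by (simp add: algebra_simps)
  with lf_nonzero have "F * W' = lf ^ d * P" by simp
  then show ?case by (rule Suc.IH)
qed

lemma lf_dvd_if_vanishes:
  fixes h :: "'a \<Rightarrow> 'e :: field"
  assumes h: "comm_ring_hom h" and inf: "infinite (UNIV :: 'e set)"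
    and 0: "\<And>y. meval h y lf = 0 \<Longrightarrow> meval h y P = 0"
  shows "lf dvd P"
  unfolding lf_dvd_iff
proof (rule meval_eq_0_imp[OF h _ inf])
  interpret h: comm_ring_hom h by fact
  show "c = 0" if "h c = 0" for c
  proof (rule ccontr)
    assume "c \<noteq> 0"
    have "h (c * inverse c) = 0" using that by (simp add: h.hom_mult)
    with \<open>c \<noteq> 0\<close> show False by (simp add: h.hom_one)
  qed
  fix y
  let ?g = "\<lambda>i. if i = i0 then mvar i0 - mconst (inverse (a i0)) * lf else mvar i"
  have *: "meval h y (elim Q) = meval h (\<lambda>i. meval h y (?g i)) Q" for Q
    unfolding elim_def by (rule meval_compose[OF h])
  show "meval h y (elim P) = 0"
    unfolding * by (rule 0) (simp add: *[symmetric] elim_lf)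
qed

end

section \<open>Univariate polynomials over algebraically closed fields, and homogeneity\<close>

lemma alg_closed_infinite: "infinite (UNIV :: 'e :: alg_closed_field set)"
proof
  assume fin: "finite (UNIV :: 'e set)"
  define P where "P = (\<Prod>a\<in>UNIV. [:-a, 1 :: 'e:]) + 1"
  have "degree (\<Prod>a\<in>(UNIV :: 'e set). [:-a, 1 :: 'e:]) = card (UNIV :: 'e set)"
    by (subst degree_prod_eq_sum_degree) auto
  moreover have "card (UNIV :: 'e set) > 0" using fin by (simp add: card_gt_0_iff)
  ultimately have "degree P > 0" unfolding P_def by (subst degree_add_eq_left) auto
  then obtain x where "poly P x = 0" using alg_closed_imp_poly_has_root by blast
  moreover have "poly P x = 1"
  proof -
    have "(\<Prod>a\<in>(UNIV :: 'e set). poly [:-a, 1:] x) = 0"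
      using fin by (intro prod_zero) auto
    then show ?thesis by (simp add: P_def poly_prod)
  qed
  ultimately show False by simp
qed

lemma poly_eq_0_if_zero:
  assumes "\<And>t. poly P t = 0"
  shows "P = (0 :: 'e :: alg_closed_field poly)"
proof (rule ccontr)
  assume "P \<noteq> 0"
  then have "finite {t. poly P t = 0}" by (rule poly_roots_finite)
  with assms alg_closed_infinite[where 'e = 'e] show False by simp
qed

lemma map_poly_hom:
  assumes "comm_ring_hom f"
  shows "comm_ring_hom (map_poly f)"
proof -
  interpret f: comm_ring_hom f by fact
  show ?thesis
  proof unfold_locales
    show "map_poly f (x + y) = map_poly f x + map_poly f y" for x y
      by (rule poly_eqI) (simp add: coeff_map_poly f.hom_add)
    show "map_poly f (x * y) = map_poly f x * map_poly f y" for x y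
      by (rule poly_eqI) (simp add: coeff_map_poly coeff_mult f.hom_sum f.hom_mult)
  qed (simp_all add: f.hom_one)
qed

lemma field_hom_eq_0:
  assumes "comm_ring_hom (h :: 'a :: field \<Rightarrow> 'e :: field)" "h x = 0"
  shows "x = 0"
proof (rule ccontr)
  interpret h: comm_ring_hom h by fact
  assume "x \<noteq> 0"
  have "h (x * inverse x) = 0" using assms(2) by (simp add: h.hom_mult)
  with \<open>x \<noteq> 0\<close> show False by (simp add: h.hom_one)
qed

lemma meval_homogeneous:
  assumes "comm_ring_hom h" "homogeneous d P"
  shows "meval h (a [*] x) P = a ^ d * meval h x P"
proof -
  have "monom_val (a [*] x) m = a ^ d * monom_val x m" if "m \<in> kys P" for m
  proof -
    have "monom_val (a [*] x) m = a ^ (\<Sum>i\<in>kys m. lkp m i) * monom_val x m"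
      by (simp add: monom_val_def power_mult_distrib prod.distrib power_sum)
    with assms(2) that show ?thesis by (simp add: homogeneous_def)
  qed
  then show ?thesis by (simp add: meval_alt sum_distrib_left ac_simps)
qed

text \<open>Because the divisor is monic this works over k[y]. The remainder gives the coordinates
  with respect to 1 and \<xi> in the quadratic extension where the two residual points are
  defined.\<close>

lemma divide_by_monic_quadratic:
  fixes u v :: "'a :: comm_ring_1"
  shows "\<exists>W A B. P = [:u, v, 1:] * W + [:A, B:]"
proof (induction P rule: pCons_induct)
  case 0
  show ?case by (rule exI[of _ 0], rule exI[of _ 0], rule exI[of _ 0]) simp
next
  case (pCons a P)
  then obtain W A B where P: "P = [:u, v, 1:] * W + [:A, B:]" by blast
  have "pCons a P = [:0, 1:] * P + [:a:]" by simp
  also have "\<dots> = [:u, v, 1:] * ([:0, 1:] * W + [:B:]) + [:a - u * B, A - v * B:]"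
    unfolding P distrib_left mult.left_commute[of "[:0, 1:]"] by (simp add: algebra_simps)
  finally show ?case by blast
qed

section \<open>Projection from a smooth point\<close>

text \<open>
  The line through \<open>p\<close> and \<open>y\<close> meets the cubic again in the points \<open>\<xi> p + l(y) y\<close> where
  \<open>\<xi>\<^sup>2 + q(y) \<xi> + l(y) F(y) = 0\<close>, with \<open>l = T(p, -)\<close> and \<open>q = T(-, p)\<close>. If this quadratic polynomial
  has no root in \<open>k[y]\<close> then forms on the cubic have a multiplicative norm in \<open>k[y]\<close>.
\<close>

locale cubic_point =
  fixes h :: "'a :: field \<Rightarrow> 'e :: alg_closed_field" and N :: nat
    and c :: "nat \<Rightarrow> nat \<Rightarrow> nat \<Rightarrow> 'a" and p :: "nat \<Rightarrow> 'a"
  fixes cE pE cM pM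
  defines "cE \<equiv> \<lambda>i j k. h (c i j k)" and "pE \<equiv> \<lambda>i. h (p i)"
    and "cM \<equiv> \<lambda>i j k. mconst (c i j k)" and "pM \<equiv> \<lambda>i. mconst (p i)"
  assumes h: "comm_ring_hom h"
    and p: "cub N c p = 0"
    and smooth: "\<exists>i<N. cubT N c p (unit i) \<noteq> 0"
    and tangent: "\<exists>y. cubT N cE pE y = 0 \<and> cub N cE y \<noteq> 0"
    and no_root: "\<And>e :: 'a mpoly. e * e - cubT N cM mvar pM * e + cubT N cM pM mvar * cub N cM mvar \<noteq> 0"
begin

abbreviation F where "F \<equiv> cub N cE"
abbreviation T where "T \<equiv> cubT N cE"
abbreviation FM where "FM \<equiv> cub N cM mvar"
abbreviation LM where "LM \<equiv> cubT N cM pM mvar"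
abbreviation QM where "QM \<equiv> cubT N cM mvar pM"

sublocale h: comm_ring_hom h by (rule h)

lemma h_eq_0: "h x = 0 \<Longrightarrow> x = 0" by (rule field_hom_eq_0[OF h])

lemma eval_FM [simp]: "meval h y FM = F y"
  and eval_LM [simp]: "meval h y LM = T pE y"
  and eval_QM [simp]: "meval h y QM = T y pE"
  by (simp_all add: hom_cub[OF h.meval_hom] hom_cubT[OF h.meval_hom] cE_def cM_def pM_def pE_def)

lemma eval_pM [simp]: "meval h y (pM i) = pE i"
  by (simp add: pM_def pE_def)

lemma zero_test: "(\<And>y. meval h y P = 0) \<Longrightarrow> P = 0"
  by (rule meval_eq_0_imp[OF h h_eq_0 alg_closed_infinite])

lemma F_pE: "F pE = 0"
  using arg_cong[OF p, of h] by (simp add: hom_cub[OF h] cE_def pE_def)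

lemma F_line: "F (\<xi> [*] pE [+] T pE y [*] y) = (T pE y)\<^sup>2 * (\<xi>\<^sup>2 + T y pE * \<xi> + T pE y * F y)"
  by (simp add: cub_simps F_pE algebra_simps power2_eq_square power3_eq_cube)

lemma LM_linear_form: "\<exists>i0 a. linear_form N a i0 \<and> LM = linear_form.lf N a"
proof -
  from smooth obtain i where i: "i < N" "cubT N c p (unit i) \<noteq> 0" by blast
  then interpret linear_form N "\<lambda>i. cubT N c p (unit i)" i by unfold_locales
  have u: "mconst (unit j k) = unit j k" for j k
    by (simp add: unit_def mconst_def)
  have "mconst (cubT N c p (unit j)) = cubT N cM pM (unit j)" for j
    by (subst hom_cubT[OF mconst_hom]) (simp add: cM_def pM_def u)
  then have "LM = lf" unfolding lf_def by (subst cubT_unit_sum) simp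
  then show ?thesis using linear_form_axioms by blast
qed

text \<open>The linear form \<open>LM\<close> is prime, and \<open>tangent\<close> prevents it from
  dividing \<open>FM\<close>.\<close>

lemma FM_dvd_cancel: "FM * W = LM ^ d * P \<Longrightarrow> FM dvd P"
proof -
  obtain i0 a where lf: "linear_form N a i0" "LM = linear_form.lf N a" using LM_linear_form by blast
  interpret linear_form N a i0 by (rule lf(1))
  have "\<not> lf dvd FM"
  proof
    assume "lf dvd FM"
    then obtain R where "FM = lf * R" by (elim dvdE)
    then have "F y = T pE y * meval h y R" for y
      using eval_FM[of y] eval_LM[of y] unfolding lf(2) by (simp add: h.meval_mult)
    with tangent show False by auto
  qed
  then show "FM * W = LM ^ d * P \<Longrightarrow> FM dvd P"
    unfolding lf(2) by (rule lf_power_cancel)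
qed

text \<open>At the generic point \<xi> p + l y the form \<open>P\<close> becomes A + B \<xi>, and
  \<open>n\<close> is the norm A^2 - q A B + l F B^2. If \<open>n = 0\<close> with B nonzero, then A
  / B is a root in k(y), hence in k[y] by integral closedness, against \<open>no_root\<close>. So A
  = B = 0, and putting \<xi> = 0 shows that \<open>FM\<close> divides a power of l times
  \<open>P\<close>.\<close>

lemma norm_form:
  assumes "meval mconst (\<lambda>i. LM * mvar i) P = LM ^ d * P"
  obtains n where
    "\<And>y \<xi> \<xi>'. \<xi> + \<xi>' = - T y pE \<Longrightarrow> \<xi> * \<xi>' = T pE y * F y \<Longrightarrow>
       meval h y n = meval h (\<xi> [*] pE [+] T pE y [*] y) P * meval h (\<xi>' [*] pE [+] T pE y [*] y) P"
    "n = 0 \<Longrightarrow> FM dvd P"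
proof -
  define P' where "P' = meval (\<lambda>c. [:mconst c:]) (\<lambda>i. [:LM * mvar i, pM i:]) P"
  obtain W A B where P': "P' = [:LM * FM, QM, 1:] * W + [:A, B:]"
    using divide_by_monic_quadratic by blast
  define n where "n = A * A - QM * A * B + LM * FM * B * B"
  have ev: "meval h (\<xi> [*] pE [+] T pE y [*] y) P = meval h y A + meval h y B * \<xi>"
    if \<xi>: "\<xi>\<^sup>2 + T y pE * \<xi> + T pE y * F y = 0" for y \<xi>
  proof -
    define ev where "ev = (\<lambda>R. poly (map_poly (meval h y) R) \<xi>)"
    have "ev = (\<lambda>R. poly R \<xi>) \<circ> map_poly (meval h y)" by (simp add: ev_def fun_eq_iff)
    then interpret ev: comm_ring_hom ev
      using comp_hom[OF poly_hom map_poly_hom[OF h.meval_hom]] by simp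
    have ev_pCons: "ev (pCons a R) = meval h y a + \<xi> * ev R" for a R
      by (simp add: ev_def map_poly_pCons)
    have "ev P' = meval h (\<xi> [*] pE [+] T pE y [*] y) P"
    proof -
      have *: "(\<lambda>i. meval h y (LM * mvar i) + \<xi> * meval h y (pM i)) = \<xi> [*] pE [+] T pE y [*] y"
        by (rule ext) (simp add: h.meval_mult)
      show ?thesis
        unfolding P'_def hom_meval[OF ev.comm_ring_hom_axioms] by (simp only: ev_pCons ev.hom_zero mult_zero_right add_0_right * h.meval_mconst)
    qed
    moreover have "ev P' = meval h y A + meval h y B * \<xi>"
      using \<xi> unfolding P' ev.hom_add ev.hom_mult
      by (simp add: ev_pCons h.meval_mult algebra_simps power2_eq_square)
    ultimately show ?thesis by simp
  qed
  show thesis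
  proof (rule that[of n])
    fix y \<xi> \<xi>' assume s: "\<xi> + \<xi>' = - T y pE" and m: "\<xi> * \<xi>' = T pE y * F y"
    have q: "T y pE = - (\<xi> + \<xi>')" using s by simp
    have r: "\<xi>\<^sup>2 + T y pE * \<xi> + T pE y * F y = 0" "\<xi>'\<^sup>2 + T y pE * \<xi>' + T pE y * F y = 0"
      unfolding q m[symmetric] by (simp_all add: algebra_simps power2_eq_square)
    show "meval h y n = meval h (\<xi> [*] pE [+] T pE y [*] y) P * meval h (\<xi>' [*] pE [+] T pE y [*] y) P"
      unfolding n_def h.meval_simps eval_FM eval_LM eval_QM ev[OF r(1)] ev[OF r(2)] m[symmetric]
      unfolding q by (simp add: algebra_simps)
  next
    assume n0: "n = 0"
    have "B = 0"
    proof (rule ccontr)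
      assume B: "B \<noteq> 0"
      then have "B dvd A" using n0 unfolding n_def by (rule quadratic_integrally_closed)
      then obtain e where "A = B * e" by (elim dvdE)
      then have "B * B * (e * e - QM * e + LM * FM) = 0"
        using n0 unfolding n_def by (simp add: algebra_simps)
      with B no_root[of e] show False by simp
    qed
    with n0 have "A = 0" unfolding n_def by simp
    have "poly P' 0 = meval mconst (\<lambda>i. LM * mvar i) P"
      unfolding P'_def hom_meval[OF poly_hom] by simp
    moreover have "poly P' 0 = LM * FM * poly W 0" using \<open>A = 0\<close> \<open>B = 0\<close> unfolding P' by simp
    ultimately have "FM * (LM * poly W 0) = LM ^ d * P" using assms by (simp add: algebra_simps)
    then show "FM dvd P" by (rule FM_dvd_cancel)
  qed
qed

lemma FM_dvd_imp_vanishes: "FM dvd P \<Longrightarrow> F x = 0 \<Longrightarrow> meval h x P = 0"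
  by (auto simp: h.meval_mult elim!: dvdE)

lemma roots_exist: obtains \<xi> \<xi>' where "\<xi> + \<xi>' = - T y pE" "\<xi> * \<xi>' = T pE y * F y"
proof -
  have "degree [:T pE y * F y, T y pE, 1:] > 0" by simp
  then obtain \<xi> where "poly [:T pE y * F y, T y pE, 1:] \<xi> = 0" using alg_closed_imp_poly_has_root by blast
  then have "T pE y * F y + \<xi> * (T y pE + \<xi>) = 0" by simp
  moreover have "\<xi> * (- T y pE - \<xi>) = T pE y * F y - (T pE y * F y + \<xi> * (T y pE + \<xi>))"
    by (simp add: algebra_simps)
  ultimately have "\<xi> * (- T y pE - \<xi>) = T pE y * F y" by simp
  then show thesis by (intro that[of \<xi> "- T y pE - \<xi>"]) simp_all
qed

lemma F_root:
  assumes "\<xi> + \<xi>' = - T y pE" "\<xi> * \<xi>' = T pE y * F y"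
  shows "F (\<xi> [*] pE [+] T pE y [*] y) = 0"
proof -
  have q: "T y pE = - (\<xi> + \<xi>')" using assms by simp
  show ?thesis unfolding F_line q assms(2)[symmetric] by (simp add: algebra_simps power2_eq_square)
qed

definition scaling :: "'a mpoly \<Rightarrow> bool" where
  "scaling P \<longleftrightarrow> (\<exists>d. meval mconst (\<lambda>i. LM * mvar i) P = LM ^ d * P)"

lemma homogeneous_scaling: "homogeneous d P \<Longrightarrow> scaling P"
  using meval_homogeneous[OF mconst_hom, of d P LM mvar] unfolding scaling_def vscale_def by (intro exI[of _ d]) simp

text \<open>The product of the two norms vanishes at every y, so one of the norms is the zero
  polynomial.\<close>

lemma prime_on_cubic:
  assumes "scaling P" "scaling P'" "\<And>x. F x = 0 \<Longrightarrow> meval h x P * meval h x P' = 0"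
  shows "FM dvd P \<or> FM dvd P'"
proof -
  obtain d d' where d: "meval mconst (\<lambda>i. LM * mvar i) P = LM ^ d * P" "meval mconst (\<lambda>i. LM * mvar i) P' = LM ^ d' * P'"
    using assms by (auto simp: scaling_def)
  obtain n where n: "\<And>y \<xi> \<xi>'. \<xi> + \<xi>' = - T y pE \<Longrightarrow> \<xi> * \<xi>' = T pE y * F y \<Longrightarrow>
       meval h y n = meval h (\<xi> [*] pE [+] T pE y [*] y) P * meval h (\<xi>' [*] pE [+] T pE y [*] y) P"
    "n = 0 \<Longrightarrow> FM dvd P" using norm_form[OF d(1)] by metis
  obtain n' where n': "\<And>y \<xi> \<xi>'. \<xi> + \<xi>' = - T y pE \<Longrightarrow> \<xi> * \<xi>' = T pE y * F y \<Longrightarrow>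
       meval h y n' = meval h (\<xi> [*] pE [+] T pE y [*] y) P' * meval h (\<xi>' [*] pE [+] T pE y [*] y) P'"
    "n' = 0 \<Longrightarrow> FM dvd P'" using norm_form[OF d(2)] by metis
  have "meval h y (n * n') = 0" for y
  proof -
    obtain \<xi> \<xi>' where r: "\<xi> + \<xi>' = - T y pE" "\<xi> * \<xi>' = T pE y * F y" by (rule roots_exist)
    then have "F (\<xi> [*] pE [+] T pE y [*] y) = 0" by (rule F_root)
    from assms(3)[OF this] show ?thesis
      by (auto simp: h.meval_mult n(1)[OF r] n'(1)[OF r])
  qed
  then have "n * n' = 0" by (rule zero_test)
  then show ?thesis using n(2) n'(2) by auto
qed

lemma vanishes_iff_dvd:
  assumes "scaling P" shows "(\<forall>x. F x = 0 \<longrightarrow> meval h x P = 0) \<longleftrightarrow> FM dvd P"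
  using prime_on_cubic[OF assms assms] FM_dvd_imp_vanishes by auto

text \<open>On a line in a direction where the cubic does not vanish, \<open>FM\<close> has degree
  exactly 3 while \<open>P\<close> has degree at most 2.\<close>

lemma FM_dvd_low_degree:
  assumes dvd: "FM dvd P"
    and quad: "\<And>y w. \<exists>a b. \<forall>t. meval h (y [+] t [*] w) P = meval h y P + t * a + t\<^sup>2 * b"
  shows "P = 0"
proof (rule zero_test, rule ccontr)
  fix y assume y: "meval h y P \<noteq> 0"
  obtain w where w: "F w \<noteq> 0" using tangent by blast
  obtain a b where ab: "\<And>t. meval h (y [+] t [*] w) P = meval h y P + t * a + t\<^sup>2 * b" using quad by blast
  obtain U where U: "P = FM * U" using dvd by (elim dvdE)
  let ?f = "[:F y, T y w, T w y, F w:]"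
  define u where "u = meval (\<lambda>c. [:h c:]) (\<lambda>i. [:y i, w i:]) U"
  have u: "poly u t = meval h (y [+] t [*] w) U" for t
    unfolding u_def hom_meval[OF poly_hom] by (simp add: vadd_def vscale_def)
  have "poly (?f * u) t = poly [:meval h y P, a, b:] t" for t
  proof -
    have "poly ?f t = F (y [+] t [*] w)"
      by (simp add: cub_simps algebra_simps power2_eq_square power3_eq_cube)
    then have "poly (?f * u) t = meval h (y [+] t [*] w) P"
      unfolding poly_mult u U h.meval_mult eval_FM by simp
    then show ?thesis by (simp only: ab) (simp add: algebra_simps power2_eq_square)
  qed
  then have "poly (?f * u - [:meval h y P, a, b:]) t = 0" for t
    unfolding poly_diff by simp
  then have eq: "?f * u = [:meval h y P, a, b:]"
    using poly_eq_0_if_zero by fastforce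
  then have "u \<noteq> 0" using y by auto
  then have "degree (?f * u) = 3 + degree u"
    using w by (subst degree_mult_eq) auto
  moreover have "degree [:meval h y P, a, b:] \<le> 2" by simp
  ultimately show False unfolding eq by simp
qed

end

instance alg_closure :: (field) field_gcd ..

section \<open>Local dominance of the third-point map\<close>

lemma dvd_if_order_le:
  fixes p q :: "'e :: alg_closed_field poly"
  assumes "p \<noteq> 0" "q \<noteq> 0" "\<And>a. order a p \<le> order a q"
  shows "p dvd q"
  using assms
proof (induction "degree p" arbitrary: p q)
  case 0
  then have "p dvd 1" by (simp add: is_unit_iff_degree)
  then show ?case by (rule dvd_trans) simp
next
  case (Suc n)
  then have "degree p > 0" by simp
  then obtain a where a: "poly p a = 0" using alg_closed_imp_poly_has_root by blast
  then have "order a p > 0" using Suc.prems(1) by (simp add: order_root)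
  with Suc.prems(3)[of a] have "order a q > 0" by linarith
  then have "poly q a = 0" using Suc.prems(2) by (simp add: order_root)
  with a obtain p' q' where p': "p = [:- a, 1:] * p'" and q': "q = [:- a, 1:] * q'"
    by (auto simp: poly_eq_0_iff_dvd elim!: dvdE)
  have nz: "p' \<noteq> 0" "q' \<noteq> 0" "p \<noteq> 0" "q \<noteq> 0" using Suc.prems p' q' by auto
  have "degree p = Suc (degree p')" unfolding p' using nz by (subst degree_mult_eq) auto
  then have "n = degree p'" using Suc.hyps(2) by simp
  moreover have "order b p' \<le> order b q'" for b
    using Suc.prems(3)[of b] order_mult[OF nz(3)[unfolded p'], of b] order_mult[OF nz(4)[unfolded q'], of b]
    unfolding p' q' by linarith
  ultimately have "p' dvd q'" using nz by (intro Suc.hyps(1)) auto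
  then show ?case unfolding p' q' by (rule mult_dvd_mono[OF dvd_refl])
qed

text \<open>Closedness along a polynomial curve: finitely many parameters, such as those where a
  common factor was divided out, can be filled in.\<close>

lemma meval_limit:
  fixes W :: "nat \<Rightarrow> 'e :: alg_closed_field poly"
  assumes h: "comm_ring_hom h" and 0: "\<And>t. t \<notin> S \<Longrightarrow> meval h (\<lambda>i. poly (W i) t) G = 0" and "finite S"
  shows "meval h (\<lambda>i. poly (W i) t) G = 0"
proof -
  define g where "g = meval (\<lambda>c. [:h c:]) W G"
  have g: "poly g t = meval h (\<lambda>i. poly (W i) t) G" for t
    unfolding g_def hom_meval[OF poly_hom] by simp
  have "g = 0"
  proof (rule ccontr)
    assume "g \<noteq> 0"
    then have "finite {t. poly g t = 0}" by (rule poly_roots_finite)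
    moreover have "- S \<subseteq> {t. poly g t = 0}" using 0 by (auto simp: g)
    ultimately have "finite (- S)" by (rule rev_finite_subset)
    with \<open>finite S\<close> have "finite (S \<union> - S)" by simp
    with alg_closed_infinite[where 'e = 'e] show False by (simp add: Compl_partition)
  qed
  then show ?thesis by (simp flip: g)
qed

text \<open>
  At a point \<open>s\<close> of the cubic the tangent section is \<open>F + \<alpha> Q = 0\<close> on \<open>T\<^sub>s / s\<close>, with \<open>Q = T(-, s)\<close>.
  The certificate is a nonzero multiple of the value at \<open>z\<^sub>0\<close> of \<open>F - w Q\<close>, where \<open>w\<close> is the only linear
  form on the span of \<open>z\<^sub>0\<close> and \<open>z\<^sub>1\<close> for which \<open>F = w Q\<close> is possible.
\<close>

definition cert :: "nat \<Rightarrow> (nat \<Rightarrow> nat \<Rightarrow> nat \<Rightarrow> 'r :: comm_ring_1) \<Rightarrow> (nat \<Rightarrow> 'r) \<Rightarrow> (nat \<Rightarrow> 'r) \<Rightarrow> (nat \<Rightarrow> 'r) \<Rightarrow> 'r" where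
  "cert N c s z\<^sub>0 z\<^sub>1 = cubT N c z\<^sub>1 s * (cub N c z\<^sub>0 * (cubT N c z\<^sub>1 s)\<^sup>2
     - (cubT N c z\<^sub>1 z\<^sub>0 * cubT N c z\<^sub>1 s - cub N c z\<^sub>1 * cubD N c z\<^sub>0 z\<^sub>1 s) * cubT N c z\<^sub>0 s)"

text \<open>
  The points of the tangent section at \<open>s\<close> are parametrized by \<open>cub_rho\<close>, and \<open>cub_third\<close> is the
  third intersection point with the line through two points of the cubic.
\<close>

definition cub_rho :: "nat \<Rightarrow> (nat \<Rightarrow> nat \<Rightarrow> nat \<Rightarrow> 'r :: comm_ring_1) \<Rightarrow> (nat \<Rightarrow> 'r) \<Rightarrow> (nat \<Rightarrow> 'r) \<Rightarrow> nat \<Rightarrow> 'r" where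
  "cub_rho N c s z = cubT N c z s [*] z [+] (- cub N c z) [*] s"

definition cub_third :: "nat \<Rightarrow> (nat \<Rightarrow> nat \<Rightarrow> nat \<Rightarrow> 'r :: comm_ring_1) \<Rightarrow> (nat \<Rightarrow> 'r) \<Rightarrow> (nat \<Rightarrow> 'r) \<Rightarrow> nat \<Rightarrow> 'r" where
  "cub_third N c u u' = cubT N c u' u [*] u [+] (- cubT N c u u') [*] u'"

text \<open>The first conjunct says that the tangent hyperplane exists. Testing on two tangent
  vectors makes the non-divisibility by \<open>Q_s\<close> a polynomial condition on s, which then
  holds for general s if it holds once.\<close>

definition good :: "nat \<Rightarrow> (nat \<Rightarrow> nat \<Rightarrow> nat \<Rightarrow> 'r :: comm_ring_1) \<Rightarrow> (nat \<Rightarrow> 'r) \<Rightarrow> bool" where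
  "good N c s \<longleftrightarrow> (\<exists>e. cubT N c s e \<noteq> 0) \<and> (\<exists>z\<^sub>0 z\<^sub>1. cubT N c s z\<^sub>0 = 0 \<and> cubT N c s z\<^sub>1 = 0 \<and> cert N c s z\<^sub>0 z\<^sub>1 \<noteq> 0)"

locale cubic_closed =
  fixes N :: nat and c :: "nat \<Rightarrow> nat \<Rightarrow> nat \<Rightarrow> 'e :: {alg_closed_field, field_gcd}"
begin

abbreviation F where "F \<equiv> cub N c"
abbreviation T where "T \<equiv> cubT N c"
abbreviation D where "D \<equiv> cubD N c"

lemma cert_zero_if_proportional:
  assumes "\<And>t. F (z\<^sub>0 [+] t [*] z\<^sub>1) = (w\<^sub>0 + w\<^sub>1 * t) * T (z\<^sub>0 [+] t [*] z\<^sub>1) s"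
  shows "cert N c s z\<^sub>0 z\<^sub>1 = 0"
proof -
  let ?P = "[:F z\<^sub>0, T z\<^sub>0 z\<^sub>1, T z\<^sub>1 z\<^sub>0, F z\<^sub>1:] - [:w\<^sub>0, w\<^sub>1:] * [:T z\<^sub>0 s, D z\<^sub>0 z\<^sub>1 s, T z\<^sub>1 s:]"
  have "poly ?P t = 0" for t
  proof -
    have "poly ?P t = F (z\<^sub>0 [+] t [*] z\<^sub>1) - (w\<^sub>0 + w\<^sub>1 * t) * T (z\<^sub>0 [+] t [*] z\<^sub>1) s"
      by (simp add: cub_simps algebra_simps power2_eq_square power3_eq_cube)
    with assms show ?thesis by simp
  qed
  then have "?P = 0" by (rule poly_eq_0_if_zero)
  then have *: "F z\<^sub>0 = w\<^sub>0 * T z\<^sub>0 s" "F z\<^sub>1 = w\<^sub>1 * T z\<^sub>1 s" "T z\<^sub>1 z\<^sub>0 = w\<^sub>0 * T z\<^sub>1 s + w\<^sub>1 * D z\<^sub>0 z\<^sub>1 s"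
    by simp_all
  show ?thesis unfolding cert_def * by (simp add: algebra_simps power2_eq_square)
qed

abbreviation rho where "rho \<equiv> cub_rho N c"
abbreviation third where "third \<equiv> cub_third N c"

lemma third_scale: "third u (a [*] u') = a\<^sup>2 [*] third u u'"
  by (simp add: cub_third_def fun_eq_iff cub_simps algebra_simps power2_eq_square)

lemma F_third: "F u = 0 \<Longrightarrow> F u' = 0 \<Longrightarrow> F (third u u') = 0"
  by (simp add: cub_third_def cub_simps algebra_simps power2_eq_square power3_eq_cube)

lemma F_rho: "F s = 0 \<Longrightarrow> T s z = 0 \<Longrightarrow> F (rho s z) = 0"
  by (simp add: cub_rho_def cub_simps algebra_simps power2_eq_square power3_eq_cube)

context
  fixes h :: "'a :: comm_ring_1 \<Rightarrow> 'e" and G :: "'a mpoly" and d :: nat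
  assumes h: "comm_ring_hom h" and G: "homogeneous d G"
begin

lemma G_scale: "meval h (a [*] x) G = a ^ d * meval h x G"
  by (rule meval_homogeneous[OF h G])

text \<open>The quadric does not divide the cubic on the pencil, so at some parameter
  \<open>a\<close> the quadric vanishes to higher order. After division by the power of t - a coming
  from F, the curve \<open>rho s' (z t)\<close> passes through a nonzero multiple of s' at
  \<open>t = a\<close>.\<close>

lemma third_limit:
  assumes s': "T s' v\<^sub>0 = 0" "T s' v\<^sub>1 = 0"
    and Q: "T v\<^sub>1 s' \<noteq> 0" and ndvd: "\<not> [:T v\<^sub>0 s', D v\<^sub>0 v\<^sub>1 s', T v\<^sub>1 s':] dvd [:F v\<^sub>0, T v\<^sub>0 v\<^sub>1, T v\<^sub>1 v\<^sub>0, F v\<^sub>1:]"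
    and 0: "\<And>z'. T s' z' = 0 \<Longrightarrow> meval h (third u (rho s' z')) G = 0"
  shows "meval h (third u s') G = 0"
proof -
  let ?f = "[:F v\<^sub>0, T v\<^sub>0 v\<^sub>1, T v\<^sub>1 v\<^sub>0, F v\<^sub>1:]" and ?q = "[:T v\<^sub>0 s', D v\<^sub>0 v\<^sub>1 s', T v\<^sub>1 s':]"
  define fP where "fP = ?f" define qP where "qP = ?q"
  have nz: "fP \<noteq> 0" "qP \<noteq> 0" using ndvd Q by (auto simp: fP_def qP_def)
  obtain a where a: "order a qP > order a fP"
    using dvd_if_order_le[OF nz(2,1)] ndvd unfolding fP_def qP_def by (meson not_le)
  define i where "i = order a fP"
  obtain f1 where f1: "fP = [:-a, 1:] ^ i * f1" "\<not> [:-a, 1:] dvd f1"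
    using order_decomp[OF nz(1), of a] unfolding i_def by blast
  have "[:-a, 1:] ^ Suc i dvd qP"
    using a unfolding i_def by (meson Suc_leI order_1 le_imp_power_dvd dvd_trans)
  then obtain q1 where q1: "qP = [:-a, 1:] ^ Suc i * q1" by (elim dvdE)
  have f1a: "poly f1 a \<noteq> 0" using f1(2) by (simp add: poly_eq_0_iff_dvd)
  let ?z = "\<lambda>t. v\<^sub>0 [+] t [*] v\<^sub>1"
  define y where "y t = ((t - a) * poly q1 t) [*] ?z t [+] (- poly f1 t) [*] s'" for t
  have Fz: "F (?z t) = (t - a) ^ i * poly f1 t" for t
  proof -
    have "F (?z t) = poly fP t"
      by (simp add: fP_def cub_simps algebra_simps power2_eq_square power3_eq_cube)
    then show ?thesis by (simp add: f1 poly_power)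
  qed
  have Qz: "T (?z t) s' = (t - a) ^ i * ((t - a) * poly q1 t)" for t
  proof -
    have "T (?z t) s' = poly qP t"
      by (simp add: qP_def cub_simps algebra_simps power2_eq_square)
    then show ?thesis by (simp add: q1 poly_power algebra_simps)
  qed
  have rho: "rho s' (?z t) = (t - a) ^ i [*] y t" for t
    unfolding cub_rho_def Fz Qz y_def by (simp add: fun_eq_iff algebra_simps)
  have y0: "meval h (third u (y t)) G = 0" if "t \<noteq> a" for t
  proof -
    have "T s' (?z t) = 0" using s' by (simp add: cub_simps)
    from 0[OF this] have "((t - a) ^ i)\<^sup>2 ^ d * meval h (third u (y t)) G = 0"
      by (simp only: rho third_scale G_scale)
    then show ?thesis using that by simp
  qed
  define yP where "yP = ([:-a, 1:] * q1) [*] ((\<lambda>i. [:v\<^sub>0 i:]) [+] [:0, 1:] [*] (\<lambda>i. [:v\<^sub>1 i:])) [+] (- f1) [*] (\<lambda>i. [:s' i:])"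
  define cP where "cP = (\<lambda>i j k. [:c i j k:])"
  define uP where "uP = (\<lambda>i. [:u i:])"
  define W where "W = cubT N cP yP uP [*] uP [+] (- cubT N cP uP yP) [*] yP"
  have yP: "(\<lambda>i. poly (yP i) t) = y t" for t
    by (simp add: yP_def y_def fun_eq_iff algebra_simps)
  have W: "(\<lambda>i. poly (W i) t) = third u (y t)" for t
    unfolding W_def cub_third_def
    by (simp add: fun_eq_iff hom_cubT[OF poly_hom] cP_def uP_def) (simp add: yP fun_cong[OF yP])
  have "meval h (\<lambda>i. poly (W i) a) G = 0"
    by (rule meval_limit[OF h, of "{a}"]) (auto simp: W y0)
  then have "meval h (third u (y a)) G = 0" by (simp only: W)
  moreover have "y a = (- poly f1 a) [*] s'" by (simp add: y_def fun_eq_iff)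
  ultimately have "(- poly f1 a)\<^sup>2 ^ d * meval h (third u s') G = 0"
    by (simp only: third_scale G_scale)
  then show ?thesis using f1a by simp
qed

end

end

context cubic_closed
begin

text \<open>A quotient of the cubic by the quadric on the pencil would have degree at most 1, which
  is the proportionality that the certificate excludes.\<close>

lemma cert_not_dvd:
  assumes "cert N c s v\<^sub>0 v\<^sub>1 \<noteq> 0" "T (v\<^sub>1 [+] \<sigma> [*] v\<^sub>0) s \<noteq> 0"
  defines "w \<equiv> v\<^sub>1 [+] \<sigma> [*] v\<^sub>0"
  shows "\<not> [:T v\<^sub>0 s, D v\<^sub>0 w s, T w s:] dvd [:F v\<^sub>0, T v\<^sub>0 w, T w v\<^sub>0, F w:]"
proof
  let ?f = "[:F v\<^sub>0, T v\<^sub>0 w, T w v\<^sub>0, F w:]" and ?q = "[:T v\<^sub>0 s, D v\<^sub>0 w s, T w s:]"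
  have q2: "T w s \<noteq> 0" using assms(2) by (simp add: w_def)
  assume "?q dvd ?f"
  then obtain k where k: "?f = ?q * k" by (elim dvdE)
  have "degree k \<le> 1"
  proof (cases "k = 0")
    case False
    have "degree ?q = 2" using q2 by simp
    then have "degree ?f = 2 + degree k" unfolding k using False q2 by (subst degree_mult_eq) auto
    moreover have "degree ?f \<le> 3" by simp
    ultimately show ?thesis by linarith
  qed simp
  then have "k = [:Polynomial.coeff k 0, Polynomial.coeff k 1:]"
    by (intro poly_eqI) (auto simp: coeff_pCons coeff_eq_0 split: nat.split)
  then obtain w\<^sub>0 w\<^sub>1 where "k = [:w\<^sub>0, w\<^sub>1:]" by blast
  with k have "F v\<^sub>0 = w\<^sub>0 * T v\<^sub>0 s" "T v\<^sub>0 w = w\<^sub>0 * D v\<^sub>0 w s + w\<^sub>1 * T v\<^sub>0 s"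
     "T w v\<^sub>0 = w\<^sub>0 * T w s + w\<^sub>1 * D v\<^sub>0 w s" "F w = w\<^sub>1 * T w s"
    by (simp_all add: algebra_simps)
  note k = this
  have "F (v\<^sub>0 [+] t [*] v\<^sub>1) = (w\<^sub>0 + (w\<^sub>1 - w\<^sub>0 * \<sigma>) * t) * T (v\<^sub>0 [+] t [*] v\<^sub>1) s" for t
  proof -
    have *: "v\<^sub>0 [+] t [*] v\<^sub>1 = (1 - t * \<sigma>) [*] v\<^sub>0 [+] t [*] w"
      by (simp add: w_def fun_eq_iff algebra_simps)
    show ?thesis unfolding * cub_lin
      by (simp add: k cubT_add cubT_scale cubD_scale algebra_simps power2_eq_square power3_eq_cube)
  qed
  then have "cert N c s v\<^sub>0 v\<^sub>1 = 0" by (rule cert_zero_if_proportional)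
  with assms(1) show False by contradiction
qed

text \<open>If f = b b' with b dividing q and b' dividing q', the degrees force b or b' to have
  degree 2; it is then associated to q or q', which would divide f.\<close>

lemma not_dvd_prod:
  fixes f q q' :: "'e poly"
  assumes "degree f = 3" "degree q = 2" "degree q' = 2" "\<not> q dvd f" "\<not> q' dvd f"
  shows "\<not> f dvd q * q'"
proof
  have nz: "q \<noteq> 0" "q' \<noteq> 0" "f \<noteq> 0" using assms by auto
  assume "f dvd q * q'"
  then obtain b b' where b: "f = b * b'" "b dvd q" "b' dvd q'" using division_decomp by metis
  have *: "r dvd f" if as: "b dvd r" "degree b = 2" "degree r = 2" "r \<noteq> 0" "b dvd f" for r b :: "'e poly"
  proof -
    obtain k where k: "r = b * k" using as(1) by (elim dvdE)
    have "k \<noteq> 0" "b \<noteq> 0" using as(4) k by auto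
    then have "degree r = degree b + degree k" unfolding k by (simp add: degree_mult_eq)
    then have "degree k = 0" using as by simp
    then have "k dvd 1" using \<open>k \<noteq> 0\<close> by (simp add: is_unit_iff_degree)
    then have "r dvd b" unfolding k by (metis dvd_refl mult_unit_dvd_iff)
    then show ?thesis using as(5) by (rule dvd_trans)
  qed
  have "b \<noteq> 0" "b' \<noteq> 0" using nz(3) b(1) by auto
  then have "degree f = degree b + degree b'" unfolding b(1) by (rule degree_mult_eq)
  moreover have "degree b \<le> 2" "degree b' \<le> 2"
    using dvd_imp_degree_le[OF b(2) nz(1)] dvd_imp_degree_le[OF b(3) nz(2)] assms by auto
  ultimately have "degree b = 2 \<or> degree b' = 2" using assms(1) by linarith
  then show False
    using *[of b q] *[of b' q'] b assms nz by auto
qed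

text \<open>Two limits are taken. First \<open>third_limit\<close> replaces the second point by s'
  itself. Then let F vanish at \<open>a\<close> to higher order than the product of the quadrics of
  s and s'. In \<open>third (rho s z) s'\<close> the coefficient \<open>Q_s(z)^2 Q_s'(z)\<close> of
  s' has the lowest order, so dividing by that power of t - a leaves a nonzero multiple of
  s'.\<close>

lemma local_dominance:
  fixes h :: "'a :: comm_ring_1 \<Rightarrow> 'e" and G :: "'a mpoly"
  assumes h: "comm_ring_hom h" and G: "homogeneous d G"
    and F: "F s = 0" "F s' = 0" and V: "T s v\<^sub>0 = 0" "T s v\<^sub>1 = 0" "T s' v\<^sub>0 = 0" "T s' v\<^sub>1 = 0"
    and cert: "cert N c s v\<^sub>0 v\<^sub>1 \<noteq> 0" "cert N c s' v\<^sub>0 v\<^sub>1 \<noteq> 0"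
    and 0: "\<And>z z'. T s z = 0 \<Longrightarrow> T s' z' = 0 \<Longrightarrow> meval h (third (rho s z) (rho s' z')) G = 0"
  shows "meval h s' G = 0"
proof -
  have q2: "T v\<^sub>1 s \<noteq> 0" "T v\<^sub>1 s' \<noteq> 0" using cert by (auto simp: cert_def)
  let ?f = "[:F v\<^sub>1, T v\<^sub>1 v\<^sub>0, T v\<^sub>0 v\<^sub>1, F v\<^sub>0:]"
  let ?q = "\<lambda>s. [:T v\<^sub>1 s, D v\<^sub>0 v\<^sub>1 s, T v\<^sub>0 s:]"
  have "?f \<noteq> 0" using cert by (auto simp: cert_def)
  moreover have "?q s \<noteq> 0" "?q s' \<noteq> 0" using q2 by simp_all
  ultimately have "?f * ?q s * ?q s' \<noteq> 0" by (metis mult_eq_0_iff)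
  \<comment> \<open>A general direction \<open>w = v\<^sub>1 + \<sigma> v\<^sub>0\<close> gives the
    polynomials in the pencil parameter the exact degrees 3, 2 and 2 required by
    \<open>not_dvd_prod\<close>.\<close>
  then obtain \<sigma> where \<sigma>: "poly (?f * ?q s * ?q s') \<sigma> \<noteq> 0" using poly_eq_0_if_zero by blast
  define w where "w = v\<^sub>1 [+] \<sigma> [*] v\<^sub>0"
  have "poly ?f \<sigma> = F w"
    by (simp add: w_def cub_simps algebra_simps power2_eq_square power3_eq_cube)
  moreover have "poly (?q r) \<sigma> = T w r" for r
    using cubD_commute(1)[of N c v\<^sub>1 v\<^sub>0 r]
    by (simp add: w_def cub_simps algebra_simps power2_eq_square)
  ultimately have w: "F w \<noteq> 0" "T w s \<noteq> 0" "T w s' \<noteq> 0"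
    using \<sigma> by (simp_all only: poly_mult mult_eq_0_iff) auto
  have Vw: "T s w = 0" "T s' w = 0" using V by (simp_all add: w_def cub_simps)
  define fP where "fP = [:F v\<^sub>0, T v\<^sub>0 w, T w v\<^sub>0, F w:]"
  define qP where "qP = [:T v\<^sub>0 s, D v\<^sub>0 w s, T w s:]"
  define qP' where "qP' = [:T v\<^sub>0 s', D v\<^sub>0 w s', T w s':]"
  have ndvd: "\<not> qP dvd fP" "\<not> qP' dvd fP"
    unfolding qP_def qP'_def fP_def w_def
    by (rule cert_not_dvd[OF cert(1)], use w in \<open>simp add: w_def\<close>)
       (rule cert_not_dvd[OF cert(2)], use w in \<open>simp add: w_def\<close>)
  have deg: "degree fP = 3" "degree qP = 2" "degree qP' = 2" using w by (simp_all add: fP_def qP_def qP'_def)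
  then have nz: "fP \<noteq> 0" "qP \<noteq> 0" "qP' \<noteq> 0" by auto
  have nd: "\<not> fP dvd qP * qP'" by (rule not_dvd_prod[OF deg ndvd])
  have lim: "meval h (third (rho s z) s') G = 0" if "T s z = 0" for z
    by (rule third_limit[OF h G V(3) Vw(2) w(3) ndvd(2)[unfolded qP'_def fP_def] 0[OF that]])
  obtain a where a: "order a fP > order a (qP * qP')"
    using dvd_if_order_le[OF nz(1), of "qP * qP'"] nz nd by (meson mult_eq_0_iff not_le)
  define b where "b = order a qP" define b' where "b' = order a qP'"
  define g where "g = order a fP - b - b'"
  have e: "order a fP = b + b' + g" "g > 0"
    using a nz order_mult[of qP qP' a] by (simp_all add: b_def b'_def g_def)
  obtain q1 where q1: "qP = [:-a, 1:] ^ b * q1" "\<not> [:-a, 1:] dvd q1"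
    using order_decomp[OF nz(2), of a] unfolding b_def by blast
  obtain q1' where q1': "qP' = [:-a, 1:] ^ b' * q1'" "\<not> [:-a, 1:] dvd q1'"
    using order_decomp[OF nz(3), of a] unfolding b'_def by blast
  obtain f1 where f1: "fP = [:-a, 1:] ^ (b + b' + g) * f1"
    using order_decomp[OF nz(1), of a] unfolding e(1) by blast
  let ?z = "\<lambda>t. v\<^sub>0 [+] t [*] w"
  have Fz: "F (?z t) = (t - a) ^ (b + b' + g) * poly f1 t" for t
  proof -
    have "F (?z t) = poly fP t"
      by (simp add: fP_def cub_simps algebra_simps power2_eq_square power3_eq_cube)
    then show ?thesis by (simp add: f1 poly_power)
  qed
  have Qz: "T (?z t) s = (t - a) ^ b * poly q1 t" for t
  proof -
    have "T (?z t) s = poly qP t" by (simp add: qP_def cub_simps algebra_simps power2_eq_square)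
    then show ?thesis by (simp add: q1 poly_power)
  qed
  have Qz': "T (?z t) s' = (t - a) ^ b' * poly q1' t" for t
  proof -
    have "T (?z t) s' = poly qP' t" by (simp add: qP'_def cub_simps algebra_simps power2_eq_square)
    then show ?thesis by (simp add: q1' poly_power)
  qed
  have Vz: "T s (?z t) = 0" "T s' (?z t) = 0" for t using V Vw by (simp_all add: cub_simps)
  let ?N = "T s s'" and ?N' = "T s' s"
  define y where "y t = (- ((t - a) ^ g * poly f1 t * ?N' * poly q1 t)) [*] ?z t
      [+] ((t - a) ^ (b' + 2 * g) * (poly f1 t)\<^sup>2 * ?N') [*] s
      [+] (- ((poly q1 t)\<^sup>2 * poly q1' t - (t - a) ^ g * poly q1 t * poly f1 t * (D v\<^sub>0 s s' + t * D w s s')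
             + (t - a) ^ (b' + 2 * g) * (poly f1 t)\<^sup>2 * ?N)) [*] s'" for t
  have third: "third (rho s (?z t)) s' = (t - a) ^ (2 * b + b') [*] y t" for t
  proof -
    define \<pi> where "\<pi> = t - a"
    have \<pi>: "(t - a) ^ k = \<pi> ^ k" for k by (simp add: \<pi>_def)
    have M': "T s' (rho s (?z t)) = - (\<pi> ^ (b + b' + g) * poly f1 t) * ?N'"
      unfolding cub_rho_def cubT_add cubT_scale using Vz(2)[of t] Fz[of t] by (simp add: cubT_add cubT_scale \<pi>)
    have M: "T (rho s (?z t)) s' = (\<pi> ^ b * poly q1 t)\<^sup>2 * (\<pi> ^ b' * poly q1' t)
        - \<pi> ^ b * poly q1 t * (\<pi> ^ (b + b' + g) * poly f1 t) * (D v\<^sub>0 s s' + t * D w s s')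
        + (\<pi> ^ (b + b' + g) * poly f1 t)\<^sup>2 * ?N"
    proof -
      have "T (rho s (?z t)) s' = (T (?z t) s)\<^sup>2 * T (?z t) s' - T (?z t) s * F (?z t) * D (?z t) s s' + (F (?z t))\<^sup>2 * ?N"
        unfolding cub_rho_def cubT_add(1)[of N c "_ [*] _"] cubT_scale cubD_scale by (simp add: power2_eq_square algebra_simps)
      then show ?thesis unfolding Fz Qz Qz' \<pi> by (simp add: cubD_add cubD_scale)
    qed
    have pw: "\<pi> ^ (b + b' + g) = \<pi> ^ b * \<pi> ^ b' * \<pi> ^ g" "\<pi> ^ (2 * b + b') = \<pi> ^ b * \<pi> ^ b * \<pi> ^ b'"
       "\<pi> ^ (b' + 2 * g) = \<pi> ^ b' * \<pi> ^ g * \<pi> ^ g"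
      by (simp_all add: power_add mult_2)
    show ?thesis
      unfolding cub_third_def M M' unfolding cub_rho_def Fz Qz y_def \<pi> pw
      by (simp add: fun_eq_iff algebra_simps power2_eq_square)
  qed
  have y0: "meval h (y t) G = 0" if "t \<noteq> a" for t
  proof -
    have "((t - a) ^ (2 * b + b')) ^ d * meval h (y t) G = 0"
      using lim[OF Vz(1)] by (simp only: third meval_homogeneous[OF h G])
    then show ?thesis using that by simp
  qed
  define yP where "yP i = - ([:-a, 1:] ^ g * f1 * [:?N':] * q1 * [:v\<^sub>0 i, w i:])
      + [:-a, 1:] ^ (b' + 2 * g) * f1\<^sup>2 * [:?N':] * [:s i:]
      - (q1\<^sup>2 * q1' - [:-a, 1:] ^ g * q1 * f1 * [:D v\<^sub>0 s s', D w s s':]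
             + [:-a, 1:] ^ (b' + 2 * g) * f1\<^sup>2 * [:?N:]) * [:s' i:]" for i
  have yP: "(\<lambda>i. poly (yP i) t) = y t" for t
    by (simp add: yP_def y_def fun_eq_iff poly_power algebra_simps)
  have "meval h (\<lambda>i. poly (yP i) a) G = 0"
    by (rule meval_limit[OF h, of "{a}"]) (simp_all add: yP y0)
  moreover have "y a = (- ((poly q1 a)\<^sup>2 * poly q1' a)) [*] s'"
    using e(2) by (simp add: y_def fun_eq_iff zero_power)
  ultimately have "(- ((poly q1 a)\<^sup>2 * poly q1' a)) ^ d * meval h s' G = 0"
    by (simp only: yP meval_homogeneous[OF h G])
  moreover have "poly q1 a \<noteq> 0" "poly q1' a \<noteq> 0" using q1(2) q1'(2) by (simp_all add: poly_eq_0_iff_dvd)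
  ultimately show ?thesis by simp
qed

end

section \<open>A criterion for unirationality\<close>

lemma to_ac_hom: "comm_ring_hom (to_ac :: 'a :: field \<Rightarrow> 'a alg_closure)"
  by unfold_locales simp_all

lemma meval_mpoly_cong:
  assumes "P \<in> poly_ring N" "\<And>i. i < N \<Longrightarrow> x i = y i"
  shows "meval h x P = meval h y P"
  using assms by (intro meval_cong) (auto simp: poly_ring_def)

lemma mvar_poly_ring: "i < N \<Longrightarrow> (mvar i :: 'a :: zero_neq_one mpoly) \<in> poly_ring N"
  by (simp add: poly_ring_def mvars_def mvar_def)

lemma mvar_homogeneous: "homogeneous 1 (mvar i :: 'a :: zero_neq_one mpoly)"
  by (simp add: homogeneous_def mvar_def)

text \<open>Dominance only has to be tested on single forms G over k, as closed sets are
  intersections of their zero sets. The values are taken on functions instead of vectors, which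
  leaves the choice of the number of parameters to the end.\<close>

lemma unirational_criterion:
  fixes F :: "'k :: field mpoly" and g :: "nat \<Rightarrow> 'k mpoly"
  assumes F: "F \<in> poly_ring N"
    and on: "\<And>t. meval to_ac (\<lambda>i. meval to_ac t (g i)) F = 0"
    and dom: "\<And>G d x. G \<in> poly_ring N \<Longrightarrow> homogeneous d G \<Longrightarrow>
        (\<And>t. meval to_ac (\<lambda>i. meval to_ac t (g i)) G = 0) \<Longrightarrow> meval to_ac x F = 0 \<Longrightarrow> meval to_ac x G = 0"
    and pt: "\<exists>x. (\<exists>i<N. x i \<noteq> 0) \<and> meval to_ac x F = 0"
  shows "unirational N F"
proof -
  interpret a: comm_ring_hom "to_ac :: 'k \<Rightarrow> 'k alg_closure" by (rule to_ac_hom)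
  let ?g = "\<lambda>t i. meval to_ac t (g i)"
  obtain m where m: "\<And>i. i < N \<Longrightarrow> g i \<in> poly_ring m" using poly_ring_exists[of N g] by blast
  have vec: "meval to_ac (($) (vec m t)) (g i) = ?g t i" if "i < N" for t i
    by (rule meval_mpoly_cong[OF m[OF that]]) simp
  \<comment> \<open>If all coordinates vanished identically, \<open>dom\<close> applied to the
    coordinate forms would make every point of the cubic zero.\<close>
  obtain t\<^sub>0 i\<^sub>0 where t0: "i\<^sub>0 < N" "?g t\<^sub>0 i\<^sub>0 \<noteq> 0"
  proof (rule ccontr)
    assume neg: "\<not> thesis"
    obtain x i where x: "i < N" "x i \<noteq> 0" "meval to_ac x F = 0" using pt by blast
    have "meval to_ac x (mvar i :: 'k mpoly) = 0"
      by (rule dom[OF mvar_poly_ring[OF x(1)] mvar_homogeneous _ x(3)])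
         (use neg that x(1) in \<open>auto simp: a.meval_mvar\<close>)
    with x(2) show False by simp
  qed
  have "meval mconst g F = 0"
    by (rule meval_eq_0_imp[OF to_ac_hom _ alg_closed_infinite]) (simp_all add: meval_compose[OF to_ac_hom] on)
  moreover have "g i\<^sub>0 \<noteq> 0" using t0(2) by auto
  ultimately have "rational_map m N F g" using m t0(1) unfolding rational_map_def by blast
  moreover have "dominant m N F g"
    unfolding dominant_def
  proof (intro allI impI)
    fix Z :: "'k alg_closure vec set"
    assume Z: "zariski_closed N Z \<and> map_image m N g \<subseteq> Z"
    from Z have "\<exists>S :: 'k mpoly set. (\<forall>G\<in>S. G \<in> poly_ring N \<and> (\<exists>d. homogeneous d G)) \<and>
        Z = {x \<in> proj_coords N. \<forall>G\<in>S. meval to_ac (($) x) G = 0}"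
      unfolding zariski_closed_def by (rule conjunct1)
    then obtain S :: "'k mpoly set" where S0: "\<forall>G\<in>S. G \<in> poly_ring N \<and> (\<exists>d. homogeneous d G)"
        and S2: "Z = {x \<in> proj_coords N. \<forall>G\<in>S. meval to_ac (($) x) G = 0}"
      by (elim exE conjE)
    have S1: "G \<in> poly_ring N \<and> (\<exists>d. homogeneous d G)" if "G \<in> S" for G using S0 that by (rule bspec)
    have van: "meval to_ac (?g t) G = 0" if G: "G \<in> S" for G t
    proof -
      obtain d where d: "homogeneous d G" "G \<in> poly_ring N" using S1[OF G] by (elim conjE exE)
      have nz: "meval to_ac (?g t) G = 0" if "i < N" "?g t i \<noteq> 0" for t i
      proof -
        let ?y = "vec N (\<lambda>i. meval to_ac (($) (vec m t)) (g i))"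
        have yi: "?y $ i \<noteq> 0" using that(2) vec[OF that(1)] that(1) by simp
        have "0\<^sub>v N $ i = (0 :: 'k alg_closure)" using that(1) by simp
        with yi have "?y \<noteq> 0\<^sub>v N" by metis
        then have "?y \<in> proj_coords N" by (simp add: proj_coords_def)
        then have "?y \<in> map_image m N g"
          unfolding map_image_def mem_Collect_eq by (intro conjI bexI[of _ "vec m t"]) simp_all
        then have "?y \<in> Z" by (rule subsetD[OF conjunct2[OF Z]])
        then have "meval to_ac (($) ?y) G = 0" 
          using G unfolding S2 mem_Collect_eq by (elim conjE) (rule bspec)
        moreover have "meval to_ac (($) ?y) G = meval to_ac (?g t) G"
          by (rule meval_mpoly_cong[OF d(2)]) (simp add: vec)
        ultimately show ?thesis by simp
      qed
      show ?thesis
      proof (cases "\<exists>i<N. ?g t i \<noteq> 0")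
        case False
        \<comment> \<open>Writing the zero vector as 0 times a nonzero image point also covers forms
          of degree 0, which do not vanish at the origin by themselves.\<close>
        have "meval to_ac (?g t) G = meval to_ac (0 [*] ?g t\<^sub>0) G"
          by (rule meval_mpoly_cong[OF d(2)]) (use False in auto)
        also have "\<dots> = 0" using nz[OF t0] by (simp add: meval_homogeneous[OF to_ac_hom d(1)])
        finally show ?thesis .
      qed (use nz in blast)
    qed
    show "geometric_points N F \<subseteq> Z"
    proof
      fix x assume x: "x \<in> geometric_points N F"
      then have "meval to_ac (($) x) F = 0" "x \<in> proj_coords N" by (auto simp: geometric_points_def)
      moreover from this have "meval to_ac (($) x) G = 0" if "G \<in> S" for G
        using S1[OF that] dom[OF _ _ van[OF that]] by blast
      ultimately show "x \<in> Z" unfolding S2 by blast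
    qed
  qed
  ultimately show ?thesis unfolding unirational_def by blast
qed

section \<open>Pairs of conjugate points\<close>

lemma hom_cub_rho: "comm_ring_hom f \<Longrightarrow> (\<lambda>i. f (cub_rho N c s z i)) = cub_rho N (\<lambda>i j k. f (c i j k)) (\<lambda>i. f (s i)) (\<lambda>i. f (z i))"
proof -
  assume f: "comm_ring_hom f"
  interpret f: comm_ring_hom f by fact
  show ?thesis
    by (simp add: cub_rho_def vadd_def vscale_def f.hom_add f.hom_mult f.hom_uminus f.hom_minus hom_cub[OF f] hom_cubT[OF f])
qed

lemma hom_cert: "comm_ring_hom f \<Longrightarrow> f (cert N c s z z') = cert N (\<lambda>i j k. f (c i j k)) (\<lambda>i. f (s i)) (\<lambda>i. f (z i)) (\<lambda>i. f (z' i))"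
proof -
  assume f: "comm_ring_hom f"
  interpret f: comm_ring_hom f by fact
  show ?thesis
    by (simp add: cert_def f.hom_minus f.hom_mult f.hom_power hom_cub[OF f] hom_cubT[OF f] hom_cubD[OF f])
qed

lemma cert_scale: "cert N c s (a [*] z) (a [*] z') = a ^ 9 * cert N c s z z'"
  unfolding cert_def by (simp add: cub_simps algebra_simps power2_eq_square power_def) 

lemma cert_scale_point: "cert N c (a [*] s) z z' = a ^ 3 * cert N c s z z'"
  unfolding cert_def by (simp add: cub_simps algebra_simps power2_eq_square power3_eq_cube)

text \<open>Projection along \<open>e\<close> onto the tangent hyperplane of \<open>s\<close>,
  multiplied by \<open>T(s, e)\<close> to keep it polynomial in \<open>s\<close>.\<close>

definition tproj :: "nat \<Rightarrow> (nat \<Rightarrow> nat \<Rightarrow> nat \<Rightarrow> 'r :: comm_ring_1) \<Rightarrow> (nat \<Rightarrow> 'r) \<Rightarrow> (nat \<Rightarrow> 'r) \<Rightarrow> (nat \<Rightarrow> 'r) \<Rightarrow> nat \<Rightarrow> 'r" where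
  "tproj N c e s z = cubT N c s e [*] z [+] (- cubT N c s z) [*] e"

lemma cubT_tproj [simp]: "cubT N c s (tproj N c e s z) = 0"
  by (simp add: tproj_def cubT_add cubT_scale)

lemma tproj_scale: "tproj N c e (a [*] s) z = a\<^sup>2 [*] tproj N c e s z"
  by (simp add: tproj_def cubT_scale fun_eq_iff algebra_simps)

lemma hom_tproj: "comm_ring_hom f \<Longrightarrow> (\<lambda>i. f (tproj N c e s z i)) = tproj N (\<lambda>i j k. f (c i j k)) (\<lambda>i. f (e i)) (\<lambda>i. f (s i)) (\<lambda>i. f (z i))"
proof -
  assume f: "comm_ring_hom f"
  interpret f: comm_ring_hom f by fact
  show ?thesis
    by (simp add: tproj_def vadd_def vscale_def f.hom_add f.hom_mult f.hom_uminus f.hom_minus hom_cubT[OF f])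
qed

context cubic_closed
begin

text \<open>On the tangent hyperplane \<open>F(z + a s) = F(z) + a Q_s(z)\<close>, so the linear
  form w in a relation F = w Q_s is merely shifted; the certificate depends on tangent vectors
  modulo \<open>s\<close> only.\<close>

lemma cert_shift:
  assumes "F s = 0" "T s z = 0" "T s z' = 0"
  shows "cert N c s (z [+] a [*] s) (z' [+] b [*] s) = cert N c s z z'"
proof -
  have 1: "D z z' s = D z' z s" "D z' s z = D z' z s" by (rule cubD_commute)+
  have 3: "D s s z = 0" "D s z s = 0" "D z s s = 0" "D s s z' = 0" "D s z' s = 0" "D z' s s = 0" "T s s = 0" "D s s s = 0"
    using assms by (simp_all add: cubD_same cubT_same)
  have 2: "T (z [+] a [*] s) s = T z s" "T (z' [+] b [*] s) s = T z' s"
    "D (z [+] a [*] s) (z' [+] b [*] s) s = D z' z s"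
    "F (z [+] a [*] s) = F z + a * T z s" "F (z' [+] b [*] s) = F z' + b * T z' s"
    "T (z' [+] b [*] s) (z [+] a [*] s) = T z' z + a * T z' s + b * D z' z s"
    using assms by (simp_all add: cub_add cub_scale cubT_add cubT_scale cubD_add cubD_scale 1 3 algebra_simps)
  show ?thesis unfolding cert_def 2 1 by (simp add: algebra_simps power2_eq_square)
qed

lemma cert_line_poly: "\<exists>P. \<forall>t. poly P t = cert N c s (a [+] t [*] b) (a' [+] t [*] b')"
proof -
  define P where "P = cert N (\<lambda>i j k. [:c i j k:]) (\<lambda>i. [:s i:]) (\<lambda>i. [:a i, b i:]) (\<lambda>i. [:a' i, b' i:])"
  have "poly P t = cert N c s (a [+] t [*] b) (a' [+] t [*] b')" for t
    unfolding P_def hom_cert[OF poly_hom] by (simp add: vadd_def vscale_def)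
  then show ?thesis by blast
qed

text \<open>As \<open>T(s, s')\<close> and \<open>T(s', s)\<close> are nonzero, tangent vectors at
  \<open>s\<close> and at \<open>s'\<close> can be shifted along \<open>s\<close> and
  \<open>s'\<close> into both hyperplanes without changing their certificates. On the line joining
  the two shifted pairs each certificate is a nonzero polynomial, so some pair serves both
  points.\<close>

lemma good_pair:
  assumes F: "F s = 0" "F s' = 0" and N: "T s s' \<noteq> 0" "T s' s \<noteq> 0"
    and z: "T s z\<^sub>0 = 0" "T s z\<^sub>1 = 0" "cert N c s z\<^sub>0 z\<^sub>1 \<noteq> 0"
    and z': "T s' z\<^sub>0' = 0" "T s' z\<^sub>1' = 0" "cert N c s' z\<^sub>0' z\<^sub>1' \<noteq> 0"
  obtains v\<^sub>0 v\<^sub>1 where "T s v\<^sub>0 = 0" "T s v\<^sub>1 = 0" "T s' v\<^sub>0 = 0" "T s' v\<^sub>1 = 0"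
    "cert N c s v\<^sub>0 v\<^sub>1 \<noteq> 0" "cert N c s' v\<^sub>0 v\<^sub>1 \<noteq> 0"
proof -
  have ss: "T s s = 0" "T s' s' = 0" using F by (simp_all add: cubT_same)
  let ?a = "\<lambda>z. z [+] (- T s' z / T s' s) [*] s" and ?b = "\<lambda>z. z [+] (- T s z / T s s') [*] s'"
  let ?v = "\<lambda>t z z'. ?a z [+] t [*] (?b z' [+] (- 1) [*] ?a z)"
  have a: "T s (?a z) = 0" "T s' (?a z) = 0" if "T s z = 0" for z
    using that ss N by (simp_all add: cubT_add cubT_scale)
  have b: "T s (?b z) = 0" "T s' (?b z) = 0" if "T s' z = 0" for z
    using that ss N by (simp_all add: cubT_add cubT_scale)
  obtain P where P: "\<And>t. poly P t = cert N c s (?v t z\<^sub>0 z\<^sub>0') (?v t z\<^sub>1 z\<^sub>1')" using cert_line_poly by metis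
  obtain P' where P': "\<And>t. poly P' t = cert N c s' (?v t z\<^sub>0 z\<^sub>0') (?v t z\<^sub>1 z\<^sub>1')" using cert_line_poly by metis
  have v: "?v 0 z z' = ?a z" "?v 1 z z' = ?b z'" for z z' by (simp_all add: fun_eq_iff)
  have "poly P 0 = cert N c s z\<^sub>0 z\<^sub>1" unfolding P v by (rule cert_shift[OF F(1) z(1,2)])
  moreover have "poly P' 1 = cert N c s' z\<^sub>0' z\<^sub>1'" unfolding P' v by (rule cert_shift[OF F(2) z'(1,2)])
  ultimately have "poly P 0 \<noteq> 0" "poly P' 1 \<noteq> 0" using z(3) z'(3) by simp_all
  then have "P * P' \<noteq> 0" by auto
  then obtain t where "poly (P * P') t \<noteq> 0" using poly_eq_0_if_zero by blast
  then have nz: "cert N c s (?v t z\<^sub>0 z\<^sub>0') (?v t z\<^sub>1 z\<^sub>1') \<noteq> 0" "cert N c s' (?v t z\<^sub>0 z\<^sub>0') (?v t z\<^sub>1 z\<^sub>1') \<noteq> 0"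
    by (simp_all add: P P')
  have V: "T s (?v t z z') = 0" "T s' (?v t z z') = 0" if "T s z = 0" "T s' z' = 0" for z z'
  proof -
    have lin: "T r (x [+] t [*] (y [+] (- 1) [*] x)) = 0" if "T r x = 0" "T r y = 0" for r x y
      using that by (simp add: cubT_add cubT_scale)
    show "T s (?v t z z') = 0" by (rule lin[OF a(1)[OF that(1)] b(1)[OF that(2)]])
    show "T s' (?v t z z') = 0" by (rule lin[OF a(2)[OF that(1)] b(2)[OF that(2)]])
  qed
  show thesis
    by (rule that[OF V(1)[OF z(1) z'(1)] V(1)[OF z(2) z'(2)] V(2)[OF z(1) z'(1)] V(2)[OF z(2) z'(2)] nz])
qed

text \<open>Vieta for the binary cubic F(a + X b): the third root is -F(a) / (F(b) \<xi> \<xi>'). It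
  involves the conjugate roots only through their product, which is why the third point is
  rational.\<close>

lemma third_point_formula:
  assumes "\<xi> \<noteq> \<xi>'" "F (a [+] \<xi> [*] b) = 0" "F (a [+] \<xi>' [*] b) = 0"
  shows "(\<xi> - \<xi>') ^ 3 [*] ((F b * (\<xi> * \<xi>')) [*] a [+] (- F a) [*] b)
     = (\<xi> * \<xi>') [*] third (a [+] \<xi> [*] b) (a [+] \<xi>' [*] b)"
proof -
  have "F a + (\<xi> * T a b + \<xi>\<^sup>2 * T b a + \<xi> ^ 3 * F b) = 0"
    using assms(2) by (simp only: cub_add cub_scale cubT_scale add.assoc)
  then have 1: "F a = - (\<xi> * T a b + \<xi>\<^sup>2 * T b a + \<xi> ^ 3 * F b)"
    unfolding eq_neg_iff_add_eq_0 .
  have "(\<xi>' - \<xi>) * (T a b + ((\<xi> + \<xi>') * T b a + (\<xi>\<^sup>2 + \<xi> * \<xi>' + \<xi>'\<^sup>2) * F b)) = 0"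
    using assms(3) unfolding cub_add cub_scale cubT_scale 1 by (simp add: algebra_simps power2_eq_square power3_eq_cube)
  then have 2: "T a b = - ((\<xi> + \<xi>') * T b a + (\<xi>\<^sup>2 + \<xi> * \<xi>' + \<xi>'\<^sup>2) * F b)"
    unfolding eq_neg_iff_add_eq_0 using assms(1) by simp
  have 3: "F a = \<xi> * \<xi>' * T b a + \<xi> * \<xi>' * (\<xi> + \<xi>') * F b"
    unfolding 1 2 by (simp add: algebra_simps power2_eq_square power3_eq_cube)
  have D: "D b a b = 2 * T b a" "D a b a = 2 * T a b" "D b a a = 2 * T a b" "D a b b = 2 * T b a" by (simp_all add: cubD_same)
  show ?thesis
    unfolding cub_third_def cubT_add cubT_scale cubD_scale cubT_same D 3 2
    by (simp add: fun_eq_iff algebra_simps power2_eq_square power3_eq_cube)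
qed

end

context cubic_closed
begin

lemma rho_scale: "rho s (a [*] z) = a ^ 3 [*] rho s z"
  by (simp add: cub_rho_def fun_eq_iff cub_simps algebra_simps power2_eq_square power3_eq_cube)

lemma third_scale_both: "third (a [*] u) (b [*] u') = (a\<^sup>2 * b\<^sup>2) [*] third u u'"
  by (simp add: cub_third_def fun_eq_iff cub_simps algebra_simps power2_eq_square)

end

text \<open>The degree is 21 = 3 + 9 * 2: the certificate has degree 3 in the point and 9 in the two
  vectors together, and each \<open>tproj\<close> has degree 2 in the point.\<close>

lemma cert_tproj_scale:
  "cert N c (a [*] s) (tproj N c e (a [*] s) z) (tproj N c e (a [*] s) z') = a ^ 21 * cert N c s (tproj N c e s z) (tproj N c e s z')"
  unfolding tproj_scale cert_scale cert_scale_point by (simp flip: power_mult power_add mult.assoc)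

section \<open>Unirationality from a smooth rational point and a good geometric point\<close>

text \<open>
  A line through the smooth point \<open>p\<close> meets the cubic in two further points \<open>s\<close>, \<open>s'\<close>, which are
  conjugate over the field of rational functions in \<open>y\<close>. Conjugate points of the tangent sections at
  \<open>s\<close> and \<open>s'\<close> are parametrized by Weil restriction, and the third intersection point with
  the line through them is rational.
\<close>

lemma unirational_if_good_point:
  fixes F :: "'k :: field mpoly" and p :: "nat \<Rightarrow> 'k"
  assumes F: "F \<in> poly_ring N" "homogeneous 3 F"
    and K: "cubic_point to_ac N (cof3 F) p"
    and E: "cubic_point id N (\<lambda>i j k. to_ac (cof3 F i j k)) (\<lambda>i. to_ac (p i))"
    and disc: "(cubT N (\<lambda>i j k. to_ac (cof3 F i j k)) y\<^sub>0 (\<lambda>i. to_ac (p i)))\<^sup>2 \<noteq>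
       4 * (cubT N (\<lambda>i j k. to_ac (cof3 F i j k)) (\<lambda>i. to_ac (p i)) y\<^sub>0 * cub N (\<lambda>i j k. to_ac (cof3 F i j k)) y\<^sub>0)"
    and s0: "cub N (\<lambda>i j k. to_ac (cof3 F i j k)) s\<^sub>0 = 0" "good N (\<lambda>i j k. to_ac (cof3 F i j k)) s\<^sub>0"
  shows "unirational N F"
proof -
  let ?h = "to_ac :: 'k \<Rightarrow> 'k alg_closure"
  define c where "c = cof3 F"
  define cE where "cE = (\<lambda>i j k. ?h (c i j k))"
  define pE where "pE = (\<lambda>i. ?h (p i))"
  define cM where "cM = (\<lambda>i j k. mconst (c i j k))"
  define pM where "pM = (\<lambda>i. mconst (p i))"
  define cEM where "cEM = (\<lambda>i j k. mconst (cE i j k))"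
  define pEM where "pEM = (\<lambda>i. mconst (pE i))"
  interpret K: cubic_point ?h N c p cE pE cM pM
    unfolding cE_def pE_def cM_def pM_def c_def by (rule K)
  interpret E: cubic_point "id :: 'k alg_closure \<Rightarrow> _" N cE pE cE pE cEM pEM
    using E unfolding cE_def pE_def cEM_def pEM_def c_def id_def .
  interpret C: cubic_closed N cE .
  note s0 = s0[folded c_def, folded cE_def]
  \<comment> \<open>The parameter space has three blocks of coordinates, sorted by residue modulo 3:
    y for the line through p, and two blocks for the vector z + \<xi> z' over the quadratic
    extension.\<close>
  define yM where "yM = (\<lambda>i. mvar (3 * i) :: 'k mpoly)"
  define L where "L = cubT N cM pM yM"
  define Q where "Q = cubT N cM yM pM"
  define R where "R = L * cub N cM yM"
  define cP where "cP = (\<lambda>i j k. [:cM i j k:])"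
  define pP where "pP = (\<lambda>i. [:pM i:])"
  define sP where "sP = (\<lambda>i. [:L * yM i, pM i:])"
  define zP where "zP = (\<lambda>i. [:mvar (3 * i + 1), mvar (3 * i + 2) :: 'k mpoly:])"
  define UP where "UP = cub_rho N cP sP (tproj N cP pP sP zP)"
  \<comment> \<open>Modulo the quadratic equation of \<xi> the point of the tangent section is A +
    \<xi> B with A and B over k; the two residual points only differ in \<xi>.\<close>
  have "\<exists>W A B. UP i = [:R, Q, 1:] * W + [:A, B:]" for i by (rule divide_by_monic_quadratic)
  then obtain W A B where UP: "\<And>i. UP i = [:R, Q, 1:] * W i + [:A i, B i:]" by metis
  \<comment> \<open>This is \<open>third_point_formula\<close> with \<open>R\<close> in place of the
    product of the two roots.\<close>
  define g where "g = (cub N cM B * R) [*] A [+] (- cub N cM A) [*] B"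

  define ypt where "ypt t = (\<lambda>i. t (3 * i))" for t :: "nat \<Rightarrow> 'k alg_closure"
  define zpt where "zpt t \<xi> = (\<lambda>i. t (3 * i + 1)) [+] \<xi> [*] (\<lambda>i. t (3 * i + 2))" for t :: "nat \<Rightarrow> 'k alg_closure" and \<xi>
  define spt where "spt y \<xi> = \<xi> [*] pE [+] C.T pE y [*] y" for y \<xi>
  define upt where "upt y \<xi> z = C.rho (spt y \<xi>) (tproj N cE pE (spt y \<xi>) z)" for y \<xi> z

  \<comment> \<open>Specialization at a geometric point of the parameter space\<close>
  have cM_ev: "(\<lambda>i j k. meval ?h t (cM i j k)) = cE" for t by (simp add: cM_def cE_def)
  have pM_ev: "(\<lambda>i. meval ?h t (pM i)) = pE" for t by (simp add: pM_def pE_def)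
  have yM_ev: "(\<lambda>i. meval ?h t (yM i)) = ypt t" for t by (simp add: yM_def ypt_def)
  have L_ev: "meval ?h t L = C.T pE (ypt t)" for t
    unfolding L_def hom_cubT[OF K.h.meval_hom] cM_ev pM_ev yM_ev ..
  have Q_ev: "meval ?h t Q = C.T (ypt t) pE" for t
    unfolding Q_def hom_cubT[OF K.h.meval_hom] cM_ev pM_ev yM_ev ..
  have R_ev: "meval ?h t R = C.T pE (ypt t) * C.F (ypt t)" for t
    unfolding R_def K.h.meval_mult L_ev hom_cub[OF K.h.meval_hom] cM_ev yM_ev ..

  have U_ev: "(\<lambda>i. meval ?h t (A i)) [+] \<xi> [*] (\<lambda>i. meval ?h t (B i)) = upt (ypt t) \<xi> (zpt t \<xi>)"
    if \<xi>: "\<xi>\<^sup>2 + C.T (ypt t) pE * \<xi> + C.T pE (ypt t) * C.F (ypt t) = 0" for t \<xi>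
  proof -
    define ev where "ev = (\<lambda>R. poly (map_poly (meval ?h t) R) \<xi>)"
    have "ev = (\<lambda>R. poly R \<xi>) \<circ> map_poly (meval ?h t)" by (simp add: ev_def fun_eq_iff)
    then have ev: "comm_ring_hom ev"
      using comp_hom[OF poly_hom map_poly_hom[OF K.h.meval_hom]] by simp
    interpret ev: comm_ring_hom ev by (rule ev)
    have ev_pCons: "ev (pCons a R) = meval ?h t a + \<xi> * ev R" for a R
      by (simp add: ev_def map_poly_pCons)
    have cP: "(\<lambda>i j k. ev (cP i j k)) = cE" by (simp add: cP_def ev_pCons fun_cong[OF fun_cong[OF fun_cong[OF cM_ev]]])
    have pP: "(\<lambda>i. ev (pP i)) = pE" by (simp add: pP_def ev_pCons fun_cong[OF pM_ev])
    have sP: "(\<lambda>i. ev (sP i)) = spt (ypt t) \<xi>"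
      by (simp add: sP_def spt_def ev_pCons fun_eq_iff K.h.meval_mult L_ev fun_cong[OF pM_ev] fun_cong[OF yM_ev] del: K.eval_pM)
    have zP: "(\<lambda>i. ev (zP i)) = zpt t \<xi>" by (simp add: zP_def zpt_def ev_pCons fun_eq_iff)
    have U: "(\<lambda>i. ev (UP i)) = upt (ypt t) \<xi> (zpt t \<xi>)"
      unfolding UP_def upt_def hom_cub_rho[OF ev] hom_tproj[OF ev] cP pP sP zP ..
    have "ev [:R, Q, 1:] = \<xi>\<^sup>2 + C.T (ypt t) pE * \<xi> + C.T pE (ypt t) * C.F (ypt t)"
      by (simp add: ev_pCons R_ev Q_ev algebra_simps power2_eq_square)
    then have "ev (UP i) = meval ?h t (A i) + \<xi> * meval ?h t (B i)" for i
      unfolding UP ev.hom_add ev.hom_mult \<xi> by (simp add: ev_pCons)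
    then show ?thesis unfolding U[symmetric] by (simp add: fun_eq_iff)
  qed

  have g_ev: "(\<lambda>i. meval ?h t (g i)) = (C.F (\<lambda>i. meval ?h t (B i)) * (C.T pE (ypt t) * C.F (ypt t))) [*] (\<lambda>i. meval ?h t (A i))
      [+] (- C.F (\<lambda>i. meval ?h t (A i))) [*] (\<lambda>i. meval ?h t (B i))" for t
    by (simp add: g_def fun_eq_iff K.h.meval_simps R_ev hom_cub[OF K.h.meval_hom] cM_ev)

  have root: "\<xi>\<^sup>2 + C.T y pE * \<xi> + C.T pE y * C.F y = 0"
    if "\<xi> + \<xi>' = - C.T y pE" "\<xi> * \<xi>' = C.T pE y * C.F y" for \<xi> \<xi>' y
  proof -
    have q: "C.T y pE = - (\<xi> + \<xi>')" using that by simp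
    show ?thesis unfolding q that(2)[symmetric] by (simp add: algebra_simps power2_eq_square)
  qed
  have F_upt: "C.F (upt y \<xi> z) = 0"
    if "\<xi> + \<xi>' = - C.T y pE" "\<xi> * \<xi>' = C.T pE y * C.F y" for \<xi> \<xi>' y z
    unfolding upt_def by (rule C.F_rho) (use K.F_root[OF that] in \<open>simp_all add: spt_def\<close>)
  have key: "(\<xi> - \<xi>') ^ 3 [*] (\<lambda>i. meval ?h t (g i)) =
      (\<xi> * \<xi>') [*] C.third (upt (ypt t) \<xi> (zpt t \<xi>)) (upt (ypt t) \<xi>' (zpt t \<xi>'))"
    if r: "\<xi> + \<xi>' = - C.T (ypt t) pE" "\<xi> * \<xi>' = C.T pE (ypt t) * C.F (ypt t)" "\<xi> \<noteq> \<xi>'" for t \<xi> \<xi>'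
  proof -
    have r': "\<xi>' + \<xi> = - C.T (ypt t) pE" "\<xi>' * \<xi> = C.T pE (ypt t) * C.F (ypt t)" using r by (simp_all add: ac_simps)
    note U = U_ev[OF root[OF r(1,2)]] U_ev[OF root[OF r']]
    show ?thesis
      unfolding g_ev r(2)[symmetric] U[symmetric]
      by (rule C.third_point_formula[OF r(3)]) (unfold U, rule F_upt[OF r(1,2)], rule F_upt[OF r'])
  qed

  have distinct: "\<xi> \<noteq> \<xi>'"
    if "\<xi> + \<xi>' = - C.T y pE" "\<xi> * \<xi>' = C.T pE y * C.F y" "(C.T y pE)\<^sup>2 - 4 * (C.T pE y * C.F y) \<noteq> 0" for \<xi> \<xi>' y
  proof
    assume "\<xi> = \<xi>'"
    then have "C.T y pE = - (\<xi> + \<xi>)" "C.T pE y * C.F y = \<xi> * \<xi>" using that(1,2) by simp_all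
    then have "(C.T y pE)\<^sup>2 - 4 * (C.T pE y * C.F y) = 0" by (simp add: power2_eq_square algebra_simps)
    with that(3) show False by contradiction
  qed

  \<comment> \<open>The parametrized points lie on the cubic\<close>
  have on: "meval ?h (\<lambda>i. meval ?h t (g i)) F = 0" for t
  proof -
    define P where "P = meval mconst g F"
    \<comment> \<open>Where the discriminant vanishes the two points coincide and \<open>key\<close>
      does not apply; multiplying by \<open>dM\<close>, which is nonzero by \<open>disc\<close>,
      covers these parameters.\<close>
    define dM where "dM = Q\<^sup>2 - 4 * R"
    have dM_ev: "meval ?h t dM = (C.T (ypt t) pE)\<^sup>2 - 4 * (C.T pE (ypt t) * C.F (ypt t))" for t
    proof -
      interpret m: comm_ring_hom "meval ?h t" by (rule K.h.meval_hom)
      show ?thesis by (simp add: dM_def m.hom_minus m.hom_power m.hom_mult m.hom_numeral Q_ev R_ev)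
    qed
    have "dM \<noteq> 0"
    proof
      assume "dM = 0"
      then have "meval ?h (\<lambda>j. y\<^sub>0 (j div 3)) dM = 0" by simp
      then show False using disc unfolding dM_ev by (simp add: ypt_def cE_def pE_def c_def)
    qed
    moreover have "meval ?h t (P * dM) = 0" for t
    proof (cases "meval ?h t dM = 0")
      case False
      obtain \<xi> \<xi>' where r: "\<xi> + \<xi>' = - C.T (ypt t) pE" "\<xi> * \<xi>' = C.T pE (ypt t) * C.F (ypt t)" by (rule K.roots_exist)
      have ne: "\<xi> \<noteq> \<xi>'" by (rule distinct[OF r]) (use False dM_ev in simp)
      have r': "\<xi>' + \<xi> = - C.T (ypt t) pE" "\<xi>' * \<xi> = C.T pE (ypt t) * C.F (ypt t)" using r by (simp_all add: ac_simps)
      have "((\<xi> - \<xi>') ^ 3) ^ 3 * C.F (\<lambda>i. meval ?h t (g i)) = 0"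
        unfolding cub_scale[symmetric] key[OF r ne] by (simp add: cub_scale C.F_third[OF F_upt[OF r] F_upt[OF r']])
      then have "C.F (\<lambda>i. meval ?h t (g i)) = 0" using ne by simp
      moreover have "meval ?h t P = C.F (\<lambda>i. meval ?h t (g i))"
        unfolding P_def meval_compose[OF to_ac_hom] meval_cubic[OF F to_ac_hom] by (simp add: cE_def c_def)
      ultimately show ?thesis by (simp add: K.h.meval_mult)
    qed (simp add: K.h.meval_mult)
    then have "P * dM = 0" by (rule K.zero_test)
    ultimately have "P = 0" by simp
    then have "meval ?h t P = 0" by simp
    then show ?thesis unfolding P_def meval_compose[OF to_ac_hom] .
  qed

  \<comment> \<open>General points of the cubic are good\<close>
  obtain e\<^sub>0 z\<^sub>0 z\<^sub>1 where e0: "C.T s\<^sub>0 e\<^sub>0 \<noteq> 0" "C.T s\<^sub>0 z\<^sub>0 = 0" "C.T s\<^sub>0 z\<^sub>1 = 0" "cert N cE s\<^sub>0 z\<^sub>0 z\<^sub>1 \<noteq> 0"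
    using s0(2) unfolding good_def by blast
  define lift where "lift = (\<lambda>(x :: nat \<Rightarrow> 'k alg_closure) i. mconst (x i) :: 'k alg_closure mpoly)"
  define CM where "CM = cert N cEM mvar (tproj N cEM (lift e\<^sub>0) mvar (lift z\<^sub>0)) (tproj N cEM (lift e\<^sub>0) mvar (lift z\<^sub>1))"
  have lift_ev: "(\<lambda>i. meval id x (lift a i)) = a" "(\<lambda>i j k. meval id x (cEM i j k)) = cE" for x a
    by (simp_all add: lift_def cEM_def)
  have CM_ev: "meval id x CM = cert N cE x (tproj N cE e\<^sub>0 x z\<^sub>0) (tproj N cE e\<^sub>0 x z\<^sub>1)" for x
    unfolding CM_def hom_cert[OF E.h.meval_hom] hom_tproj[OF E.h.meval_hom] lift_ev by simp
  have CM_scaling: "meval mconst (\<lambda>i. E.LM * mvar i) CM = E.LM ^ 21 * CM"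
  proof -
    have "(\<lambda>i j k. meval mconst x (cEM i j k)) = cEM" "(\<lambda>i. meval mconst x (lift a i)) = lift a"
      "(\<lambda>i. meval mconst x (mvar i)) = x" for x a
      by (simp_all add: lift_def cEM_def comm_ring_hom.meval_mconst[OF mconst_hom] comm_ring_hom.meval_mvar[OF mconst_hom])
    then show ?thesis
      unfolding CM_def hom_cert[OF comm_ring_hom.meval_hom[OF mconst_hom]] hom_tproj[OF comm_ring_hom.meval_hom[OF mconst_hom]]
      using cert_tproj_scale[of N cEM E.LM mvar "lift e\<^sub>0" "lift z\<^sub>0" "lift z\<^sub>1"] by (simp add: vscale_def)
  qed
  \<comment> \<open>The certificate involves geometric vectors, so its norm has to be formed over
    the closure; it is nonzero because the certificate does not vanish at
    \<open>s\<^sub>0\<close>.\<close>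
  obtain nC where nC: "\<And>y \<xi> \<xi>'. \<xi> + \<xi>' = - C.T y pE \<Longrightarrow> \<xi> * \<xi>' = C.T pE y * C.F y \<Longrightarrow>
       meval id y nC = meval id (\<xi> [*] pE [+] C.T pE y [*] y) CM * meval id (\<xi>' [*] pE [+] C.T pE y [*] y) CM"
    "nC = 0 \<Longrightarrow> E.FM dvd CM"
    using E.norm_form[OF CM_scaling] by metis
  have "nC \<noteq> 0"
  proof
    assume "nC = 0"
    then have "meval id s\<^sub>0 CM = 0" using nC(2) E.FM_dvd_imp_vanishes s0(1) by blast
    moreover have "tproj N cE e\<^sub>0 s\<^sub>0 z\<^sub>0 = C.T s\<^sub>0 e\<^sub>0 [*] z\<^sub>0" "tproj N cE e\<^sub>0 s\<^sub>0 z\<^sub>1 = C.T s\<^sub>0 e\<^sub>0 [*] z\<^sub>1"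
      using e0 by (simp_all add: tproj_def fun_eq_iff)
    ultimately show False using e0 by (simp add: CM_ev cert_scale)
  qed

  \<comment> \<open>Density of the image\<close>
  have dom: "meval ?h x G = 0"
    if G: "G \<in> poly_ring N" "homogeneous d G" and Gg: "\<And>t. meval ?h (\<lambda>i. meval ?h t (g i)) G = 0" and x: "meval ?h x F = 0"
    for G d x
  proof -
    obtain d' where "meval mconst (\<lambda>i. K.LM * mvar i) G = K.LM ^ d' * G"
      using K.homogeneous_scaling[OF G(2)] unfolding K.scaling_def by blast
    from K.norm_form[OF this] obtain n where n: "\<And>y \<xi> \<xi>'. \<xi> + \<xi>' = - C.T y pE \<Longrightarrow> \<xi> * \<xi>' = C.T pE y * C.F y \<Longrightarrow>
         meval ?h y n = meval ?h (\<xi> [*] pE [+] C.T pE y [*] y) G * meval ?h (\<xi>' [*] pE [+] C.T pE y [*] y) G"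
      "n = 0 \<Longrightarrow> K.FM dvd G" by metis
    \<comment> \<open>Off the zero set of \<open>H\<close> the residual points are distinct, good,
      and in general position. The norm of G is shown to vanish there, and then everywhere because
      \<open>H\<close> is not the zero polynomial.\<close>
    define H where "H = E.LM * E.FM * (E.QM\<^sup>2 - 4 * (E.LM * E.FM)) * nC"
    have H_ev: "meval id y H = C.T pE y * C.F y * ((C.T y pE)\<^sup>2 - 4 * (C.T pE y * C.F y)) * meval id y nC" for y
    proof -
      interpret m: comm_ring_hom "meval id y" by (rule E.h.meval_hom)
      show ?thesis unfolding H_def m.hom_mult m.hom_minus m.hom_power m.hom_numeral E.eval_LM E.eval_FM E.eval_QM ..
    qed
    have "H \<noteq> 0"
    proof -
      have "E.LM \<noteq> 0" using E.smooth E.eval_LM by (metis E.h.meval_0 E.LM_linear_form linear_form.lf_nonzero)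
      moreover have "E.FM \<noteq> 0" using E.tangent E.eval_FM by (metis E.h.meval_0)
      moreover have "E.QM\<^sup>2 - 4 * (E.LM * E.FM) \<noteq> 0"
      proof
        assume *: "E.QM\<^sup>2 - 4 * (E.LM * E.FM) = 0"
        interpret m: comm_ring_hom "meval id y\<^sub>0" by (rule E.h.meval_hom)
        have "meval id y\<^sub>0 (E.QM\<^sup>2 - 4 * (E.LM * E.FM)) = (C.T y\<^sub>0 pE)\<^sup>2 - 4 * (C.T pE y\<^sub>0 * C.F y\<^sub>0)"
          unfolding m.hom_mult m.hom_minus m.hom_power m.hom_numeral E.eval_LM E.eval_FM E.eval_QM ..
        with * disc show False by (simp add: cE_def pE_def c_def)
      qed
      ultimately show ?thesis using \<open>nC \<noteq> 0\<close> by (simp add: H_def)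
    qed
    have n0: "meval ?h y n = 0" if "meval id y H \<noteq> 0" for y
    proof -
      have nz: "C.T pE y \<noteq> 0" "C.F y \<noteq> 0" "(C.T y pE)\<^sup>2 - 4 * (C.T pE y * C.F y) \<noteq> 0" "meval id y nC \<noteq> 0"
        using that unfolding H_ev by auto
      obtain \<xi> \<xi>' where r: "\<xi> + \<xi>' = - C.T y pE" "\<xi> * \<xi>' = C.T pE y * C.F y" by (rule K.roots_exist)
      have r': "\<xi>' + \<xi> = - C.T y pE" "\<xi>' * \<xi> = C.T pE y * C.F y" using r by (simp_all add: ac_simps)
      have ne: "\<xi> \<noteq> \<xi>'" by (rule distinct[OF r nz(3)])
      define s s' where "s = spt y \<xi>" and "s' = spt y \<xi>'"
      have Fs: "C.F s = 0" "C.F s' = 0"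
        using K.F_root[OF r] K.F_root[OF r'] by (simp_all add: s_def s'_def spt_def)
      have Tp: "C.T (spt y a) pE = (C.T pE y)\<^sup>2 * (2 * a + C.T y pE)" for a
        unfolding spt_def cubT_add cubT_scale cubD_scale cubD_same cubT_same
        by (simp add: K.F_pE cubD_same algebra_simps power2_eq_square)
      have q: "C.T y pE = - (\<xi> + \<xi>')" using r by simp
      have Tsp: "C.T s pE = (C.T pE y)\<^sup>2 * (\<xi> - \<xi>')" "C.T s' pE = (C.T pE y)\<^sup>2 * (\<xi>' - \<xi>)"
        unfolding s_def s'_def Tp q by (simp_all add: algebra_simps)
      have nzp: "C.T s pE \<noteq> 0" "C.T s' pE \<noteq> 0" using Tsp nz(1) ne by simp_all
      have sdiff: "s' = s [+] (\<xi>' - \<xi>) [*] pE" "s = s' [+] (\<xi> - \<xi>') [*] pE"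
        by (simp_all add: s_def s'_def spt_def fun_eq_iff algebra_simps)
      have "C.T s s' = 3 * C.F s + (\<xi>' - \<xi>) * C.T s pE"
        by (subst sdiff(1)) (simp only: cubT_add(2) cubT_scale(2) cubT_same)
      moreover have "C.T s' s = 3 * C.F s' + (\<xi> - \<xi>') * C.T s' pE"
        by (subst sdiff(2)) (simp only: cubT_add(2) cubT_scale(2) cubT_same)
      ultimately have N: "C.T s s' \<noteq> 0" "C.T s' s \<noteq> 0" using Fs nzp ne by auto
      have "meval id s CM * meval id s' CM \<noteq> 0"
        using nC(1)[OF r] nz(4) by (simp add: s_def s'_def spt_def)
      then have ct: "cert N cE s (tproj N cE e\<^sub>0 s z\<^sub>0) (tproj N cE e\<^sub>0 s z\<^sub>1) \<noteq> 0"
        "cert N cE s' (tproj N cE e\<^sub>0 s' z\<^sub>0) (tproj N cE e\<^sub>0 s' z\<^sub>1) \<noteq> 0"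
        unfolding CM_ev by auto
      obtain v\<^sub>0 v\<^sub>1 where v: "C.T s v\<^sub>0 = 0" "C.T s v\<^sub>1 = 0" "C.T s' v\<^sub>0 = 0" "C.T s' v\<^sub>1 = 0"
        "cert N cE s v\<^sub>0 v\<^sub>1 \<noteq> 0" "cert N cE s' v\<^sub>0 v\<^sub>1 \<noteq> 0"
        by (rule C.good_pair[OF Fs N cubT_tproj cubT_tproj ct(1) cubT_tproj cubT_tproj ct(2)])
      have "meval ?h s' G = 0"
      proof (rule C.local_dominance[OF to_ac_hom G(2) Fs v])
        fix z z' assume z: "C.T s z = 0" "C.T s' z' = 0"
        \<comment> \<open>Solves \<open>z1 + \<xi> z2 = z\<close> and
          \<open>z1 + \<xi>' z2 = z'\<close>: over the closure the Weil restriction reaches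
          arbitrary pairs of tangent vectors.\<close>
        define z2 where "z2 = (1 / (\<xi> - \<xi>')) [*] (z [+] (- 1) [*] z')"
        define z1 where "z1 = z [+] (- \<xi>) [*] z2"
        define t where "t = (\<lambda>j. if j mod 3 = 0 then y (j div 3) else if j mod 3 = 1 then z1 (j div 3) else z2 (j div 3))"
        have y: "ypt t = y" by (simp add: ypt_def t_def)
        have zt: "zpt t a = z1 [+] a [*] z2" for a
        proof -
          have "(3 * i + 1) mod 3 = 1" "(3 * i + 1) div 3 = i" "(3 * i + 2) mod 3 = 2" "(3 * i + 2) div 3 = i" for i :: nat
            by presburger+
          then show ?thesis by (simp add: zpt_def t_def fun_eq_iff del: add_2_eq_Suc')
        qed
        have "zpt t \<xi> = z" by (simp add: zt z1_def fun_eq_iff)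
        moreover have "zpt t \<xi>' = z'"
        proof -
          have *: "a - \<xi> * (1 / (\<xi> - \<xi>') * (a - b)) + \<xi>' * (1 / (\<xi> - \<xi>') * (a - b)) = b" for a b
          proof -
            have "a - \<xi> * (1 / (\<xi> - \<xi>') * (a - b)) + \<xi>' * (1 / (\<xi> - \<xi>') * (a - b)) = a - (\<xi> - \<xi>') * (1 / (\<xi> - \<xi>')) * (a - b)"
              by (simp only: algebra_simps)
            then show ?thesis using ne by simp
          qed
          show ?thesis unfolding zt z1_def z2_def fun_eq_iff using * by simp
        qed
        ultimately have zz: "zpt t \<xi> = z" "zpt t \<xi>' = z'" by auto
        have "tproj N cE pE s z = C.T s pE [*] z" "tproj N cE pE s' z' = C.T s' pE [*] z'"
          using z by (simp_all add: tproj_def fun_eq_iff)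
        then have u: "upt y \<xi> z = (C.T s pE) ^ 3 [*] C.rho s z" "upt y \<xi>' z' = (C.T s' pE) ^ 3 [*] C.rho s' z'"
          by (simp_all add: upt_def C.rho_scale flip: s_def s'_def)
        have "(\<xi> * \<xi>') [*] (((C.T s pE) ^ 3)\<^sup>2 * ((C.T s' pE) ^ 3)\<^sup>2) [*] C.third (C.rho s z) (C.rho s' z')
            = (\<xi> - \<xi>') ^ 3 [*] (\<lambda>i. meval ?h t (g i))"
          using key[of \<xi> \<xi>' t] r ne unfolding y zz u C.third_scale_both by simp
        then have "meval ?h ((\<xi> * \<xi>') [*] (((C.T s pE) ^ 3)\<^sup>2 * ((C.T s' pE) ^ 3)\<^sup>2) [*] C.third (C.rho s z) (C.rho s' z')) G = 0"
          using Gg[of t] by (simp add: meval_homogeneous[OF to_ac_hom G(2)])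
        then have "(\<xi> * \<xi>') ^ d * (((C.T s pE) ^ 3)\<^sup>2 * ((C.T s' pE) ^ 3)\<^sup>2) ^ d * meval ?h (C.third (C.rho s z) (C.rho s' z')) G = 0"
          by (simp only: meval_homogeneous[OF to_ac_hom G(2)] mult.assoc)
        moreover have "\<xi> * \<xi>' \<noteq> 0" using r(2) nz by simp
        ultimately show "meval ?h (C.third (C.rho s z) (C.rho s' z')) G = 0" using nzp by simp
      qed
      then show ?thesis using n(1)[OF r] by (simp add: s'_def spt_def)
    qed
    define nE where "nE = meval (\<lambda>a. mconst (?h a)) mvar n"
    have nE_ev: "meval id y nE = meval ?h y n" for y
      unfolding nE_def hom_meval[OF E.h.meval_hom] by simp
    have "meval id y (H * nE) = 0" for y
      using n0[of y] by (cases "meval id y H = 0") (simp_all add: E.h.meval_mult nE_ev)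
    then have "H * nE = 0" by (rule E.zero_test)
    with \<open>H \<noteq> 0\<close> have "nE = 0" by simp
    then have "meval ?h y n = 0" for y using nE_ev[of y] by simp
    then have "n = 0" by (rule K.zero_test)
    then have "K.FM dvd G" by (rule n(2))
    moreover have "C.F x = 0" using x unfolding meval_cubic[OF F to_ac_hom] by (simp add: cE_def c_def)
    ultimately show ?thesis by (rule K.FM_dvd_imp_vanishes)
  qed
  show ?thesis
  proof (rule unirational_criterion[OF F(1) on dom])
    have "meval ?h pE F = 0" unfolding meval_cubic[OF F to_ac_hom] using K.F_pE by (simp add: cE_def c_def)
    moreover have "\<exists>i<N. pE i \<noteq> 0"
    proof (rule ccontr)
      assume "\<not> ?thesis"
      then have 0: "\<And>i. i < N \<Longrightarrow> pE i = 0" by auto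
      from K.tangent obtain y where "C.F y \<noteq> 0" by blast
      obtain i where i: "i < N" "cubT N c p (unit i) \<noteq> 0" using K.smooth by blast
      have "p j = 0" if "j < N" for j using 0[OF that] by (simp add: pE_def)
      then have "cubT N c p (unit i) = cubT N c (\<lambda>_. 0) (unit i)" by (intro cubT_cong) auto
      with i(2) show False by simp
    qed
    ultimately show "\<exists>x. (\<exists>i<N. x i \<noteq> 0) \<and> meval ?h x F = 0" by blast
  qed
qed

section \<open>Irreducible cubic forms\<close>

lemma meval_line_poly:
  assumes "comm_ring_hom h"
  shows "\<exists>P. \<forall>t. poly P t = meval h (x [+] t [*] y) G"
proof (intro exI allI)
  interpret h: comm_ring_hom h by fact
  fix t
  show "poly (meval (\<lambda>c. [:h c:]) (\<lambda>i. [:x i, y i:]) G) t = meval h (x [+] t [*] y) G"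
    by (simp add: hom_meval[OF poly_hom] vadd_def vscale_def)
qed

lemma cubT_linear_form:
  fixes c :: "nat \<Rightarrow> nat \<Rightarrow> nat \<Rightarrow> 'a :: field"
  assumes "\<exists>i<N. cubT N c p (unit i) \<noteq> 0"
  obtains i0 where "linear_form N (\<lambda>i. cubT N c p (unit i)) i0"
    "cubT N (\<lambda>i j k. mconst (c i j k)) (\<lambda>i. mconst (p i)) mvar = linear_form.lf N (\<lambda>i. cubT N c p (unit i))"
proof -
  obtain i0 where i0: "i0 < N" "cubT N c p (unit i0) \<noteq> 0" using assms by blast
  interpret linear_form N "\<lambda>i. cubT N c p (unit i)" i0 by unfold_locales (use i0 in auto)
  interpret m: comm_ring_hom "mconst :: 'a \<Rightarrow> 'a mpoly" by (rule mconst_hom)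
  have "cubT N (\<lambda>i j k. mconst (c i j k)) (\<lambda>i. mconst (p i)) (unit i) = (mconst (cubT N c p (unit i)) :: 'a mpoly)" for i
  proof -
    have "(\<lambda>j. mconst (unit i j)) = (unit i :: nat \<Rightarrow> 'a mpoly)" by (simp add: fun_eq_iff unit_def)
    then show ?thesis unfolding hom_cubT[OF mconst_hom] by simp
  qed
  then show ?thesis
    using that[OF linear_form_axioms] by (simp add: lf_def cubT_unit_sum[of N _ _ mvar])
qed

text \<open>The prime linear form l divides e (q - e), hence one of the two roots e and q - e;
  cancelling l leaves the displayed factorization of the cubic.\<close>

lemma cubic_quadratic_root:
  fixes c :: "nat \<Rightarrow> nat \<Rightarrow> nat \<Rightarrow> 'a :: field" and p :: "nat \<Rightarrow> 'a"
  defines "cM \<equiv> \<lambda>i j k. mconst (c i j k) :: 'a mpoly" and "pM \<equiv> \<lambda>i. mconst (p i)"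
  assumes smooth: "\<exists>i<N. cubT N c p (unit i) \<noteq> 0"
    and e: "e * e - cubT N cM mvar pM * e + cubT N cM pM mvar * cub N cM mvar = 0"
  shows "\<exists>b. cub N cM mvar = b * (cubT N cM mvar pM - cubT N cM pM mvar * b)"
proof -
  obtain i0 where lf: "linear_form N (\<lambda>i. cubT N c p (unit i)) i0"
    and LM: "cubT N cM pM mvar = linear_form.lf N (\<lambda>i. cubT N c p (unit i))"
    using cubT_linear_form[OF smooth] unfolding cM_def pM_def by blast
  interpret linear_form N "\<lambda>i. cubT N c p (unit i)" i0 by (rule lf)
  have *: ?thesis if e: "e' * (cubT N cM mvar pM - e') = lf * cub N cM mvar" and dvd: "lf dvd e'" for e'
  proof -
    obtain b where b: "e' = lf * b" using dvd by (rule dvdE)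
    have "lf * cub N cM mvar = lf * (b * (cubT N cM mvar pM - lf * b))"
      unfolding e[symmetric] b by (simp only: mult.assoc)
    then have "cub N cM mvar = b * (cubT N cM mvar pM - lf * b)" using lf_nonzero by simp
    then show ?thesis unfolding LM by blast
  qed
  have e': "e * (cubT N cM mvar pM - e) = lf * cub N cM mvar"
    using e unfolding LM by (simp add: algebra_simps)
  then have "lf dvd e * (cubT N cM mvar pM - e)" by simp
  then consider "lf dvd e" | "lf dvd (cubT N cM mvar pM - e)" using lf_prime by blast
  then show ?thesis
  proof cases
    case 1
    then show ?thesis by (rule *[OF e'])
  next
    case 2
    show ?thesis by (rule *[OF _ 2]) (use e' in \<open>simp add: ac_simps\<close>)
  qed
qed

locale irreducible_cubic =
  fixes N :: nat and f :: "'k :: field mpoly"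
  assumes poly_ring: "f \<in> poly_ring N" and homogeneous: "homogeneous 3 f" and irreducible: "irreducible f"
begin

definition c where "c = cof3 f"
definition cE where "cE = (\<lambda>i j k. to_ac (c i j k))"
definition hv :: "(nat \<Rightarrow> 'k) \<Rightarrow> nat \<Rightarrow> 'k alg_closure" where "hv x = (\<lambda>i. to_ac (x i))"

sublocale C: cubic_closed N cE .
sublocale a: comm_ring_hom "to_ac :: 'k \<Rightarrow> 'k alg_closure" by (rule to_ac_hom)

abbreviation "F \<equiv> cub N cE"
abbreviation "T \<equiv> cubT N cE"
abbreviation "D \<equiv> cubD N cE"

lemma meval_f: "meval to_ac x f = F x"
  unfolding meval_cubic[OF poly_ring homogeneous to_ac_hom] cE_def c_def ..

lemma F_hv: "F (hv x) = to_ac (cub N c x)" and T_hv: "T (hv x) (hv y) = to_ac (cubT N c x y)"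
  and D_hv: "D (hv x) (hv y) (hv z) = to_ac (cubD N c x y z)"
  by (simp_all add: hv_def cE_def hom_cub[OF to_ac_hom] hom_cubT[OF to_ac_hom] hom_cubD[OF to_ac_hom])

lemma hv_simps: "hv (x [+] y) = hv x [+] hv y" "hv (r [*] x) = to_ac r [*] hv x" "hv (unit i) = unit i"
  "hv (\<lambda>_. 0) = (\<lambda>_. 0)"
  by (simp_all add: hv_def fun_eq_iff unit_def)

lemma FM: "cub N (\<lambda>i j k. mconst (c i j k)) mvar = f"
  using meval_cubic[OF poly_ring homogeneous mconst_hom, of mvar] by (simp add: c_def)

text \<open>Restricted to lines through the origin, a unit becomes a unit of a univariate polynomial
  ring over a field.\<close>

lemma unit_constant:
  assumes "U dvd (1 :: 'k mpoly)"
  shows "meval to_ac y U = meval to_ac (\<lambda>_. 0) U" "meval to_ac y U \<noteq> 0"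
proof -
  obtain V where V: "U * V = 1" using assms by (metis dvdE)
  have 1: "meval to_ac x U * meval to_ac x V = 1" for x
    using arg_cong[OF V, of "meval to_ac x"] by (simp add: a.meval_mult)
  obtain P where P: "\<And>t. poly P t = meval to_ac ((\<lambda>_. 0) [+] t [*] y) U"
    using meval_line_poly[OF to_ac_hom] by blast
  obtain P' where P': "\<And>t. poly P' t = meval to_ac ((\<lambda>_. 0) [+] t [*] y) V"
    using meval_line_poly[OF to_ac_hom] by blast
  have "P * P' - 1 = 0" by (rule poly_eq_0_if_zero) (simp add: P P' 1)
  then have "1 = P * P'" by simp
  then have "P dvd 1" by (rule dvdI)
  then obtain r where "P = [:r:]" using is_unit_polyE by blast
  then have "poly P 0 = poly P 1" by simp
  then show "meval to_ac y U = meval to_ac (\<lambda>_. 0) U" by (simp add: P vadd_def vscale_def)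
  show "meval to_ac y U \<noteq> 0" using 1[of y] by auto
qed

text \<open>Otherwise the linear form divides \<open>f\<close>, and irreducibility makes the
  cofactor constant; scaling the argument by r then compares r^3 with r.\<close>

lemma F_nonzero_on_hyperplane:
  assumes "\<exists>i<N. a i \<noteq> 0"
  shows "\<exists>y. (\<Sum>i<N. y i * to_ac (a i)) = 0 \<and> F y \<noteq> 0"
proof (rule ccontr)
  assume neg: "\<nexists>y. (\<Sum>i<N. y i * to_ac (a i)) = 0 \<and> F y \<noteq> 0"
  obtain i0 where i0: "i0 < N" "a i0 \<noteq> 0" using assms by blast
  interpret linear_form N a i0 by unfold_locales (use i0 in auto)
  have lf: "meval to_ac y lf = (\<Sum>i<N. y i * to_ac (a i))" for y by (simp add: lf_def a.meval_simps)
  have "lf dvd f"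
    by (rule lf_dvd_if_vanishes[OF to_ac_hom alg_closed_infinite]) (use neg in \<open>simp add: lf meval_f\<close>)
  then obtain g where g: "f = lf * g" by (elim dvdE)
  have eval: "F y = (\<Sum>i<N. y i * to_ac (a i)) * meval to_ac y g" for y
    using arg_cong[OF g, of "meval to_ac y"] by (simp add: meval_f a.meval_mult lf)
  have "meval to_ac (\<lambda>_. 0) lf = 0" by (simp add: lf)
  then have "\<not> lf dvd 1" using unit_constant(2)[of lf "\<lambda>_. 0"] by blast
  then have "g dvd 1" using irreducibleD[OF irreducible g] by blast
  note g = unit_constant[OF this]
  obtain y where y: "(\<Sum>i<N. y i * to_ac (a i)) \<noteq> 0"
    using meval_eq_0_imp[OF to_ac_hom _ alg_closed_infinite, of lf] lf_nonzero unfolding lf by auto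
  have l: "(\<Sum>i<N. (r [*] y) i * to_ac (a i)) = r * (\<Sum>i<N. y i * to_ac (a i))" for r
    by (simp add: sum_distrib_left mult.assoc)
  have "r ^ 3 * F y = r * F y" for r
    using eval[of "r [*] y"] eval[of "1 [*] y"] unfolding cub_scale l g(1)[of "r [*] y"] g(1)[of "1 [*] y"] by simp
  then have "poly ([:0, - F y, 0, F y:]) r = 0" for r
    by (simp add: algebra_simps power3_eq_cube)
  then have "[:0, - F y, 0, F y:] = 0" by (rule poly_eq_0_if_zero)
  then have "F y = 0" by simp
  then show False using eval[of "1 [*] y"] unfolding l using g(2) y by simp
qed

context
  fixes p :: "nat \<Rightarrow> 'k"
  assumes p: "cub N c p = 0" and smooth: "\<exists>i<N. cubT N c p (unit i) \<noteq> 0"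
begin

lemma F_nonzero_on_tangent: "\<exists>y. T (hv p) y = 0 \<and> F y \<noteq> 0"
proof -
  have "to_ac (cubT N c p (unit i)) = T (hv p) (unit i)" for i by (simp flip: T_hv add: hv_simps)
  then show ?thesis using F_nonzero_on_hyperplane[OF smooth] by (simp flip: cubT_unit_sum)
qed

lemma cubic_point_k: "cubic_point to_ac N c p"
proof
  interpret m: comm_ring_hom "mconst :: 'k \<Rightarrow> 'k mpoly" by (rule mconst_hom)
  let ?cM = "\<lambda>i j k. mconst (c i j k)" let ?pM = "\<lambda>i. mconst (p i)"
  show "cub N c p = 0" by (rule p)
  show "\<exists>i<N. cubT N c p (unit i) \<noteq> 0" by (rule smooth)
  show "\<exists>y. cubT N (\<lambda>i j k. to_ac (c i j k)) (\<lambda>i. to_ac (p i)) y = 0 \<and> cub N (\<lambda>i j k. to_ac (c i j k)) y \<noteq> 0"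
    using F_nonzero_on_tangent by (simp add: cE_def hv_def)
  have cM_ev: "(\<lambda>i j k. meval to_ac y (?cM i j k)) = cE" "(\<lambda>i. meval to_ac y (?pM i)) = hv p" for y
    by (simp_all add: cE_def hv_def)
  have ev: "meval to_ac y (cubT N ?cM mvar ?pM) = T y (hv p)" "meval to_ac y (cubT N ?cM ?pM mvar) = T (hv p) y" for y
    unfolding hom_cubT[OF a.meval_hom] cM_ev by simp_all
  fix e :: "'k mpoly"
  show "e * e - cubT N ?cM mvar ?pM * e + cubT N ?cM ?pM mvar * cub N ?cM mvar \<noteq> 0"
  proof
    assume "e * e - cubT N ?cM mvar ?pM * e + cubT N ?cM ?pM mvar * cub N ?cM mvar = 0"
    from cubic_quadratic_root[OF smooth this] obtain b
      where b: "f = b * (cubT N ?cM mvar ?pM - cubT N ?cM ?pM mvar * b)" unfolding FM by blast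
    have eval: "F y = meval to_ac y b * (T y (hv p) - T (hv p) y * meval to_ac y b)" for y
      using arg_cong[OF b, of "meval to_ac y"] by (simp add: a.meval_simps meval_f ev)
    have "\<not> (cubT N ?cM mvar ?pM - cubT N ?cM ?pM mvar * b) dvd 1"
    proof
      assume "(cubT N ?cM mvar ?pM - cubT N ?cM ?pM mvar * b) dvd 1"
      from unit_constant(2)[OF this, of "\<lambda>_. 0"] show False by (simp add: a.meval_simps ev)
    qed
    then have "b dvd 1" using irreducibleD[OF irreducible b] by blast
    note u = unit_constant[OF this]
    \<comment> \<open>As \<open>b\<close> is a constant, \<open>f\<close> would be a quadratic form
      plus a linear one; comparing powers of the scaling factor r kills the linear form
      \<open>T(p, -)\<close>.\<close>
    define \<beta> where "\<beta> = meval to_ac (\<lambda>_. 0) b"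
    have "T (hv p) y = 0" for y
    proof -
      have "r ^ 3 * F y - \<beta> * (r\<^sup>2 * T y (hv p)) + \<beta> * (r * T (hv p) y * \<beta>) = 0" for r
        using eval[of "r [*] y"] unfolding u(1)[of "r [*] y"] by (simp add: cub_simps \<beta>_def algebra_simps)
      moreover have "poly [:0, \<beta> * \<beta> * v, - \<beta> * w, x:] r = r ^ 3 * x - \<beta> * (r\<^sup>2 * w) + \<beta> * (r * v * \<beta>)" for r v w x
        by (simp add: algebra_simps power3_eq_cube power2_eq_square)
      ultimately have "poly [:0, \<beta> * \<beta> * T (hv p) y, - \<beta> * T y (hv p), F y:] r = 0" for r by presburger
      then have "[:0, \<beta> * \<beta> * T (hv p) y, - \<beta> * T y (hv p), F y:] = 0" by (rule poly_eq_0_if_zero)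
      then show ?thesis using u(2)[of "\<lambda>_. 0"] by (simp add: \<beta>_def)
    qed
    then have "T (hv p) (hv (unit i)) = 0" for i .
    then show False using smooth unfolding T_hv by simp
  qed
qed

text \<open>Over the closure \<open>f\<close> may become reducible. The assumption replaces
  irreducibility: a root in k[y] would give F = b Q_p on the tangent hyperplane.\<close>

lemma cubic_point_E:
  assumes "\<And>b :: 'k alg_closure mpoly. \<exists>y. T (hv p) y = 0 \<and> F y \<noteq> meval id y b * T y (hv p)"
  shows "cubic_point id N cE (hv p)"
proof
  interpret i: comm_ring_hom "id :: 'k alg_closure \<Rightarrow> _" by (rule id_hom)
  let ?cM = "\<lambda>i j k. mconst (cE i j k)" let ?pM = "\<lambda>i. mconst (hv p i)"
  show "cub N cE (hv p) = 0" by (simp add: F_hv p)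
  have "T (hv p) (unit i) = to_ac (cubT N c p (unit i))" for i by (simp flip: T_hv add: hv_simps)
  then show smoothE: "\<exists>i<N. cubT N cE (hv p) (unit i) \<noteq> 0" using smooth by auto
  show "\<exists>y. cubT N (\<lambda>i j k. id (cE i j k)) (\<lambda>i. id (hv p i)) y = 0 \<and> cub N (\<lambda>i j k. id (cE i j k)) y \<noteq> 0"
    using F_nonzero_on_tangent by simp
  have cM_ev: "(\<lambda>i j k. meval id y (?cM i j k)) = cE" "(\<lambda>i. meval id y (?pM i)) = hv p" for y by simp_all
  have ev: "meval id y (cubT N ?cM mvar ?pM) = T y (hv p)" "meval id y (cubT N ?cM ?pM mvar) = T (hv p) y"
     "meval id y (cub N ?cM mvar) = F y" for y
    unfolding hom_cubT[OF i.meval_hom] hom_cub[OF i.meval_hom] cM_ev by simp_all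
  fix e :: "'k alg_closure mpoly"
  show "e * e - cubT N ?cM mvar ?pM * e + cubT N ?cM ?pM mvar * cub N ?cM mvar \<noteq> 0"
  proof
    assume "e * e - cubT N ?cM mvar ?pM * e + cubT N ?cM ?pM mvar * cub N ?cM mvar = 0"
    from cubic_quadratic_root[OF smoothE this] obtain b
      where b: "cub N ?cM mvar = b * (cubT N ?cM mvar ?pM - cubT N ?cM ?pM mvar * b)" by blast
    have eval: "F y = meval id y b * (T y (hv p) - T (hv p) y * meval id y b)" for y
      using arg_cong[OF b, of "meval id y"] by (simp add: i.meval_simps ev)
    obtain y where y: "T (hv p) y = 0" "F y \<noteq> meval id y b * T y (hv p)" using assms by blast
    then show False using eval[of y] by simp
  qed
qed simp_all

lemma unirational_if_good:
  assumes "\<And>b :: 'k alg_closure mpoly. \<exists>y. T (hv p) y = 0 \<and> F y \<noteq> meval id y b * T y (hv p)"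
    and "\<exists>y. (T y (hv p))\<^sup>2 \<noteq> 4 * (T (hv p) y * F y)"
    and "F s = 0" "good N cE s"
  shows "unirational N f"
proof -
  obtain y where "(T y (hv p))\<^sup>2 \<noteq> 4 * (T (hv p) y * F y)" using assms(2) by blast
  then show ?thesis
    using unirational_if_good_point[OF poly_ring homogeneous, folded c_def, OF cubic_point_k, folded cE_def, folded hv_def,
      OF cubic_point_E[OF assms(1)] _ assms(3,4)] by blast
qed

end

end

text \<open>All coefficients of a quadratic form are determined by its values at the unit vectors
  and their pairwise sums. This transfers vanishing at rational vectors to geometric ones, even over
  a finite field.\<close>

lemma quadratic_form_zero_test:
  fixes q :: "(nat \<Rightarrow> 'e :: comm_ring_1) \<Rightarrow> 'e"
  assumes q: "\<And>x y. q (x [+] y) = q x + q y + B x y" "\<And>a x. q (a [*] x) = a\<^sup>2 * q x"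
    and B: "\<And>x y z. B (x [+] y) z = B x z + B y z" "\<And>a x z. B (a [*] x) z = a * B x z" "\<And>x y. B x y = B y x"
    and cong: "\<And>x y. (\<And>i. i < N \<Longrightarrow> x i = y i) \<Longrightarrow> q x = q y"
    and 0: "\<And>i. i < N \<Longrightarrow> q (unit i) = 0" "\<And>i j. i < N \<Longrightarrow> j < N \<Longrightarrow> q (unit i [+] unit j) = 0"
  shows "q x = 0"
proof -
  define y where "y M = (\<lambda>i. if i < M then x i else 0)" for M
  have y0: "y 0 = (\<lambda>_. 0)" by (simp add: y_def)
  have z: "q (\<lambda>_. 0) = 0" "B (\<lambda>_. 0) v = 0" for v using q(2)[of 0 "unit 0"] B(2)[of 0 "unit 0" v] by (simp_all add: vscale_def)
  have y_Suc: "y (Suc M) = y M [+] x M [*] unit M" for M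
    by (auto simp: y_def fun_eq_iff unit_def less_Suc_eq)
  have Bu: "B (unit i) (unit j) = 0" if "i < N" "j < N" for i j
    using 0(2)[OF that] 0(1) that by (simp add: q)
  have By: "M \<le> N \<Longrightarrow> j < N \<Longrightarrow> B (y M) (unit j) = 0" for M j
    by (induction M) (simp_all add: y0 y_Suc B(1,2) Bu z)
  have "M \<le> N \<Longrightarrow> q (y M) = 0" for M
  proof (induction M)
    case 0
    show ?case by (simp add: y0 z)
  next
    case (Suc M)
    have "B (y M) (x M [*] unit M) = x M * B (y M) (unit M)" by (simp add: B(2) B(3)[of "y M"])
    then show ?case unfolding y_Suc q using Suc By[of M M] 0(1)[of M] by simp
  qed
  from this[of N] have "q (y N) = 0" by simp
  moreover have "q x = q (y N)" by (rule cong) (simp add: y_def)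
  ultimately show ?thesis by simp
qed

section \<open>Sufficient conditions for goodness\<close>

context cubic_closed
begin

lemma good_if_tangent_zero:
  assumes "T s e \<noteq> 0" "T s z\<^sub>0 = 0" "T s z\<^sub>1 = 0" "T z\<^sub>0 s = 0" "F z\<^sub>0 \<noteq> 0" "T z\<^sub>1 s \<noteq> 0"
  shows "good N c s"
proof -
  have "cert N c s z\<^sub>0 z\<^sub>1 \<noteq> 0" unfolding cert_def using assms by simp
  then show ?thesis using assms unfolding good_def by blast
qed

text \<open>
  On the span of \<open>v\<close> and \<open>w\<close> both \<open>F\<close> and \<open>Q\<^sub>s\<close> are divisible by the linear form vanishing at \<open>v\<close>; the last
  assumption says that the resultant of the cofactors is nonzero.
\<close>

lemma good_if_resultant:
  assumes e: "T s e \<noteq> 0" and ker: "T s w = 0" "T s v = 0" and v: "T v s = 0" "F v = 0"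
    and res: "F w * (D w v s)\<^sup>2 - T w v * T w s * D w v s + T v w * (T w s)\<^sup>2 \<noteq> 0"
  shows "good N c s"
proof (cases "T w s = 0")
  case True
  have "T (w [+] v) s = D w v s" "T s (w [+] v) = 0" using True ker by (simp_all add: cub_simps v)
  then show ?thesis using good_if_tangent_zero[OF e ker(1) _ True, of "w [+] v"] res True by auto
next
  case False
  have "cert N c s (w [+] v) w = T w s * (F w * (D w v s)\<^sup>2 - T w v * T w s * D w v s + T v w * (T w s)\<^sup>2)"
    unfolding cert_def by (simp add: cub_simps v cubD_commute(2)[of N c w s v] cubD_commute(1)[of N c v w s] algebra_simps power2_eq_square)
  then have "cert N c s (w [+] v) w \<noteq> 0" using False res by simp
  moreover have "T s (w [+] v) = 0" using ker by (simp add: cub_simps)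
  ultimately show ?thesis using e ker(1) unfolding good_def by blast
qed

text \<open>On the line through the two test vectors the cofactor \<open>b\<close> is forced to have
  degree at most 1, whatever its total degree, which is what the certificate excludes.\<close>

lemma not_multiple_if_cert:
  assumes z: "T s z\<^sub>0 = 0" "T s z\<^sub>1 = 0" and cert: "cert N c s z\<^sub>0 z\<^sub>1 \<noteq> 0"
  shows "\<exists>y. T s y = 0 \<and> F y \<noteq> meval id y b * T y s"
proof (rule ccontr)
  assume "\<nexists>y. T s y = 0 \<and> F y \<noteq> meval id y b * T y s"
  then have *: "F y = meval id y b * T y s" if "T s y = 0" for y using that by blast
  have q2: "T z\<^sub>1 s \<noteq> 0" using cert unfolding cert_def by auto
  obtain P where P: "\<And>t. poly P t = meval id (z\<^sub>0 [+] t [*] z\<^sub>1) b"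
    using meval_line_poly[OF id_hom] by blast
  let ?Q = "[:T z\<^sub>0 s, D z\<^sub>0 z\<^sub>1 s, T z\<^sub>1 s:]" and ?F = "[:F z\<^sub>0, T z\<^sub>0 z\<^sub>1, T z\<^sub>1 z\<^sub>0, F z\<^sub>1:]"
  have Q: "poly ?Q t = T (z\<^sub>0 [+] t [*] z\<^sub>1) s" for t
    by (simp add: cub_simps algebra_simps power2_eq_square)
  have F: "poly ?F t = F (z\<^sub>0 [+] t [*] z\<^sub>1)" for t
    by (simp add: cub_simps algebra_simps power2_eq_square power3_eq_cube)
  have "?F - P * ?Q = 0"
  proof (rule poly_eq_0_if_zero)
    fix t
    have "T s (z\<^sub>0 [+] t [*] z\<^sub>1) = 0" using z by (simp add: cub_simps)
    from *[OF this] show "poly (?F - P * ?Q) t = 0" unfolding poly_diff poly_mult Q F P by simp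
  qed
  then have eq: "?F = P * ?Q" by simp
  have "degree P \<le> 1"
  proof (cases "P = 0")
    case False
    have "degree P + degree ?Q = degree ?F" unfolding eq by (rule degree_mult_eq[symmetric]) (use False q2 in simp_all)
    moreover have "degree ?Q = 2" using q2 by simp
    moreover have "degree ?F \<le> 3" by (rule degree_le) (simp add: coeff_pCons split: nat.splits)
    ultimately show ?thesis by simp
  qed simp
  then have "P = [:Polynomial.coeff P 0, Polynomial.coeff P 1:]"
    by (intro poly_eqI) (auto simp: coeff_pCons coeff_eq_0 split: nat.splits)
  then obtain w\<^sub>0 w\<^sub>1 where "P = [:w\<^sub>0, w\<^sub>1:]" by blast
  then have "F (z\<^sub>0 [+] t [*] z\<^sub>1) = (w\<^sub>0 + w\<^sub>1 * t) * T (z\<^sub>0 [+] t [*] z\<^sub>1) s" for t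
    unfolding F[symmetric] Q[symmetric] eq poly_mult by (simp add: algebra_simps)
  then have "cert N c s z\<^sub>0 z\<^sub>1 = 0" by (rule cert_zero_if_proportional)
  with cert show False by simp
qed

end

section \<open>Rationality over the ground field and cancellation on the cubic\<close>

context irreducible_cubic
begin

definition kval where "kval r \<longleftrightarrow> (\<exists>r'. r = (to_ac r' :: 'k alg_closure))"

lemma kval_to_ac [simp]: "kval (to_ac r)" and kval_0 [simp]: "kval 0" and kval_1 [simp]: "kval 1"
  unfolding kval_def by (metis, metis to_ac_0, metis to_ac_1)

lemma kval_mult: "kval r \<Longrightarrow> kval s \<Longrightarrow> kval (r * s)"
  and kval_uminus: "kval r \<Longrightarrow> kval (- r)"
  and kval_diff: "kval r \<Longrightarrow> kval s \<Longrightarrow> kval (r - s)"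
  and kval_divide: "kval r \<Longrightarrow> kval s \<Longrightarrow> kval (r / s)"
  unfolding kval_def by (metis to_ac_mult, metis to_ac_minus, metis to_ac_diff, metis to_ac_divide)

lemma kval_numeral [simp]: "kval (numeral n)" unfolding kval_def by (metis to_ac_numeral)

lemma kval_F [simp]: "kval (F (hv x))" and kval_T [simp]: "kval (T (hv x) (hv y))" and kval_D [simp]: "kval (D (hv x) (hv y) (hv z))"
  by (simp_all add: F_hv T_hv D_hv)

definition klin where "klin l \<longleftrightarrow> (\<exists>a. \<forall>x. l x = (\<Sum>i<N. x i * (to_ac (a i :: 'k))))"

lemma klin_add: "klin l \<Longrightarrow> l (x [+] y) = l x + l y" and klin_scale: "klin l \<Longrightarrow> l (r [*] x) = r * l x"
  by (auto simp: klin_def algebra_simps sum.distrib sum_distrib_left)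

lemma klin_cong: "klin l \<Longrightarrow> (\<And>i. i < N \<Longrightarrow> x i = y i) \<Longrightarrow> l x = l y"
  by (auto simp: klin_def)

lemma klin_kval: "klin l \<Longrightarrow> kval (l (hv x))"
proof -
  assume "klin l"
  then obtain a where "\<And>x. l x = (\<Sum>i<N. x i * to_ac (a i))" unfolding klin_def by blast
  then have "l (hv x) = to_ac (\<Sum>i<N. x i * a i)" by (simp add: hv_def a.hom_sum)
  then show ?thesis by simp
qed

lemma klin_plus: "klin l \<Longrightarrow> klin l' \<Longrightarrow> klin (\<lambda>x. l x + l' x)"
proof -
  assume "klin l" "klin l'"
  then obtain a a' where "\<And>x. l x = (\<Sum>i<N. x i * to_ac (a i))" "\<And>x. l' x = (\<Sum>i<N. x i * to_ac (a' i))"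
    unfolding klin_def by blast
  then show ?thesis unfolding klin_def
    by (intro exI[of _ "\<lambda>i. a i + a' i"]) (simp add: algebra_simps sum.distrib)
qed

lemma klin_times: "klin l \<Longrightarrow> kval r \<Longrightarrow> klin (\<lambda>x. r * l x)"
proof -
  assume "klin l" "kval r"
  then obtain a r' where "\<And>x. l x = (\<Sum>i<N. x i * to_ac (a i))" "r = to_ac r'"
    unfolding klin_def kval_def by blast
  then show ?thesis unfolding klin_def
    by (intro exI[of _ "\<lambda>i. r' * a i"]) (simp add: algebra_simps sum_distrib_left)
qed

lemma klin_minus: "klin l \<Longrightarrow> klin l' \<Longrightarrow> klin (\<lambda>x. l x - l' x)"
  using klin_plus[of l "\<lambda>x. - 1 * l' x"] klin_times[of l' "-1"] kval_uminus[of 1] by simp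

lemma klin_T: "klin (T (hv u))"
proof -
  have "T (hv u) x = (\<Sum>i<N. x i * to_ac (cubT N c u (unit i)))" for x
    unfolding cubT_unit_sum[of N _ _ x] by (simp add: hv_simps flip: T_hv)
  then show ?thesis unfolding klin_def by (intro exI allI)
qed

lemma klin_D: "klin (D (hv u) (hv v))"
proof -
  have "D (hv u) (hv v) = (\<lambda>x. T (hv (u [+] v)) x - T (hv u) x - T (hv v) x)"
    by (simp add: hv_simps cub_simps fun_eq_iff)
  then show ?thesis by (metis klin_minus klin_T)
qed

lemma klin_nonzero_unit:
  assumes "klin l" "l x \<noteq> 0"
  obtains i where "i < N" "l (unit i) \<noteq> 0"
proof -
  obtain a where a: "\<And>x. l x = (\<Sum>i<N. x i * to_ac (a i))" using assms(1) unfolding klin_def by blast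
  obtain i where i: "i < N" "a i \<noteq> 0" using assms(2) unfolding a by (metis (no_types, lifting) lessThan_iff mult_zero_right sum.neutral to_ac_0)
  have "l (unit i) = (\<Sum>j<N. if j = i then to_ac (a i) else 0)" unfolding a by (intro sum.cong refl) (simp add: unit_def)
  also have "\<dots> = to_ac (a i)" using i(1) by simp
  finally show ?thesis using that i by simp
qed

lemma F_nonzero_on_klin:
  assumes "klin l" "l x \<noteq> 0"
  obtains y where "l y = 0" "F y \<noteq> 0"
proof -
  obtain a where a: "\<And>x. l x = (\<Sum>i<N. x i * to_ac (a i))" using assms(1) unfolding klin_def by blast
  have "\<exists>i<N. a i \<noteq> 0" using assms(2) unfolding a by (metis (no_types, lifting) lessThan_iff mult_zero_right sum.neutral to_ac_0)
  from F_nonzero_on_hyperplane[OF this] show ?thesis using that unfolding a by blast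
qed

text \<open>
  The subspace \<open>l = m = 0\<close> has codimension 2: an irreducible cubic form does not vanish on a hyperplane.
\<close>

definition contains_plane where
  "contains_plane \<longleftrightarrow> (\<exists>l m x. klin l \<and> klin m \<and> l x \<noteq> 0 \<and> (\<forall>x. l x = 0 \<longrightarrow> m x = 0 \<longrightarrow> F x = 0))"

definition smooth_pt where "smooth_pt p \<longleftrightarrow> cub N c p = 0 \<and> (\<exists>i<N. cubT N c p (unit i) \<noteq> 0)"

lemma T_hv_unit: "T (hv p) (unit i) = to_ac (cubT N c p (unit i))"
  by (simp add: hv_simps flip: T_hv)

lemma smooth_ptI:
  assumes "F (hv p) = 0" "T (hv p) y \<noteq> 0"
  shows "smooth_pt p"
proof -
  obtain i where "i < N" "T (hv p) (unit i) \<noteq> 0" by (rule klin_nonzero_unit[OF klin_T assms(2)])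
  then show ?thesis using assms(1) unfolding smooth_pt_def T_hv_unit F_hv by auto
qed

lemma smooth_ptD:
  assumes "smooth_pt p"
  shows "F (hv p) = 0" "\<exists>y. T (hv p) y \<noteq> 0"
proof -
  show "F (hv p) = 0" using assms by (simp add: smooth_pt_def F_hv)
  obtain i where "T (hv p) (unit i) \<noteq> 0" using assms unfolding smooth_pt_def T_hv_unit by auto
  then show "\<exists>y. T (hv p) y \<noteq> 0" by (intro exI[of _ "unit i"])
qed

text \<open>Homogeneity is encoded by the scaling identity that the norm requires; in this shape it
  passes to sums and products by evaluation alone.\<close>

definition is_form :: "nat \<Rightarrow> ((nat \<Rightarrow> 'k alg_closure) \<Rightarrow> 'k alg_closure) \<Rightarrow> bool" where
  "is_form d q \<longleftrightarrow> (\<exists>P :: 'k mpoly. (\<forall>x. meval to_ac x P = q x) \<and> (\<forall>l. meval mconst (\<lambda>i. l * mvar i) P = l ^ d * P))"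

lemma is_form_mult: "is_form d q \<Longrightarrow> is_form d' q' \<Longrightarrow> is_form (d + d') (\<lambda>x. q x * q' x)"
proof -
  interpret m: comm_ring_hom "mconst :: 'k \<Rightarrow> 'k mpoly" by (rule mconst_hom)
  assume "is_form d q" "is_form d' q'"
  then obtain P P' :: "'k mpoly" where "\<And>x. meval to_ac x P = q x" "\<And>l. meval mconst (\<lambda>i. l * mvar i) P = l ^ d * P"
    "\<And>x. meval to_ac x P' = q' x" "\<And>l. meval mconst (\<lambda>i. l * mvar i) P' = l ^ d' * P'" unfolding is_form_def by metis
  then show ?thesis unfolding is_form_def
    by (intro exI[of _ "P * P'"]) (simp add: a.meval_mult m.meval_mult power_add)
qed

lemma is_form_add: "is_form d q \<Longrightarrow> is_form d q' \<Longrightarrow> is_form d (\<lambda>x. q x + q' x)"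
proof -
  interpret m: comm_ring_hom "mconst :: 'k \<Rightarrow> 'k mpoly" by (rule mconst_hom)
  assume "is_form d q" "is_form d q'"
  then obtain P P' :: "'k mpoly" where "\<And>x. meval to_ac x P = q x" "\<And>l. meval mconst (\<lambda>i. l * mvar i) P = l ^ d * P"
    "\<And>x. meval to_ac x P' = q' x" "\<And>l. meval mconst (\<lambda>i. l * mvar i) P' = l ^ d * P'" unfolding is_form_def by metis
  then show ?thesis unfolding is_form_def
    by (intro exI[of _ "P + P'"]) (simp add: a.meval_add m.meval_add distrib_left)
qed

lemma is_form_const: "kval r \<Longrightarrow> is_form 0 (\<lambda>x. r)"
proof -
  interpret m: comm_ring_hom "mconst :: 'k \<Rightarrow> 'k mpoly" by (rule mconst_hom)
  assume "kval r"
  then obtain r' where "r = to_ac r'" unfolding kval_def by blast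
  then show ?thesis unfolding is_form_def by (intro exI[of _ "mconst r'"]) simp
qed

lemma is_form_homogeneous: "homogeneous d G \<Longrightarrow> is_form d (\<lambda>x. meval to_ac x G)"
  unfolding is_form_def using meval_homogeneous[OF mconst_hom, of d G _ mvar]
  by (intro exI[of _ G]) (simp add: vscale_def)

lemma is_form_klin:
  assumes "klin l"
  shows "is_form 1 l"
proof -
  interpret m: comm_ring_hom "mconst :: 'k \<Rightarrow> 'k mpoly" by (rule mconst_hom)
  obtain a where "\<And>x. l x = (\<Sum>i<N. x i * to_ac (a i))" using assms unfolding klin_def by blast
  then show ?thesis unfolding is_form_def
    by (intro exI[of _ "\<Sum>i<N. mvar i * mconst (a i)"]) (simp add: a.meval_simps m.meval_simps sum_distrib_left mult.assoc)
qed

lemma is_form_Q: "is_form 2 (\<lambda>x. T x (hv u))"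
proof -
  interpret m: comm_ring_hom "mconst :: 'k \<Rightarrow> 'k mpoly" by (rule mconst_hom)
  have 1: "(\<lambda>i j k. meval mconst x (mconst (c i j k))) = (\<lambda>i j k. mconst (c i j k))"
    "(\<lambda>i. meval mconst x (mconst (u i))) = (\<lambda>i. mconst (u i))" "(\<lambda>i. meval mconst x (mvar i)) = x" for x :: "nat \<Rightarrow> 'k mpoly"
    by simp_all
  have 2: "(\<lambda>i j k. meval to_ac x (mconst (c i j k))) = cE"
    "(\<lambda>i. meval to_ac x (mconst (u i))) = hv u" for x by (simp_all add: cE_def hv_def)
  have "meval mconst (\<lambda>i. l * mvar i) (cubT N (\<lambda>i j k. mconst (c i j k)) mvar (\<lambda>i. mconst (u i))) =
    l ^ 2 * cubT N (\<lambda>i j k. mconst (c i j k)) mvar (\<lambda>i. mconst (u i))" for l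
    unfolding hom_cubT[OF m.meval_hom] 1 unfolding vscale_def[symmetric] cub_simps ..
  moreover have "meval to_ac x (cubT N (\<lambda>i j k. mconst (c i j k)) mvar (\<lambda>i. mconst (u i))) = T x (hv u)" for x
    unfolding hom_cubT[OF a.meval_hom] 2 by simp
  ultimately show ?thesis unfolding is_form_def by blast
qed

lemma prime_form:
  assumes p: "smooth_pt p" and g: "is_form d g" and q: "is_form d' q" and x1: "F x\<^sub>1 = 0" "q x\<^sub>1 \<noteq> 0"
    and 0: "\<And>x. F x = 0 \<Longrightarrow> g x * q x = 0" and x: "F x = 0"
  shows "g x = 0"
proof -
  interpret K: cubic_point to_ac N c p cE "hv p" "\<lambda>i j k. mconst (c i j k)" "\<lambda>i. mconst (p i)"
    unfolding cE_def hv_def using cubic_point_k p unfolding smooth_pt_def by blast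
  obtain G where G: "\<And>x. meval to_ac x G = g x" "\<And>l. meval mconst (\<lambda>i. l * mvar i) G = l ^ d * G" using g unfolding is_form_def by blast
  obtain P where P: "\<And>x. meval to_ac x P = q x" "\<And>l. meval mconst (\<lambda>i. l * mvar i) P = l ^ d' * P" using q unfolding is_form_def by blast
  have "K.scaling G" "K.scaling P" using G(2) P(2) unfolding K.scaling_def by blast+
  from K.prime_on_cubic[OF this] consider "K.FM dvd G" | "K.FM dvd P"
    using 0 G(1) P(1) by auto
  then show ?thesis
    using K.FM_dvd_imp_vanishes[of G x] K.FM_dvd_imp_vanishes[of P x\<^sub>1] x x1 G(1) P(1) by cases auto
qed

lemma quadratic_nonzero_on_cubic:
  assumes p: "smooth_pt p" and q: "is_form d' q"
    and quad: "\<And>y w. \<exists>a b. \<forall>t. q (y [+] t [*] w) = q y + t * a + t\<^sup>2 * b" and nz: "q x\<^sub>0 \<noteq> 0"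
  shows "\<exists>x. F x = 0 \<and> q x \<noteq> 0"
proof (rule ccontr)
  interpret K: cubic_point to_ac N c p cE "hv p" "\<lambda>i j k. mconst (c i j k)" "\<lambda>i. mconst (p i)"
    unfolding cE_def hv_def using cubic_point_k p unfolding smooth_pt_def by blast
  obtain P where P: "\<And>x. meval to_ac x P = q x" "\<And>l. meval mconst (\<lambda>i. l * mvar i) P = l ^ d' * P" using q unfolding is_form_def by blast
  assume neg: "\<nexists>x. F x = 0 \<and> q x \<noteq> 0"
  have "K.scaling P" using P(2) unfolding K.scaling_def by blast
  from K.vanishes_iff_dvd[OF this] neg have dvd: "K.FM dvd P" unfolding P(1) by auto
  have "P = 0" by (rule K.FM_dvd_low_degree[OF dvd]) (use quad in \<open>simp add: P(1)\<close>)
  then show False using P(1)[of x\<^sub>0] nz by simp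
qed

text \<open>A nonzero form of degree at most 2 cannot vanish on the whole cubic, so primality allows
  it to be cancelled. This discards the exceptional loci in the density arguments.\<close>

lemma cancel_form:
  assumes p: "smooth_pt p" and g: "is_form d g" and q: "is_form d' q"
    and quad: "\<And>y w. \<exists>a b. \<forall>t. q (y [+] t [*] w) = q y + t * a + t\<^sup>2 * b" and nz: "q x\<^sub>0 \<noteq> 0"
    and 0: "\<And>x. F x = 0 \<Longrightarrow> g x * q x = 0" and x: "F x = 0"
  shows "g x = 0"
proof -
  obtain x\<^sub>1 where "F x\<^sub>1 = 0" "q x\<^sub>1 \<noteq> 0" using quadratic_nonzero_on_cubic[OF p q quad nz] by blast
  then show ?thesis using prime_form[OF p g q _ _ 0 x] by blast
qed

lemma quad_Q: "\<exists>a b. \<forall>t. T (y [+] t [*] w) u = T y u + t * a + t\<^sup>2 * b"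
  by (intro exI[of _ "D y w u"] exI[of _ "T w u"]) (simp add: cub_simps)

lemma quad_L: "klin l \<Longrightarrow> \<exists>a b. \<forall>t. l (y [+] t [*] w) = l y + t * a + t\<^sup>2 * b"
  by (intro exI[of _ "l w"] exI[of _ 0]) (simp add: klin_add klin_scale)

text \<open>If the discriminant vanished identically, \<open>Q_p\<close> would vanish on the cubic;
  cancelling it from 1 * Q_p = 0 would give 1 = 0.\<close>

lemma discriminant_nonzero:
  assumes p: "smooth_pt p" and y0: "T y\<^sub>0 (hv p) \<noteq> 0"
  shows "\<exists>y. (T y (hv p))\<^sup>2 \<noteq> 4 * (T (hv p) y * F y)"
proof (rule ccontr)
  assume neg: "\<nexists>y. (T y (hv p))\<^sup>2 \<noteq> 4 * (T (hv p) y * F y)"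
  then have 0: "T y (hv p) = 0" if "F y = 0" for y using that by (metis mult_zero_right power_eq_0_iff)
  have "(1 :: 'k alg_closure) = 0" if "F x = 0" for x
    by (rule cancel_form[OF p is_form_const is_form_Q quad_Q y0 _ that]) (simp_all add: 0)
  from this[OF cub_0] show False by simp
qed

text \<open>Restricted to the tangent hyperplane, \<open>Q_p\<close> is a quadratic form over k, so
  if it is nonzero then it is nonzero at a rational vector. The restriction is expressed by the
  projection \<open>pr\<close> along a unit vector.\<close>

lemma tangent_quadric_cases:
  assumes p: "smooth_pt p"
  obtains "\<And>y. T (hv p) y = 0 \<Longrightarrow> T y (hv p) = 0"
  | z where "T (hv p) (hv z) = 0" "T (hv z) (hv p) \<noteq> 0"
proof (cases "\<exists>z. T (hv p) (hv z) = 0 \<and> T (hv z) (hv p) \<noteq> 0")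
  case True
  then show ?thesis using that by blast
next
  case False
  then have 0: "T (hv z) (hv p) = 0" if "T (hv p) (hv z) = 0" for z using that by blast
  obtain i where i: "i < N" "T (hv p) (unit i) \<noteq> 0" using p unfolding smooth_pt_def T_hv_unit by auto
  define pr where "pr x = T (hv p) (unit i) [*] x [+] (- T (hv p) x) [*] unit i" for x
  define pk where "pk x = cubT N c p (unit i) [*] x [+] (- cubT N c p x) [*] unit i" for x
  have hv_pk: "hv (pk x) = pr (hv x)" for x by (simp add: pk_def pr_def hv_simps flip: T_hv)
  have T_pr: "T (hv p) (pr x) = 0" for x by (simp add: pr_def cub_simps)
  have pr_add: "pr (x [+] y) = pr x [+] pr y" and pr_scale: "pr (r [*] x) = r [*] pr x" for x y r
    by (simp_all add: pr_def cub_simps fun_eq_iff algebra_simps)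
  have "T (pr x) (hv p) = 0" for x
  proof (rule quadratic_form_zero_test[where q = "\<lambda>x. T (pr x) (hv p)" and B = "\<lambda>x y. D (pr x) (pr y) (hv p)" and N = N])
    show "T (pr x) (hv p) = T (pr y) (hv p)" if "\<And>i. i < N \<Longrightarrow> x i = y i" for x y
      by (rule cubT_cong) (use that klin_cong[OF klin_T that] in \<open>simp_all add: pr_def\<close>)
    show "T (pr (unit j)) (hv p) = 0" "T (pr (unit i [+] unit j)) (hv p) = 0" for i j
      using 0[of "pk (unit j)"] 0[of "pk (unit i [+] unit j)"] T_pr by (simp_all add: hv_pk hv_simps)
  qed (simp_all add: pr_add pr_scale cub_simps algebra_simps cubD_commute)
  then have *: "T (pr y) (hv p) = 0" for y .
  have "T y (hv p) = 0" if "T (hv p) y = 0" for y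
  proof -
    have "pr y = T (hv p) (unit i) [*] y" using that by (simp add: pr_def fun_eq_iff)
    then show ?thesis using *[of y] i(2) by (simp add: cub_simps)
  qed
  then show ?thesis using that by blast
qed

text \<open>If all certificates at \<open>p\<close> vanish, solving the one for \<open>x\<close> and
  the rational vector \<open>z\<close> for F(x) gives F = w Q_p on the tangent hyperplane with w
  over k, so F vanishes on \<open>T(p, -) = w = 0\<close>.\<close>

lemma generic_point_cases:
  assumes p: "smooth_pt p" and z: "T (hv p) (hv z) = 0" "T (hv z) (hv p) \<noteq> 0"
  shows "unirational N f \<or> contains_plane"
proof (cases "\<exists>z\<^sub>0 z\<^sub>1. T (hv p) z\<^sub>0 = 0 \<and> T (hv p) z\<^sub>1 = 0 \<and> cert N cE (hv p) z\<^sub>0 z\<^sub>1 \<noteq> 0")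
  case True
  then obtain z\<^sub>0 z\<^sub>1 where z01: "T (hv p) z\<^sub>0 = 0" "T (hv p) z\<^sub>1 = 0" "cert N cE (hv p) z\<^sub>0 z\<^sub>1 \<noteq> 0" by blast
  have "good N cE (hv p)" unfolding good_def using z01 smooth_ptD(2)[OF p] by blast
  then have "unirational N f"
    using p unirational_if_good[OF _ _ C.not_multiple_if_cert[OF z01] discriminant_nonzero[OF p z(2)] smooth_ptD(1)[OF p]]
    unfolding smooth_pt_def by blast
  then show ?thesis ..
next
  case False
  define r where "r = T (hv z) (hv p)"
  define w where "w x = (1 / r\<^sup>2) * (r * T (hv z) x - F (hv z) * D (hv z) (hv p) x)" for x
  have r: "r \<noteq> 0" "kval r" using z by (simp_all add: r_def)
  have "klin w"
    unfolding w_def power2_eq_square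
    by (intro klin_minus klin_times klin_T klin_D kval_divide kval_mult kval_F r(2) kval_1)
  have F: "F x = w x * T x (hv p)" if "T (hv p) x = 0" for x
  proof -
    have "cert N cE (hv p) x (hv z) = 0" using False that z(1) by blast
    then have "F x * r\<^sup>2 - (T (hv z) x * r - F (hv z) * D x (hv z) (hv p)) * T x (hv p) = 0"
      using z(2) unfolding cert_def r_def by simp
    moreover have "D x (hv z) (hv p) = D (hv z) (hv p) x" by (metis cubD_commute)
    ultimately show ?thesis using r(1) by (simp add: w_def field_simps)
  qed
  obtain y where "T (hv p) y \<noteq> 0" using smooth_ptD(2)[OF p] by blast
  then have contains_plane
    unfolding contains_plane_def using klin_T[of p] \<open>klin w\<close> F by (metis mult_zero_left)
  then show ?thesis ..
qed

end

section \<open>Singular and inseparable points\<close>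

lemma perfect_sqrt:
  fixes x :: "'a :: field"
  assumes perf: "perfect_field TYPE('a)" and 2: "(2 :: 'a) = 0"
  shows "\<exists>y. y\<^sup>2 = x"
proof -
  have two: "(of_nat 2 :: 'a) = 0" using 2 by simp
  then have "CHAR('a) dvd 2" using of_nat_eq_0_iff_char_dvd by blast
  then have "CHAR('a) = 2" using CHAR_not_1' by (metis One_nat_def prime_nat_iff two_is_prime_nat)
  then have "surj (\<lambda>x :: 'a. x ^ 2)" using perf unfolding perfect_field_def by auto
  then show ?thesis by (metis surjD)
qed

lemma perfect_cube_root:
  fixes x :: "'a :: field"
  assumes perf: "perfect_field TYPE('a)" and 3: "(3 :: 'a) = 0"
  shows "\<exists>y. y ^ 3 = x"
proof -
  have "(of_nat 3 :: 'a) = 0" using 3 by simp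
  then have "CHAR('a) dvd 3" using of_nat_eq_0_iff_char_dvd by blast
  moreover have "prime (3 :: nat)" by simp
  ultimately have "CHAR('a) = 3" using CHAR_not_1' by (metis One_nat_def prime_nat_iff)
  then have "surj (\<lambda>x :: 'a. x ^ 3)" using perf unfolding perfect_field_def by auto
  then show ?thesis by (metis surjD)
qed

context irreducible_cubic
begin

lemma smooth_pt_geometric: 
  assumes "smooth_pt p"
  shows "\<exists>x. (\<exists>i<N. x i \<noteq> 0) \<and> meval to_ac x f = 0"
proof -
  obtain y where y: "T (hv p) y \<noteq> 0" using smooth_ptD(2)[OF assms] by blast
  have "\<exists>i<N. hv p i \<noteq> 0"
  proof (rule ccontr)
    assume "\<not> (\<exists>i<N. hv p i \<noteq> 0)"
    then have "T (hv p) y = T (\<lambda>_. 0) y" by (intro cubT_cong) auto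
    with y show False by simp
  qed
  then show ?thesis using smooth_ptD(1)[OF assms] unfolding meval_f by blast
qed

lemma hom_consts:
  "(\<lambda>i j k. meval to_ac t (mconst (c i j k))) = cE" "(\<lambda>i. meval to_ac t (mconst (u i))) = hv u"
  by (simp_all add: cE_def hv_def)

text \<open>For y on the cubic the parametrization returns \<open>Q_s(y) y\<close>, so it reaches
  every point outside the quadric, and the quadric can be cancelled.\<close>

lemma unirational_if_singular:
  assumes p: "smooth_pt p" and s: "F (hv s) = 0" "\<And>y. T (hv s) y = 0" and Q: "T x\<^sub>0 (hv s) \<noteq> 0"
  shows "unirational N f"
proof (rule unirational_criterion[OF poly_ring])
  let ?g = "cub_rho N (\<lambda>i j k. mconst (c i j k)) (\<lambda>i. mconst (s i)) mvar"
  have g: "(\<lambda>i. meval to_ac t (?g i)) = C.rho (hv s) t" for t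
    unfolding hom_cub_rho[OF a.meval_hom] hom_consts(1) hom_consts(2)[of t s] by simp
  show "meval to_ac (\<lambda>i. meval to_ac t (?g i)) f = 0" for t
    unfolding g meval_f by (rule C.F_rho) (use s in simp_all)
  show "\<exists>x. (\<exists>i<N. x i \<noteq> 0) \<and> meval to_ac x f = 0" by (rule smooth_pt_geometric[OF p])
  fix G d x
  assume G: "homogeneous d (G :: 'k mpoly)" "\<And>t. meval to_ac (\<lambda>i. meval to_ac t (?g i)) G = 0" and x: "meval to_ac x f = 0"
  have 0: "meval to_ac y G * T y (hv s) = 0" if y: "F y = 0" for y
  proof -
    have "C.rho (hv s) y = T y (hv s) [*] y" using y by (simp add: cub_rho_def fun_eq_iff)
    with G(2)[of y] have "T y (hv s) ^ d * meval to_ac y G = 0"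
      unfolding g by (simp add: meval_homogeneous[OF to_ac_hom G(1)])
    then show ?thesis by auto
  qed
  show "meval to_ac x G = 0"
    using cancel_form[OF p is_form_homogeneous[OF G(1)] is_form_Q quad_Q Q] 0 x unfolding meval_f by blast
qed

text \<open>
  If \<open>T(y, p) = 0\<close> for all \<open>y\<close>, then the line through \<open>p\<close> and \<open>y\<close> meets the cubic in \<open>p\<close> and in a
  point whose parameter is the square root of \<open>F(y) / T(p, y)\<close>.
\<close>

lemma unirational_if_inseparable:
  assumes p: "smooth_pt p" and 2: "(2 :: 'k) = 0" and sq: "\<And>x :: 'k. \<exists>y. y\<^sup>2 = x" and 0: "\<And>y. T y (hv p) = 0"
  shows "unirational N f"
proof -
  obtain r :: "'k \<Rightarrow> 'k" where r: "\<And>x. (r x)\<^sup>2 = x" using sq by metis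
  have 2: "(2 :: 'k alg_closure) = 0" using arg_cong[OF 2, of to_ac] by simp
  have frob: "comm_ring_hom (\<lambda>x :: 'k alg_closure. x\<^sup>2)"
  proof
    fix x y :: "'k alg_closure"
    have "(x + y)\<^sup>2 = x\<^sup>2 + y\<^sup>2 + 2 * (x * y)" by (simp add: power2_eq_square algebra_simps)
    then show "(x + y)\<^sup>2 = x\<^sup>2 + y\<^sup>2" by (simp add: 2)
  qed (simp_all add: power_mult_distrib)
  interpret fr: comm_ring_hom "\<lambda>x :: 'k alg_closure. x\<^sup>2" by (rule frob)
  \<comment> \<open>Square roots of the coefficients make \<open>\<phi>\<close> and
    \<open>\<mu>\<close> polynomials over k whose squares are F and \<open>T(p, -)\<close> at the
    squared parameters; \<open>\<phi> / \<mu>\<close> is thus the required square root.\<close>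
  define \<phi> where "\<phi> = cub N (\<lambda>i j k. mconst (r (c i j k))) mvar"
  define \<mu> where "\<mu> = (\<Sum>i<N. mvar i * mconst (r (cubT N c p (unit i))))"
  let ?g = "\<lambda>i. \<phi> * mconst (p i) + \<mu> * (mvar i)\<^sup>2"
  define sqv where "sqv t = (\<lambda>i. (t i)\<^sup>2)" for t :: "nat \<Rightarrow> 'k alg_closure"
  have g: "(\<lambda>i. meval to_ac t (?g i)) = meval to_ac t \<phi> [*] hv p [+] meval to_ac t \<mu> [*] sqv t" for t
    by (simp add: fun_eq_iff a.meval_simps sqv_def hv_def)
  have \<phi>: "(meval to_ac t \<phi>)\<^sup>2 = F (sqv t)" for t
    unfolding \<phi>_def hom_cub[OF a.meval_hom] hom_cub[OF frob] by (simp add: r cE_def sqv_def flip: to_ac_power)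
  have \<mu>: "(meval to_ac t \<mu>)\<^sup>2 = T (hv p) (sqv t)" for t
    unfolding \<mu>_def a.meval_sum fr.hom_sum cubT_unit_sum[of N _ _ "sqv t"] T_hv_unit
    by (simp add: a.meval_mult power_mult_distrib r sqv_def flip: to_ac_power)
  have on: "meval to_ac (\<lambda>i. meval to_ac t (?g i)) f = 0" for t
  proof -
    have "F (x [*] hv p [+] y [*] sqv t) = y * (x\<^sup>2 * T (hv p) (sqv t) + y\<^sup>2 * F (sqv t))" for x y
      by (simp add: cub_simps smooth_ptD(1)[OF p] 0 algebra_simps power2_eq_square power3_eq_cube)
    then have "F (meval to_ac t \<phi> [*] hv p [+] meval to_ac t \<mu> [*] sqv t) = meval to_ac t \<mu> * (2 * ((meval to_ac t \<mu>)\<^sup>2 * (meval to_ac t \<phi>)\<^sup>2))"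
      by (simp flip: \<phi> \<mu> add: mult.commute)
    then show ?thesis unfolding g meval_f by (simp add: 2)
  qed
  have dom: "meval to_ac x G = 0"
    if G: "homogeneous d (G :: 'k mpoly)" "\<And>t. meval to_ac (\<lambda>i. meval to_ac t (?g i)) G = 0" and x: "meval to_ac x f = 0" for G d x
  proof -
    have 0: "meval to_ac y G * T (hv p) y = 0" if y: "F y = 0" for y
    proof -
      obtain r' :: "'k alg_closure \<Rightarrow> 'k alg_closure" where r': "\<And>x. (r' x)\<^sup>2 = x" using nth_root_exists[of 2] by (metis pos2)
      define t where "t = (\<lambda>i. r' (y i))"
      have t: "sqv t = y" by (simp add: t_def sqv_def r')
      have "meval to_ac t \<phi> = 0" using \<phi>[of t] y t by simp
      then have "(\<lambda>i. meval to_ac t (?g i)) = meval to_ac t \<mu> [*] y" unfolding g t by (simp add: fun_eq_iff)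
      with G(2)[of t] have "meval to_ac t \<mu> ^ d * meval to_ac y G = 0"
        by (simp add: meval_homogeneous[OF to_ac_hom G(1)])
      then show ?thesis using \<mu>[of t] t by auto
    qed
    obtain x\<^sub>0 where "T (hv p) x\<^sub>0 \<noteq> 0" using smooth_ptD(2)[OF p] by blast
    then show ?thesis
      using cancel_form[OF p is_form_homogeneous[OF G(1)] is_form_klin[OF klin_T] quad_L[OF klin_T]] 0 x unfolding meval_f by blast
  qed
  show ?thesis
    by (rule unirational_criterion[OF poly_ring on dom smooth_pt_geometric[OF p]])
qed

text \<open>Polarizing \<open>Q_p = 0\<close> gives 2 T(p, y) = 0, and smoothness makes
  \<open>T(p, -)\<close> nonzero, so the characteristic is 2.\<close>

lemma unirational_if_char_2_point:
  assumes p: "smooth_pt p" and perf: "perfect_field TYPE('k)" and 0: "\<And>y. T y (hv p) = 0"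
  shows "unirational N f"
proof (rule unirational_if_inseparable[OF p _ _ 0])
  obtain y where y: "T (hv p) y \<noteq> 0" using smooth_ptD(2)[OF p] by blast
  have "D (hv p) y (hv p) = 0"
    using 0[of "hv p [+] y"] 0[of y] 0[of "hv p"] by (simp add: cubT_add)
  then have "(of_nat 2 :: 'k alg_closure) = 0" using y by (simp add: cubD_same)
  then have "to_ac (of_nat 2 :: 'k) = 0" by simp
  then have two: "(of_nat 2 :: 'k) = 0" by (simp only: to_ac_eq_0_iff)
  then show "(2 :: 'k) = 0" by simp
  show "\<exists>y. y\<^sup>2 = x" for x :: 'k by (rule perfect_sqrt[OF perf]) (use two in simp)
qed

end

section \<open>Smooth points whose polar quadric vanishes on the tangent hyperplane\<close>

text \<open>Here \<open>v\<close> is a zero of F on the intersection of the tangent hyperplanes at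
  \<open>s\<^sub>1\<close> and \<open>s\<^sub>2\<close>, simple in the direction \<open>w\<close>.
  The candidates are the points v + \<beta> s_2; the resultant, as a polynomial in \<beta>, is
  nonzero by its lowest term.\<close>

lemma (in cubic_closed) good_if_simple_zero:
  assumes s: "F s\<^sub>1 = 0" "F s\<^sub>2 = 0" "T s\<^sub>1 s\<^sub>2 = - d" "T s\<^sub>2 s\<^sub>1 = - d" "d \<noteq> 0"
    and v: "T s\<^sub>1 v = 0" "T s\<^sub>2 v = 0" "T v s\<^sub>1 = 0" "T v s\<^sub>2 = 0" "D v s\<^sub>1 s\<^sub>2 = - d * l\<^sub>0"
    and w: "T s\<^sub>1 w = 0" "T s\<^sub>2 w = 0" "T w s\<^sub>1 = 0" "T w s\<^sub>2 = 0" "D w s\<^sub>1 s\<^sub>2 = - d * l\<^sub>1"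
    and vw: "D v w s\<^sub>1 = 0" "D v w s\<^sub>2 = 0" "F v = 0" "T v w \<noteq> 0"
  shows "\<exists>s. F s = 0 \<and> good N c s"
proof -
  define \<phi> where "\<phi> = T v w"
  define k where "k = inverse d"
  have \<phi>: "\<phi> \<noteq> 0" and k: "k \<noteq> 0" "d * k = 1" using vw(4) s(5) by (simp_all add: \<phi>_def k_def)
  define B where "B = T w v"
  define f1 where "f1 = F w"
  define Lm where "Lm \<beta> = l\<^sub>1 * \<beta> * (l\<^sub>0 + \<beta>) + k * \<phi>" for \<beta>
  define Th where "Th \<beta> = B * \<beta> * (l\<^sub>0 + \<beta>)\<^sup>2 - \<phi> * Lm \<beta>" for \<beta>
  \<comment> \<open>the numerator of the resultant in \<open>good_if_resultant\<close> for the point \<open>v + \<beta> s\<^sub>2\<close>\<close>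
  define P where "P \<beta> = - f1 * \<phi> * (l\<^sub>0 + 2 * \<beta>)\<^sup>2 * \<beta>\<^sup>2 * (l\<^sub>0 + \<beta>) ^ 3 + \<phi> * Lm \<beta> * (l\<^sub>0 + 2 * \<beta>) * Th \<beta> + \<beta> * (Th \<beta>)\<^sup>2" for \<beta>
  have "\<exists>\<beta>. \<beta> \<noteq> 0 \<and> l\<^sub>0 + \<beta> \<noteq> 0 \<and> P \<beta> \<noteq> 0"
  proof -
    define Xp where "Xp = ([:0, 1:] :: 'e poly)"
    define M where "M = [:l\<^sub>0, 1:]"
    define LP where "LP = [:l\<^sub>1:] * Xp * M + [:k * \<phi>:]"
    define TP where "TP = [:B:] * Xp * M\<^sup>2 - [:\<phi>:] * LP"
    \<comment> \<open>For \<open>l\<^sub>0 = 0\<close> the polynomial \<open>P\<close> is divisible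
      by \<beta> and \<open>H\<close> is the quotient; in both cases the value of \<open>H\<close>
      at 0 is visibly nonzero.\<close>
    define H where "H = (if l\<^sub>0 = 0 then [:- 4 * f1 * \<phi>:] * Xp ^ 6 + [:2 * \<phi>:] * LP * TP + TP\<^sup>2
      else [:- f1 * \<phi>:] * (M + Xp)\<^sup>2 * Xp\<^sup>2 * M ^ 3 + [:\<phi>:] * LP * (M + Xp) * TP + Xp * TP\<^sup>2)"
    have Xp: "poly Xp \<beta> = \<beta>" "poly M \<beta> = l\<^sub>0 + \<beta>" for \<beta> by (simp_all add: Xp_def M_def)
    have LP: "poly LP \<beta> = Lm \<beta>" and TP: "poly TP \<beta> = Th \<beta>" for \<beta>
      by (simp_all add: LP_def TP_def Lm_def Th_def Xp)
    have H: "P \<beta> = (if l\<^sub>0 = 0 then \<beta> * poly H \<beta> else poly H \<beta>)" for \<beta>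
    proof -
      have "\<beta>\<^sup>2 * \<beta>\<^sup>2 * \<beta> ^ 3 = \<beta> * \<beta> ^ 6" by (simp flip: power_Suc power_add)
      then show ?thesis
        by (simp add: H_def P_def Xp LP TP algebra_simps)
    qed
    have L0: "Lm 0 = k * \<phi>" and T0: "Th 0 = - (k * \<phi>\<^sup>2)" by (simp_all add: Lm_def Th_def power2_eq_square)
    have "poly H 0 \<noteq> 0"
    proof (cases "l\<^sub>0 = 0")
      case True
      have "poly H 0 = - (k\<^sup>2 * \<phi> ^ 4)"
        using True by (simp add: H_def Xp LP TP L0 T0 power2_eq_square power4_eq_xxxx algebra_simps)
      then show ?thesis using k \<phi> by simp
    next
      case False
      have "poly H 0 = - (k\<^sup>2 * \<phi> ^ 4 * l\<^sub>0)"
        using False by (simp add: H_def Xp LP TP L0 T0 power2_eq_square power4_eq_xxxx algebra_simps)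
      then show ?thesis using k \<phi> False by simp
    qed
    then have "H \<noteq> 0" by auto
    moreover have "Xp \<noteq> 0" "M \<noteq> 0" by (simp_all add: Xp_def M_def)
    ultimately have "H * Xp * M \<noteq> 0" by simp
    then obtain \<beta> where "poly (H * Xp * M) \<beta> \<noteq> 0" using poly_eq_0_if_zero[of "H * Xp * M"] by blast
    then have "poly H \<beta> \<noteq> 0" "\<beta> \<noteq> 0" "l\<^sub>0 + \<beta> \<noteq> 0" by (simp_all only: poly_mult Xp) auto
    then show ?thesis by (intro exI[of _ \<beta>]) (simp add: H)
  qed
  then obtain \<beta> where \<beta>: "\<beta> \<noteq> 0" "l\<^sub>0 + \<beta> \<noteq> 0" "P \<beta> \<noteq> 0" by blast
  \<comment> \<open>The value of \<epsilon>, and with it of \<alpha>, is forced by the tangency T(t,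
    z) = \<phi> - d \<alpha> \<beta> (l_0 + \<beta>) = 0.\<close>
  define \<epsilon> where "\<epsilon> = \<phi> / (\<beta> * (l\<^sub>0 + \<beta>))"
  have \<epsilon>: "\<epsilon> * \<beta> * (l\<^sub>0 + \<beta>) = \<phi>" "\<epsilon> \<noteq> 0" using \<beta> \<phi> by (simp_all add: \<epsilon>_def)
  define \<alpha> where "\<alpha> = k * \<epsilon>"
  have \<alpha>: "d * \<alpha> = \<epsilon>" using k by (simp add: \<alpha>_def flip: mult.assoc)
  define t where "t = v [+] \<beta> [*] s\<^sub>2"
  define z where "z = w [+] \<alpha> [*] s\<^sub>1"
  have sym: "D s\<^sub>2 s\<^sub>1 v = D v s\<^sub>1 s\<^sub>2" "D s\<^sub>1 s\<^sub>2 v = D v s\<^sub>1 s\<^sub>2" "D v s\<^sub>2 s\<^sub>1 = D v s\<^sub>1 s\<^sub>2" "D s\<^sub>1 v s\<^sub>2 = D v s\<^sub>1 s\<^sub>2" "D s\<^sub>2 v s\<^sub>1 = D v s\<^sub>1 s\<^sub>2"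
     "D s\<^sub>2 s\<^sub>1 w = D w s\<^sub>1 s\<^sub>2" "D s\<^sub>1 s\<^sub>2 w = D w s\<^sub>1 s\<^sub>2" "D w s\<^sub>2 s\<^sub>1 = D w s\<^sub>1 s\<^sub>2" "D s\<^sub>1 w s\<^sub>2 = D w s\<^sub>1 s\<^sub>2" "D s\<^sub>2 w s\<^sub>1 = D w s\<^sub>1 s\<^sub>2"
     "D v s\<^sub>1 w = D v w s\<^sub>1" "D v s\<^sub>2 w = D v w s\<^sub>2" "D w v s\<^sub>1 = D v w s\<^sub>1" "D w v s\<^sub>2 = D v w s\<^sub>2"
     "D w s\<^sub>1 v = D v w s\<^sub>1" "D w s\<^sub>2 v = D v w s\<^sub>2" "D s\<^sub>1 v w = D v w s\<^sub>1" "D s\<^sub>2 v w = D v w s\<^sub>2" "D s\<^sub>1 w v = D v w s\<^sub>1" "D s\<^sub>2 w v = D v w s\<^sub>2"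
    by (simp_all add: cubD_def)
  note simps = cub_simps s v w vw(1-3) sym
  have Ft: "F t = 0" unfolding t_def by (simp add: simps)
  have Ttz: "T t z = 0"
  proof -
    have "T t z = T v w - (d * \<alpha>) * \<beta> * (l\<^sub>0 + \<beta>)"
      unfolding t_def z_def by (simp add: simps algebra_simps power2_eq_square)
    then show ?thesis unfolding \<alpha> \<epsilon>(1) by (simp add: \<phi>_def)
  qed
  have Tts2: "T t s\<^sub>2 = 0" "T s\<^sub>2 t = 0" unfolding t_def by (simp_all add: simps)
  have Tts1: "T t s\<^sub>1 = - d * \<beta> * (l\<^sub>0 + \<beta>)"
    unfolding t_def by (simp add: simps algebra_simps power2_eq_square)
  have q: "T z t = B - d * \<alpha> * \<beta> * (l\<^sub>1 + \<alpha>)"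
    unfolding t_def z_def B_def by (simp add: simps algebra_simps power2_eq_square)
  have q': "D z s\<^sub>2 t = - (d * \<alpha>) * (l\<^sub>0 + 2 * \<beta>)"
    unfolding t_def z_def by (simp add: simps algebra_simps power2_eq_square)
  have A: "T z s\<^sub>2 = - (d * \<alpha>) * (l\<^sub>1 + \<alpha>)" "T s\<^sub>2 z = - (d * \<alpha>)" "F z = f1"
    unfolding z_def f1_def by (simp_all add: simps algebra_simps power2_eq_square)
  have Lm: "(l\<^sub>1 + \<alpha>) * (\<beta> * (l\<^sub>0 + \<beta>)) = Lm \<beta>"
    unfolding \<alpha>_def Lm_def \<epsilon>(1)[symmetric] by (simp add: algebra_simps)
  have Th: "T z t * (\<beta> * (l\<^sub>0 + \<beta>)\<^sup>2) = Th \<beta>"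
    unfolding q \<alpha> Th_def Lm[symmetric] \<epsilon>(1)[symmetric] by (simp add: algebra_simps power2_eq_square)
  have "(F z * (D z s\<^sub>2 t)\<^sup>2 - T z s\<^sub>2 * T z t * D z s\<^sub>2 t + T s\<^sub>2 z * (T z t)\<^sup>2) * (\<beta> ^ 3 * (l\<^sub>0 + \<beta>) ^ 4) = - \<epsilon> * P \<beta>"
    unfolding P_def Th[symmetric] unfolding q' A \<alpha> Lm[symmetric] \<epsilon>(1)[symmetric]
    by (simp add: algebra_simps power_def numeral_eq_Suc)
  then have res: "F z * (D z s\<^sub>2 t)\<^sup>2 - T z s\<^sub>2 * T z t * D z s\<^sub>2 t + T s\<^sub>2 z * (T z t)\<^sup>2 \<noteq> 0"
    using \<epsilon>(2) \<beta>(3) by auto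
  have "T t s\<^sub>1 \<noteq> 0" unfolding Tts1 using s(5) \<beta>(1,2) by simp
  then have "good N c t" by (rule good_if_resultant[OF _ Ttz Tts2(1,2) s(2) res])
  then show ?thesis using Ft by blast
qed

lemma vec_induct:
  assumes cong: "\<And>x y. (\<And>i. i < N \<Longrightarrow> x i = y i) \<Longrightarrow> P x \<Longrightarrow> P y"
    and 0: "P (\<lambda>_. 0)" and add: "\<And>x i r. i < N \<Longrightarrow> P x \<Longrightarrow> P (x [+] r [*] unit i)"
  shows "P x"
proof -
  define y where "y M = (\<lambda>i. if i < M then x i else 0)" for M
  have y_Suc: "y (Suc M) = y M [+] x M [*] unit M" for M
    by (auto simp: y_def fun_eq_iff unit_def less_Suc_eq)
  have "M \<le> N \<Longrightarrow> P (y M)" for M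
  proof (induction M)
    case 0
    show ?case using \<open>P (\<lambda>_. 0)\<close> by (simp add: y_def)
  next
    case (Suc M)
    then show ?case unfolding y_Suc by (intro add) simp_all
  qed
  from this[of N] have "P (y N)" by simp
  then show ?thesis by (rule cong[rotated]) (simp add: y_def)
qed

context irreducible_cubic
begin

lemma kval_hv: "kval r \<Longrightarrow> \<exists>x. r [*] hv u = hv x"
  unfolding kval_def using hv_simps(2) by metis

text \<open>
  If \<open>F(z) \<noteq> 0\<close>, then every zero \<open>u\<close> satisfies \<open>T(z, u) = 0\<close>, since otherwise the line through \<open>u\<close> and \<open>z\<close>
  contains a simple zero. Hence the zeros form a hyperplane; in characteristic 3 its coefficients are
  cube roots of elements of the ground field.
\<close>

lemma zeros_linear_if_no_simple_zero:
  assumes perf: "perfect_field TYPE('k)"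
    and pr: "\<And>x y. pr (x [+] y) = pr x [+] pr y" "\<And>r x. pr (r [*] x) = r [*] pr x"
      "\<And>x y. (\<And>i. i < N \<Longrightarrow> x i = y i) \<Longrightarrow> F (pr x) = F (pr y)" "\<And>x. pr (pr x) = pr x"
    and prk: "\<And>i. \<exists>u. pr (unit i) = hv u"
    and sing: "\<And>x y. F (pr x) = 0 \<Longrightarrow> T (pr x) (pr y) = 0"
  shows "\<exists>w. klin w \<and> (\<forall>x. w x = 0 \<longrightarrow> F (pr x) = 0)"
proof (cases "\<exists>j. F (pr (unit j)) \<noteq> 0")
  case False
  have add: "F (x [+] y) = 0" if "F x = 0" "F y = 0" "pr x = x" "pr y = y" for x y
    using that sing[of x y] sing[of y x] by (simp add: cub_simps)
  have pr0: "pr (\<lambda>_. 0) = (\<lambda>_. 0)" using pr(2)[of 0 "\<lambda>_. 0"] by (simp add: vscale_def)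
  have "F (pr x) = 0" for x
  proof (rule vec_induct[where N = N and P = "\<lambda>x. F (pr x) = 0"])
    show "F (pr y) = 0" if "\<And>i. i < N \<Longrightarrow> x i = y i" "F (pr x) = 0" for x y
      using pr(3)[OF that(1)] that(2) by simp
    show "F (pr (x [+] r [*] unit i)) = 0" if "F (pr x) = 0" for x i r
      unfolding pr(1) by (rule add) (use False that in \<open>simp_all add: pr(1,2,4) cub_simps\<close>)
  qed (simp add: pr0)
  moreover have "klin (\<lambda>_. 0)" using klin_times[OF klin_T kval_0] by simp
  ultimately show ?thesis by blast
next
  case True
  then obtain z z' where z: "F z \<noteq> 0" "pr z = z" "z = hv z'" using prk pr(4) by metis
  have add: "F (x [+] y) = 0" if "F x = 0" "F y = 0" "pr x = x" "pr y = y" for x y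
    using that sing[of x y] sing[of y x] by (simp add: cub_simps)
  have tangent: "T z u = 0" if u: "F u = 0" "pr u = u" for u
  proof (rule ccontr)
    assume nz: "T z u \<noteq> 0"
    define t where "t = - T z u / F z"
    have t: "t * F z = - T z u" using z(1) by (simp add: t_def)
    have Tu: "T u z = 0" using sing[of u z] u z(2) by simp
    have "F (u [+] t [*] z) = t\<^sup>2 * (T z u + t * F z)"
      by (simp add: cub_simps u Tu algebra_simps power2_eq_square power3_eq_cube)
    then have "F (u [+] t [*] z) = 0" by (simp add: t)
    then have "T (u [+] t [*] z) z = 0" using sing[of "u [+] t [*] z" z] u z(2) by (simp add: pr(1,2,4))
    moreover have "T (u [+] t [*] z) z = 2 * t * T z u + 3 * t * (t * F z)"
      using cubD_same(2)[of N cE z u] by (simp add: cub_simps Tu cubD_commute(2)[of N cE u z z] cubD_same algebra_simps power2_eq_square)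
    ultimately have "t * T z u = 0" unfolding t by (simp add: algebra_simps)
    then show False using nz z(1) by (simp add: t_def)
  qed
  have decomp: "\<exists>k. F (v [+] (- k) [*] z) = 0" for v
  proof -
    have "\<exists>k. poly [:F v, - T v z, T z v, - F z:] k = 0"
      by (rule alg_closed_imp_poly_has_root) (use z(1) in simp)
    moreover have "poly [:F v, - T v z, T z v, - F z:] k = F (v [+] (- k) [*] z)" for k
      by (simp add: cub_simps algebra_simps power2_eq_square power3_eq_cube)
    ultimately show ?thesis by auto
  qed
  have "\<exists>a :: 'k. F (pr (unit i) [+] (- to_ac a) [*] z) = 0" for i
  proof -
    obtain v where v: "pr (unit i) = hv v" using prk by blast
    obtain k where k: "F (hv v [+] (- k) [*] z) = 0" using decomp by blast
    define u where "u = hv v [+] (- k) [*] z"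
    have u: "F u = 0" "pr u = u" using k v pr(4)[of "unit i"] z(2) by (simp_all add: u_def pr(1,2))
    have vu: "hv v = u [+] k [*] z" by (simp add: u_def fun_eq_iff)
    have "T u z = 0" using sing[of u z] u z(2) by simp
    then have Fv: "F (hv v) = k ^ 3 * F z" unfolding vu by (simp add: cub_simps u tangent[OF u])
    have Tv: "T z (hv v) = 3 * F z * k" unfolding vu by (simp add: cub_simps tangent[OF u])
    have "kval k"
    proof (cases "(3 :: 'k) = 0")
      case False
      then have "(3 :: 'k alg_closure) \<noteq> 0" by (metis to_ac_eq_0_iff to_ac_numeral)
      then have "k = T z (hv v) / (3 * F z)" using Tv z(1) by simp
      then show ?thesis unfolding z(3) by (simp add: kval_divide kval_mult)
    next
      case True
      have "kval (k ^ 3)"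
      proof -
        have "k ^ 3 = F (hv v) / F z" using Fv z(1) by simp
        then show ?thesis unfolding z(3) by (simp add: kval_divide)
      qed
      then obtain r where r: "k ^ 3 = to_ac r" unfolding kval_def by blast
      obtain y where y: "y ^ 3 = r" using perfect_cube_root[OF perf True] by blast
      have 3: "(3 :: 'k alg_closure) = 0" using arg_cong[OF True, of to_ac] by simp
      have "(k - to_ac y) ^ 3 = k ^ 3 - to_ac y ^ 3 - 3 * (k * to_ac y * (k - to_ac y))"
        by (simp add: power3_eq_cube algebra_simps)
      also have "\<dots> = 0" by (simp add: 3 r flip: y)
      finally have "k = to_ac y" by simp
      then show ?thesis by simp
    qed
    then obtain r where "k = to_ac r" unfolding kval_def by blast
    then show ?thesis by (intro exI[of _ r]) (use k v in simp)
  qed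
  then obtain a :: "nat \<Rightarrow> 'k" where a: "\<And>i. F (pr (unit i) [+] (- to_ac (a i)) [*] z) = 0" by metis
  define w where "w x = (\<Sum>i<N. x i * to_ac (a i))" for x
  have "klin w" unfolding klin_def w_def by blast
  have wu: "w (unit i) = to_ac (a i)" if "i < N" for i
  proof -
    have "w (unit i) = (\<Sum>j<N. if j = i then to_ac (a i) else 0)" unfolding w_def by (intro sum.cong refl) (simp add: unit_def)
    then show ?thesis using that by simp
  qed
  have F0: "F (pr x [+] (- w x) [*] z) = 0" for x
  proof (rule vec_induct[where N = N and P = "\<lambda>x. F (pr x [+] (- w x) [*] z) = 0"])
    show "F (pr y [+] (- w y) [*] z) = 0" if xy: "\<And>i. i < N \<Longrightarrow> x i = y i" "F (pr x [+] (- w x) [*] z) = 0" for x y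
    proof -
      have "F (pr (x [+] (- w x) [*] z)) = F (pr (y [+] (- w y) [*] z))"
        by (rule pr(3)) (use xy(1) klin_cong[OF \<open>klin w\<close> xy(1)] in simp)
      then show ?thesis using xy(2) by (simp add: pr(1,2,4) z(2))
    qed
    have pr0: "pr (\<lambda>_. 0) = (\<lambda>_. 0)" using pr(2)[of 0 "\<lambda>_. 0"] by (simp add: vscale_def)
    have "pr (\<lambda>_. 0) [+] (- w (\<lambda>_. 0)) [*] z = (\<lambda>_. 0)" by (simp add: pr0 w_def fun_eq_iff)
    then show "F (pr (\<lambda>_. 0) [+] (- w (\<lambda>_. 0)) [*] z) = 0" by simp
    show "F (pr (x [+] r [*] unit i) [+] (- w (x [+] r [*] unit i)) [*] z) = 0"
      if i: "i < N" "F (pr x [+] (- w x) [*] z) = 0" for x i r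
    proof -
      have eq: "pr (x [+] r [*] unit i) [+] (- w (x [+] r [*] unit i)) [*] z =
        (pr x [+] (- w x) [*] z) [+] r [*] (pr (unit i) [+] (- to_ac (a i)) [*] z)"
        by (simp add: pr(1,2,4) klin_add[OF \<open>klin w\<close>] klin_scale[OF \<open>klin w\<close>] wu[OF i(1)] fun_eq_iff algebra_simps)
      show ?thesis unfolding eq by (rule add) (use i(2) a in \<open>simp_all add: pr(1,2,4) z(2) cub_scale\<close>)
    qed
  qed
  have "F (pr x) = 0" if "w x = 0" for x
  proof -
    have "pr x [+] (- w x) [*] z = pr x" using that by (simp add: fun_eq_iff)
    then show ?thesis using F0[of x] by simp
  qed
  then show ?thesis using \<open>klin w\<close> by blast
qed

end

context irreducible_cubic
begin

lemma klin_hvD: "klin (\<lambda>x. D x (hv u) (hv v))"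
proof -
  have "(\<lambda>x. D x (hv u) (hv v)) = D (hv u) (hv v)" by (simp add: fun_eq_iff cubD_def)
  then show ?thesis using klin_D by metis
qed

text \<open>F is nonzero at some point of the tangent hyperplane while \<open>Q_p\<close> vanishes
  on all of it, so F is no multiple of \<open>Q_p\<close> there.\<close>

lemma unirational_if_vanishing_polar:
  assumes p: "smooth_pt p" and I: "\<And>y. T (hv p) y = 0 \<Longrightarrow> T y (hv p) = 0" and y0: "T y\<^sub>0 (hv p) \<noteq> 0"
    and s: "F s = 0" "good N cE s"
  shows "unirational N f"
proof -
  obtain x where x: "T (hv p) x \<noteq> 0" using smooth_ptD(2)[OF p] by blast
  obtain y where y: "T (hv p) y = 0" "F y \<noteq> 0" by (rule F_nonzero_on_klin[OF klin_T x])
  have "\<exists>y. T (hv p) y = 0 \<and> F y \<noteq> meval id y b * T y (hv p)" for b :: "'k alg_closure mpoly"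
    by (intro exI[of _ y]) (simp add: y I)
  then show ?thesis
    using p discriminant_nonzero[OF p y0] s unfolding smooth_pt_def by (intro unirational_if_good) auto
qed

context
  assumes perf: "perfect_field TYPE('k)"
    and noncone: "\<And>s. F (hv s) = 0 \<Longrightarrow> (\<And>y. T (hv s) y = 0) \<Longrightarrow> \<exists>i<N. s i \<noteq> 0 \<Longrightarrow> \<exists>x. T x (hv s) \<noteq> 0"
begin

lemma point_cases:
  assumes p: "smooth_pt p" and s: "F (hv s) = 0" "\<exists>i<N. s i \<noteq> 0"
  shows "unirational N f \<or> smooth_pt s"
proof (cases "\<exists>y. T (hv s) y \<noteq> 0")
  case True
  then show ?thesis using smooth_ptI s(1) by blast
next
  case False
  then have 0: "T (hv s) y = 0" for y by blast
  from noncone[OF s(1) 0 s(2)] show ?thesis using unirational_if_singular[OF p s(1) 0] by blast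
qed

text \<open>With \<open>T(p, e) = 1\<close> the line through p and e has residual points e + x p
  with x^2 + m x + q = 0. They, or points constructed from them, are tested for goodness; each
  failure forces F to vanish on a hyperplane section of the tangent hyperplane.\<close>

lemma vanishing_polar_cases:
  assumes p: "smooth_pt p" and I: "\<And>y. T (hv p) y = 0 \<Longrightarrow> T y (hv p) = 0"
  shows "unirational N f \<or> contains_plane"
proof (cases "\<exists>y\<^sub>0. T y\<^sub>0 (hv p) \<noteq> 0")
  case False
  then show ?thesis using unirational_if_char_2_point[OF p perf] by blast
next
  case True
  then obtain y\<^sub>0 where y0: "T y\<^sub>0 (hv p) \<noteq> 0" by blast
  have W: "unirational N f" if "F s = 0" "good N cE s" for s
    by (rule unirational_if_vanishing_polar[OF p I y0 that])
  define P where "P = hv p"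
  have FP: "F P = 0" using smooth_ptD(1)[OF p] by (simp add: P_def)
  have TPP: "T P P = 0" by (simp add: cubT_same FP)
  note I = I[folded P_def]
  obtain i where i: "T P (unit i) \<noteq> 0" using p unfolding smooth_pt_def P_def T_hv_unit by auto
  define e' where "e' = inverse (cubT N c p (unit i)) [*] unit i"
  define e where "e = hv e'"
  have l_e: "T P e = 1" using i unfolding e_def e'_def hv_simps P_def T_hv_unit by (simp add: cub_simps T_hv_unit)
  define m where "m = T e P"
  define q where "q = F e"
  have kv: "kval m" "kval q" by (simp_all add: m_def q_def e_def P_def)
  have klin_l: "klin (T P)" by (simp add: P_def klin_T)
  have DPe: "D P e P = 2" "D e P P = 2" "D P P e = 2" "D P e e = 2 * m" "D e P e = 2 * m" "D e e P = 2 * m"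
    by (simp_all add: cubD_same l_e m_def)
  \<comment> \<open>\<open>Q_p\<close> vanishes on the hyperplane \<open>T(p, -) = 0\<close>, hence
    is a product of two linear forms; the second factor comes from applying \<open>I\<close> to the
    projection of y along \<open>e\<close>.\<close>
  have Q: "T y P = T P y * (D y e P - T P y * m)" for y
  proof -
    have "T P (y [+] (- T P y) [*] e) = 0" by (simp add: cub_simps l_e)
    then have "T (y [+] (- T P y) [*] e) P = 0" by (rule I)
    then show ?thesis by (simp add: cub_simps m_def algebra_simps power2_eq_square)
  qed
  show ?thesis
  proof (cases "m\<^sup>2 = 4 * q")

    \<comment> \<open>A double residual point on the line through \<open>P\<close> and
      \<open>e\<close>\<close>
    case True
    have "\<exists>x. kval x \<and> 2 * x + m = 0 \<and> x\<^sup>2 + m * x + q = 0"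
    proof (cases "(2 :: 'k) = 0")
      case False
      then have 2: "(2 :: 'k alg_closure) \<noteq> 0" by (metis to_ac_eq_0_iff to_ac_numeral)
      define x where "x = - (m / 2)"
      have x: "2 * x = - m" using 2 by (simp add: x_def)
      have "4 * (x\<^sup>2 + m * x + q) = (2 * x)\<^sup>2 + 2 * m * (2 * x) + 4 * q" by (simp add: algebra_simps power2_eq_square)
      also have "\<dots> = 0" unfolding x True[symmetric] by (simp add: power2_eq_square)
      finally have "4 * (x\<^sup>2 + m * x + q) = 0" .
      moreover have "(4 :: 'k alg_closure) \<noteq> 0" using 2 by (metis mult_2 mult_eq_0_iff numeral_Bit0)
      ultimately have "x\<^sup>2 + m * x + q = 0" by (metis mult_eq_0_iff)
      moreover have "kval x" using kv by (simp add: x_def kval_divide kval_uminus)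
      ultimately show ?thesis using x by (intro exI[of _ x]) simp
    next
      assume char2: "(2 :: 'k) = 0"
      have two: "(2 :: 'k alg_closure) = 0" using arg_cong[OF char2, of to_ac] by simp
      have "(4 :: 'k alg_closure) = 2 * 2" by simp
      then have m: "m = 0" using True two by simp
      obtain q1 where q1: "q = to_ac q1" using kv(2) unfolding kval_def by blast
      obtain r where r: "r\<^sup>2 = q1" using perfect_sqrt[OF perf char2] by blast
      have "(to_ac r)\<^sup>2 + q = 2 * q" using r q1 by (simp flip: to_ac_power)
      then show ?thesis by (intro exI[of _ "to_ac r"]) (simp add: m two)
    qed
    then obtain x where x: "kval x" "2 * x + m = 0" "x\<^sup>2 + m * x + q = 0" by blast
    obtain x' where x': "x = to_ac x'" using x(1) unfolding kval_def by blast
    define s' where "s' = x' [*] p [+] e'"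
    define s where "s = hv s'"
    have s: "s = x [*] P [+] e" by (simp add: s_def s'_def x' hv_simps P_def e_def)
    have Fs: "F s = 0" using x(3) by (simp add: s cub_simps FP l_e m_def q_def algebra_simps power2_eq_square)
    have TPs: "T P s = 1" by (simp add: s cub_simps FP l_e)
    have TsP: "T s P = 0" using x(2) by (simp add: s cub_simps FP DPe l_e m_def[symmetric] algebra_simps)
    have "\<exists>i<N. s' i \<noteq> 0"
    proof (rule ccontr)
      assume "\<not> (\<exists>i<N. s' i \<noteq> 0)"
      then have "T P s = T P (\<lambda>_. 0)" by (intro cubT_cong) (auto simp: s_def hv_def)
      then show False by (simp add: TPs)
    qed
    then have "unirational N f \<or> smooth_pt s'" using point_cases[OF p] Fs by (simp add: s_def)
    then show ?thesis
    proof
      assume "smooth_pt s'"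
      then obtain y where y: "T s y \<noteq> 0" unfolding s_def using smooth_ptD(2) by blast
      show ?thesis
      proof (cases "\<exists>z. T P z = 0 \<and> T s z = 0 \<and> F z \<noteq> 0")
        case True
        then obtain z where z: "T P z = 0" "T s z = 0" "F z \<noteq> 0" by blast
        \<comment> \<open>Adding b P to \<open>z\<close> changes neither F nor the tangency at
          \<open>s\<close>, because \<open>T(P, z)\<close>, \<open>Q_p(z)\<close> and
          \<open>T(s, P)\<close> vanish; so b may be chosen to kill \<open>Q_s\<close>.\<close>
        have "\<exists>b. poly [:T z s, D z P s, 1:] b = 0"
          by (rule alg_closed_imp_poly_has_root) simp
        then obtain b where b: "poly [:T z s, D z P s, 1:] b = 0" by blast
        have "good N cE s"
        proof (rule C.good_if_tangent_zero[OF y])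
          show "T s (z [+] b [*] P) = 0" "T s P = 0" "T P s \<noteq> 0" by (simp_all add: cub_simps z TsP TPs)
          show "T (z [+] b [*] P) s = 0" using b by (simp add: cub_simps TPs algebra_simps power2_eq_square)
          show "F (z [+] b [*] P) \<noteq> 0" using z I[OF z(1)] by (simp add: cub_simps FP)
        qed
        then show ?thesis using W[OF Fs] by blast
      next
        case False
        then have F0: "F z = 0" if "T P z = 0" "T s z = 0" for z using that by blast
        have "klin (T s)" by (simp add: s_def klin_T)
        then have contains_plane
          unfolding contains_plane_def using klin_l l_e F0
          by (intro exI[of _ "T P"] exI[of _ "T s"] exI[of _ e]) simp
        then show ?thesis ..
      qed
    qed blast
  next

    \<comment> \<open>Two distinct residual points\<close>
    case False
    obtain x1 x2 where x: "x1 + x2 = - m" "x1 * x2 = q"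
    proof -
      have "\<exists>x. poly [:q, m, 1:] x = 0" by (rule alg_closed_imp_poly_has_root) simp
      then obtain x where x: "poly [:q, m, 1:] x = 0" by blast
      have "x * (- m - x) = q - poly [:q, m, 1:] x" by (simp add: algebra_simps)
      also have "\<dots> = q" by (simp only: x diff_0_right)
      finally have "x * (- m - x) = q" .
      then show ?thesis by (intro that[of x "- m - x"]) simp_all
    qed
    define d where "d = (x1 - x2)\<^sup>2"
    have m: "m = - (x1 + x2)" using x(1) by simp
    have d: "d = m\<^sup>2 - 4 * q" unfolding m x(2)[symmetric] d_def by (simp add: power2_eq_square algebra_simps)
    have d0: "d \<noteq> 0" using False d by simp
    define s1 where "s1 = x1 [*] P [+] e"
    define s2 where "s2 = x2 [*] P [+] e"
    have s1P: "T s1 P = x1 - x2" "T s2 P = x2 - x1"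
      by (simp_all add: s1_def s2_def cub_simps FP DPe l_e m_def[symmetric] m algebra_simps)
    have Fs: "F s1 = 0" "F s2 = 0"
      by (simp_all add: s1_def s2_def cub_simps FP l_e m_def[symmetric] q_def[symmetric] x(2)[symmetric] m algebra_simps power2_eq_square)
    have s12: "T s1 s2 = - d" "T s2 s1 = - d"
    proof -
      have "s1 [+] (x2 - x1) [*] P = s2" "s2 [+] (x1 - x2) [*] P = s1"
        by (simp_all add: s1_def s2_def fun_eq_iff algebra_simps)
      moreover have "T s1 (s1 [+] (x2 - x1) [*] P) = - d" "T s2 (s2 [+] (x1 - x2) [*] P) = - d"
        by (simp_all add: cub_simps Fs s1P d_def power2_eq_square algebra_simps)
      ultimately show "T s1 s2 = - d" "T s2 s1 = - d" by (simp_all only:)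
    qed
    \<comment> \<open>The common kernel of \<open>mm\<close> and \<open>nn\<close> is the
      intersection of the tangent hyperplanes at \<open>s1\<close> and \<open>s2\<close>, described
      by forms over k although the points may only be conjugate.\<close>
    define mm where "mm y = D y e P - T P y * m" for y
    define nn where "nn y = T e y - q * T P y" for y
    have klin_mm: "klin mm" and klin_nn: "klin nn"
      unfolding mm_def nn_def mult.commute[of _ m]
      by (intro klin_minus klin_times kv klin_l klin_hvD[of e' p, folded e_def P_def] klin_T[of e', folded e_def])+
    \<comment> \<open>Cramer's rule: \<open>mm\<close> and \<open>nn\<close> have the matrix (2, m;
      m, 2 q) on P, e, with determinant -d. Subtracting bb P + aa e projects onto the common
      kernel.\<close>
    define bb where "bb y = (1 / d) * (m * nn y - 2 * q * mm y)" for y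
    define aa where "aa y = (1 / d) * (m * mm y - 2 * nn y)" for y
    have kd: "kval d" unfolding d power2_eq_square by (intro kval_diff kval_mult kv kval_numeral)
    have klin_aa: "klin aa" and klin_bb: "klin bb"
      unfolding aa_def bb_def
      by (intro klin_times[OF _ kval_divide[OF kval_1 kd]] klin_minus klin_times klin_mm klin_nn kval_mult kval_numeral kv)+
    define pr where "pr y = y [+] (- bb y) [*] P [+] (- aa y) [*] e" for y
    note lin = klin_add[OF klin_aa] klin_add[OF klin_bb] klin_scale[OF klin_aa] klin_scale[OF klin_bb]
      klin_add[OF klin_mm] klin_add[OF klin_nn] klin_scale[OF klin_mm] klin_scale[OF klin_nn]
    have mP: "mm P = 2" "mm e = m" "nn P = m" "nn e = 2 * q"
      by (simp_all add: mm_def nn_def DPe FP l_e m_def[symmetric] cubT_same q_def[symmetric])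
    have mm0: "mm (pr y) = 0" and nn0: "nn (pr y) = 0" for y
    proof -
      have "d * mm (pr y) = d * mm y - 2 * (d * bb y) - m * (d * aa y)"
        "d * nn (pr y) = d * nn y - m * (d * bb y) - 2 * q * (d * aa y)"
        unfolding pr_def lin mP by (simp_all add: algebra_simps)
      moreover have "d * bb y = m * nn y - 2 * q * mm y" "d * aa y = m * mm y - 2 * nn y"
        using d0 by (simp_all add: aa_def bb_def)
      ultimately have "d * mm (pr y) = (d - (m\<^sup>2 - 4 * q)) * mm y" "d * nn (pr y) = (d - (m\<^sup>2 - 4 * q)) * nn y"
        by (simp_all add: algebra_simps power2_eq_square)
      then show "mm (pr y) = 0" "nn (pr y) = 0" using d0 d by simp_all
    qed
    have pr_id: "pr v = v" if "mm v = 0" "nn v = 0" for v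
      using that by (simp add: pr_def aa_def bb_def fun_eq_iff)
    have pr_add: "pr (y [+] z) = pr y [+] pr z" and pr_scale: "pr (r [*] y) = r [*] pr y" for y z r
      by (simp_all add: pr_def lin fun_eq_iff algebra_simps)
    have pr_pr: "pr (pr y) = pr y" for y by (rule pr_id[OF mm0 nn0])
    have prk: "\<exists>v. pr (hv u) = hv v" for u
    proof -
      obtain a b where ab: "aa (hv u) = to_ac a" "bb (hv u) = to_ac b"
        using klin_kval[OF klin_aa, of u] klin_kval[OF klin_bb, of u] unfolding kval_def by blast
      have "pr (hv u) = hv (u [+] (- b) [*] p [+] (- a) [*] e')"
        by (simp add: pr_def ab hv_simps P_def e_def)
      then show ?thesis by (intro exI[of _ "u [+] (- b) [*] p [+] (- a) [*] e'"])
    qed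
    have pr_cong: "pr x i = pr y i" if xy: "\<And>i. i < N \<Longrightarrow> x i = y i" and "i < N" for x y i
      using that klin_cong[OF klin_aa xy] klin_cong[OF klin_bb xy] by (simp add: pr_def)
    have DyPe: "D v P e = m * T P v" "D v e P = m * T P v" "D P v e = m * T P v" "D P e v = m * T P v" "D e P v = m * T P v" "D e v P = m * T P v"
      and Tev: "T e v = q * T P v" and TvP: "T v P = 0" if v: "pr v = v" for v
    proof -
      have 0: "mm v = 0" "nn v = 0" using mm0[of v] nn0[of v] unfolding v by simp_all
      show 1: "D v e P = m * T P v" using 0(1) by (simp add: mm_def)
      have "D v P e = D v e P" "D P v e = D v e P" "D P e v = D v e P" "D e P v = D v e P" "D e v P = D v e P" by (simp_all add: cubD_def)
      then show "D v P e = m * T P v" "D P v e = m * T P v" "D P e v = m * T P v" "D e P v = m * T P v" "D e v P = m * T P v" using 1 by simp_all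
      show "T e v = q * T P v" using 0(2) by (simp add: nn_def)
      show "T v P = 0" using Q[of v] 0(1) by (simp add: mm_def)
    qed
    have dec: "y = pr y [+] (bb y [*] P [+] aa y [*] e)" for y by (simp add: pr_def fun_eq_iff)
    \<comment> \<open>in the coordinates \<open>pr\<close>, \<open>aa\<close>, \<open>bb\<close> the tangent section at \<open>s1\<close> is \<open>F(v) + a T(v, e)\<close>\<close>
    have decF: "F y = F (pr y) + aa y * T (pr y) e + ((bb y)\<^sup>2 + m * aa y * bb y + q * (aa y)\<^sup>2) * T P y" for y
    proof -
      define v where "v = pr y"
      have v: "pr v = v" by (simp add: v_def pr_pr)
      have y: "y = v [+] (bb y [*] P [+] aa y [*] e)" unfolding v_def by (rule dec)
      have TPy: "T P y = T P v + aa y" by (subst y) (simp add: cub_simps FP l_e)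
      have "F (v [+] (b [*] P [+] a [*] e)) = F v + a * T v e + (b\<^sup>2 + m * a * b + q * a\<^sup>2) * (T P v + a)" for a b
        by (simp add: cub_simps FP l_e m_def[symmetric] q_def[symmetric] DyPe[OF v] Tev[OF v] TvP[OF v] algebra_simps power2_eq_square power3_eq_cube)
      from this[of "bb y" "aa y"] show ?thesis unfolding y[symmetric] TPy v_def[symmetric] .
    qed
    have Ts: "T s1 v = 0" "T s2 v = 0" "T v s1 = T v e" "T v s2 = T v e" "D v s1 s2 = - d * T P v" if v: "pr v = v" for v
    proof -
      show "T s1 v = 0" "T s2 v = 0" by (simp_all add: s1_def s2_def cub_simps DyPe[OF v] Tev[OF v] x(2)[symmetric] m algebra_simps power2_eq_square)
      show "T v s1 = T v e" "T v s2 = T v e" by (simp_all add: s1_def s2_def cub_simps TvP[OF v])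
      show "D v s1 s2 = - d * T P v"
        by (simp add: s1_def s2_def cub_simps DyPe[OF v] Tev[OF v] x(2)[symmetric] d_def m algebra_simps power2_eq_square)
    qed
    show ?thesis
    proof (cases "\<exists>v. pr v = v \<and> T v e \<noteq> 0")
      case True
      obtain z' where z': "T (pr (hv z')) e \<noteq> 0"
      proof (rule ccontr)
        assume neg: "\<not> thesis"
        have 0: "T (pr (hv z)) e = 0" for z using neg that by blast
        have "T (pr v) e = 0" for v
        proof (rule quadratic_form_zero_test[where q = "\<lambda>x. T (pr x) e" and B = "\<lambda>x y. D (pr x) (pr y) e" and N = N])
          show "T (pr x) e = T (pr y) e" if "\<And>i. i < N \<Longrightarrow> x i = y i" for x y
            by (rule cubT_cong) (use pr_cong[OF that] in simp_all)
          show "T (pr (unit j)) e = 0" "T (pr (unit i [+] unit j)) e = 0" for i j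
            using 0[of "unit j"] 0[of "unit i [+] unit j"] by (simp_all only: hv_simps)
          show "D (pr x) (pr y) e = D (pr y) (pr x) e" for x y by (rule cubD_commute)
        qed (simp_all add: pr_add pr_scale cub_simps)
        then have *: "T (pr v) e = 0" for v .
        obtain v where "pr v = v" "T v e \<noteq> 0" using True by (elim exE conjE)
        then show False using *[of v] by simp
      qed
      obtain z'' where z'': "pr (hv z') = hv z''" using prk by blast
      define z where "z = hv z''"
      have z: "pr z = z" "T z e \<noteq> 0" using z' z'' pr_pr[of "hv z'"] by (simp_all add: z_def)
      define r where "r = T z e"
      \<comment> \<open>The linear form forced by the certificate with \<open>z\<close> if F is to
        be a multiple of \<open>T(-, e)\<close> on the kernel; there \<open>T(-, e)\<close> equals
        the quadric of \<open>s1\<close>.\<close>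
      define w where "w x = (1 / r\<^sup>2) * (r * T z x - F z * D x z e)" for x
      have "kval r" by (simp add: r_def z_def e_def)
      have "klin w"
        unfolding w_def power2_eq_square
        by (intro klin_minus klin_times kval_divide kval_mult kval_1 \<open>kval r\<close> klin_T[of z'', folded z_def]
            klin_hvD[of z'' e', folded z_def e_def] kval_F[of z'', folded z_def])
      show ?thesis
      proof (cases "\<exists>v. pr v = v \<and> F v \<noteq> w v * T v e")
        case True
        then obtain v where v: "pr v = v" "F v \<noteq> w v * T v e" by blast
        have "D v z s1 = D v z e"
        proof -
          have "T (v [+] z) s1 = T (v [+] z) e" using Ts(3)[of "v [+] z"] v z by (simp add: pr_add)
          then show ?thesis using Ts(3)[OF v(1)] Ts(3)[OF z(1)] by (simp add: cub_simps)
        qed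
        then have "cert N cE s1 v z = r * (r\<^sup>2 * (F v - w v * T v e))"
          using z(2) by (simp add: cert_def Ts[OF z(1)] Ts[OF v(1)] r_def[symmetric] w_def field_simps power2_eq_square)
        then have "cert N cE s1 v z \<noteq> 0" using v(2) z(2) by (simp add: r_def)
        then have "good N cE s1" unfolding good_def using s12(1) d0 Ts(1)[OF v(1)] Ts(1)[OF z(1)] by (metis neg_equal_0_iff_equal)
        then show ?thesis using W Fs(1) by blast
      next
        case False
        then have "\<forall>v. pr v = v \<longrightarrow> F v = w v * T v e"
          by (simp only: not_ex de_Morgan_conj not_not imp_conv_disj simp_thms)
        then have Fw: "F (pr v) = w (pr v) * T (pr v) e" for v by (elim allE[of _ "pr v"] impE) (rule pr_pr)
        have wpr: "w (pr y) = w y - w P * bb y - w e * aa y" for y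
          by (simp add: pr_def klin_add[OF \<open>klin w\<close>] klin_scale[OF \<open>klin w\<close>])
        \<comment> \<open>By \<open>decF\<close>, on \<open>T(P, y) = 0\<close> the cubic is F(v) +
          aa(y) T(v, e) with v = pr y, so it has the linear factor w(v) + aa(y).\<close>
        have "klin (\<lambda>y. w y - w P * bb y - w e * aa y + aa y)"
          using klin_kval[OF \<open>klin w\<close>, of p] klin_kval[OF \<open>klin w\<close>, of e']
          by (intro klin_plus klin_minus klin_times klin_aa klin_bb \<open>klin w\<close>) (simp_all add: P_def e_def)
        moreover have "F y = 0" if "T P y = 0" "w y - w P * bb y - w e * aa y + aa y = 0" for y
        proof -
          have "F y = (w y - w P * bb y - w e * aa y + aa y) * T (pr y) e"
            unfolding decF[of y] Fw wpr that(1) by (simp add: algebra_simps)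
          then show ?thesis using that(2) by simp
        qed
        ultimately have contains_plane
          unfolding contains_plane_def using klin_l l_e
          by (intro exI[of _ "T P"] exI[of _ "\<lambda>y. w y - w P * bb y - w e * aa y + aa y"] exI[of _ e]) simp
        then show ?thesis ..
      qed
    next
      case False
      then have rho: "T v e = 0" if "pr v = v" for v using that by blast
      show ?thesis
      proof (cases "\<exists>v w. pr v = v \<and> pr w = w \<and> F v = 0 \<and> T v w \<noteq> 0")
        case True
        then obtain v w where vw: "pr v = v" "pr w = w" "F v = 0" "T v w \<noteq> 0" by blast
        have "pr (v [+] w) = v [+] w" using vw by (simp add: pr_add)
        note Ts' = Ts(3,4)[OF this, unfolded rho[OF this]]
        have D0: "D v w s1 = 0" "D v w s2 = 0"
          using Ts' Ts(3,4)[OF vw(1)] Ts(3,4)[OF vw(2)] rho[OF vw(1)] rho[OF vw(2)] by (simp_all add: cub_simps)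
        have "\<exists>s. F s = 0 \<and> good N cE s"
          using C.good_if_simple_zero[OF Fs s12 d0 Ts(1,2)[OF vw(1)] _ _ Ts(5)[OF vw(1)] Ts(1,2)[OF vw(2)] _ _ Ts(5)[OF vw(2)] D0 vw(3,4)]
            Ts(3,4)[OF vw(1)] Ts(3,4)[OF vw(2)] rho[OF vw(1)] rho[OF vw(2)] by simp
        then show ?thesis using W by blast
      next
        case False
        have "\<exists>w. klin w \<and> (\<forall>x. w x = 0 \<longrightarrow> F (pr x) = 0)"
        proof (rule zeros_linear_if_no_simple_zero[OF perf pr_add pr_scale _ pr_pr])
          show "F (pr x) = F (pr y)" if "\<And>i. i < N \<Longrightarrow> x i = y i" for x y
            by (rule cub_cong) (rule pr_cong[OF that])
          show "\<exists>u. pr (unit i) = hv u" for i using prk[of "unit i"] by (simp add: hv_simps)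
          show "T (pr x) (pr y) = 0" if "F (pr x) = 0" for x y using False that pr_pr by blast
        qed
        then obtain w where w: "klin w" "\<And>x. w x = 0 \<Longrightarrow> F (pr x) = 0" by blast
        have "F y = 0" if "T P y = 0" "w y = 0" for y
          unfolding decF[of y] rho[OF pr_pr] using that w(2) by simp
        then have contains_plane
          unfolding contains_plane_def using klin_l l_e w(1)
          by (intro exI[of _ "T P"] exI[of _ w] exI[of _ e]) simp
        then show ?thesis ..
      qed
    qed
  qed
qed

end

end

lemma cubD_cong:
  assumes "\<And>i. i < N \<Longrightarrow> x i = x' i" "\<And>i. i < N \<Longrightarrow> y i = y' i" "\<And>i. i < N \<Longrightarrow> z i = z' i"
  shows "cubD N c x y z = cubD N c x' y' z'"
  unfolding cubD_def using assms by (intro arg_cong2[of _ _ _ _ "(+)"] trilin_cong) auto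

section \<open>Cubics containing a linear subspace of codimension 2\<close>

text \<open>The vectors \<open>e\<^sub>1\<close>, \<open>e\<^sub>2\<close> span a rational
  complement of the subspace. A singular rational point of the subspace violates
  \<open>nosing\<close>; it gives a parametrization by itself and is treated before entering the
  locale.\<close>

locale cubic_with_plane = irreducible_cubic N f for N and f :: "'k :: field mpoly" +
  fixes l\<^sub>1 l\<^sub>2 :: "(nat \<Rightarrow> 'k alg_closure) \<Rightarrow> 'k alg_closure" and e\<^sub>1 e\<^sub>2 p :: "nat \<Rightarrow> 'k"
  assumes klin: "klin l\<^sub>1" "klin l\<^sub>2"
    and dual: "l\<^sub>1 (hv e\<^sub>1) = 1" "l\<^sub>1 (hv e\<^sub>2) = 0" "l\<^sub>2 (hv e\<^sub>1) = 0" "l\<^sub>2 (hv e\<^sub>2) = 1"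
    and vanish: "l\<^sub>1 x = 0 \<Longrightarrow> l\<^sub>2 x = 0 \<Longrightarrow> F x = 0"
    and smooth: "smooth_pt p"
    and nosing: "l\<^sub>1 (hv u) = 0 \<Longrightarrow> l\<^sub>2 (hv u) = 0 \<Longrightarrow> (\<And>y. T (hv u) y = 0) \<Longrightarrow> i < N \<Longrightarrow> u i = 0"
begin

definition Lam where "Lam x \<longleftrightarrow> l\<^sub>1 x = 0 \<and> l\<^sub>2 x = 0"
definition E\<^sub>1 where "E\<^sub>1 = hv e\<^sub>1"
definition E\<^sub>2 where "E\<^sub>2 = hv e\<^sub>2"
definition pr where "pr x = x [+] (- l\<^sub>1 x) [*] E\<^sub>1 [+] (- l\<^sub>2 x) [*] E\<^sub>2"

lemmas lin = klin_add[OF klin(1)] klin_add[OF klin(2)] klin_scale[OF klin(1)] klin_scale[OF klin(2)]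
lemmas dualE = dual[folded E\<^sub>1_def E\<^sub>2_def]

lemma Lam_pr: "Lam (pr x)" by (simp add: Lam_def pr_def lin dualE)
lemma Lam_add: "Lam x \<Longrightarrow> Lam y \<Longrightarrow> Lam (x [+] y)" and Lam_scale: "Lam x \<Longrightarrow> Lam (r [*] x)"
  by (simp_all add: Lam_def lin)
lemma pr_Lam: "Lam x \<Longrightarrow> pr x = x" by (simp add: pr_def Lam_def fun_eq_iff)
lemma pr_add: "pr (x [+] y) = pr x [+] pr y" and pr_scale: "pr (r [*] x) = r [*] pr x"
  by (simp_all add: pr_def lin fun_eq_iff algebra_simps)
lemma pr_dec: "x = pr x [+] (l\<^sub>1 x [*] E\<^sub>1 [+] l\<^sub>2 x [*] E\<^sub>2)" by (simp add: pr_def fun_eq_iff)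

lemma F_Lam: "Lam u \<Longrightarrow> F u = 0" by (simp add: Lam_def vanish)

lemma T_Lam:
  assumes "Lam u" "Lam v"
  shows "T u v = 0"
proof -
  have "poly [:0, T u v, T v u:] t = 0" for t
    using F_Lam[OF Lam_add[OF assms(1) Lam_scale[OF assms(2)]], of t] F_Lam[OF assms(1)] F_Lam[OF assms(2)]
    by (simp add: cub_simps algebra_simps power2_eq_square)
  then have "[:0, T u v, T v u:] = 0" by (rule poly_eq_0_if_zero)
  then show ?thesis by simp
qed

lemma D_Lam: "Lam u \<Longrightarrow> Lam v \<Longrightarrow> Lam w \<Longrightarrow> D u v w = 0"
  using T_Lam[of "u [+] v" w] T_Lam[of u w] T_Lam[of v w] Lam_add[of u v] by (simp add: cub_simps)

text \<open>The tangent hyperplane at a point of the subspace contains the subspace, so it belongs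
  to the pencil spanned by \<open>l\<^sub>1\<close> and \<open>l\<^sub>2\<close>.\<close>

lemma T_Lam_left: "Lam u \<Longrightarrow> T u x = l\<^sub>1 x * T u E\<^sub>1 + l\<^sub>2 x * T u E\<^sub>2"
  by (subst pr_dec[of x]) (simp add: cub_simps T_Lam Lam_pr)

lemma D_Lam_left: "Lam u \<Longrightarrow> Lam v \<Longrightarrow> D u v x = l\<^sub>1 x * D u v E\<^sub>1 + l\<^sub>2 x * D u v E\<^sub>2"
  by (subst pr_dec[of x]) (simp add: cub_simps D_Lam Lam_pr)


context
  fixes u\<^sub>0 u\<^sub>1 :: "nat \<Rightarrow> 'k"
  assumes u: "Lam (hv u\<^sub>0)" "Lam (hv u\<^sub>1)"
    and M: "\<not> (D (hv u\<^sub>0) (hv u\<^sub>1) E\<^sub>1 * T (hv u\<^sub>1) E\<^sub>2 = D (hv u\<^sub>0) (hv u\<^sub>1) E\<^sub>2 * T (hv u\<^sub>1) E\<^sub>1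
      \<and> T (hv u\<^sub>1) E\<^sub>1 * T (hv u\<^sub>0) E\<^sub>2 = T (hv u\<^sub>1) E\<^sub>2 * T (hv u\<^sub>0) E\<^sub>1
      \<and> T (hv u\<^sub>0) E\<^sub>1 * D (hv u\<^sub>0) (hv u\<^sub>1) E\<^sub>2 = T (hv u\<^sub>0) E\<^sub>2 * D (hv u\<^sub>0) (hv u\<^sub>1) E\<^sub>1)"
begin

text \<open>Along this line the values of \<open>T(pt a b)\<close> on \<open>E\<^sub>1\<close> and
  \<open>E\<^sub>2\<close> are two binary quadratic forms; the assumption \<open>M\<close> says that
  their 2 x 3 coefficient matrix has rank 2.\<close>

definition pt where "pt a b = a [*] hv u\<^sub>0 [+] b [*] hv u\<^sub>1"

lemma Lam_pt: "Lam (pt a b)" unfolding pt_def by (intro Lam_add Lam_scale u)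

lemma T_pt: "T (pt a b) x = a\<^sup>2 * T (hv u\<^sub>0) x + a * b * D (hv u\<^sub>0) (hv u\<^sub>1) x + b\<^sup>2 * T (hv u\<^sub>1) x"
  by (simp add: pt_def cub_simps algebra_simps)

text \<open>Elimination makes a common zero with \<open>a \<noteq> 0\<close> proportional to the
  minors (M1, M2), hence rational. Then \<open>nosing\<close> makes that vector zero, and the
  relation between \<open>u\<^sub>0\<close> and \<open>u\<^sub>1\<close> kills the minors.\<close>

lemma no_common_zero:
  assumes z: "T (pt a b) E\<^sub>1 = 0" "T (pt a b) E\<^sub>2 = 0"
  shows "a = 0 \<and> b = 0"
proof -
  define \<alpha> \<beta> \<gamma> where "\<alpha> = T (hv u\<^sub>0)" and "\<beta> = D (hv u\<^sub>0) (hv u\<^sub>1)" and "\<gamma> = T (hv u\<^sub>1)"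
  define M1 M2 M3 where "M1 = \<beta> E\<^sub>1 * \<gamma> E\<^sub>2 - \<beta> E\<^sub>2 * \<gamma> E\<^sub>1" and "M2 = \<gamma> E\<^sub>1 * \<alpha> E\<^sub>2 - \<gamma> E\<^sub>2 * \<alpha> E\<^sub>1"
    and "M3 = \<alpha> E\<^sub>1 * \<beta> E\<^sub>2 - \<alpha> E\<^sub>2 * \<beta> E\<^sub>1"
  have M0: "\<not> (M1 = 0 \<and> M2 = 0 \<and> M3 = 0)" using M by (auto simp: M1_def M2_def M3_def \<alpha>_def \<beta>_def \<gamma>_def)
  have z: "a\<^sup>2 * \<alpha> E\<^sub>1 + a * b * \<beta> E\<^sub>1 + b\<^sup>2 * \<gamma> E\<^sub>1 = 0" "a\<^sup>2 * \<alpha> E\<^sub>2 + a * b * \<beta> E\<^sub>2 + b\<^sup>2 * \<gamma> E\<^sub>2 = 0"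
    using z by (simp_all add: T_pt \<alpha>_def \<beta>_def \<gamma>_def)
  have *: "a\<^sup>2 * M2 = a * b * M1" "a\<^sup>2 * M3 = b\<^sup>2 * M1" "a * b * M3 = b\<^sup>2 * M2"
  proof -
    have "a\<^sup>2 * M2 - a * b * M1 = \<gamma> E\<^sub>1 * (a\<^sup>2 * \<alpha> E\<^sub>2 + a * b * \<beta> E\<^sub>2 + b\<^sup>2 * \<gamma> E\<^sub>2) - \<gamma> E\<^sub>2 * (a\<^sup>2 * \<alpha> E\<^sub>1 + a * b * \<beta> E\<^sub>1 + b\<^sup>2 * \<gamma> E\<^sub>1)"
      "b\<^sup>2 * M1 - a\<^sup>2 * M3 = \<beta> E\<^sub>1 * (a\<^sup>2 * \<alpha> E\<^sub>2 + a * b * \<beta> E\<^sub>2 + b\<^sup>2 * \<gamma> E\<^sub>2) - \<beta> E\<^sub>2 * (a\<^sup>2 * \<alpha> E\<^sub>1 + a * b * \<beta> E\<^sub>1 + b\<^sup>2 * \<gamma> E\<^sub>1)"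
      "a * b * M3 - b\<^sup>2 * M2 = \<alpha> E\<^sub>1 * (a\<^sup>2 * \<alpha> E\<^sub>2 + a * b * \<beta> E\<^sub>2 + b\<^sup>2 * \<gamma> E\<^sub>2) - \<alpha> E\<^sub>2 * (a\<^sup>2 * \<alpha> E\<^sub>1 + a * b * \<beta> E\<^sub>1 + b\<^sup>2 * \<gamma> E\<^sub>1)"
      by (simp_all add: M1_def M2_def M3_def algebra_simps)
    then show "a\<^sup>2 * M2 = a * b * M1" "a\<^sup>2 * M3 = b\<^sup>2 * M1" "a * b * M3 = b\<^sup>2 * M2" unfolding z by simp_all
  qed
  have kv: "kval M1" "kval M2" unfolding M1_def M2_def \<alpha>_def \<beta>_def \<gamma>_def E\<^sub>1_def E\<^sub>2_def by (intro kval_diff kval_mult kval_T kval_D)+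
  have zero: "hv v i = (\<lambda>_. 0) i" if "Lam (hv v)" "T (hv v) E\<^sub>1 = 0" "T (hv v) E\<^sub>2 = 0" "i < N" for v i
  proof -
    have "T (hv v) y = 0" for y using that T_Lam_left[of "hv v" y] by simp
    then show ?thesis using nosing[of v i] that(1,4) unfolding Lam_def by (simp add: hv_def)
  qed
  show ?thesis
  proof (cases "a = 0")
    case True
    show ?thesis
    proof (rule ccontr)
      assume "\<not> ?thesis"
      then have b: "b \<noteq> 0" using True by simp
      have m: "M1 = 0" "M2 = 0" using * b True by simp_all
      have "\<gamma> E\<^sub>1 = 0" "\<gamma> E\<^sub>2 = 0" using z b True by simp_all
      then have 0: "hv u\<^sub>1 i = (\<lambda>_. 0) i" if "i < N" for i using zero[OF u(2)] that by (simp add: \<gamma>_def)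
      have "\<beta> x = 0" for x unfolding \<beta>_def
        using cubD_cong[of N "hv u\<^sub>0" "hv u\<^sub>0" "hv u\<^sub>1" "\<lambda>_. 0" x x cE] 0 by simp
      then show False using M0 m by (simp add: M3_def)
    qed
  next
    case a: False
    have "M1 \<noteq> 0" using * a M0 by auto
    obtain m1 m2 where m: "M1 = to_ac m1" "M2 = to_ac m2" using kv unfolding kval_def by blast
    define v where "v = m1 [*] u\<^sub>0 [+] m2 [*] u\<^sub>1"
    have v: "hv v = M1 [*] hv u\<^sub>0 [+] M2 [*] hv u\<^sub>1" by (simp add: v_def hv_simps m)
    have vpt: "hv v = pt M1 M2" by (simp add: v pt_def)
    have aM: "a * M2 = b * M1" using *(1) a by (simp add: power2_eq_square)
    have T0: "T (hv v) E\<^sub>1 = 0" "T (hv v) E\<^sub>2 = 0"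
    proof -
      have "a\<^sup>2 * T (hv v) x = (a * M1)\<^sup>2 * \<alpha> x + (a * M1) * (a * M2) * \<beta> x + (a * M2)\<^sup>2 * \<gamma> x" for x
        by (simp add: vpt T_pt \<alpha>_def \<beta>_def \<gamma>_def algebra_simps power2_eq_square)
      also have "\<dots> x = M1\<^sup>2 * (a\<^sup>2 * \<alpha> x + a * b * \<beta> x + b\<^sup>2 * \<gamma> x)" for x
        unfolding aM by (simp add: algebra_simps power2_eq_square)
      finally show "T (hv v) E\<^sub>1 = 0" "T (hv v) E\<^sub>2 = 0" using z a by (metis mult_eq_0_iff mult_zero_right power_eq_0_iff)+
    qed
    have 0: "hv v i = (\<lambda>_. 0) i" if "i < N" for i
      by (rule zero[OF _ T0 that]) (simp add: vpt Lam_pt)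
    have "D (hv v) (hv u\<^sub>1) x = 0" for x
      using cubD_cong[of N "hv v" "\<lambda>_. 0" "hv u\<^sub>1" "hv u\<^sub>1" x x cE] 0 by simp
    then have "M1 * \<beta> x + M2 * (2 * \<gamma> x) = 0" for x
      unfolding v by (simp add: cub_simps \<beta>_def \<gamma>_def)
    then have "M1 * \<beta> E\<^sub>1 = - (M2 * (2 * \<gamma> E\<^sub>1))" "M1 * \<beta> E\<^sub>2 = - (M2 * (2 * \<gamma> E\<^sub>2))"
      by (simp_all only: eq_neg_iff_add_eq_0)
    moreover have "M1 * M1 = (M1 * \<beta> E\<^sub>1) * \<gamma> E\<^sub>2 - (M1 * \<beta> E\<^sub>2) * \<gamma> E\<^sub>1"
      by (subst (2) M1_def) (simp add: algebra_simps)
    ultimately have "M1 * M1 = 0" by (simp add: algebra_simps)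
    with \<open>M1 \<noteq> 0\<close> show ?thesis by simp
  qed
qed


text \<open>A point x of the cubic in the tangent hyperplane at \<open>pt a b\<close> is its own
  parameter: \<open>rho\<close> returns x up to the displayed scalar.\<close>

lemma conic_bundle_dominance:
  assumes dom: "\<And>a b z. g (C.rho (pt a b) (tproj N cE E\<^sub>1 (pt a b) z)) = 0"
    and g: "\<And>r x. g (r [*] x) = r ^ d * g x"
    and x: "F x = 0" "T (pt a b) x = 0"
  shows "g x * (T (pt a b) E\<^sub>1 * T x (pt a b)) = 0"
proof -
  define r where "r = T (pt a b) E\<^sub>1"
  have tp: "tproj N cE E\<^sub>1 (pt a b) x = r [*] x" by (simp add: tproj_def x r_def fun_eq_iff)
  have "C.rho (pt a b) (tproj N cE E\<^sub>1 (pt a b) x) = (r ^ 3 * T x (pt a b)) [*] x"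
    unfolding tp by (simp add: cub_rho_def cub_simps x fun_eq_iff power2_eq_square power3_eq_cube)
  with dom[of a b x] have "(r ^ 3 * T x (pt a b)) ^ d * g x = 0" by (simp add: g)
  then show ?thesis by (auto simp: r_def)
qed

text \<open>
  Every point \<open>x\<close> lies on the tangent hyperplanes of the two roots \<open>pt a b\<close> of a binary quadratic form, and
  is in the image of the parametrization unless \<open>T(x, pt a b) = 0\<close> for both roots. In characteristic 2
  the two roots can coincide for all \<open>x\<close>; then the exceptional set is \<open>W = 0\<close>, where \<open>W\<close> is invariant under
  translation by \<open>u\<^sub>0\<close>, so that \<open>W\<close> cannot vanish on the cubic without being zero.
\<close>

lemma unirational_if_independent:
  assumes perf: "perfect_field TYPE('k)"
  shows "unirational N f"
proof -
  define P where "P = T (hv u\<^sub>0)"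
  define C where "C = D (hv u\<^sub>0) (hv u\<^sub>1)"
  define Q where "Q = T (hv u\<^sub>1)"
  define L0 where "L0 = (\<lambda>x. T x (hv u\<^sub>0))"
  define L1 where "L1 = (\<lambda>x. T x (hv u\<^sub>1))"
  have T_pt': "T (pt a b) x = a\<^sup>2 * P x + a * b * C x + b\<^sup>2 * Q x" for a b x
    unfolding P_def C_def Q_def by (rule T_pt)
  have L_pt: "T x (pt a b) = a * L0 x + b * L1 x" for a b x by (simp add: pt_def cub_simps L0_def L1_def)
  have PE: "P x = l\<^sub>1 x * P E\<^sub>1 + l\<^sub>2 x * P E\<^sub>2" "Q x = l\<^sub>1 x * Q E\<^sub>1 + l\<^sub>2 x * Q E\<^sub>2" "C x = l\<^sub>1 x * C E\<^sub>1 + l\<^sub>2 x * C E\<^sub>2" for x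
    unfolding P_def Q_def C_def by (rule T_Lam_left[OF u(1)], rule T_Lam_left[OF u(2)], rule D_Lam_left[OF u])
  have M': "\<not> (C E\<^sub>1 * Q E\<^sub>2 = C E\<^sub>2 * Q E\<^sub>1 \<and> Q E\<^sub>1 * P E\<^sub>2 = Q E\<^sub>2 * P E\<^sub>1 \<and> P E\<^sub>1 * C E\<^sub>2 = P E\<^sub>2 * C E\<^sub>1)"
    unfolding P_def C_def Q_def by (rule M)
  have klinPQ: "klin P" "klin C" "klin Q" by (simp_all add: P_def C_def Q_def klin_T klin_D)
  define uM where "uM i = mvar 0 * mconst (u\<^sub>0 i) + mvar 1 * mconst (u\<^sub>1 i)" for i
  define zM :: "nat \<Rightarrow> 'k mpoly" where "zM i = mvar (i + 2)" for i
  define gM where "gM = cub_rho N (\<lambda>i j k. mconst (c i j k)) uM (tproj N (\<lambda>i j k. mconst (c i j k)) (\<lambda>i. mconst (e\<^sub>1 i)) uM zM)"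
  have uM: "(\<lambda>i. meval to_ac t (uM i)) = pt (t 0) (t 1)" for t
    by (simp add: uM_def pt_def hv_def fun_eq_iff a.meval_simps)
  have zM: "(\<lambda>i. meval to_ac t (zM i)) = (\<lambda>i. t (i + 2))" for t
    by (simp add: zM_def)
  have gM: "(\<lambda>i. meval to_ac t (gM i)) = C.rho (pt (t 0) (t 1)) (tproj N cE E\<^sub>1 (pt (t 0) (t 1)) (\<lambda>i. t (i + 2)))" for t
    unfolding gM_def hom_cub_rho[OF a.meval_hom] hom_tproj[OF a.meval_hom] uM zM hom_consts(1) hom_consts(2)[of t e\<^sub>1] E\<^sub>1_def ..
  have on: "meval to_ac (\<lambda>i. meval to_ac t (gM i)) f = 0" for t
    unfolding gM meval_f by (rule C.F_rho) (simp_all add: F_Lam Lam_pt)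
  have pt: "\<exists>x. (\<exists>i<N. x i \<noteq> 0) \<and> meval to_ac x f = 0" by (rule smooth_pt_geometric[OF smooth])
  show ?thesis
  proof (cases "\<forall>x. L0 x = 0")
    case True
    have "\<exists>y. T (hv u\<^sub>0) y \<noteq> 0"
    proof (rule ccontr)
      assume "\<nexists>y. T (hv u\<^sub>0) y \<noteq> 0"
      then have "T (pt 1 0) E\<^sub>1 = 0" "T (pt 1 0) E\<^sub>2 = 0" by (simp_all add: T_pt)
      then show False using no_common_zero[of 1 0] by simp
    qed
    then have "smooth_pt u\<^sub>0" using smooth_ptI F_Lam[OF u(1)] by blast
    then show ?thesis using unirational_if_char_2_point[OF _ perf] True unfolding L0_def by blast
  next
    case L0: False
    then obtain x\<^sub>0 where x0: "L0 x\<^sub>0 \<noteq> 0" by blast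
    have dom: "meval to_ac y G = 0"
      if G: "homogeneous d (G :: 'k mpoly)" "\<And>t. meval to_ac (\<lambda>i. meval to_ac t (gM i)) G = 0" and y: "meval to_ac y f = 0" for G d y
    proof -
      define g where "g = (\<lambda>x. meval to_ac x G)"
      have formg: "is_form d g" using is_form_homogeneous[OF G(1)] by (simp add: g_def)
      have g_scale: "g (r [*] x) = r ^ d * g x" for r x by (simp add: g_def meval_homogeneous[OF to_ac_hom G(1)])
      have g0: "g (C.rho (pt a b) (tproj N cE E\<^sub>1 (pt a b) z)) = 0" for a b z
      proof -
        define t where "t = (\<lambda>i :: nat. if i = 0 then a else if i = 1 then b else z (i - 2))"
        have t: "t 0 = a" "t 1 = b" "(\<lambda>i. t (i + 2)) = z" by (simp_all add: t_def)
        show ?thesis using G(2)[of t] unfolding gM t g_def .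
      qed
      note dom = conic_bundle_dominance[of g d, OF g0 g_scale]
      \<comment> \<open>If \<open>T(pt a b, E\<^sub>1)\<close> vanished with
        \<open>l\<^sub>2 x \<noteq> 0\<close>, the whole tangent form at \<open>pt a b\<close> would
        vanish, against \<open>no_common_zero\<close>; this is why the factor
        \<open>l\<^sub>2\<close> appears.\<close>
      have root: "g x * l\<^sub>2 x * (a * L0 x + b * L1 x) = 0"
        if x: "F x = 0" and ab: "a \<noteq> 0 \<or> b \<noteq> 0" "T (pt a b) x = 0" for x a b
      proof (cases "l\<^sub>2 x = 0")
        case False
        have "T (pt a b) E\<^sub>1 \<noteq> 0"
        proof
          assume 0: "T (pt a b) E\<^sub>1 = 0"
          have "T (pt a b) x = l\<^sub>1 x * T (pt a b) E\<^sub>1 + l\<^sub>2 x * T (pt a b) E\<^sub>2" by (rule T_Lam_left[OF Lam_pt])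
          then have "T (pt a b) E\<^sub>2 = 0" using 0 ab(2) False by simp
          then show False using no_common_zero[OF 0] ab(1) by blast
        qed
        then show ?thesis using dom[OF x ab(2)] by (auto simp: L_pt)
      qed simp
      have l2: "is_form 1 l\<^sub>2" by (rule is_form_klin[OF klin(2)])
      have finish: "g y = 0" if "\<And>x. F x = 0 \<Longrightarrow> g x * l\<^sub>2 x = 0"
        by (rule cancel_form[OF smooth formg l2 quad_L[OF klin(2)], of E\<^sub>2]) (use that dualE y in \<open>simp_all add: meval_f\<close>)
      have gl: "is_form (d + 1) (\<lambda>x. g x * l\<^sub>2 x)" by (rule is_form_mult[OF formg l2])
      define disc where "disc = (\<lambda>x. C x * C x + - 4 * (P x * Q x))"
      have "g y = 0"
      proof (cases "\<exists>x. disc x \<noteq> 0")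

        \<comment> \<open>Two distinct tangency points for general \<open>x\<close>\<close>
        case True
        then obtain x\<^sub>1 where x1: "disc x\<^sub>1 \<noteq> 0" by blast
        have fd: "is_form 2 disc"
        proof -
          have "is_form (0 + (1 + 1)) (\<lambda>x. - 4 * (P x * Q x))"
            by (intro is_form_mult is_form_const is_form_klin klinPQ) (simp add: kval_uminus)
          then have "is_form 2 (\<lambda>x. - 4 * (P x * Q x))" by (simp add: numeral_2_eq_2)
          moreover have "is_form (1 + 1) (\<lambda>x. C x * C x)" by (intro is_form_mult is_form_klin klinPQ)
          then have "is_form 2 (\<lambda>x. C x * C x)" by (simp add: numeral_2_eq_2)
          ultimately show ?thesis unfolding disc_def by (intro is_form_add)
        qed
        have fL0: "is_form 2 L0" unfolding L0_def by (rule is_form_Q)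
        have quadd: "\<exists>a b. \<forall>t. disc (y [+] t [*] w) = disc y + t * a + t\<^sup>2 * b" for y w
          by (intro exI[of _ "2 * C y * C w - 4 * (P y * Q w + P w * Q y)"] exI[of _ "disc w"])
            (simp add: disc_def klin_add[OF klinPQ(1)] klin_add[OF klinPQ(2)] klin_add[OF klinPQ(3)] klin_scale[OF klinPQ(1)] klin_scale[OF klinPQ(2)] klin_scale[OF klinPQ(3)] algebra_simps power2_eq_square)
        have all: "g x * l\<^sub>2 x * disc x * L0 x = 0" if x: "F x = 0" for x
        proof (cases "disc x = 0")
          case False
          have "\<exists>a b a' b'. T (pt a b) x = 0 \<and> T (pt a' b') x = 0 \<and> a * b' \<noteq> a' * b"
          proof (cases "P x = 0")
            case True
            then have "C x \<noteq> 0" using False by (auto simp: disc_def)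
            then show ?thesis
              by (intro exI[of _ 1] exI[of _ 0] exI[of _ "- Q x"] exI[of _ "C x"]) (simp add: T_pt' True algebra_simps power2_eq_square)
          next
            case P: False
            have "\<exists>r. poly [:Q x, C x, P x:] r = 0" by (rule alg_closed_imp_poly_has_root) (use P in simp)
            then obtain r where r: "poly [:Q x, C x, P x:] r = 0" by blast
            define s where "s = - r - C x / P x"
            have s: "P x * s = - P x * r - C x" using P by (simp add: s_def field_simps)
            have r': "Q x + r * (C x + r * P x) = 0" using r by simp
            have "P x * (Q x + s * (C x + s * P x)) = P x * Q x + (P x * s) * (C x + P x * s)" by (simp add: algebra_simps)
            also have "\<dots> = P x * (Q x + r * (C x + r * P x))" unfolding s by (simp add: algebra_simps)
            finally have s': "Q x + s * (C x + s * P x) = 0" using P r' by simp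
            have "r \<noteq> s"
            proof
              assume rs: "r = s"
              then have Cx: "C x = - 2 * P x * r" using s by (simp add: algebra_simps eq_neg_iff_add_eq_0)
              have "Q x = P x * r * r" using r' unfolding Cx by (simp add: algebra_simps)
              then show False using False unfolding disc_def Cx by (simp add: algebra_simps)
            qed
            then show ?thesis using r' s'
              by (intro exI[of _ r] exI[of _ 1] exI[of _ s] exI[of _ 1]) (simp add: T_pt' algebra_simps power2_eq_square)
          qed
          then obtain a b a' b' where ab: "T (pt a b) x = 0" "T (pt a' b') x = 0" "a * b' \<noteq> a' * b" by blast
          have r1: "g x * l\<^sub>2 x * (a * L0 x + b * L1 x) = 0"
            by (rule root[OF x _ ab(1)]) (use ab(3) in force)
          have r2: "g x * l\<^sub>2 x * (a' * L0 x + b' * L1 x) = 0"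
            by (rule root[OF x _ ab(2)]) (use ab(3) in force)
          have "(a * b' - a' * b) * (g x * l\<^sub>2 x * L0 x) = b' * (g x * l\<^sub>2 x * (a * L0 x + b * L1 x)) - b * (g x * l\<^sub>2 x * (a' * L0 x + b' * L1 x))"
            by (simp add: algebra_simps)
          also have "\<dots> = 0" unfolding r1 r2 by simp
          finally have "(a * b' - a' * b) * (g x * l\<^sub>2 x * L0 x) = 0" .
          then show ?thesis using ab(3) by auto
        qed simp
        have gd: "is_form (d + 1 + 2) (\<lambda>x. g x * l\<^sub>2 x * disc x)" by (rule is_form_mult[OF gl fd])
        have "g x * l\<^sub>2 x * disc x = 0" if "F x = 0" for x
          by (rule cancel_form[OF smooth gd fL0 _ x0 all that]) (simp only: L0_def quad_Q)
        then have "g x * l\<^sub>2 x = 0" if "F x = 0" for x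
          by (rule cancel_form[OF smooth gl fd quadd x1 _ that])
        then show ?thesis by (rule finish)
      next

        \<comment> \<open>Identically vanishing discriminant\<close>
        case False
        then have disc0: "C x * C x = 4 * (P x * Q x)" for x by (simp add: disc_def)
        have two: "(2 :: 'k alg_closure) = 0"
        proof (rule ccontr)
          assume 2: "(2 :: 'k alg_closure) \<noteq> 0"
          define a1 b1 c1 a2 b2 c2 where "a1 = P E\<^sub>1" and "b1 = C E\<^sub>1" and "c1 = Q E\<^sub>1" and "a2 = P E\<^sub>2" and "b2 = C E\<^sub>2" and "c2 = Q E\<^sub>2"
          have d1: "b1 * b1 = 4 * (a1 * c1)" and d2: "b2 * b2 = 4 * (a2 * c2)" using disc0 by (simp_all add: a1_def b1_def c1_def a2_def b2_def c2_def)
          \<comment> \<open>Polarizing the vanishing discriminant shows that outside characteristic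
            2 a pencil of squares consists of multiples of one square, so all minors vanish, against
            \<open>M'\<close>.\<close>
          have "(b1 + b2) * (b1 + b2) = 4 * ((a1 + a2) * (c1 + c2))"
            using disc0[of "E\<^sub>1 [+] E\<^sub>2"] by (simp add: klin_add[OF klinPQ(1)] klin_add[OF klinPQ(2)] klin_add[OF klinPQ(3)] a1_def b1_def c1_def a2_def b2_def c2_def)
          then have "2 * (b1 * b2) = 2 * (2 * (a1 * c2 + a2 * c1))" using d1 d2 by (simp add: algebra_simps)
          then have d12: "b1 * b2 = 2 * (a1 * c2 + a2 * c1)" by (simp only: mult_left_cancel[OF 2])
          have "(b1 * c2 - b2 * c1)\<^sup>2 = (b1 * b1) * c2 * c2 + (b2 * b2) * c1 * c1 - 2 * (b1 * b2) * c1 * c2" by (simp add: algebra_simps power2_eq_square)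
          also have "\<dots> = 0" unfolding d1 d2 d12 by (simp add: algebra_simps)
          finally have m1: "b1 * c2 = b2 * c1" by simp
          have "(a1 * b2 - a2 * b1)\<^sup>2 = (b2 * b2) * a1 * a1 + (b1 * b1) * a2 * a2 - 2 * (b1 * b2) * a1 * a2" by (simp add: algebra_simps power2_eq_square)
          also have "\<dots> = 0" unfolding d1 d2 d12 by (simp add: algebra_simps)
          finally have m3: "a1 * b2 = a2 * b1" by simp
          have "(2 * (c1 * a2 - c2 * a1))\<^sup>2 = (2 * (a1 * c2 + a2 * c1))\<^sup>2 - (4 * (a1 * c1)) * (4 * (a2 * c2))" by (simp add: algebra_simps power2_eq_square)
          also have "\<dots> = 0" unfolding d1[symmetric] d2[symmetric] d12[symmetric] by (simp add: algebra_simps power2_eq_square)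
          finally have m2: "c1 * a2 = c2 * a1" using 2 by simp
          show False using M' m1 m2 m3 unfolding a1_def b1_def c1_def a2_def b2_def c2_def by blast
        qed
        have four: "(4 :: 'k alg_closure) = 0" by (simp only: numeral_Bit0[of "num.Bit0 num.One"] two add_0_left)
        have C0: "C x = 0" for x
        proof -
          have "C x * C x = 0" unfolding disc0[of x] by (simp only: four mult_zero_left)
          then show ?thesis by simp
        qed
        have PQ: "P E\<^sub>1 * Q E\<^sub>2 \<noteq> P E\<^sub>2 * Q E\<^sub>1" using M' C0 by (auto simp: mult.commute)
        define W where "W = (\<lambda>x. Q x * (L0 x * L0 x) + P x * (L1 x * L1 x))"
        have fW: "is_form (1 + (2 + 2)) W"
          unfolding W_def L0_def L1_def by (intro is_form_add is_form_mult is_form_klin klinPQ is_form_Q)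
        show ?thesis
        proof (cases "\<exists>x. F x = 0 \<and> W x \<noteq> 0")
          case True
          then obtain x\<^sub>1 where x1: "F x\<^sub>1 = 0" "W x\<^sub>1 \<noteq> 0" by blast
          have all: "g x * l\<^sub>2 x * P x * W x = 0" if x: "F x = 0" for x
          proof (cases "P x = 0")
            case False
            obtain a where a: "a\<^sup>2 = Q x" using nth_root_exists[of 2 "Q x"] by auto
            obtain b where b: "b\<^sup>2 = P x" using nth_root_exists[of 2 "P x"] by auto
            have "T (pt a b) x = 2 * (P x * Q x)" unfolding T_pt' a b C0 by simp
            then have "g x * l\<^sub>2 x * (a * L0 x + b * L1 x) = 0" using two b False by (intro root[OF x]) auto
            moreover have "(a * L0 x + b * L1 x) * (a * L0 x + b * L1 x) = W x + 2 * (a * b * L0 x * L1 x)"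
              unfolding W_def a[symmetric] b[symmetric] by (simp add: algebra_simps power2_eq_square)
            ultimately show ?thesis using two by auto
          qed simp
          have gP: "is_form (d + 1 + 1) (\<lambda>x. g x * l\<^sub>2 x * P x)" by (rule is_form_mult[OF gl is_form_klin[OF klinPQ(1)]])
          have P0: "\<exists>x. P x \<noteq> 0" using PQ by (metis mult_zero_left)
          then obtain x\<^sub>2 where x2: "P x\<^sub>2 \<noteq> 0" by blast
          have "g x * l\<^sub>2 x * P x = 0" if "F x = 0" for x
            by (rule prime_form[OF smooth gP fW x1 all that])
          then have "g x * l\<^sub>2 x = 0" if "F x = 0" for x
            by (rule cancel_form[OF smooth gl is_form_klin[OF klinPQ(1)] quad_L[OF klinPQ(1)] x2 _ that])
          then show ?thesis by (rule finish)
        next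
          case False
          then have WX: "W x = 0" if "F x = 0" for x using that by blast
          have WP: "W x * P x = 0" for x
          proof (cases "P x = 0")
            case False
            have "\<exists>t. poly [:F x, L0 x, P x:] t = 0" by (rule alg_closed_imp_poly_has_root) (use False in simp)
            then obtain t where t: "poly [:F x, L0 x, P x:] t = 0" by blast
            have "F (x [+] t [*] hv u\<^sub>0) = 0" using t
              by (simp add: cub_simps L0_def P_def F_Lam[OF u(1)] algebra_simps power2_eq_square)
            from WX[OF this] have "W (x [+] t [*] hv u\<^sub>0) = 0" .
            moreover have "L0 (x [+] t [*] hv u\<^sub>0) = L0 x"
              using cubD_same(2)[of N cE "hv u\<^sub>0" x] by (simp add: L0_def cub_simps F_Lam[OF u(1)] two)
            moreover have "L1 (x [+] t [*] hv u\<^sub>0) = L1 x"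
            proof -
              have "D x (hv u\<^sub>0) (hv u\<^sub>1) = C x" unfolding C_def by (simp add: cubD_def)
              then show ?thesis by (simp add: L1_def cub_simps C0 T_Lam[OF u])
            qed
            moreover have "P (x [+] t [*] hv u\<^sub>0) = P x" "Q (x [+] t [*] hv u\<^sub>0) = Q x"
              by (simp_all add: P_def Q_def cub_simps T_Lam[OF u(2,1)] F_Lam[OF u(1)])
            ultimately show ?thesis by (simp add: W_def)
          qed simp
          obtain WM :: "'k mpoly" where WM: "\<And>x. meval to_ac x WM = W x" using fW unfolding is_form_def by blast
          have vanish_prod: "(\<forall>x. q x = 0) \<or> (\<forall>x. q' x = 0)" if "is_form i q" "is_form j q'" "\<And>x. q x * q' x = 0" for i j q q'
          proof -
            obtain A B :: "'k mpoly" where A: "\<And>x. meval to_ac x A = q x" and B: "\<And>x. meval to_ac x B = q' x"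
              using \<open>is_form i q\<close> \<open>is_form j q'\<close> unfolding is_form_def by blast
            have "A * B = 0"
              by (rule meval_eq_0_imp[OF to_ac_hom _ alg_closed_infinite]) (simp_all add: a.meval_mult A B \<open>\<And>x. q x * q' x = 0\<close>)
            then have "A = 0 \<or> B = 0" by simp
            then show ?thesis using A B by (metis a.meval_0)
          qed
          have W0: "W x = 0" for x
            using vanish_prod[OF fW is_form_klin[OF klinPQ(1)] WP] PQ by (metis mult_zero_left)
          \<comment> \<open>A direction along which Q is constant while P is not.\<close>
          define e where "e = Q E\<^sub>2 [*] E\<^sub>1 [+] (- Q E\<^sub>1) [*] E\<^sub>2"
          have Pe: "P e \<noteq> 0" and Qe: "Q e = 0"
            using PQ by (simp_all add: e_def klin_add[OF klinPQ(1)] klin_add[OF klinPQ(3)] klin_scale[OF klinPQ(1)] klin_scale[OF klinPQ(3)] algebra_simps)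
          have "Q x * L0 x = 0" for x
          proof (cases "Q x = 0")
            case False
            define p0 where "p0 = [:L0 x, D x e (hv u\<^sub>0), L0 e:]"
            define p1 where "p1 = [:L1 x, D x e (hv u\<^sub>1), L1 e:]"
            have "[:Q x:] * (p0 * p0) + [:P x, P e:] * (p1 * p1) = 0"
            proof (rule poly_eq_0_if_zero)
              fix t
              have "poly p0 t = L0 (x [+] t [*] e)" "poly p1 t = L1 (x [+] t [*] e)"
                by (simp_all add: p0_def p1_def L0_def L1_def cub_simps algebra_simps power2_eq_square)
              moreover have "poly [:Q x:] t = Q (x [+] t [*] e)" "poly [:P x, P e:] t = P (x [+] t [*] e)"
                by (simp_all add: klin_add[OF klinPQ(1)] klin_add[OF klinPQ(3)] klin_scale[OF klinPQ(1)] klin_scale[OF klinPQ(3)] Qe)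
              ultimately show "poly ([:Q x:] * (p0 * p0) + [:P x, P e:] * (p1 * p1)) t = 0"
                using W0[of "x [+] t [*] e"] by (simp only: poly_add poly_mult W_def)
            qed
            then have eq: "- ([:Q x:] * (p0 * p0)) = [:P x, P e:] * (p1 * p1)"
              by (rule minus_unique)
            \<comment> \<open>Degree parity: a constant times a square equals a polynomial of degree
              1 times a square.\<close>
            have "p1 = 0"
            proof (rule ccontr)
              assume p1: "p1 \<noteq> 0"
              have lin: "degree [:P x, P e:] = 1" "[:P x, P e:] \<noteq> 0" using Pe by simp_all
              have "degree ([:P x, P e:] * (p1 * p1)) = degree [:P x, P e:] + degree (p1 * p1)"
                by (rule degree_mult_eq) (use lin p1 in simp_all)
              moreover have "degree (p1 * p1) = degree p1 + degree p1" by (rule degree_mult_eq[OF p1 p1])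
              ultimately have deg1: "degree ([:P x, P e:] * (p1 * p1)) = Suc (degree p1 + degree p1)"
                using lin(1) by linarith
              have "p0 \<noteq> 0"
              proof
                assume "p0 = 0"
                then have "[:P x, P e:] * (p1 * p1) = 0" unfolding eq[symmetric] by simp
                then have "p1 * p1 = 0" using lin(2) unfolding mult_eq_0_iff by blast
                then show False using p1 by simp
              qed
              then have "degree (- ([:Q x:] * (p0 * p0))) = degree p0 + degree p0" using False by (simp add: degree_mult_eq)
              with deg1 arg_cong[OF eq, of degree] have "degree p0 + degree p0 = Suc (degree p1 + degree p1)" by linarith
              then show False by presburger
            qed
            then have "p0 = 0" using eq False by simp
            then show ?thesis by (simp add: p0_def)
          qed simp
          from vanish_prod[OF is_form_klin[OF klinPQ(3)] _ this, of 2] have "(\<forall>x. Q x = 0) \<or> (\<forall>x. L0 x = 0)"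
            unfolding L0_def using is_form_Q by blast
          then have False
          proof
            assume "\<forall>x. Q x = 0"
            then have "Q E\<^sub>1 = 0" "Q E\<^sub>2 = 0" by blast+
            then show False using PQ by simp
          next
            assume "\<forall>x. L0 x = 0"
            then show False using x0 by blast
          qed
          then show ?thesis ..
        qed
      qed
      then show ?thesis by (simp add: g_def)
    qed
    show ?thesis by (rule unirational_criterion[OF poly_ring on dom pt])
  qed
qed

end

end

context cubic_closed
begin

text \<open>The candidates e_2 + P / x tend to P as x tends to 0. At x = 0 the cleared resultant is
  r^3 (4 r r' - \<beta>^2), nonzero by \<open>disc\<close>, so some x serves.\<close>

lemma good_point_on_ruled_section:
  assumes F0: "F P = 0" "F u = 0" "F e\<^sub>2 = 0" and T0: "T P u = 0" "T u P = 0" "T P e\<^sub>2 = 0" "T u e\<^sub>2 = 0" "D P u e\<^sub>2 = 0"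
    and e2: "T e\<^sub>2 P = 0" "T e\<^sub>2 u = 1" "T e\<^sub>2 e\<^sub>1 = 0"
    and r: "T P e\<^sub>1 \<noteq> 0" and disc: "4 * (T P e\<^sub>1 * T u e\<^sub>1) \<noteq> (D P u e\<^sub>1)\<^sup>2"
  shows "\<exists>s. F s = 0 \<and> good N c s"
proof -
  define r r' \<beta> \<delta> \<eta> a\<^sub>1 c\<^sub>0 where "r = T P e\<^sub>1" and "r' = T u e\<^sub>1" and "\<beta> = D P u e\<^sub>1"
    and "\<delta> = D e\<^sub>1 e\<^sub>2 P" and "\<eta> = D e\<^sub>1 e\<^sub>2 u" and "a\<^sub>1 = T e\<^sub>1 P" and "c\<^sub>0 = T e\<^sub>1 e\<^sub>2"
  \<comment> \<open>the resultant in \<open>good_if_resultant\<close> for the point \<open>e\<^sub>2 + P / x\<close>, multiplied by \<open>x\<^sup>6\<close>\<close>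
  define H where "H x = (F e\<^sub>1 * x ^ 4 - (r + \<delta> * x) * x\<^sup>2 * T e\<^sub>1 u + (r + \<delta> * x)\<^sup>2 * r') * (\<delta> * x + 2 * r)\<^sup>2
     - (a\<^sub>1 * x\<^sup>2 - (r + \<delta> * x) * \<beta>) * (c\<^sub>0 * x ^ 3 - (r + \<delta> * x) * \<eta> * x + (a\<^sub>1 * x\<^sup>2 - (r + \<delta> * x) * \<beta>)) * (\<delta> * x + 2 * r)
     + r * (c\<^sub>0 * x ^ 3 - (r + \<delta> * x) * \<eta> * x + (a\<^sub>1 * x\<^sup>2 - (r + \<delta> * x) * \<beta>))\<^sup>2" for x
  have "\<exists>x. x \<noteq> 0 \<and> H x \<noteq> 0"
  proof -
    define Xp where "Xp = ([:0, 1:] :: 'e poly)"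
    define R where "R = [:r, \<delta>:]"
    define V where "V = [:a\<^sub>1:] * Xp\<^sup>2 - R * [:\<beta>:]"
    define S where "S = [:2 * r, \<delta>:]"
    define W where "W = [:c\<^sub>0:] * Xp ^ 3 - R * [:\<eta>:] * Xp + V"
    define HP where "HP = ([:F e\<^sub>1:] * Xp ^ 4 - R * Xp\<^sup>2 * [:T e\<^sub>1 u:] + R\<^sup>2 * [:r':]) * S\<^sup>2 - V * W * S + [:r:] * W\<^sup>2"
    have ev: "poly Xp x = x" "poly R x = r + \<delta> * x" "poly S x = \<delta> * x + 2 * r" "poly [:a:] x = a" for x a
      by (simp_all add: Xp_def R_def S_def)
    have HP: "poly HP x = H x" for x
      by (simp only: HP_def H_def V_def W_def poly_mult poly_add poly_diff poly_power ev)
    have "H 0 = r ^ 3 * (4 * (r * r') - \<beta>\<^sup>2)"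
      by (simp add: H_def algebra_simps power2_eq_square power3_eq_cube)
    then have "poly HP 0 \<noteq> 0" using r disc by (simp add: HP r_def r'_def \<beta>_def)
    then have "HP \<noteq> 0" "Xp \<noteq> 0" by (auto simp: Xp_def)
    then have "HP * Xp \<noteq> 0" by simp
    then obtain x where "poly (HP * Xp) x \<noteq> 0" using poly_eq_0_if_zero[of "HP * Xp"] by blast
    then show ?thesis by (intro exI[of _ x]) (simp add: HP ev)
  qed
  then obtain x where x: "x \<noteq> 0" "H x \<noteq> 0" by blast
  define b where "b = inverse x"
  have bx: "b * x = 1" using x(1) by (simp add: b_def)
  define \<theta> where "\<theta> = b * \<delta> + b\<^sup>2 * r"
  define t where "t = e\<^sub>2 [+] b [*] P"
  define w where "w = e\<^sub>1 [+] (- \<theta>) [*] u"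
  have sym: "D e\<^sub>2 P e\<^sub>1 = \<delta>" "D e\<^sub>1 P e\<^sub>2 = \<delta>" "D e\<^sub>1 u e\<^sub>2 = \<eta>" "D e\<^sub>1 u P = \<beta>" "D e\<^sub>2 P u = 0" "D u P e\<^sub>2 = 0" "D P u e\<^sub>1 = \<beta>"
    using T0(5) by (simp_all add: \<delta>_def \<eta>_def \<beta>_def cubD_def ac_simps)
  note simps = cub_simps F0 T0 e2 sym r_def[symmetric] r'_def[symmetric] a\<^sub>1_def[symmetric] c\<^sub>0_def[symmetric]
  have Ft: "F t = 0" by (simp add: t_def simps)
  have Ttu: "T t u = 1" by (simp add: t_def simps)
  have Ttw: "T t w = 0" by (simp add: t_def w_def simps \<theta>_def algebra_simps power2_eq_square)
  have TtP: "T t P = 0" "T P t = 0" by (simp_all add: t_def simps)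
  have q': "D w P t = \<delta> + 2 * b * r" by (simp add: t_def w_def simps algebra_simps)
  have TwP: "T w P = a\<^sub>1 - \<theta> * \<beta>" "T P w = r" by (simp_all add: w_def simps algebra_simps)
  have q: "T w t = c\<^sub>0 - \<theta> * \<eta> + b * (a\<^sub>1 - \<theta> * \<beta>)" by (simp add: t_def w_def simps algebra_simps)
  have Fw: "F w = F e\<^sub>1 - \<theta> * T e\<^sub>1 u + \<theta>\<^sup>2 * r'" by (simp add: w_def simps algebra_simps)
  have th: "\<theta> * x\<^sup>2 = r + \<delta> * x"
  proof -
    have "\<theta> * x\<^sup>2 = \<delta> * ((b * x) * x) + r * ((b * x) * (b * x))" by (simp add: \<theta>_def algebra_simps power2_eq_square)
    then show ?thesis unfolding bx by simp
  qed
  have "D w P t * x = \<delta> * x + 2 * r" "T w P * x\<^sup>2 = a\<^sub>1 * x\<^sup>2 - (r + \<delta> * x) * \<beta>"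
    "F w * x ^ 4 = F e\<^sub>1 * x ^ 4 - (r + \<delta> * x) * x\<^sup>2 * T e\<^sub>1 u + (r + \<delta> * x)\<^sup>2 * r'"
    "T w t * x ^ 3 = c\<^sub>0 * x ^ 3 - (r + \<delta> * x) * \<eta> * x + (a\<^sub>1 * x\<^sup>2 - (r + \<delta> * x) * \<beta>)"
  proof -
    have "D w P t * x = \<delta> * x + 2 * r * (b * x)" by (simp add: q' algebra_simps)
    then show "D w P t * x = \<delta> * x + 2 * r" by (simp add: bx)
    show 1: "T w P * x\<^sup>2 = a\<^sub>1 * x\<^sup>2 - (r + \<delta> * x) * \<beta>" unfolding TwP th[symmetric] by (simp add: algebra_simps)
    show "F w * x ^ 4 = F e\<^sub>1 * x ^ 4 - (r + \<delta> * x) * x\<^sup>2 * T e\<^sub>1 u + (r + \<delta> * x)\<^sup>2 * r'"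
      unfolding Fw th[symmetric] by (simp add: algebra_simps power2_eq_square power4_eq_xxxx)
    have "T w t * x ^ 3 = c\<^sub>0 * x ^ 3 - (\<theta> * x\<^sup>2) * \<eta> * x + (b * x) * (T w P * x\<^sup>2)"
      unfolding q TwP by (simp add: algebra_simps power2_eq_square power3_eq_cube)
    then show "T w t * x ^ 3 = c\<^sub>0 * x ^ 3 - (r + \<delta> * x) * \<eta> * x + (a\<^sub>1 * x\<^sup>2 - (r + \<delta> * x) * \<beta>)"
      unfolding th bx 1 by simp
  qed
  then have "H x = (F w * x ^ 4) * (D w P t * x)\<^sup>2 - (T w P * x\<^sup>2) * (T w t * x ^ 3) * (D w P t * x) + r * (T w t * x ^ 3)\<^sup>2"
    by (simp only: H_def)
  also have "\<dots> = (F w * (D w P t)\<^sup>2 - T w P * T w t * D w P t + T P w * (T w t)\<^sup>2) * x ^ 6"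
    unfolding TwP(2) by (simp add: algebra_simps power_def numeral_eq_Suc)
  finally have "F w * (D w P t)\<^sup>2 - T w P * T w t * D w P t + T P w * (T w t)\<^sup>2 \<noteq> 0" using x(2) by auto
  then have "good N c t" using good_if_resultant[of t u w P] Ttu Ttw TtP F0(1) by simp
  then show ?thesis using Ft by blast
qed

text \<open>At t = e_1 + s_2 the multiple \<omega> of s_3 makes w tangent, and the resultant reduces
  to its first term F(e_2) (\<omega> b)^2.\<close>

lemma good_point_simple_root:
  assumes F0: "F s\<^sub>2 = 0" "F s\<^sub>3 = 0" "T s\<^sub>2 s\<^sub>3 = 0" "T s\<^sub>3 s\<^sub>2 = 0" "T s\<^sub>2 e\<^sub>1 = 0" "T s\<^sub>3 e\<^sub>1 = 0" "T s\<^sub>2 e\<^sub>2 = 0" "T s\<^sub>3 e\<^sub>2 = 0"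
    and D0: "D s\<^sub>2 s\<^sub>3 e\<^sub>2 = 0" "D e\<^sub>1 e\<^sub>2 s\<^sub>2 = 0" "D e\<^sub>1 e\<^sub>2 s\<^sub>3 = 0" "T e\<^sub>2 s\<^sub>2 = 0" "T e\<^sub>2 s\<^sub>3 = 0" "T e\<^sub>1 s\<^sub>2 = 0" "T e\<^sub>1 s\<^sub>3 = 0"
    and nz: "D s\<^sub>2 s\<^sub>3 e\<^sub>1 \<noteq> 0" "F e\<^sub>2 \<noteq> 0" and e1: "F e\<^sub>1 = 0" "T e\<^sub>1 e\<^sub>2 \<noteq> 0"
  shows "\<exists>s. F s = 0 \<and> good N c s"
proof -
  define b where "b = D s\<^sub>2 s\<^sub>3 e\<^sub>1"
  define \<omega> where "\<omega> = - T e\<^sub>1 e\<^sub>2 / b"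
  have b: "b \<noteq> 0" "\<omega> * b = - T e\<^sub>1 e\<^sub>2" "\<omega> \<noteq> 0" using nz e1 by (simp_all add: b_def \<omega>_def)
  have sym: "D e\<^sub>1 s\<^sub>2 e\<^sub>2 = 0" "D e\<^sub>1 s\<^sub>2 s\<^sub>3 = b" "D e\<^sub>2 s\<^sub>2 e\<^sub>1 = 0" "D s\<^sub>3 s\<^sub>2 e\<^sub>1 = b" "D e\<^sub>2 s\<^sub>3 s\<^sub>2 = 0"
    using D0 by (simp_all add: b_def cubD_def ac_simps)
  define t where "t = e\<^sub>1 [+] s\<^sub>2"
  define w where "w = e\<^sub>2 [+] \<omega> [*] s\<^sub>3"
  note simps = cub_simps F0 D0 sym e1(1)
  have "F t = 0" by (simp add: t_def simps)
  moreover have "good N c t"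
  proof (rule good_if_resultant[of t s\<^sub>3 w s\<^sub>2])
    show "T t s\<^sub>3 \<noteq> 0" using b by (simp add: t_def simps)
    show "T t w = 0" using b(2) by (simp add: t_def w_def simps)
    show "T t s\<^sub>2 = 0" "T s\<^sub>2 t = 0" "F s\<^sub>2 = 0" by (simp_all add: t_def simps)
    have "D w s\<^sub>2 t = \<omega> * b" "T w s\<^sub>2 = 0" "T s\<^sub>2 w = 0" "F w = F e\<^sub>2" by (simp_all add: t_def w_def simps)
    then show "F w * (D w s\<^sub>2 t)\<^sup>2 - T w s\<^sub>2 * T w t * D w s\<^sub>2 t + T s\<^sub>2 w * (T w t)\<^sup>2 \<noteq> 0"
      using b e1(2) nz by simp
  qed
  ultimately show ?thesis by blast
qed

text \<open>The vector e_1 may be moved along e_2 to a zero E of F. A simple zero on this line is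
  settled by the preceding lemma, a double zero leaves another simple one, and a triple zero leads
  to the normal form b x y z + k u^3.\<close>

lemma good_point_on_triple_section:
  assumes F0: "F s\<^sub>2 = 0" "F s\<^sub>3 = 0" "T s\<^sub>2 s\<^sub>3 = 0" "T s\<^sub>3 s\<^sub>2 = 0" "T s\<^sub>2 e\<^sub>1 = 0" "T s\<^sub>3 e\<^sub>1 = 0" "T s\<^sub>2 e\<^sub>2 = 0" "T s\<^sub>3 e\<^sub>2 = 0"
    and D0: "D s\<^sub>2 s\<^sub>3 e\<^sub>2 = 0" "D e\<^sub>1 e\<^sub>2 s\<^sub>2 = 0" "D e\<^sub>1 e\<^sub>2 s\<^sub>3 = 0" "T e\<^sub>2 s\<^sub>2 = 0" "T e\<^sub>2 s\<^sub>3 = 0" "T e\<^sub>1 s\<^sub>2 = 0" "T e\<^sub>1 s\<^sub>3 = 0"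
    and nz: "D s\<^sub>2 s\<^sub>3 e\<^sub>1 \<noteq> 0" "F e\<^sub>2 \<noteq> 0"
  shows "\<exists>s. F s = 0 \<and> good N c s"
proof -
  define k where "k = F e\<^sub>2"
  have shift: "T s\<^sub>2 (e\<^sub>1 [+] a [*] e\<^sub>2) = 0" "T s\<^sub>3 (e\<^sub>1 [+] a [*] e\<^sub>2) = 0" "D (e\<^sub>1 [+] a [*] e\<^sub>2) e\<^sub>2 s\<^sub>2 = 0" "D (e\<^sub>1 [+] a [*] e\<^sub>2) e\<^sub>2 s\<^sub>3 = 0"
    "T (e\<^sub>1 [+] a [*] e\<^sub>2) s\<^sub>2 = 0" "T (e\<^sub>1 [+] a [*] e\<^sub>2) s\<^sub>3 = 0" "D s\<^sub>2 s\<^sub>3 (e\<^sub>1 [+] a [*] e\<^sub>2) \<noteq> 0" for a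
    using nz by (simp_all add: cub_simps F0 D0)
  note simple = good_point_simple_root[OF F0(1-4) shift(1,2) F0(7,8) D0(1) shift(3,4) D0(4,5) shift(5-7) nz(2)]
  have "\<exists>a. poly [:F e\<^sub>1, T e\<^sub>1 e\<^sub>2, T e\<^sub>2 e\<^sub>1, F e\<^sub>2:] a = 0" by (rule alg_closed_imp_poly_has_root) (use nz in simp)
  then obtain a where a: "poly [:F e\<^sub>1, T e\<^sub>1 e\<^sub>2, T e\<^sub>2 e\<^sub>1, F e\<^sub>2:] a = 0" by blast
  define E where "E = e\<^sub>1 [+] a [*] e\<^sub>2"
  have FE: "F E = 0" using a by (simp add: E_def cub_simps algebra_simps power2_eq_square power3_eq_cube)
  note shiftE = shift[of a, folded E_def]
  show ?thesis
  proof (cases "T E e\<^sub>2 = 0")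
    case False
    then show ?thesis using simple[of a] FE by (simp add: E_def)
  next
    case TE: True
    show ?thesis
    proof (cases "T e\<^sub>2 E = 0")
      case False
      define t where "t = - T e\<^sub>2 E / k"
      have t: "t * k = - T e\<^sub>2 E" "t \<noteq> 0" using nz False by (simp_all add: t_def k_def)
      have E': "e\<^sub>1 [+] (a + t) [*] e\<^sub>2 = E [+] t [*] e\<^sub>2" by (simp add: E_def fun_eq_iff algebra_simps)
      have "F (E [+] t [*] e\<^sub>2) = t\<^sup>2 * (T e\<^sub>2 E + t * k)"
        by (simp add: cub_simps FE TE k_def algebra_simps power2_eq_square power3_eq_cube)
      then have 1: "F (E [+] t [*] e\<^sub>2) = 0" using t(1) by simp
      have "T (E [+] t [*] e\<^sub>2) e\<^sub>2 = 2 * t * T e\<^sub>2 E + 3 * t * (t * k)"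
        by (simp add: cub_simps TE k_def algebra_simps power2_eq_square)
      also have "\<dots> = - (t * T e\<^sub>2 E)" unfolding t(1) by (simp add: algebra_simps)
      finally have 2: "T (E [+] t [*] e\<^sub>2) e\<^sub>2 \<noteq> 0" using t(2) False by simp
      show ?thesis using simple[of "a + t"] 1 2 unfolding E' by blast
    next
      case True
      define b where "b = D s\<^sub>2 s\<^sub>3 E"
      define y where "y = - k / b"
      have b: "b \<noteq> 0" "y * b = - k" using shiftE(7) by (simp_all add: b_def y_def)
      \<comment> \<open>A primitive cube root of unity, or 1 in characteristic 3. Both facts used, 1
        + w + w^2 = 0 and w^3 = 1, hold in either case and make z tangent with T(z, t) = 0.\<close>
      have "\<exists>w. poly [:1, 1, 1 :: 'e:] w = 0" by (rule alg_closed_imp_poly_has_root) simp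
      then obtain w where "poly [:1, 1, 1 :: 'e:] w = 0" by blast
      then have w: "1 + w + w\<^sup>2 = 0" by (simp add: power2_eq_square algebra_simps)
      have "w ^ 3 - 1 = (w - 1) * (1 + w + w\<^sup>2)" by (simp add: algebra_simps power2_eq_square power3_eq_cube)
      then have w3: "w ^ 3 = 1" unfolding w by simp
      have sym: "D E s\<^sub>2 s\<^sub>3 = b" "D s\<^sub>3 E s\<^sub>2 = b" "D s\<^sub>2 E s\<^sub>3 = b" "D E s\<^sub>3 s\<^sub>2 = b" "D s\<^sub>3 s\<^sub>2 E = b" "D s\<^sub>2 s\<^sub>3 E = b" "D E s\<^sub>2 e\<^sub>2 = 0" "D E s\<^sub>3 e\<^sub>2 = 0" "D s\<^sub>2 s\<^sub>3 e\<^sub>2 = 0"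
        "D s\<^sub>2 E e\<^sub>2 = 0" "D s\<^sub>3 E e\<^sub>2 = 0" "D s\<^sub>3 s\<^sub>2 e\<^sub>2 = 0" "D E e\<^sub>2 s\<^sub>2 = 0" "D E e\<^sub>2 s\<^sub>3 = 0" "D s\<^sub>2 e\<^sub>2 s\<^sub>3 = 0" "D s\<^sub>3 e\<^sub>2 s\<^sub>2 = 0" "D s\<^sub>2 e\<^sub>2 E = 0" "D s\<^sub>3 e\<^sub>2 E = 0"
        using D0(1) shiftE(3,4) by (simp_all add: b_def cubD_def ac_simps)
      define t where "t = E [+] s\<^sub>2 [+] y [*] s\<^sub>3 [+] e\<^sub>2"
      define z where "z = E [+] w [*] s\<^sub>2 [+] (y * w\<^sup>2) [*] s\<^sub>3"
      note simps = cub_simps F0(1-4,7,8) D0(1,4,5) shiftE(1-6) FE TE True sym k_def[symmetric]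
      have "F t = y * b + k" by (simp add: t_def simps)
      then have "F t = 0" by (simp add: b)
      moreover have "good N c t"
      proof (rule good_if_tangent_zero[of t s\<^sub>2 z "E [+] (- 1) [*] s\<^sub>2"])
        have Tt: "T t E = y * b" "T t s\<^sub>2 = y * b" "T t s\<^sub>3 = b" by (simp_all add: t_def simps)
        show "T t s\<^sub>2 \<noteq> 0" unfolding Tt b(2) using nz(2) by (simp add: k_def)
        have "T t z = T t E + w * T t s\<^sub>2 + y * w\<^sup>2 * T t s\<^sub>3" by (simp only: z_def cubT_add(2) cubT_scale(2))
        also have "\<dots> = y * b * (1 + w + w\<^sup>2)" unfolding Tt by (simp add: distrib_left ac_simps)
        finally have "T t z = y * b * (1 + w + w\<^sup>2)" .
        then show "T t z = 0" by (simp add: w)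
        show "T t (E [+] (- 1) [*] s\<^sub>2) = 0" by (simp add: cubT_add(2) cubT_scale(2) Tt)
        have Tz: "T z E = y * b * w ^ 3" "T z s\<^sub>2 = y * b * w\<^sup>2" "T z s\<^sub>3 = b * w" "T z e\<^sub>2 = 0"
          by (simp_all add: z_def simps power2_eq_square power3_eq_cube)
        have "T z t = T z E + T z s\<^sub>2 + y * T z s\<^sub>3 + T z e\<^sub>2" by (simp only: t_def cubT_add(2) cubT_scale(2))
        also have "\<dots> = y * b * (w + w\<^sup>2 + w ^ 3)" unfolding Tz by (simp add: distrib_left ac_simps)
        also have "\<dots> = 0"
        proof -
          have "w + w\<^sup>2 + w ^ 3 = 0" using w by (simp add: w3 ac_simps)
          then show ?thesis by simp
        qed
        finally have "T z t = 0" .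
        then show "T z t = 0" .
        have "F z = y * b * w ^ 3" by (simp add: z_def simps power2_eq_square power3_eq_cube)
        then show "F z \<noteq> 0" using b nz by (simp add: w3 k_def)
        have "T (E [+] (- 1) [*] s\<^sub>2) t = - (y * b)" by (simp add: t_def simps)
        then show "T (E [+] (- 1) [*] s\<^sub>2) t \<noteq> 0" using b nz by (simp add: k_def)
      qed
      ultimately show ?thesis by blast
    qed
  qed
qed

end

context irreducible_cubic
begin

text \<open>Three linear forms over k in at least four variables: they fill the first three rows of
  a square matrix whose row 3 is zero, so the matrix is singular.\<close>

lemma common_kernel_vector:
  assumes N: "4 \<le> N" and kl: "klin l" "klin m" "klin g"
  obtains v i where "i < N" "v i \<noteq> 0" "l (hv v) = 0" "m (hv v) = 0" "g (hv v) = 0"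
proof -
  obtain a where a: "\<And>x. l x = (\<Sum>i<N. x i * to_ac (a i))" using kl(1) unfolding klin_def by blast
  obtain b where b: "\<And>x. m x = (\<Sum>i<N. x i * to_ac (b i))" using kl(2) unfolding klin_def by blast
  obtain d where d: "\<And>x. g x = (\<Sum>i<N. x i * to_ac (d i))" using kl(3) unfolding klin_def by blast
  define A where "A = Matrix.mat N N (\<lambda>(i, j). if i = 0 then a j else if i = 1 then b j else if i = 2 then d j else 0)"
  have A: "A \<in> carrier_mat N N" by (simp add: A_def)
  have AT: "transpose_mat A \<in> carrier_mat N N" using A by simp
  have "transpose_mat A *\<^sub>v unit_vec N 3 = 0\<^sub>v N"
  proof (rule eq_vecI)
    fix i assume i: "i < dim_vec (0\<^sub>v N :: 'k vec)"
    have "row (transpose_mat A) i \<in> carrier_vec N" using i A by simp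
    then have "(transpose_mat A *\<^sub>v unit_vec N 3) $ i = row (transpose_mat A) i $ 3" using i A N by simp
    then show "(transpose_mat A *\<^sub>v unit_vec N 3) $ i = 0\<^sub>v N $ i" using i N by (simp add: A_def)
  qed (use A in simp)
  moreover have "unit_vec N 3 \<noteq> (0\<^sub>v N :: 'k vec)"
  proof
    assume "unit_vec N 3 = (0\<^sub>v N :: 'k vec)"
    from arg_cong[OF this, of "\<lambda>v. vec_index v 3"] show False using N by simp
  qed
  ultimately have "det (transpose_mat A) = 0"
    using det_0_iff_vec_prod_zero_field[OF AT] unit_vec_carrier by blast
  then have "det A = 0" using det_transpose[OF A] by simp
  then obtain v where v: "v \<in> carrier_vec N" "v \<noteq> 0\<^sub>v N" "A *\<^sub>v v = 0\<^sub>v N"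
    using det_0_iff_vec_prod_zero_field[OF A] by blast
  obtain i where i: "i < N" "v $ i \<noteq> 0"
  proof (rule ccontr)
    assume neg: "\<not> thesis"
    note * = that
    have "v $ i = 0" if "i < N" for i using *[OF that] neg by blast
    then have "v = 0\<^sub>v N" using v(1) by (intro eq_vecI) auto
    with v(2) show False by contradiction
  qed
  have row: "(\<Sum>j<N. A $$ (r, j) * v $ j) = 0" if "r < N" for r
  proof -
    have "(A *\<^sub>v v) $ r = (\<Sum>j<N. A $$ (r, j) * v $ j)"
      using that A v(1) by (simp add: scalar_prod_def row_def lessThan_atLeast0)
    then show ?thesis using v(3) that by simp
  qed
  have "(\<Sum>j<N. hv (($) v) j * to_ac (q j)) = to_ac (\<Sum>j<N. q j * v $ j)" for q
    by (simp add: hv_def a.hom_sum mult.commute)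
  moreover have "(\<Sum>j<N. a j * v $ j) = 0" "(\<Sum>j<N. b j * v $ j) = 0" "(\<Sum>j<N. d j * v $ j) = 0"
    using row[of 0] row[of 1] row[of 2] N by (simp_all add: A_def)
  ultimately have "l (hv (($) v)) = 0" "m (hv (($) v)) = 0" "g (hv (($) v)) = 0" unfolding a b d by simp_all
  then show ?thesis by (rule that[where v = "($) v", OF i])
qed

lemma klin_coordinate: "i < N \<Longrightarrow> klin (\<lambda>x. x i)"
proof -
  assume i: "i < N"
  have "(\<Sum>j<N. x j * to_ac (if j = i then 1 else 0 :: 'k)) = (\<Sum>j<N. if j = i then x i else 0)" for x
    by (intro sum.cong refl) simp
  then have "x i = (\<Sum>j<N. x j * to_ac (if j = i then 1 else 0 :: 'k))" for x using i by simp
  then show ?thesis unfolding klin_def by (intro exI[of _ "\<lambda>j. if j = i then 1 else 0"] allI)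
qed

end

context cubic_with_plane
begin

lemma pr_hv: "\<exists>v. pr (hv u) = hv v"
proof -
  obtain a b where ab: "l\<^sub>1 (hv u) = to_ac a" "l\<^sub>2 (hv u) = to_ac b"
    using klin_kval[OF klin(1), of u] klin_kval[OF klin(2), of u] unfolding kval_def by blast
  have "pr (hv u) = hv (u [+] (- a) [*] e\<^sub>1 [+] (- b) [*] e\<^sub>2)"
    by (simp add: pr_def ab hv_simps E\<^sub>1_def E\<^sub>2_def)
  then show ?thesis by (intro exI)
qed

text \<open>By \<open>R2\<close> all tangent hyperplanes along the subspace equal
  \<open>l\<^sub>1 = 0\<close>. A rational vector of the subspace killed by
  \<open>T(E\<^sub>2, -)\<close> is a smooth point whose polar quadric vanishes on its tangent
  hyperplane, so producing one good geometric point suffices.\<close>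

lemma unirational_if_dependent:
  assumes perf: "perfect_field TYPE('k)" and N: "4 \<le> N" and R2: "\<And>x. Lam x \<Longrightarrow> T x E\<^sub>2 = 0"
  shows "unirational N f"
proof -
  have DE2: "D x y E\<^sub>2 = 0" if "Lam x" "Lam y" for x y
    using R2[OF Lam_add[OF that]] R2[OF that(1)] R2[OF that(2)] by (simp add: cub_simps)
  have DE2': "D x E\<^sub>2 y = 0" "D E\<^sub>2 x y = 0" if "Lam x" "Lam y" for x y
    using DE2[OF that] by (simp_all add: cubD_def ac_simps)
  \<comment> \<open>The quadratic form \<open>T(-, E\<^sub>1)\<close> on the subspace has no
    nontrivial rational zero, as such a zero would be a singular point.\<close>
  have aniso: "u i = 0" if "Lam (hv u)" "T (hv u) E\<^sub>1 = 0" "i < N" for u i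
  proof -
    have "T (hv u) y = 0" for y using T_Lam_left[OF that(1), of y] that(2) R2[OF that(1)] by simp
    then show ?thesis using nosing[of u i] that unfolding Lam_def by simp
  qed
  obtain p\<^sub>0 i\<^sub>0 where p0: "i\<^sub>0 < N" "p\<^sub>0 i\<^sub>0 \<noteq> 0" "l\<^sub>1 (hv p\<^sub>0) = 0" "l\<^sub>2 (hv p\<^sub>0) = 0" "T E\<^sub>2 (hv p\<^sub>0) = 0"
    by (rule common_kernel_vector[OF N klin klin_T[of e\<^sub>2, folded E\<^sub>2_def]])
  define P where "P = hv p\<^sub>0"
  have P: "Lam P" "T E\<^sub>2 P = 0" using p0 by (simp_all add: P_def Lam_def)
  define r where "r = T P E\<^sub>1"
  have r: "r \<noteq> 0" using aniso[of p\<^sub>0 i\<^sub>0] P(1) p0 by (auto simp: r_def P_def)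
  have TP: "T P y = l\<^sub>1 y * r" for y using T_Lam_left[OF P(1), of y] R2[OF P(1)] by (simp add: r_def)
  have sm: "smooth_pt p\<^sub>0" using smooth_ptI[of p\<^sub>0 E\<^sub>1] F_Lam[OF P(1)] r by (simp add: P_def r_def)
  have I: "T y P = 0" if "T P y = 0" for y
  proof -
    have l1: "l\<^sub>1 y = 0" using that r by (simp add: TP)
    have y: "y = pr y [+] l\<^sub>2 y [*] E\<^sub>2" using pr_dec[of y] l1 by (simp add: fun_eq_iff)
    have "T (pr y [+] l\<^sub>2 y [*] E\<^sub>2) P = 0"
      by (simp add: cub_simps T_Lam[OF Lam_pr P(1)] DE2'[OF Lam_pr P(1)] P(2))
    then show ?thesis unfolding y[symmetric] .
  qed
  show ?thesis
  proof (cases "\<exists>y. T y P \<noteq> 0")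
    case False
    then have "T y (hv p\<^sub>0) = 0" for y unfolding P_def by blast
    then show ?thesis by (rule unirational_if_char_2_point[OF sm perf])
  next
    case True
    then obtain y\<^sub>0 where y0: "T y\<^sub>0 (hv p\<^sub>0) \<noteq> 0" unfolding P_def by blast
    \<comment> \<open>A binary restriction with zero discriminant has a double root, rational
      because k is perfect, against \<open>aniso\<close>.\<close>
    have disc: "4 * (r * T (hv u) E\<^sub>1) \<noteq> (D P (hv u) E\<^sub>1)\<^sup>2"
      if u: "Lam (hv u)" and indep: "\<And>s. \<exists>i<N. s * p\<^sub>0 i + u i \<noteq> 0" for u
    proof
      define \<beta> r' where "\<beta> = D P (hv u) E\<^sub>1" and "r' = T (hv u) E\<^sub>1"
      assume eq: "4 * (r * T (hv u) E\<^sub>1) = (D P (hv u) E\<^sub>1)\<^sup>2"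
      have kv: "kval r" "kval \<beta>" "kval r'" by (simp_all add: r_def P_def \<beta>_def r'_def E\<^sub>1_def)
      have "\<exists>s. kval s \<and> s\<^sup>2 * r + s * \<beta> + r' = 0"
      proof (cases "(2 :: 'k) = 0")
        case False
        then have 2: "(2 :: 'k alg_closure) \<noteq> 0" by (metis to_ac_eq_0_iff to_ac_numeral)
        define s where "s = - \<beta> / (2 * r)"
        have s: "2 * (s * r) = - \<beta>" using 2 r by (simp add: s_def)
        have "(4 * r) * (s\<^sup>2 * r + s * \<beta> + r') = (2 * (s * r))\<^sup>2 + 2 * (2 * (s * r)) * \<beta> + 4 * (r * r')"
          by (simp add: algebra_simps power2_eq_square)
        also have "\<dots> = 0" unfolding s eq[folded \<beta>_def r'_def] by (simp add: algebra_simps power2_eq_square)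
        finally have "(4 * r) * (s\<^sup>2 * r + s * \<beta> + r') = 0" .
        moreover have "(4 :: 'k alg_closure) \<noteq> 0" using 2 by (metis mult_2 mult_eq_0_iff numeral_Bit0)
        ultimately have "s\<^sup>2 * r + s * \<beta> + r' = 0" using r by (metis mult_eq_0_iff)
        moreover have "kval s" unfolding s_def by (intro kval_divide kval_uminus kval_mult kval_numeral kv)
        ultimately show ?thesis by blast
      next
        case 2: True
        have two: "(2 :: 'k alg_closure) = 0" using arg_cong[OF 2, of to_ac] by simp
        have "(4 :: 'k alg_closure) = 0" by (simp only: numeral_Bit0[of "num.Bit0 num.One"] two add_0_left)
        then have "\<beta>\<^sup>2 = 0" using eq[folded \<beta>_def r'_def] by (simp only: mult_zero_left)
        then have b: "\<beta> = 0" by simp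
        obtain q where q: "r' / r = to_ac q" using kval_divide[OF kv(3,1)] unfolding kval_def by blast
        obtain s where s: "s\<^sup>2 = q" using perfect_sqrt[OF perf 2] by blast
        have "(to_ac s)\<^sup>2 * r = r'" using r q by (simp add: s field_simps flip: to_ac_power)
        then have "(to_ac s)\<^sup>2 * r + to_ac s * \<beta> + r' = 2 * r'" by (simp add: b)
        also have "\<dots> = 0" by (simp only: two mult_zero_left)
        finally show ?thesis by (intro exI[of _ "to_ac s"]) simp
      qed
      then obtain s where "kval s" and s: "s\<^sup>2 * r + s * \<beta> + r' = 0" by blast
      then obtain s' where s': "s = to_ac s'" unfolding kval_def by blast
      define v where "v = s' [*] p\<^sub>0 [+] u"
      have v: "hv v = s [*] P [+] hv u" by (simp add: v_def hv_simps s' P_def)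
      have "Lam (hv v)" unfolding v by (intro Lam_add Lam_scale P(1) u)
      moreover have "T (hv v) E\<^sub>1 = 0" unfolding v using s by (simp add: cub_simps r_def \<beta>_def r'_def)
      ultimately have "v i = 0" if "i < N" for i using aniso that by blast
      then show False using indep[of s'] by (auto simp: v_def)
    qed
    have "\<exists>s. F s = 0 \<and> good N cE s"
    proof (cases "\<exists>x. Lam x \<and> T E\<^sub>2 x \<noteq> 0")
      case True
      then obtain x where x: "Lam x" "T E\<^sub>2 x \<noteq> 0" by blast
      define \<gamma> where "\<gamma> x = T E\<^sub>2 x - T E\<^sub>2 E\<^sub>1 * l\<^sub>1 x - T E\<^sub>2 E\<^sub>2 * l\<^sub>2 x" for x
      have g: "\<gamma> x = T E\<^sub>2 (pr x)" for x by (simp add: \<gamma>_def pr_def cub_simps)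
      have "klin \<gamma>" unfolding \<gamma>_def E\<^sub>1_def E\<^sub>2_def by (intro klin_minus klin_times klin klin_T kval_T)
      moreover have "\<gamma> x \<noteq> 0" using x by (simp add: g pr_Lam)
      ultimately obtain i where i: "\<gamma> (unit i) \<noteq> 0" using klin_nonzero_unit by blast
      obtain v where v: "pr (hv (unit i)) = hv v" using pr_hv by blast
      define q where "q = T E\<^sub>2 (hv v)"
      have q: "q \<noteq> 0" "kval q" using i unfolding g q_def v[symmetric] hv_simps(3) by (simp_all add: E\<^sub>2_def v[unfolded hv_simps(3)])
      obtain u where u: "hv u = (1 / q) [*] hv v" using kval_hv[OF kval_divide[OF kval_1 q(2)], of v] by metis
      define U where "U = hv u"
      have U: "Lam U" "T E\<^sub>2 U = 1"
        using Lam_scale[OF Lam_pr[of "hv (unit i)"], of "1 / q"] q(1) by (simp_all add: U_def u v q_def cub_simps)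
      have indep: "\<exists>i<N. s * p\<^sub>0 i + u i \<noteq> 0" for s
      proof (rule ccontr)
        assume neg: "\<not> (\<exists>i<N. s * p\<^sub>0 i + u i \<noteq> 0)"
        have "T E\<^sub>2 (to_ac s [*] P [+] U) = T E\<^sub>2 (\<lambda>_. 0)"
        proof (rule cubT_cong)
          show "(to_ac s [*] P [+] U) i = 0" if "i < N" for i
            using neg that by (simp add: P_def U_def hv_def flip: to_ac_mult to_ac_add)
        qed simp
        then show False by (simp add: cub_simps P U)
      qed
      note d = disc[OF U(1)[unfolded U_def] indep, folded U_def]
      define k where "k = F E\<^sub>2"
      \<comment> \<open>Shifts along U achieve \<open>F G2 = 0\<close> and
        \<open>T G2 G1 = 0\<close>, using \<open>T(E\<^sub>2, U) = 1\<close>.\<close>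
      define G2 where "G2 = E\<^sub>2 [+] (- k) [*] U"
      define G1 where "G1 = E\<^sub>1 [+] (- T G2 E\<^sub>1) [*] U"
      note simps = cub_simps F_Lam[OF U(1)] F_Lam[OF P(1)] T_Lam[OF U(1) P(1)] T_Lam[OF P(1) U(1)] R2[OF U(1)] R2[OF P(1)] P(2) U(2)
        DE2[OF U(1) P(1)] DE2[OF P(1) U(1)] DE2'[OF U(1) P(1)] DE2'[OF P(1) U(1)]
      have G: "F G2 = 0" "T P G2 = 0" "T U G2 = 0" "D P U G2 = 0" "T G2 P = 0" "T G2 U = 1"
        unfolding G2_def by (simp_all add: simps k_def[symmetric])
      have G': "T P G1 = r" "T U G1 = T U E\<^sub>1" "D P U G1 = D P U E\<^sub>1" "T G2 G1 = 0"
        unfolding G1_def by (simp_all add: simps r_def G)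
      show ?thesis
        by (rule C.good_point_on_ruled_section[of P U G2 G1]) (use d r in \<open>simp_all add: G G' simps\<close>)
    next
      case False
      then have g0: "T E\<^sub>2 x = 0" if "Lam x" for x using that by blast
      have kappa: "F E\<^sub>2 \<noteq> 0"
      proof
        assume 0: "F E\<^sub>2 = 0"
        obtain y where y: "l\<^sub>1 y = 0" "F y \<noteq> 0" by (rule F_nonzero_on_klin[OF klin(1), of E\<^sub>1]) (simp add: dualE)
        have y': "y = pr y [+] l\<^sub>2 y [*] E\<^sub>2" using pr_dec[of y] y(1) by (simp add: fun_eq_iff)
        have "F (pr y [+] l\<^sub>2 y [*] E\<^sub>2) = 0"
          by (simp add: cub_simps F_Lam[OF Lam_pr] R2[OF Lam_pr] g0[OF Lam_pr] 0)
        then show False using y(2) unfolding y'[symmetric] by simp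
      qed
      \<comment> \<open>A second vector of the subspace, independent of \<open>p\<^sub>0\<close>
        because its coordinate \<open>i\<^sub>0\<close> vanishes.\<close>
      obtain u j where u: "j < N" "u j \<noteq> 0" "l\<^sub>1 (hv u) = 0" "l\<^sub>2 (hv u) = 0" "hv u i\<^sub>0 = 0"
        by (rule common_kernel_vector[OF N klin klin_coordinate[OF p0(1)]])
      define U where "U = hv u"
      have U: "Lam U" using u by (simp add: U_def Lam_def)
      have indep: "\<exists>i<N. s * p\<^sub>0 i + u i \<noteq> 0" for s
      proof (cases "s = 0")
        case True
        then show ?thesis using u(1,2) by auto
      next
        case False
        moreover have "u i\<^sub>0 = 0" using u(5) by (simp add: hv_def)
        ultimately show ?thesis using p0(1,2) by auto
      qed
      note d = disc[OF U[unfolded U_def] indep, folded U_def]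
      define \<beta> r' where "\<beta> = D P U E\<^sub>1" and "r' = T U E\<^sub>1"
      have d: "4 * (r * r') \<noteq> \<beta>\<^sup>2" using d by (simp add: \<beta>_def r'_def)
      have "\<exists>x. poly [:r', \<beta>, r:] x = 0" by (rule alg_closed_imp_poly_has_root) (use r in simp)
      then obtain x1 where x1: "r' + x1 * (\<beta> + x1 * r) = 0" by auto
      define x2 where "x2 = - \<beta> / r - x1"
      have x12: "r * x2 = - \<beta> - r * x1" using r by (simp add: x2_def field_simps)
      have prod: "r' = (r * x2) * x1" using x1 unfolding x12 by (simp add: algebra_simps eq_neg_iff_add_eq_0)
      have beta: "\<beta> = - (r * x1 + r * x2)" unfolding x12 by simp
      have x2: "r' + x2 * (\<beta> + x2 * r) = 0" unfolding prod beta by (simp add: algebra_simps)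
      define s2 where "s2 = x1 [*] P [+] U"
      define s3 where "s3 = x2 [*] P [+] U"
      have s: "Lam s2" "Lam s3" unfolding s2_def s3_def by (intro Lam_add Lam_scale P(1) U)+
      have Ts: "T s2 E\<^sub>1 = 0" "T s3 E\<^sub>1 = 0"
        using x1 x2 by (simp_all add: s2_def s3_def cub_simps r_def[symmetric] r'_def[symmetric] \<beta>_def[symmetric] algebra_simps power2_eq_square)
      define b where "b = D s2 s3 E\<^sub>1"
      have "D U P E\<^sub>1 = \<beta>" by (simp add: \<beta>_def cubD_def)
      then have bexp: "b = 2 * r * x1 * x2 + \<beta> * (x1 + x2) + 2 * r'"
        by (simp add: b_def s2_def s3_def cub_simps r_def[symmetric] r'_def[symmetric] \<beta>_def[symmetric] algebra_simps)
      have "r * b = 4 * (r * r') - \<beta>\<^sup>2" unfolding bexp prod beta by (simp add: algebra_simps power2_eq_square)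
      then have b: "b \<noteq> 0" using d by auto
      note L = F_Lam[OF s(1)] F_Lam[OF s(2)] T_Lam[OF s] T_Lam[OF s(2,1)] R2[OF s(1)] R2[OF s(2)] g0[OF s(1)] g0[OF s(2)] Ts
        DE2[OF s(1) s(2)] DE2[OF s(2) s(1)] DE2'[OF s] DE2'[OF s(2,1)] DE2'[OF s(1,1)] DE2'[OF s(2,2)]
      \<comment> \<open>Corrections inside the span of s2 and s3, the two zeros of
        \<open>T(-, E\<^sub>1)\<close>, remove the mixed terms; they are solvable since b is
        nonzero.\<close>
      define G1 where "G1 = E\<^sub>1 [+] (- (T E\<^sub>1 s3 / b)) [*] s2 [+] (- (T E\<^sub>1 s2 / b)) [*] s3"
      have bsym: "D E\<^sub>1 s2 s3 = b" "D E\<^sub>1 s3 s2 = b" "D s2 E\<^sub>1 s3 = b" "D s3 E\<^sub>1 s2 = b" "D s2 s3 E\<^sub>1 = b" "D s3 s2 E\<^sub>1 = b"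
        by (simp_all add: b_def cubD_def)
      have D3: "D s2 s3 s2 = 0" "D s2 s3 s3 = 0" "D s3 s2 s2 = 0" "D s3 s2 s3 = 0" by (simp_all add: D_Lam s)
      have G1: "T G1 s2 = 0" "T G1 s3 = 0" "T s2 G1 = 0" "T s3 G1 = 0" "D s2 s3 G1 = b"
        unfolding G1_def by (simp_all add: cub_simps L bsym D3 b)
      have bsym': "D G1 s2 s3 = b" "D G1 s3 s2 = b" using G1(5) by (simp_all add: cubD_def ac_simps)
      define G2 where "G2 = E\<^sub>2 [+] (- (D G1 E\<^sub>2 s3 / b)) [*] s2 [+] (- (D G1 E\<^sub>2 s2 / b)) [*] s3"
      have G2: "T G2 s2 = 0" "T G2 s3 = 0" "T s2 G2 = 0" "T s3 G2 = 0" "D s2 s3 G2 = 0" "D G1 G2 s2 = 0" "D G1 G2 s3 = 0" "F G2 = F E\<^sub>2"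
        unfolding G2_def by (simp_all add: cub_simps L D3 bsym' b G1)
      show ?thesis
        by (rule C.good_point_on_triple_section[of s2 s3 G1 G2]) (use b kappa in \<open>simp_all add: G1 G2 L\<close>)
    qed
    then obtain s where s: "F s = 0" "good N cE s" by blast
    show ?thesis by (rule unirational_if_vanishing_polar[OF sm _ y0 s]) (rule I[unfolded P_def])
  qed
qed

end

context cubic_with_plane
begin

lemma unirational_if_dependent_rational:
  assumes perf: "perfect_field TYPE('k)" and N: "4 \<le> N" and R2: "\<And>v. Lam (hv v) \<Longrightarrow> T (hv v) E\<^sub>2 = 0"
  shows "unirational N f"
proof (rule unirational_if_dependent[OF perf N])
  fix x assume x: "Lam x"
  have "T (pr x) E\<^sub>2 = 0"
  proof (rule quadratic_form_zero_test[where q = "\<lambda>x. T (pr x) E\<^sub>2" and B = "\<lambda>x y. D (pr x) (pr y) E\<^sub>2" and N = N])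
    show "T (pr x) E\<^sub>2 = T (pr y) E\<^sub>2" if xy: "\<And>i. i < N \<Longrightarrow> x i = y i" for x y
      by (rule cubT_cong) (use xy klin_cong[OF klin(1) xy] klin_cong[OF klin(2) xy] in \<open>simp_all add: pr_def\<close>)
    have *: "T (pr (hv v)) E\<^sub>2 = 0" for v using pr_hv[of v] R2 Lam_pr[of "hv v"] by metis
    show "T (pr (unit i)) E\<^sub>2 = 0" "T (pr (unit i [+] unit j)) E\<^sub>2 = 0" for i j
      using *[of "unit i"] *[of "unit i [+] unit j"] by (simp_all only: hv_simps)
    show "D (pr x) (pr y) E\<^sub>2 = D (pr y) (pr x) E\<^sub>2" for x y by (rule cubD_commute)
  qed (simp_all add: pr_add pr_scale cub_simps)
  then show "T x E\<^sub>2 = 0" using pr_Lam[OF x] by simp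
qed

end

context irreducible_cubic
begin

text \<open>If no pair of rational vectors of the subspace is independent, the values on the dual
  basis have one fixed ratio r1 : r2, so all tangent hyperplanes agree; changing the basis of the
  pencil makes the common hyperplane \<open>l\<^sub>1 = 0\<close>.\<close>

lemma unirational_if_contains_plane:
  assumes perf: "perfect_field TYPE('k)" and N: "4 \<le> N" and p: "smooth_pt p"
    and noncone: "\<And>s. F (hv s) = 0 \<Longrightarrow> (\<And>y. T (hv s) y = 0) \<Longrightarrow> \<exists>i<N. s i \<noteq> 0 \<Longrightarrow> \<exists>x. T x (hv s) \<noteq> 0"
    and plane: contains_plane
  shows "unirational N f"
proof -
  obtain l m x where l: "klin l" "klin m" "l x \<noteq> 0" and van: "\<And>x. l x = 0 \<Longrightarrow> m x = 0 \<Longrightarrow> F x = 0"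
    using plane unfolding contains_plane_def by blast
  obtain i where i: "l (unit i) \<noteq> 0" by (rule klin_nonzero_unit[OF l(1,3)])
  define a where "a = l (unit i)"
  have kv: "kval (l (unit j))" "kval (m (unit j))" for j
    using klin_kval[OF l(1), of "unit j"] klin_kval[OF l(2), of "unit j"] by (simp_all only: hv_simps)
  define m' where "m' x = m x - (m (unit i) / a) * l x" for x
  have m': "klin m'" unfolding m'_def a_def by (intro klin_minus klin_times l kval_divide kv)
  obtain y where y: "l y = 0" "F y \<noteq> 0" by (rule F_nonzero_on_klin[OF l(1,3)])
  then have "m' y \<noteq> 0" using van[of y] by (auto simp: m'_def)
  then obtain j where j: "m' (unit j) \<noteq> 0" using klin_nonzero_unit[OF m'] by blast
  define b where "b = m' (unit j)"
  have kb: "kval b" using klin_kval[OF m', of "unit j"] by (simp only: hv_simps b_def)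
  have ka: "kval a" by (simp add: a_def kv)
  \<comment> \<open>The vectors f1 and f2 are dual to l and m. They are built from unit vectors with
    coefficients in k, hence rational.\<close>
  define f2 where "f2 = (1 / b) [*] (unit j [+] (- (l (unit j) / a)) [*] unit i)"
  define f1 where "f1 = (1 / a) [*] unit i [+] (- (m (unit i) / a)) [*] f2"
  have hv_add: "\<exists>w. hv u [+] hv v = hv w" for u v using hv_simps(1) by metis
  have hv_unit: "\<exists>w. unit i = hv w" for i using hv_simps(3) by metis
  have "\<exists>w. f2 = hv w"
  proof -
    obtain w1 where w1: "(- (l (unit j) / a)) [*] unit i = hv w1"
      using kval_hv[OF kval_uminus[OF kval_divide[OF kv(1) ka]], of j "unit i"] unfolding hv_simps by blast
    obtain w2 where w2: "unit j [+] hv w1 = hv w2" using hv_add[of "unit j" w1] unfolding hv_simps by blast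
    show ?thesis unfolding f2_def w1 w2 by (rule kval_hv[OF kval_divide[OF kval_1 kb]])
  qed
  then obtain e2 where e2: "f2 = hv e2" by blast
  have "\<exists>w. f1 = hv w"
  proof -
    obtain w1 where w1: "(- (m (unit i) / a)) [*] f2 = hv w1"
      using kval_hv[OF kval_uminus[OF kval_divide[OF kv(2) ka]], of i e2] unfolding e2 by blast
    obtain w2 where w2: "(1 / a) [*] unit i = hv w2"
      using kval_hv[OF kval_divide[OF kval_1 ka], of "unit i"] unfolding hv_simps by blast
    show ?thesis unfolding f1_def w1 w2 by (rule hv_add)
  qed
  then obtain e1 where e1: "f1 = hv e1" by blast
  note lin = klin_add[OF l(1)] klin_add[OF l(2)] klin_scale[OF l(1)] klin_scale[OF l(2)]
  have dual2: "l f2 = 0" "m f2 = 1"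
    using i j by (simp_all add: f2_def lin a_def b_def m'_def field_simps)
  have dual1: "l f1 = 1" "m f1 = 0"
    using i by (simp_all add: f1_def lin dual2 a_def)
  show ?thesis
  proof (cases "\<exists>u i. l (hv u) = 0 \<and> m (hv u) = 0 \<and> (\<forall>y. T (hv u) y = 0) \<and> i < N \<and> u i \<noteq> 0")
    case True
    then obtain u i where u: "l (hv u) = 0" "m (hv u) = 0" "\<And>y. T (hv u) y = 0" "i < N" "u i \<noteq> 0" by blast
    have Fu: "F (hv u) = 0" by (rule van[OF u(1,2)])
    obtain x where "T x (hv u) \<noteq> 0" using noncone[OF Fu u(3)] u(4,5) by blast
    then show ?thesis by (rule unirational_if_singular[OF p Fu u(3)])
  next
    case False
    then have nosing: "u i = 0" if "l (hv u) = 0" "m (hv u) = 0" "\<And>y. T (hv u) y = 0" "i < N" for u i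
      using that by blast
    interpret L: cubic_with_plane N f l m e1 e2 p
      by unfold_locales (use l dual1 dual2 e1 e2 van p nosing in simp_all)
    show ?thesis
    proof (rule ccontr)
      assume neg: "\<not> unirational N f"
      have dep: "T (hv v) L.E\<^sub>1 * T (hv u) L.E\<^sub>2 = T (hv v) L.E\<^sub>2 * T (hv u) L.E\<^sub>1"
        if "L.Lam (hv u)" "L.Lam (hv v)" for u v
        using L.unirational_if_independent[OF that _ perf] neg by blast
      obtain u i where u: "i < N" "u i \<noteq> 0" "l (hv u) = 0" "m (hv u) = 0"
        by (rule common_kernel_vector[OF N l(1,2) l(1)])
      have Lu: "L.Lam (hv u)" using u by (simp add: L.Lam_def)
      define r1 r2 where "r1 = T (hv u) L.E\<^sub>1" and "r2 = T (hv u) L.E\<^sub>2"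
      have dep': "T (hv v) L.E\<^sub>1 * r2 = T (hv v) L.E\<^sub>2 * r1" if "L.Lam (hv v)" for v
        using dep[OF Lu that] by (simp add: r1_def r2_def)
      have nz: "r1 \<noteq> 0 \<or> r2 \<noteq> 0"
      proof (rule ccontr)
        assume "\<not> (r1 \<noteq> 0 \<or> r2 \<noteq> 0)"
        then have "T (hv u) y = 0" for y using L.T_Lam_left[OF Lu, of y] by (simp add: r1_def r2_def)
        then show False using nosing[OF u(3,4) _ u(1)] u(2) by blast
      qed
      have kr: "kval r1" "kval r2" by (simp_all add: r1_def r2_def L.E\<^sub>1_def L.E\<^sub>2_def)
      show False
      proof (cases "r1 = 0")
        case True
        then have r2: "r2 \<noteq> 0" using nz by simp
        interpret L': cubic_with_plane N f m l e2 e1 p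
          by unfold_locales (use l dual1 dual2 e1 e2 van p nosing in simp_all)
        have "T (hv v) L'.E\<^sub>2 = 0" if "L'.Lam (hv v)" for v
        proof -
          have "L.Lam (hv v)" using that by (simp add: L.Lam_def L'.Lam_def)
          from dep'[OF this] show ?thesis using True r2 by (simp add: L.E\<^sub>1_def L'.E\<^sub>2_def)
        qed
        from L'.unirational_if_dependent_rational[OF perf N this] show False using neg by contradiction
      next
        case False
        obtain q where q: "r2 / r1 = to_ac q" using kval_divide[OF kr(2,1)] unfolding kval_def by blast
        \<comment> \<open>With \<open>e3 = e2 - q e1\<close> the tangent forms vanish on the second
          basis vector, and l' is the change of l that keeps the bases dual.\<close>
        define l' where "l' x = l x + to_ac q * m x" for x
        define e3 where "e3 = e2 [+] (- q) [*] e1"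
        have e3: "hv e3 = hv e2 [+] (- to_ac q) [*] hv e1" by (simp add: e3_def hv_simps)
        have kl': "klin l'" unfolding l'_def by (intro klin_plus klin_times l kval_to_ac)
        interpret L': cubic_with_plane N f l' m e1 e3 p
          by unfold_locales (use kl' l dual1 dual2 van p nosing in \<open>simp_all add: l'_def e3 lin flip: e1 e2\<close>)
        have "T (hv v) L'.E\<^sub>2 = 0" if "L'.Lam (hv v)" for v
        proof -
          have "L.Lam (hv v)" using that by (auto simp: L.Lam_def L'.Lam_def l'_def)
          from dep'[OF this] have "T (hv v) L.E\<^sub>2 = to_ac q * T (hv v) L.E\<^sub>1" using False by (simp add: q[symmetric] field_simps)
          then show ?thesis by (simp add: L'.E\<^sub>2_def L.E\<^sub>2_def L.E\<^sub>1_def e3 cub_simps)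
        qed
        from L'.unirational_if_dependent_rational[OF perf N this] show False using neg by contradiction
      qed
    qed
  qed
qed

lemma unirational_if_smooth_point:
  assumes perf: "perfect_field TYPE('k)" and N: "4 \<le> N" and p: "smooth_pt p"
    and noncone: "\<And>s. F (hv s) = 0 \<Longrightarrow> (\<And>y. T (hv s) y = 0) \<Longrightarrow> \<exists>i<N. s i \<noteq> 0 \<Longrightarrow> \<exists>x. T x (hv s) \<noteq> 0"
  shows "unirational N f"
proof -
  have "unirational N f \<or> contains_plane"
  proof (rule tangent_quadric_cases[OF p])
    assume I: "\<And>y. T (hv p) y = 0 \<Longrightarrow> T y (hv p) = 0"
    show ?thesis
    proof (rule vanishing_polar_cases[OF perf _ p])
      show "\<exists>x. T x (hv s) \<noteq> 0" if "F (hv s) = 0" "\<And>y. T (hv s) y = 0" "\<exists>i<N. s i \<noteq> 0" for s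
        by (rule noncone[OF that])
    qed (rule I)
  next
    fix z assume "T (hv p) (hv z) = 0" "T (hv z) (hv p) \<noteq> 0"
    then show ?thesis by (rule generic_point_cases[OF p])
  qed
  moreover have "unirational N f" if contains_plane
  proof (rule unirational_if_contains_plane[OF perf N p _ that])
    show "\<exists>x. T x (hv s) \<noteq> 0" if "F (hv s) = 0" "\<And>y. T (hv s) y = 0" "\<exists>i<N. s i \<noteq> 0" for s
      by (rule noncone[OF that])
  qed
  ultimately show ?thesis by blast
qed

text \<open>If x is singular, some rational y has \<open>Q_x(y) \<noteq> 0\<close>, and s = Q_x(y) y
  - F(y) x is smooth because T(s, x) = Q_x(y)^3.\<close>

lemma smooth_point_exists:
  assumes x: "F (hv x) = 0" "\<exists>i<N. x i \<noteq> 0"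
    and noncone: "\<And>s. F (hv s) = 0 \<Longrightarrow> (\<And>y. T (hv s) y = 0) \<Longrightarrow> \<exists>i<N. s i \<noteq> 0 \<Longrightarrow> \<exists>x. T x (hv s) \<noteq> 0"
  shows "\<exists>p. smooth_pt p"
proof (cases "\<exists>y. T (hv x) y \<noteq> 0")
  case True
  then show ?thesis using smooth_ptI x(1) by blast
next
  case False
  then have 0: "T (hv x) y = 0" for y by blast
  have "\<exists>y. T (hv y) (hv x) \<noteq> 0"
  proof (rule ccontr)
    assume "\<nexists>y. T (hv y) (hv x) \<noteq> 0"
    then have z: "T (hv y) (hv x) = 0" for y by blast
    have "T y (hv x) = 0" for y
    proof (rule quadratic_form_zero_test[where q = "\<lambda>y. T y (hv x)" and B = "\<lambda>y z. D y z (hv x)" and N = N])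
      show "T y (hv x) = T z (hv x)" if "\<And>i. i < N \<Longrightarrow> y i = z i" for y z
        by (rule cubT_cong) (use that in simp_all)
      show "T (unit i) (hv x) = 0" "T (unit i [+] unit j) (hv x) = 0" for i j
        using z[of "unit i"] z[of "unit i [+] unit j"] by (simp_all only: hv_simps)
      show "D y z (hv x) = D z y (hv x)" for y z by (rule cubD_commute)
    qed (simp_all add: cub_simps)
    then show False using noncone[OF x(1) 0 x(2)] by blast
  qed
  then obtain y where y: "T (hv y) (hv x) \<noteq> 0" by blast
  define s where "s = cubT N c y x [*] y [+] (- cub N c y) [*] x"
  have s: "hv s = C.rho (hv x) (hv y)" by (simp add: s_def hv_simps cub_rho_def F_hv T_hv)
  have "F (hv s) = 0" unfolding s by (rule C.F_rho[OF x(1) 0])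
  moreover have "T (hv s) (hv x) \<noteq> 0"
    unfolding s using y by (simp add: cub_rho_def cub_simps x(1) 0)
  ultimately show ?thesis using smooth_ptI by blast
qed

end

section \<open>Rational points of unirational cubics\<close>

lemma factor_common_power:
  fixes g :: "nat \<Rightarrow> 'a :: field poly"
  assumes "i\<^sub>0 < N" "g i\<^sub>0 \<noteq> 0"
  shows "\<exists>d \<delta>. (\<forall>i<N. g i = [:0, 1:] ^ d * \<delta> i) \<and> (\<exists>i<N. poly (\<delta> i) 0 \<noteq> 0)"
  using assms
proof (induction "degree (g i\<^sub>0)" arbitrary: g rule: less_induct)
  case less
  show ?case
  proof (cases "\<exists>i<N. poly (g i) 0 \<noteq> 0")
    case True
    then show ?thesis by (intro exI[of _ 0] exI[of _ g]) simp
  next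
    case False
    have "\<exists>q. g i = [:0, 1:] * q" if "i < N" for i
    proof -
      obtain a q where "g i = pCons a q" by (cases "g i")
      moreover have "a = 0" using False that \<open>g i = pCons a q\<close> by (metis poly_0_coeff_0 coeff_pCons_0)
      ultimately show ?thesis by (intro exI[of _ q]) simp
    qed
    then obtain q where q: "\<And>i. i < N \<Longrightarrow> g i = [:0, 1:] * q i" by metis
    have q0: "q i\<^sub>0 \<noteq> 0" using q[OF less.prems(1)] less.prems(2) by auto
    then have "degree (q i\<^sub>0) < degree (g i\<^sub>0)" using q[OF less.prems(1)] by simp
    from less.hyps[of q, OF this less.prems(1) q0] obtain d \<delta> where
      "\<forall>i<N. q i = [:0, 1:] ^ d * \<delta> i" "\<exists>i<N. poly (\<delta> i) 0 \<noteq> 0" by blast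
    then show ?thesis using q by (intro exI[of _ "Suc d"] exI[of _ \<delta>]) (simp add: mult.assoc)
  qed
qed

text \<open>Over a finite field all g_i may vanish at every rational parameter. A curve over k given
  by Kronecker's substitution keeps one of them nonzero as a polynomial in t.\<close>

lemma rational_point_if_rational_map:
  fixes F :: "'k :: field mpoly"
  assumes F: "F \<in> poly_ring N" "homogeneous 3 F" and g: "rational_map m N F g"
  shows "\<exists>x. (\<exists>i<N. x i \<noteq> 0) \<and> meval id x F = 0"
proof -
  interpret p: comm_ring_hom "\<lambda>c :: 'k. [:c:]" by (rule const_poly_hom)
  obtain i\<^sub>0 where i0: "i\<^sub>0 < N" "g i\<^sub>0 \<noteq> 0" using g unfolding rational_map_def by blast
  obtain e :: "nat \<Rightarrow> nat" where e: "meval (\<lambda>c. [:c:]) (\<lambda>i. Polynomial.monom 1 (e i)) (g i\<^sub>0) \<noteq> 0"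
    using kronecker_substitution[OF i0(2)] by blast
  define \<phi> where "\<phi> = meval (\<lambda>c :: 'k. [:c:]) (\<lambda>i. Polynomial.monom 1 (e i))"
  have \<phi>: "comm_ring_hom \<phi>" unfolding \<phi>_def by (rule p.meval_hom)
  have 0: "meval (\<lambda>c. [:c:]) (\<lambda>i. \<phi> (g i)) F = 0"
  proof -
    have "meval mconst g F = 0" using g unfolding rational_map_def by blast
    then have "\<phi> (meval mconst g F) = 0" by (simp add: \<phi>_def)
    then show ?thesis unfolding hom_meval[OF \<phi>] by (simp add: \<phi>_def)
  qed
  have "\<phi> (g i\<^sub>0) \<noteq> 0" using e by (simp add: \<phi>_def)
  from factor_common_power[where g = "\<lambda>i. \<phi> (g i)", OF i0(1) this] obtain d \<delta>
    where d: "\<forall>i<N. \<phi> (g i) = [:0, 1:] ^ d * \<delta> i" "\<exists>i<N. poly (\<delta> i) 0 \<noteq> 0" by blast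
  have "meval (\<lambda>c. [:c:]) (\<lambda>i. \<phi> (g i)) F = meval (\<lambda>c. [:c:]) ([:0, 1:] ^ d [*] \<delta>) F"
    by (rule meval_mpoly_cong[OF F(1)]) (use d(1) in simp)
  also have "\<dots> = ([:0, 1:] ^ d) ^ 3 * meval (\<lambda>c. [:c:]) \<delta> F"
    by (rule meval_homogeneous[OF const_poly_hom F(2)])
  finally have "meval (\<lambda>c. [:c:]) \<delta> F = 0" using 0 by simp
  then have "poly (meval (\<lambda>c. [:c:]) \<delta> F) 0 = 0" by simp
  then have "meval id (\<lambda>i. poly (\<delta> i) 0) F = 0" unfolding hom_meval[OF poly_hom] by (simp add: id_def)
  with d(2) show ?thesis by (intro exI[of _ "\<lambda>i. poly (\<delta> i) 0"] conjI)
qed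

lemma mvars_subst:
  fixes p :: "'a :: comm_ring_1 mpoly"
  assumes "\<And>i. j \<notin> mvars (y i)"
  shows "j \<notin> mvars (meval mconst y p)"
proof -
  interpret m: comm_ring_hom "mconst :: 'a \<Rightarrow> 'a mpoly" by (rule mconst_hom)
  show ?thesis
  proof (induction p rule: mpoly_induct)
    case (const c)
    show ?case unfolding m.meval_mconst by (simp add: mvars_def mconst_def)
  next
    case (var i)
    show ?case using assms by simp
  next
    case (add p q)
    then show ?case using mvars_add[of "meval mconst y p" "meval mconst y q"] by (auto simp: m.meval_add)
  next
    case (mult p q)
    then show ?case using mvars_mult[of "meval mconst y p" "meval mconst y q"] by (auto simp: m.meval_mult)
  qed
qed

context irreducible_cubic
begin

text \<open>The assumptions make F invariant under translation by multiples of s. The matrix A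
  replaces the basis vector with index \<open>i\<^sub>0\<close> by s, so the corresponding new
  variable drops out.\<close>

lemma cone_if_triple_point:
  assumes s: "F (hv s) = 0" "\<And>y. T (hv s) y = 0" "\<And>y. T y (hv s) = 0" and i0: "i\<^sub>0 < N" "s i\<^sub>0 \<noteq> 0"
  shows "is_cone N f"
proof -
  define A where "A = Matrix.mat N N (\<lambda>(i, j). if j = i\<^sub>0 then s i else if i = j then 1 else 0)"
  have A: "A \<in> carrier_mat N N" by (simp add: A_def)
  define y :: "nat \<Rightarrow> 'k mpoly" where "y i = (if i = i\<^sub>0 then 0 else mvar i)" for i
  have sum: "(\<Sum>j<N. A' j * x j) = (if i = i\<^sub>0 then 0 else x i) + s' * x i\<^sub>0"
    if "i < N" "\<And>j. j < N \<Longrightarrow> A' j = (if j = i\<^sub>0 then s' else if i = j then 1 else 0)" for A' x :: "nat \<Rightarrow> 'z :: comm_ring_1" and i s'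
  proof -
    have "(\<Sum>j<N. A' j * x j) = (\<Sum>j<N. (if j = i\<^sub>0 then s' * x i\<^sub>0 else 0) + (if j = i then (if i = i\<^sub>0 then 0 else x i) else 0))"
      by (intro sum.cong refl) (use that in auto)
    also have "\<dots> = s' * x i\<^sub>0 + (if i = i\<^sub>0 then 0 else x i)" using that(1) i0(1) by (simp only: sum.distrib sum.delta finite_lessThan lessThan_iff if_True)
    finally show ?thesis by (simp add: add.commute)
  qed
  have "det A \<noteq> 0"
  proof
    assume "det A = 0"
    then obtain v where v: "v \<in> carrier_vec N" "v \<noteq> 0\<^sub>v N" "A *\<^sub>v v = 0\<^sub>v N"
      using det_0_iff_vec_prod_zero_field[OF A] by blast
    have row: "(if i = i\<^sub>0 then 0 else v $ i) + s i * v $ i\<^sub>0 = 0" if "i < N" for i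
    proof -
      have "(A *\<^sub>v v) $ i = (\<Sum>j<N. A $$ (i, j) * v $ j)"
        using that A v(1) by (simp add: scalar_prod_def row_def lessThan_atLeast0)
      also have "\<dots> = (if i = i\<^sub>0 then 0 else v $ i) + s i * v $ i\<^sub>0"
        by (rule sum[OF that]) (use that in \<open>simp add: A_def\<close>)
      finally show ?thesis using v(3) that by simp
    qed
    have "v $ i\<^sub>0 = 0" using row[OF i0(1)] i0(2) by simp
    then have "v $ i = 0" if "i < N" for i using row[OF that] by (cases "i = i\<^sub>0") simp_all
    then have "v = 0\<^sub>v N" using v(1) by (intro eq_vecI) auto
    with v(2) show False by contradiction
  qed
  then have "invertible_mat A"
    using det_non_zero_imp_unit[OF A, of "()"] A unfolding invertible_mat_def inverts_mat_def Units_def ring_mat_def by auto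
  moreover have "lin_subst N A f = meval mconst y f"
  proof -
    have "meval to_ac t (lin_subst N A f - meval mconst y f) = 0" for t
    proof -
      define Y where "Y = (\<lambda>i. if i = i\<^sub>0 then 0 else t i)"
      have "meval to_ac t (lin_subst N A f) = meval to_ac (Y [+] t i\<^sub>0 [*] hv s) f"
        unfolding lin_subst_def meval_compose[OF to_ac_hom]
      proof (rule meval_mpoly_cong[OF poly_ring])
        fix i assume i: "i < N"
        have "(\<Sum>j<N. to_ac (A $$ (i, j)) * t j) = (if i = i\<^sub>0 then 0 else t i) + to_ac (s i) * t i\<^sub>0"
          by (rule sum[OF i]) (use i in \<open>simp add: A_def\<close>)
        then show "meval to_ac t (\<Sum>j<N. mconst (A $$ (i, j)) * mvar j) = (Y [+] t i\<^sub>0 [*] hv s) i"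
          by (simp add: a.meval_simps Y_def hv_def mult.commute)
      qed
      also have "\<dots> = F Y" unfolding meval_f by (simp add: cub_simps s)
      also have "F Y = meval to_ac t (meval mconst y f)"
      proof -
        have "(\<lambda>i. meval to_ac t (y i)) = Y" by (simp add: y_def Y_def fun_eq_iff)
        then show ?thesis unfolding meval_compose[OF to_ac_hom] meval_f by simp
      qed
      finally show ?thesis by (simp add: a.meval_diff)
    qed
    then have "lin_subst N A f - meval mconst y f = 0"
      by (rule meval_eq_0_imp[OF to_ac_hom _ alg_closed_infinite, rotated]) simp
    then show ?thesis by simp
  qed
  moreover have "i\<^sub>0 \<notin> mvars (meval mconst y f)"
    by (rule mvars_subst) (simp add: y_def mvars_def mvar_def)
  ultimately show ?thesis
    unfolding is_cone_def by (intro bexI[of _ A] conjI exI[of _ i\<^sub>0]) (simp_all only: A i0(1) not_False_eq_True)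
qed

end

theorem theorem2:
  fixes F :: "'k :: field mpoly" and n :: nat
  assumes "perfect_field TYPE('k)"
    and "n \<ge> 2"
    and "cubic_form (n + 2) F"
    and "irreducible F"
    and "\<not> is_cone (n + 2) F"
  shows "(unirational (n + 2) F \<longleftrightarrow> rational_points (n + 2) F \<noteq> {}) \<and>
         (rational_points (n + 2) F \<noteq> {} \<longleftrightarrow>
            (\<exists>x \<in> rational_points (n + 2) F. smooth_at (n + 2) F x))"
proof -
  define N where "N = n + 2"
  note assms = assms[folded N_def]
  have F: "F \<in> poly_ring N" "homogeneous 3 F" using assms(3) by (simp_all add: cubic_form_def)
  interpret irreducible_cubic N F by unfold_locales (use F assms(4) in simp_all)
  \<comment> \<open>The geometric hypothesis is used in this form: a rational singular point has a
    nonzero polar quadric.\<close>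
  have noncone: "\<exists>x. T x (hv s) \<noteq> 0"
    if s: "cub N cE (hv s) = 0" "\<And>y. T (hv s) y = 0" "\<exists>i<N. s i \<noteq> 0" for s
  proof (rule ccontr)
    assume neg: "\<nexists>x. T x (hv s) \<noteq> 0"
    obtain i where "i < N" "s i \<noteq> 0" using s(3) by blast
    then have "is_cone N F" by (rule cone_if_triple_point[OF s(1,2), rotated]) (use neg in blast)
    with assms(5) show False by contradiction
  qed
  have eval: "meval id x F = cub N c x" for x
    using meval_cubic[OF F id_hom] by (simp add: c_def)
  have pt: "\<exists>x \<in> rational_points N F. \<forall>i<N. x $ i = v i" if v: "cub N c v = 0" "\<exists>i<N. v i \<noteq> 0" for v
  proof (intro bexI[of _ "vec N v"])
    obtain i where i: "i < N" "v i \<noteq> 0" using v(2) by blast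
    have "vec N v \<noteq> 0\<^sub>v N"
    proof
      assume "vec N v = 0\<^sub>v N"
      from arg_cong[OF this, of "\<lambda>v. vec_index v i"] show False using i by simp
    qed
    moreover have "cub N c (($) (vec N v)) = cub N c v" by (rule cub_cong) simp
    then have "cub N c (($) (vec N v)) = 0" using v(1) by simp
    ultimately show "vec N v \<in> rational_points N F" by (simp add: rational_points_def proj_coords_def eval)
  qed simp
  have 12: "rational_points N F \<noteq> {}" if "unirational N F"
    using that rational_point_if_rational_map[OF F] pt unfolding unirational_def eval by blast
  have 23: "\<exists>x \<in> rational_points N F. smooth_at N F x" if "rational_points N F \<noteq> {}"
  proof -
    obtain x where x: "x \<in> rational_points N F" using \<open>rational_points N F \<noteq> {}\<close> by blast
    have "\<exists>i<N. x $ i \<noteq> 0"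
    proof (rule ccontr)
      assume "\<not> (\<exists>i<N. x $ i \<noteq> 0)"
      then have "x = 0\<^sub>v N" using x by (intro eq_vecI) (auto simp: rational_points_def proj_coords_def)
      then show False using x by (simp add: rational_points_def proj_coords_def)
    qed
    moreover have "cub N cE (hv (($) x)) = 0" using x by (simp add: F_hv rational_points_def eval)
    ultimately obtain p where p: "smooth_pt p" using smooth_point_exists noncone by blast
    have "\<exists>i<N. p i \<noteq> 0"
    proof (rule ccontr)
      assume "\<not> (\<exists>i<N. p i \<noteq> 0)"
      then have "cubT N c p z = cubT N c (\<lambda>_. 0) z" for z by (intro cubT_cong) auto
      then show False using p by (simp add: smooth_pt_def)
    qed
    then obtain z where z: "z \<in> rational_points N F" "\<forall>i<N. vec_index z i = p i" using pt[of p] p unfolding smooth_pt_def by blast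
    have "cubT N c (vec_index z) (unit i) = cubT N c p (unit i)" for i by (rule cubT_cong) (use z(2) in simp_all)
    then have "smooth_at N F z" using p unfolding smooth_at_def meval_mpderiv_cubic[OF F] smooth_pt_def c_def by simp
    with z(1) show ?thesis by blast
  qed
  have 31: "unirational N F" if "x \<in> rational_points N F" "smooth_at N F x" for x
  proof (rule unirational_if_smooth_point[OF assms(1)])
    show "\<exists>x. T x (hv s) \<noteq> 0" if "cub N cE (hv s) = 0" "\<And>y. T (hv s) y = 0" "\<exists>i<N. s i \<noteq> 0" for s
      by (rule noncone[OF that])
    show "4 \<le> N" using assms(2) by (simp add: N_def)
    show "smooth_pt (($) x)"
      using that unfolding smooth_pt_def smooth_at_def rational_points_def meval_mpderiv_cubic[OF F] eval c_def by simp
  qed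
  show ?thesis unfolding N_def[symmetric] using 12 23 31 by blast
qed

end
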